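(* Let $\{X_k\}_{k=1}^\infty$ be a sequence of centred real random variables with $\mathbb{E}X_k^2\leqslant 1$ for all $k\geqslant 1$. Let $\{\varphi_k\}_{k=1}^\infty$ be a non-increasing sequence of non-negative numbers such that, for all $i<j<k<l$, $$|\mathrm{Cov}(X_i,X_jX_kX_l)|\leqslant \varphi_{j-i},\quad |\mathrm{Cov}(X_iX_jX_k,X_l)|\leqslant \varphi_{l-k},$$ $$|\mathrm{Cov}(X_iX_j,X_kX_l)|\leqslant \varphi_{k-j},\quad |\mathrm{Cov}(X_i,X_j)|\leqslant \varphi_{j-i},$$ and let $\{\phi_k\}_{k=1}^\infty$ be a sequence of non-negative numbers such that $\mathrm{Cov}(X_i^2,X_j^2)\leqslant \phi_{j-i}$ for all $i<j$. Assume that $\Phi_0=\sup_{k\geqslant 1}\mathbb{E}X_k^4$, $\Phi_1=\sum_{k=1}^\infty k\varphi_k$ and $\Phi_2=\sum_{k=1}^\infty\phi_k$ are finite. For each $p\geqslant 1$, let the random vector $\mathbf{y}_p$ in $\mathbb{R}^p$ be given in one of the following two ways: either (i) $\mathbf{y}_p=(X_1,\ldots,X_p)$ for all $p$; or (ii) the $X_k$, $k\geqslant 1$, are in addition orthonormal ($\mathbb{E}X_k^2=1$ and $\mathbb{E}X_iX_j=0$ for $i\ne j$), and $\mathbf{y}_p=(Y_1,\ldots,Y_p)$ for all $p$, where each $Y_j$ can be written as $Y_j=\sum_{k=1}^\infty a_k^{(j)}X_k$ (convergence in $L_2$) for some real $a_k^{(j)}$, $k\geqslant 1$, with $\sum_{k=1}^\infty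 (a_k^{(j)})^2<\infty$. For each $p,n\geqslant 1$, let $\mathbf{Y}_{pn}$ be a $p\times n$ random matrix whose columns are independent copies of $\mathbf{y}_p$. Suppose that (1) $p=p(n)$ is such that $p/n\to c$ as $n\to\infty$ for some $c>0$; (2) the spectral norm of $\Sigma_p=\mathbb{E}\mathbf{y}_p\mathbf{y}_p^\top$ is bounded over $p$; (3) the empirical spectral distribution of the eigenvalues of $\Sigma_p$ has a weak limit $P(d\lambda)$ as $p\to\infty$. Then, with probability one, the empirical spectral distribution of the eigenvalues of $n^{-1}\mathbf{Y}_{pn}\mathbf{Y}_{pn}^\top$ (with $p=p(n)$) has, as $n\to\infty$, a weak limit whose Stieltjes transform $m=m(z)$ satisfies $$m(z)=\int_0^\infty\frac{P(d\lambda)}{\lambda(1-c-czm(z))-z},\quad z\in\mathbb{C},\quad \mathrm{Im}(z)>0.$$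
   Context: Vectors are regarded as columns. The empirical spectral distribution of a symmetric $p\times p$ matrix with eigenvalues $\lambda_1,\ldots,\lambda_p$ is the probability measure $p^{-1}\sum_{i=1}^p\delta_{\lambda_i}$. The Stieltjes transform of a probability measure $F$ on $\mathbb{R}$ is $m(z)=\int (\lambda-z)^{-1}F(d\lambda)$, $\mathrm{Im}(z)>0$. All matrices $\mathbf{Y}_{pn}$ are defined on a common probability space. *)

theory Defs
  imports "HOL-Probability.Probability" "Jordan_Normal_Form.Char_Poly"
begin

definition covariance :: "'a measure \<Rightarrow> ('a \<Rightarrow> real) \<Rightarrow> ('a \<Rightarrow> real) \<Rightarrow> real" where
  "covariance M U V =
    (\<integral>\<omega>. (U \<omega> - (\<integral>\<omega>'. U \<omega>' \<partial>M)) * (V \<omega> - (\<integral>\<omega>'. V \<omega>' \<partial>M)) \<partial>M)"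

text \<open>Convergence of the series \<open>\<Sum>k\<ge>1. a k * X k\<close> to \<open>V\<close> in \<open>L\<^sub>2\<close>. The squared distance is
  a nonnegative integral, so that it is infinite (and not 0, as a Bochner integral would be) when
  the difference is not square integrable.\<close>

definition L2_series ::
  "'a measure \<Rightarrow> (nat \<Rightarrow> real) \<Rightarrow> (nat \<Rightarrow> 'a \<Rightarrow> real) \<Rightarrow> ('a \<Rightarrow> real) \<Rightarrow> bool" where
  "L2_series M a X V \<longleftrightarrow> V \<in> borel_measurable M \<and>
    (\<lambda>m. \<integral>\<^sup>+\<omega>. ennreal ((V \<omega> - (\<Sum>k=1..m. a k * X k \<omega>))\<^sup>2) \<partial>M) \<longlonglongrightarrow> 0"

text \<open>A vector in \<open>\<real>\<^sup>p\<close> is viewed as a point of the product space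
  \<open>\<Pi>\<^sub>M i\<in>{..<p}. borel\<close>, which carries the Borel sets of \<open>\<real>\<^sup>p\<close>.\<close>

definition coords :: "nat \<Rightarrow> real Matrix.vec \<Rightarrow> nat \<Rightarrow> real" where
  "coords p v = (\<lambda>i\<in>{..<p}. vec_index v i)"

abbreviation borel_vec :: "nat \<Rightarrow> (nat \<Rightarrow> real) measure" where
  "borel_vec p \<equiv> PiM {..<p} (\<lambda>_. borel)"

text \<open>\<open>A\<close> is a random \<open>p \<times> n\<close> matrix on \<open>N\<close> whose columns are independent copies of the random
  vector \<open>y\<close> on \<open>M\<close>. Measurability of the columns is part of independence.\<close>

definition columns_indep_copies ::
  "'b measure \<Rightarrow> 'a measure \<Rightarrow> nat \<Rightarrow> nat \<Rightarrow> ('b \<Rightarrow> real mat) \<Rightarrow> ('a \<Rightarrow> real Matrix.vec) \<Rightarrow> bool"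
  where
  "columns_indep_copies N M p n A y \<longleftrightarrow>
    (\<forall>\<omega>\<in>space N. A \<omega> \<in> carrier_mat p n) \<and>
    prob_space.indep_vars N (\<lambda>_. borel_vec p) (\<lambda>j \<omega>. coords p (col (A \<omega>) j)) {..<n} \<and>
    (\<forall>j<n. distr N (borel_vec p) (\<lambda>\<omega>. coords p (col (A \<omega>) j)) =
           distr M (borel_vec p) (\<lambda>\<omega>. coords p (y \<omega>)))"

text \<open>The matrix \<open>E(y y\<^sup>T)\<close> for a random vector \<open>y\<close> in \<open>\<real>\<^sup>p\<close>.\<close>

definition second_moment_mat :: "'a measure \<Rightarrow> nat \<Rightarrow> ('a \<Rightarrow> real Matrix.vec) \<Rightarrow> real mat" where
  "second_moment_mat M p y =
    Matrix.mat p p (\<lambda>(i, j). \<integral>\<omega>. vec_index (y \<omega>) i * vec_index (y \<omega>) j \<partial>M)"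

definition euclid_norm :: "real Matrix.vec \<Rightarrow> real" where
  "euclid_norm v = sqrt (scalar_prod v v)"

definition spectral_norm :: "real mat \<Rightarrow> real" where
  "spectral_norm A =
    (SUP v\<in>{v \<in> carrier_vec (dim_col A). euclid_norm v \<le> 1}. euclid_norm (A *\<^sub>v v))"

text \<open>The characteristic polynomial of a symmetric real \<open>p \<times> p\<close> matrix splits over the reals, so
  its roots form a multiset of exactly \<open>p\<close> eigenvalues, each of which gets mass \<open>1/p\<close>. The
  definition is meant only for symmetric matrices with \<open>p \<ge> 1\<close>.\<close>

definition esd :: "real mat \<Rightarrow> real measure" where
  "esd A = distr (measure_pmf (pmf_of_multiset (proots (char_poly A)))) borel (\<lambda>x. x)"

lemma real_distribution_esd: "real_distribution (esd A)"
proof -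
  interpret prob_space "esd A"
    unfolding esd_def by (rule measure_pmf.prob_space_distr) simp
  show ?thesis
    by unfold_locales (simp_all add: esd_def)
qed

definition stieltjes :: "real measure \<Rightarrow> complex \<Rightarrow> complex" where
  "stieltjes F z = (\<integral>x. 1 / (complex_of_real x - z) \<partial>F)"

end

theory Submission
  imports Defs "HOL-Complex_Analysis.Complex_Analysis" "Jordan_Normal_Form.Schur_Decomposition"
begin

text \<open>
  The argument takes place at the points \<open>z = - t\<close> with \<open>t > 0\<close>, where the resolvents of positive
  semidefinite real matrices are real and bounded by \<open>1 / t\<close>. The upper half-plane is reached only
  at the very end, by analytic continuation.

  Write \<open>G\<close> for the sample covariance matrix, which is the sum of \<open>r\<^sub>j r\<^sub>j\<^sup>T\<close> over the columns
  \<open>r\<^sub>j = y\<^sub>j / \<surd>n\<close>, put \<open>R = (G + t)\<^sup>-\<^sup>1\<close>, let \<open>R\<^sub>j\<close> be the resolvent with column \<open>j\<close> left out and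
  \<open>q\<^sub>j = r\<^sub>j\<^sup>T R\<^sub>j r\<^sub>j\<close>. Since \<open>R r\<^sub>j = R\<^sub>j r\<^sub>j / (1 + q\<^sub>j)\<close>, the trace of \<open>(G + t) R = 1\<close> says that the
  average of the \<open>1 / (1 + q\<^sub>j)\<close> is \<open>1 - p/n + (t/n) tr R\<close> (lemma \<open>sum_leave_one_out\<close>). Let
  \<open>D = (b \<Sigma> + t)\<^sup>-\<^sup>1\<close>. Then \<open>tr R - tr D\<close> equals \<open>b tr (R \<Sigma> D)\<close> minus the sum of
  \<open>r\<^sub>j\<^sup>T D R\<^sub>j r\<^sub>j / (1 + q\<^sub>j)\<close> (lemma \<open>resolvent_comparison\<close>). If the quadratic form at \<open>r\<^sub>j\<close> may be
  replaced by \<open>tr (D R\<^sub>j \<Sigma>) / n\<close>, and this by \<open>tr (R \<Sigma> D) / n\<close>, then the choice of \<open>b\<close> as the mean of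
  the average of the \<open>1 / (1 + q\<^sub>j)\<close> makes everything cancel. So \<open>m = E tr R / p\<close> solves, up to a
  small error, the equation \<open>m = \<integral> 1 / (\<lambda> (1 - c + c t m) + t) P(d\<lambda>)\<close> with \<open>p/n\<close> for \<open>c\<close> and with the
  spectral distribution of \<open>\<Sigma>\<close> for \<open>P\<close> (theorem \<open>mean_resolvent_trace\<close>). Three facts make this
  work.

  First, quadratic forms concentrate. The column \<open>j\<close> is independent of \<open>D R\<^sub>j\<close>, so the replacement
  needs a bound for \<open>y\<^sup>T A y - tr (A \<Sigma>)\<close> with a fixed matrix \<open>A\<close>. Its variance is at most a constant
  times the squared Frobenius norm of \<open>A\<close> (theorem \<open>quadratic_form_variance\<close>), hence of the order
  \<open>p\<close> and not \<open>p\<^sup>2\<close>. The reason is that in a moment of four variables with ordered indices two of the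
  three gaps control the covariance at once, so that it is at most of the order of \<open>\<phi>\<close> at the larger
  of the two, and the sum of \<open>\<phi> (max g h)\<close> over \<open>g\<close> and \<open>h\<close> is at most \<open>2 \<Phi>1\<close>. For linear processes
  the form is one in the \<open>X\<^sub>k\<close> up to a truncation error, and its coefficients have squared Frobenius
  norm tending to \<open>tr (A \<Sigma> A\<^sup>T \<Sigma>)\<close> (lemma \<open>quadratic_form_linear_process\<close>).

  Secondly, traces concentrate. Exchanging one column moves \<open>tr R\<close> by at most \<open>2 / t\<close>, whatever the
  size of the column. McDiarmid's inequality therefore gives exponential tails for \<open>tr R / p\<close>; these
  allow \<open>tr R\<close> to be replaced by its mean inside the equation, and they give almost sure convergence by
  the Borel-Cantelli lemma.

  Thirdly, on the real axis the equation is stable: its right-hand side decreases in \<open>m\<close> while the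
  left-hand side increases, so an approximate solution is close to the exact one (lemma
  \<open>fixed_point_stability\<close>).

  Thus, with probability one, the integrals of \<open>1 / (x + t)\<close> converge for all rational \<open>t > 0\<close>. They
  determine weak convergence on the half-line, because polynomials in \<open>1 / (x + 1)\<close> are dense
  (theorem \<open>weak_conv_of_resolvent_integrals\<close>), and by Helly's selection theorem their limits come
  from a probability measure (theorem \<open>weak_limit_exists_of_resolvent_integrals\<close>). Both sides of
  the limiting equation are holomorphic in the upper half-plane and for \<open>Re z\<close> very negative, so it
  carries over from the negative half-line (theorem \<open>stieltjes_equation_continuation\<close>).
\<close>

no_notation inner (infix "\<bullet>" 70)
no_notation Finite_Cartesian_Product.vec_nth (infixl "$" 90)
no_notation fps_nth (infixl "$" 75)
hide_const (open) Finite_Cartesian_Product.vec Determinants.det Finite_Cartesian_Product.mat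

section \<open>Traces, positive semidefinite matrices and resolvents\<close>

definition mtrace :: "real mat \<Rightarrow> real" where
  "mtrace A = (\<Sum>i<dim_row A. A $$ (i, i))"

text \<open>The inverse goes through the adjugate because this makes its entries quotients of polynomials in
  the entries of the matrix, and hence measurable.\<close>

definition minv :: "real mat \<Rightarrow> real mat" where
  "minv A = (1 / Determinant.det A) \<cdot>\<^sub>m adj_mat A"

definition psd :: "nat \<Rightarrow> real mat \<Rightarrow> bool" where
  "psd p A \<longleftrightarrow> A \<in> carrier_mat p p \<and> transpose_mat A = A \<and>
     (\<forall>v\<in>carrier_vec p. 0 \<le> v \<bullet> (A *\<^sub>v v))"

text \<open>A bound for the operator norm, stated for squared lengths so that no square roots enter the
  matrix algebra.\<close>

definition op_bound :: "nat \<Rightarrow> real \<Rightarrow> real mat \<Rightarrow> bool" where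
  "op_bound p \<kappa> A \<longleftrightarrow> A \<in> carrier_mat p p \<and>
     (\<forall>v\<in>carrier_vec p. (A *\<^sub>v v) \<bullet> (A *\<^sub>v v) \<le> \<kappa>\<^sup>2 * (v \<bullet> v))"

text \<open>The resolvent \<open>(A - z)\<^sup>-\<^sup>1\<close> at \<open>z = - t\<close>.\<close>

definition resolvent :: "real \<Rightarrow> real mat \<Rightarrow> real mat" where
  "resolvent t A = minv (A + t \<cdot>\<^sub>m 1\<^sub>m (dim_row A))"

lemma scalar_prod_self_nonneg: "0 \<le> (v :: real vec) \<bullet> v"
  by (simp add: scalar_prod_def sum_nonneg)

lemma scalar_prod_Cauchy_Schwarz:
  fixes u v :: "real vec"
  assumes "dim_vec u = dim_vec v"
  shows "(u \<bullet> v)\<^sup>2 \<le> (u \<bullet> u) * (v \<bullet> v)"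
  using Cauchy_Schwarz_ineq_sum[of "\<lambda>i. u $ i" "\<lambda>i. v $ i" "{0..<dim_vec v}"] assms
  by (simp add: scalar_prod_def power2_eq_square)

lemma mtrace_add: "A \<in> carrier_mat p p \<Longrightarrow> B \<in> carrier_mat p p \<Longrightarrow> mtrace (A + B) = mtrace A + mtrace B"
  by (simp add: mtrace_def sum.distrib)

lemma mtrace_smult: "A \<in> carrier_mat p p \<Longrightarrow> mtrace (c \<cdot>\<^sub>m A) = c * mtrace A"
  by (simp add: mtrace_def sum_distrib_left)

lemma mtrace_mult: 
  assumes "A \<in> carrier_mat p q" "B \<in> carrier_mat q p"
  shows "mtrace (A * B) = (\<Sum>i<p. \<Sum>j<q. A $$ (i, j) * B $$ (j, i))"
  using assms by (simp add: mtrace_def scalar_prod_def atLeast0LessThan)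

lemma mtrace_comm:
  assumes "A \<in> carrier_mat p q" "B \<in> carrier_mat q p"
  shows "mtrace (A * B) = mtrace (B * A)"
  unfolding mtrace_mult[OF assms] mtrace_mult[OF assms(2,1)]
  by (subst sum.swap) (simp add: mult.commute)

lemma mtrace_one: "mtrace (1\<^sub>m p) = real p"
  by (simp add: mtrace_def)

lemma minv_inverse:
  assumes A: "A \<in> carrier_mat p p" and d: "Determinant.det A \<noteq> 0"
  shows "minv A \<in> carrier_mat p p" "A * minv A = 1\<^sub>m p" "minv A * A = 1\<^sub>m p"
proof -
  note adj = adj_mat[OF A]
  show "minv A \<in> carrier_mat p p" using adj by (simp add: minv_def)
  show "A * minv A = 1\<^sub>m p"
    using adj d A by (simp add: minv_def mult_smult_distrib[OF A adj(1)] smult_smult_assoc)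
      (rule eq_matI; simp)
  show "minv A * A = 1\<^sub>m p"
    using adj d A by (simp add: minv_def mult_smult_assoc_mat[OF adj(1) A])
      (rule eq_matI; simp)
qed

lemma scalar_prod_mat_symmetric:
  fixes A :: "real mat"
  assumes "A \<in> carrier_mat p p" "transpose_mat A = A" "u \<in> carrier_vec p" "v \<in> carrier_vec p"
  shows "u \<bullet> (A *\<^sub>v v) = (A *\<^sub>v u) \<bullet> v"
  using transpose_vec_mult_scalar[OF assms(1,4,3)] assms by simp

lemma shift_mult_vec:
  fixes A :: "real mat"
  assumes "A \<in> carrier_mat p p" "u \<in> carrier_vec p"
  shows "(A + t \<cdot>\<^sub>m 1\<^sub>m p) *\<^sub>v u = A *\<^sub>v u + t \<cdot>\<^sub>v u"
  using assms by (auto simp: add_mult_distrib_mat_vec[of _ p p] intro!: eq_vecI)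

text \<open>Coercivity of \<open>A + t\<close>, from which its invertibility and all bounds for its inverse follow.\<close>

lemma psd_shift_energy:
  assumes "psd p A" "u \<in> carrier_vec p"
  shows "t * (u \<bullet> u) \<le> u \<bullet> ((A + t \<cdot>\<^sub>m 1\<^sub>m p) *\<^sub>v u)"
proof -
  have A: "A \<in> carrier_mat p p" and nn: "0 \<le> u \<bullet> (A *\<^sub>v u)"
    using assms by (auto simp: psd_def)
  have Au: "A *\<^sub>v u \<in> carrier_vec p" using A assms(2) by auto
  show ?thesis
    using nn assms(2) Au by (simp add: shift_mult_vec[OF A] scalar_prod_add_distrib[of _ p])
qed

lemma psd_shift_det:
  assumes "psd p A" "t > 0"
  shows "Determinant.det (A + t \<cdot>\<^sub>m 1\<^sub>m p) \<noteq> 0"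
proof
  assume d: "Determinant.det (A + t \<cdot>\<^sub>m 1\<^sub>m p) = 0"
  have A: "A \<in> carrier_mat p p" using assms by (simp add: psd_def)
  then obtain u where u: "u \<in> carrier_vec p" "u \<noteq> 0\<^sub>v p" "(A + t \<cdot>\<^sub>m 1\<^sub>m p) *\<^sub>v u = 0\<^sub>v p"
    using d det_0_iff_vec_prod_zero_field[of "A + t \<cdot>\<^sub>m 1\<^sub>m p" p] by auto
  from psd_shift_energy[OF assms(1) u(1), of t] have "t * (u \<bullet> u) \<le> 0" using u by simp
  hence "u \<bullet> u = 0" using assms(2) scalar_prod_self_nonneg[of u]
    by (smt (verit) mult_pos_pos)
  moreover have "u \<bullet>c u = u \<bullet> u" by simp
  ultimately show False using u(1,2) conjugate_square_eq_0_vec[OF u(1)] by simp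
qed

lemma resolvent_inverse:
  assumes "psd p A" "t > 0"
  shows "resolvent t A \<in> carrier_mat p p"
    "(A + t \<cdot>\<^sub>m 1\<^sub>m p) * resolvent t A = 1\<^sub>m p" "resolvent t A * (A + t \<cdot>\<^sub>m 1\<^sub>m p) = 1\<^sub>m p"
proof -
  have A: "A \<in> carrier_mat p p" using assms by (simp add: psd_def)
  hence *: "A + t \<cdot>\<^sub>m 1\<^sub>m p \<in> carrier_mat p p" by auto
  from minv_inverse[OF * psd_shift_det[OF assms]] A
  show "resolvent t A \<in> carrier_mat p p"
    "(A + t \<cdot>\<^sub>m 1\<^sub>m p) * resolvent t A = 1\<^sub>m p" "resolvent t A * (A + t \<cdot>\<^sub>m 1\<^sub>m p) = 1\<^sub>m p"
    unfolding resolvent_def by auto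
qed

lemma resolvent_symmetric:
  assumes "psd p A" "t > 0"
  shows "transpose_mat (resolvent t A) = resolvent t A"
proof -
  let ?R = "resolvent t A" and ?A = "A + t \<cdot>\<^sub>m 1\<^sub>m p"
  note R = resolvent_inverse[OF assms]
  have A: "A \<in> carrier_mat p p" and At: "transpose_mat A = A" using assms by (simp_all add: psd_def)
  have At': "transpose_mat ?A = ?A"
  proof (rule eq_matI)
    fix i j assume ij: "i < dim_row ?A" "j < dim_col ?A"
    with A have "A $$ (j, i) = A $$ (i, j)" using arg_cong[OF At, of "\<lambda>B. B $$ (i, j)"] by simp
    with ij A show "transpose_mat ?A $$ (i, j) = ?A $$ (i, j)" by auto
  qed (use A in auto)
  have "transpose_mat ?R * ?A = 1\<^sub>m p"
    using arg_cong[OF R(2), of transpose_mat] R(1) A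
    by (subst (asm) transpose_mult[of _ p p _ p]) (auto simp: At')
  hence "transpose_mat ?R * ?A * ?R = ?R" using R(1) by simp
  moreover have "transpose_mat ?R * ?A * ?R = transpose_mat ?R"
    using R A by (subst assoc_mult_mat[of _ p p _ p _ p]) auto
  ultimately show ?thesis by simp
qed

text \<open>Coercivity at the vector \<open>u = R v\<close>, for which \<open>(A + t) u = v\<close>. The bound by the quadratic form of
  \<open>R\<close> is sharper than one by \<open>v \<bullet> v\<close>, and rank-one updates depend on this sharper form.\<close>

lemma resolvent_energy:
  assumes "psd p A" "t > 0" "v \<in> carrier_vec p"
  shows "t * ((resolvent t A *\<^sub>v v) \<bullet> (resolvent t A *\<^sub>v v)) \<le> v \<bullet> (resolvent t A *\<^sub>v v)"
proof -
  let ?R = "resolvent t A" and ?A = "A + t \<cdot>\<^sub>m 1\<^sub>m p"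
  note R = resolvent_inverse[OF assms(1,2)]
  have A: "A \<in> carrier_mat p p" using assms by (simp add: psd_def)
  have u: "?R *\<^sub>v v \<in> carrier_vec p" using R assms(3) by auto
  have "?A *\<^sub>v (?R *\<^sub>v v) = v"
    using A R assms(3) by (subst assoc_mult_mat_vec[symmetric, of _ p p _ p]) auto
  thus ?thesis using psd_shift_energy[OF assms(1) u, of t] u assms(3)
    by (simp add: comm_scalar_prod[of _ p])
qed

lemma resolvent_psd:
  assumes "psd p A" "t > 0"
  shows "psd p (resolvent t A)"
proof -
  have "0 \<le> v \<bullet> (resolvent t A *\<^sub>v v)" if "v \<in> carrier_vec p" for v
    using resolvent_energy[OF assms that] scalar_prod_self_nonneg[of "resolvent t A *\<^sub>v v"] assms(2)
    by (meson less_imp_le order_trans mult_nonneg_nonneg)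
  thus ?thesis using resolvent_inverse[OF assms] resolvent_symmetric[OF assms]
    by (auto simp: psd_def)
qed

text \<open>With \<open>u = R v\<close>, coercivity and the Cauchy-Schwarz inequality give
  \<open>t \<parallel>u\<parallel>\<^sup>2 \<le> v \<bullet> u \<le> \<parallel>v\<parallel> \<parallel>u\<parallel>\<close>.\<close>

lemma resolvent_op_bound:
  assumes "psd p A" "t > 0"
  shows "op_bound p (1 / t) (resolvent t A)"
  unfolding op_bound_def
proof (intro conjI ballI)
  note R = resolvent_inverse[OF assms(1,2)]
  show "resolvent t A \<in> carrier_mat p p" by (rule R)
  fix v :: "real vec" assume v: "v \<in> carrier_vec p"
  define u where "u = resolvent t A *\<^sub>v v"
  have u: "u \<in> carrier_vec p" using R v by (auto simp: u_def)
  have e: "t * (u \<bullet> u) \<le> v \<bullet> u" using resolvent_energy[OF assms v] by (simp add: u_def)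
  have uu: "0 \<le> u \<bullet> u" by (rule scalar_prod_self_nonneg)
  have "(t * (u \<bullet> u))\<^sup>2 \<le> (v \<bullet> u)\<^sup>2"
    using e uu assms(2) by (intro power_mono) auto
  also have "\<dots> \<le> (v \<bullet> v) * (u \<bullet> u)"
    by (rule scalar_prod_Cauchy_Schwarz) (use u v in auto)
  finally have "(t\<^sup>2 * (u \<bullet> u)) * (u \<bullet> u) \<le> (v \<bullet> v) * (u \<bullet> u)"
    by (simp add: power2_eq_square algebra_simps)
  hence "t\<^sup>2 * (u \<bullet> u) \<le> v \<bullet> v"
    using uu scalar_prod_self_nonneg[of v] by (cases "u \<bullet> u = 0") auto
  thus "u \<bullet> u \<le> (1 / t)\<^sup>2 * (v \<bullet> v)"
    using assms(2) by (simp add: field_simps power2_eq_square)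
qed

lemma op_bound_quadratic:
  assumes "op_bound p \<kappa> C" "u \<in> carrier_vec p" "\<kappa> \<ge> 0"
  shows "\<bar>u \<bullet> (C *\<^sub>v u)\<bar> \<le> \<kappa> * (u \<bullet> u)"
proof -
  have C: "C \<in> carrier_mat p p" using assms by (simp add: op_bound_def)
  have "(u \<bullet> (C *\<^sub>v u))\<^sup>2 \<le> (u \<bullet> u) * ((C *\<^sub>v u) \<bullet> (C *\<^sub>v u))"
    by (rule scalar_prod_Cauchy_Schwarz) (use C assms in auto)
  also have "\<dots> \<le> (u \<bullet> u) * (\<kappa>\<^sup>2 * (u \<bullet> u))"
    using assms by (intro mult_left_mono scalar_prod_self_nonneg) (auto simp: op_bound_def)
  also have "\<dots> = (\<kappa> * (u \<bullet> u))\<^sup>2" by (simp add: power2_eq_square)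
  finally show ?thesis
    using abs_le_square_iff[of "u \<bullet> (C *\<^sub>v u)" "\<kappa> * (u \<bullet> u)"] assms(3) scalar_prod_self_nonneg[of u] by simp
qed

lemma op_bound_mult:
  assumes "op_bound p \<kappa> A" "op_bound p \<mu> B"
  shows "op_bound p (\<kappa> * \<mu>) (A * B)"
  unfolding op_bound_def
proof (intro conjI ballI)
  have A: "A \<in> carrier_mat p p" and B: "B \<in> carrier_mat p p" using assms by (auto simp: op_bound_def)
  show "A * B \<in> carrier_mat p p" using A B by auto
  fix v :: "real vec" assume v: "v \<in> carrier_vec p"
  have Bv: "B *\<^sub>v v \<in> carrier_vec p" using B v by auto
  have "(A * B *\<^sub>v v) = A *\<^sub>v (B *\<^sub>v v)" using A B v by (simp add: assoc_mult_mat_vec[of _ p p _ p])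
  hence "(A * B *\<^sub>v v) \<bullet> (A * B *\<^sub>v v) \<le> \<kappa>\<^sup>2 * ((B *\<^sub>v v) \<bullet> (B *\<^sub>v v))"
    using assms(1) Bv by (simp add: op_bound_def)
  also have "\<dots> \<le> \<kappa>\<^sup>2 * (\<mu>\<^sup>2 * (v \<bullet> v))"
    using assms(2) v by (intro mult_left_mono) (auto simp: op_bound_def)
  finally show "(A * B *\<^sub>v v) \<bullet> (A * B *\<^sub>v v) \<le> (\<kappa> * \<mu>)\<^sup>2 * (v \<bullet> v)"
    by (simp add: power_mult_distrib mult.assoc)
qed

lemma unit_vec_quadratic:
  fixes A :: "real mat"
  assumes "A \<in> carrier_mat p p" "i < p"
  shows "unit_vec p i \<bullet> (A *\<^sub>v unit_vec p i) = A $$ (i, i)"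
  using assms by simp

text \<open>Diagonal entries are quadratic forms at unit vectors.\<close>

lemma op_bound_mtrace:
  assumes "op_bound p \<kappa> A" "\<kappa> \<ge> 0"
  shows "\<bar>mtrace A\<bar> \<le> \<kappa> * real p"
proof -
  have A: "A \<in> carrier_mat p p" using assms by (auto simp: op_bound_def)
  have "\<bar>mtrace A\<bar> \<le> (\<Sum>i<p. \<bar>A $$ (i, i)\<bar>)" using A by (simp add: mtrace_def)
  also have "\<dots> \<le> (\<Sum>i<p. \<kappa>)"
  proof (rule sum_mono)
    fix i assume i: "i \<in> {..<p}"
    have "unit_vec p i \<bullet> (unit_vec p i :: real vec) = 1" using i by (simp add: scalar_prod_left_unit)
    with op_bound_quadratic[OF assms(1) unit_vec_carrier assms(2), of i] i
    show "\<bar>A $$ (i, i)\<bar> \<le> \<kappa>" by (simp add: unit_vec_quadratic[OF A])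
  qed
  finally show ?thesis by (simp add: mult.commute)
qed

lemma psd_smult:
  assumes S: "psd p S" and b: "0 \<le> b"
  shows "psd p (b \<cdot>\<^sub>m S)"
proof -
  have Sc: "S \<in> carrier_mat p p" and St: "transpose_mat S = S"
    and nn: "\<And>v. v \<in> carrier_vec p \<Longrightarrow> 0 \<le> v \<bullet> (S *\<^sub>v v)" using S by (auto simp: psd_def)
  have "transpose_mat (b \<cdot>\<^sub>m S) = b \<cdot>\<^sub>m S"
  proof (rule eq_matI)
    fix i k assume ij: "i < dim_row (b \<cdot>\<^sub>m S)" "k < dim_col (b \<cdot>\<^sub>m S)"
    have "S $$ (k, i) = transpose_mat S $$ (i, k)" using ij Sc by simp
    also have "\<dots> = S $$ (i, k)" unfolding St ..
    finally show "transpose_mat (b \<cdot>\<^sub>m S) $$ (i, k) = (b \<cdot>\<^sub>m S) $$ (i, k)" using ij Sc by simp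
  qed (use Sc in auto)
  moreover have "0 \<le> v \<bullet> ((b \<cdot>\<^sub>m S) *\<^sub>v v)" if v: "v \<in> carrier_vec p" for v
  proof -
    have "(b \<cdot>\<^sub>m S) *\<^sub>v v = b \<cdot>\<^sub>v (S *\<^sub>v v)" using Sc v by (intro eq_vecI) auto
    moreover have "S *\<^sub>v v \<in> carrier_vec p" using Sc v by simp
    ultimately show ?thesis using nn[OF v] b v by simp
  qed
  ultimately show ?thesis using Sc by (auto simp: psd_def)
qed

lemma psd_mtrace:
  assumes "psd p A"
  shows "0 \<le> mtrace A"
proof -
  have A: "A \<in> carrier_mat p p" using assms by (simp add: psd_def)
  have "0 \<le> A $$ (i, i)" if "i < p" for i
    using assms unit_vec_quadratic[OF A that] unit_vec_carrier[of p i] unfolding psd_def by metis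
  thus ?thesis using A by (auto simp: mtrace_def intro!: sum_nonneg)
qed

section \<open>Rank-one updates of Gram matrices\<close>

text \<open>The index set is an argument so that a vector can be left out of the sum of the matrices
  \<open>r\<^sub>j r\<^sub>j\<^sup>T\<close> without renumbering the others.\<close>

definition gram :: "nat \<Rightarrow> (nat \<Rightarrow> real vec) \<Rightarrow> nat set \<Rightarrow> real mat" where
  "gram p r J = Matrix.mat p p (\<lambda>(a, b). \<Sum>j\<in>J. r j $ a * r j $ b)"

lemma gram_carrier [simp, intro]: "gram p r J \<in> carrier_mat p p"
  by (simp add: gram_def)

lemma gram_symmetric: "transpose_mat (gram p r J) = gram p r J"
  by (rule eq_matI) (auto simp: gram_def mult.commute)

lemma gram_mult_vec:
  assumes "\<And>j. j \<in> J \<Longrightarrow> r j \<in> carrier_vec p" "v \<in> carrier_vec p" "a < p"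
  shows "(gram p r J *\<^sub>v v) $ a = (\<Sum>j\<in>J. r j $ a * (r j \<bullet> v))"
  using assms
  by (simp add: gram_def scalar_prod_def sum_distrib_right sum_distrib_left mult.assoc)
    (rule sum.swap)

lemma scalar_prod_gram:
  assumes "\<And>j. j \<in> J \<Longrightarrow> r j \<in> carrier_vec p" "v \<in> carrier_vec p" "u \<in> carrier_vec p"
  shows "u \<bullet> (gram p r J *\<^sub>v v) = (\<Sum>j\<in>J. (r j \<bullet> u) * (r j \<bullet> v))"
proof -
  have d: "dim_vec (gram p r J *\<^sub>v v) = p" by (simp add: gram_def)
  have "u \<bullet> (gram p r J *\<^sub>v v) = (\<Sum>a<p. u $ a * (\<Sum>j\<in>J. r j $ a * (r j \<bullet> v)))"
    unfolding scalar_prod_def[of u] d atLeast0LessThan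
    by (intro sum.cong refl arg_cong2[where f="(*)"] gram_mult_vec assms) auto
  also have "\<dots> = (\<Sum>j\<in>J. \<Sum>a<p. u $ a * (r j $ a * (r j \<bullet> v)))"
    unfolding sum_distrib_left by (rule sum.swap)
  also have "\<dots> = (\<Sum>j\<in>J. (r j \<bullet> u) * (r j \<bullet> v))"
    using assms(3) by (intro sum.cong refl)
      (simp add: scalar_prod_def[of _ u] sum_distrib_left sum_distrib_right atLeast0LessThan mult_ac)
  finally show ?thesis .
qed

lemma gram_psd:
  assumes "\<And>j. j \<in> J \<Longrightarrow> r j \<in> carrier_vec p"
  shows "psd p (gram p r J)"
  unfolding psd_def by (auto simp: gram_symmetric scalar_prod_gram[OF assms] intro!: sum_nonneg)

lemma mtrace_gram_mult:
  assumes "\<And>j. j \<in> J \<Longrightarrow> r j \<in> carrier_vec p" "C \<in> carrier_mat p p"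
  shows "mtrace (gram p r J * C) = (\<Sum>j\<in>J. r j \<bullet> (C *\<^sub>v r j))"
proof -
  have "mtrace (gram p r J * C) = (\<Sum>a<p. \<Sum>b<p. \<Sum>j\<in>J. r j $ b * (C $$ (b, a) * r j $ a))"
    by (subst mtrace_mult[OF gram_carrier assms(2)])
      (simp add: gram_def sum_distrib_right sum_distrib_left mult_ac)
  also have "\<dots> = (\<Sum>b<p. \<Sum>a<p. \<Sum>j\<in>J. r j $ b * (C $$ (b, a) * r j $ a))" by (rule sum.swap)
  also have "\<dots> = (\<Sum>b<p. \<Sum>j\<in>J. \<Sum>a<p. r j $ b * (C $$ (b, a) * r j $ a))"
    by (intro sum.cong refl sum.swap)
  also have "\<dots> = (\<Sum>j\<in>J. \<Sum>b<p. \<Sum>a<p. r j $ b * (C $$ (b, a) * r j $ a))" by (rule sum.swap)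
  also have "\<dots> = (\<Sum>j\<in>J. r j \<bullet> (C *\<^sub>v r j))"
  proof (intro sum.cong refl)
    fix j assume "j \<in> J"
    hence "r j \<in> carrier_vec p" by (rule assms)
    thus "(\<Sum>b<p. \<Sum>a<p. r j $ b * (C $$ (b, a) * r j $ a)) = r j \<bullet> (C *\<^sub>v r j)"
      using assms(2) by (simp add: scalar_prod_def sum_distrib_left atLeast0LessThan)
  qed
  finally show ?thesis .
qed

lemma gram_insert:
  assumes "finite J" "j \<notin> J"
  shows "gram p r (insert j J) = gram p r J + gram p r {j}"
  by (rule eq_matI) (use assms in \<open>auto simp: gram_def\<close>)

context
  fixes p :: nat and r :: "nat \<Rightarrow> real vec" and J :: "nat set" and j :: nat and t :: real
  assumes J: "finite J" "j \<notin> J" and r: "\<And>i. r i \<in> carrier_vec p" and t: "t > 0"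
begin

private abbreviation "R0 \<equiv> resolvent t (gram p r J)"
private abbreviation "R1 \<equiv> resolvent t (gram p r (insert j J))"
private abbreviation "q0 \<equiv> r j \<bullet> (R0 *\<^sub>v r j)"

lemma quadratic_resolvent_nonneg: "0 \<le> q0"
  using resolvent_psd[OF gram_psd t, of J r] r by (simp add: psd_def)

text \<open>The Sherman-Morrison formula applied to the new vector. For \<open>u = R0 r\<^sub>j\<close> the enlarged matrix
  satisfies \<open>(A1 + t) u = r\<^sub>j + r\<^sub>j (r\<^sub>j \<bullet> u) = (1 + q0) r\<^sub>j\<close>, and it remains to apply \<open>R1\<close>.\<close>

lemma resolvent_insert_mult:
  "R1 *\<^sub>v r j = (1 / (1 + q0)) \<cdot>\<^sub>v (R0 *\<^sub>v r j)"
proof -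
  have P0: "psd p (gram p r J)" and P1: "psd p (gram p r (insert j J))" by (intro gram_psd r)+
  note R0 = resolvent_inverse[OF P0 t] and R1 = resolvent_inverse[OF P1 t]
  define u where "u = R0 *\<^sub>v r j"
  have u: "u \<in> carrier_vec p" using R0(1) r by (auto simp: u_def)
  have q: "q0 = r j \<bullet> u" by (simp add: u_def)
  have q1: "1 + q0 \<noteq> 0" using quadratic_resolvent_nonneg by simp
  let ?A0 = "gram p r J + t \<cdot>\<^sub>m 1\<^sub>m p" and ?A1 = "gram p r (insert j J) + t \<cdot>\<^sub>m 1\<^sub>m p"
  have A0: "?A0 \<in> carrier_mat p p" and A1: "?A1 \<in> carrier_mat p p" by auto
  have A1e: "?A1 = ?A0 + gram p r {j}"
    unfolding gram_insert[OF J] by (rule eq_matI) (auto simp: gram_def)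
  have "?A0 *\<^sub>v u = r j"
    unfolding u_def using R0 r A0
    by (subst assoc_mult_mat_vec[symmetric, of _ p p _ p]) auto
  moreover have "gram p r {j} *\<^sub>v u = q0 \<cdot>\<^sub>v r j"
  proof (rule eq_vecI)
    fix i assume "i < dim_vec (q0 \<cdot>\<^sub>v r j)"
    hence "i < p" "i < dim_vec (r j)" using r[of j] by auto
    thus "(gram p r {j} *\<^sub>v u) $ i = (q0 \<cdot>\<^sub>v r j) $ i"
      using r u gram_mult_vec[of "{j}" r p u i] by (simp add: q del: index_mult_mat_vec)
  qed (use r[of j] in \<open>simp add: gram_def\<close>)
  ultimately have "?A1 *\<^sub>v u = r j + q0 \<cdot>\<^sub>v r j"
    unfolding A1e using u A0 by (subst add_mult_distrib_mat_vec[of _ p p]) auto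
  also have "\<dots> = (1 + q0) \<cdot>\<^sub>v r j" by (rule eq_vecI) (auto simp: algebra_simps)
  finally have "R1 *\<^sub>v (?A1 *\<^sub>v u) = (1 + q0) \<cdot>\<^sub>v (R1 *\<^sub>v r j)"
    using R1 r by (simp add: mult_mat_vec[of _ p p])
  moreover have "R1 *\<^sub>v (?A1 *\<^sub>v u) = u"
    using R1 A1 u by (subst assoc_mult_mat_vec[symmetric, of _ p p _ p]) auto
  ultimately have "u = (1 + q0) \<cdot>\<^sub>v (R1 *\<^sub>v r j)" by simp
  hence "(1 / (1 + q0)) \<cdot>\<^sub>v u = R1 *\<^sub>v r j" using q1 R1(1) r
    by (simp add: smult_smult_assoc)
  thus ?thesis by (simp add: u_def)
qed

text \<open>The resolvent identity \<open>R0 - R1 = R1 r\<^sub>j r\<^sub>j\<^sup>T R0\<close>, tested against \<open>C\<close>; the factor \<open>R1 r\<^sub>j\<close> is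
  known from the Sherman-Morrison formula.\<close>

lemma mtrace_resolvent_insert:
  assumes C: "C \<in> carrier_mat p p"
  shows "mtrace (R0 * C) - mtrace (R1 * C) = ((R0 *\<^sub>v r j) \<bullet> (C *\<^sub>v (R0 *\<^sub>v r j))) / (1 + q0)"
proof -
  have P0: "psd p (gram p r J)" and P1: "psd p (gram p r (insert j J))" by (intro gram_psd r)+
  note R0 = resolvent_inverse[OF P0 t] and R1 = resolvent_inverse[OF P1 t]
  let ?A0 = "gram p r J + t \<cdot>\<^sub>m 1\<^sub>m p" and ?A1 = "gram p r (insert j J) + t \<cdot>\<^sub>m 1\<^sub>m p"
  let ?g = "gram p r {j}"
  have A0: "?A0 \<in> carrier_mat p p" and A1: "?A1 \<in> carrier_mat p p" by auto
  have A1e: "?A1 = ?A0 + ?g"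
    unfolding gram_insert[OF J] by (rule eq_matI) (auto simp: gram_def)
  have "R1 * (?A0 + ?g) * R0 = R0" using R1 R0 by (simp add: A1e[symmetric])
  moreover have "R1 * (?A0 + ?g) * R0 = R1 * ?A0 * R0 + R1 * ?g * R0"
    using R1(1) R0(1) A0
    by (simp add: mult_add_distrib_mat[OF R1(1) A0 gram_carrier] add_mult_distrib_mat[of _ p p _ _ p]
        del: mult_add_distrib_mat)
  moreover have "R1 * ?A0 * R0 = R1"
    using R1(1) R0(1,2) A0 by (simp add: assoc_mult_mat[of R1 p p ?A0 p R0 p] del: mult_add_distrib_mat add_mult_distrib_mat)
  ultimately have e: "R0 = R1 + R1 * ?g * R0" by simp
  have gc: "R1 * ?g * R0 \<in> carrier_mat p p" using R0 R1 by auto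
  have "mtrace (R0 * C) = mtrace ((R1 + R1 * ?g * R0) * C)" using e by simp
  also have "\<dots> = mtrace (R1 * C) + mtrace (R1 * ?g * R0 * C)"
    using R1(1) gc C by (simp add: add_mult_distrib_mat[of _ p p _ _ p] mtrace_add[of _ p])
  also have "R1 * ?g * R0 * C = R1 * (?g * (R0 * C))"
    using R1(1) R0(1) C mult_carrier_mat[OF gram_carrier R0(1), of r "{j}"]
      mult_carrier_mat[OF gram_carrier mult_carrier_mat[OF R0(1) C], of r "{j}"]
    by (simp add: assoc_mult_mat[of _ p p _ p _ p])
  also have "mtrace \<dots> = mtrace (?g * (R0 * C) * R1)"
    using R1(1) R0(1) C by (intro mtrace_comm[of _ p p]) (auto intro!: mult_carrier_mat[of _ p p])
  also have "\<dots> = mtrace (?g * (R0 * C * R1))"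
    using R1(1) R0(1) C by (simp add: assoc_mult_mat[of _ p p _ p _ p])
  also have "\<dots> = r j \<bullet> ((R0 * C * R1) *\<^sub>v r j)"
    using R1(1) R0(1) C r by (subst mtrace_gram_mult) auto
  also have "(R0 * C * R1) *\<^sub>v r j = R0 *\<^sub>v (C *\<^sub>v (R1 *\<^sub>v r j))"
    using R1(1) R0(1) C r by (simp add: assoc_mult_mat_vec[of _ p p _ p])
  also have "r j \<bullet> \<dots> = (R0 *\<^sub>v r j) \<bullet> (C *\<^sub>v (R1 *\<^sub>v r j))"
    using R0(1) R1(1) C r resolvent_symmetric[OF P0 t]
    by (intro scalar_prod_mat_symmetric) auto
  also have "\<dots> = ((R0 *\<^sub>v r j) \<bullet> (C *\<^sub>v (R0 *\<^sub>v r j))) / (1 + q0)"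
    unfolding resolvent_insert_mult using R0(1) C r
    by (subst mult_mat_vec[of _ p p]) auto
  finally show ?thesis by simp
qed

text \<open>The bound does not depend on the length of the inserted vector: the numerator is at most
  \<open>\<kappa> \<parallel>R0 r\<^sub>j\<parallel>\<^sup>2 \<le> \<kappa> q0 / t\<close>, and the denominator \<open>1 + q0\<close> absorbs \<open>q0\<close>.\<close>

lemma mtrace_resolvent_insert_bound:
  assumes C: "op_bound p \<kappa> C" and \<kappa>: "\<kappa> \<ge> 0"
  shows "\<bar>mtrace (R0 * C) - mtrace (R1 * C)\<bar> \<le> \<kappa> / t"
proof -
  have P0: "psd p (gram p r J)" by (intro gram_psd r)
  note R0 = resolvent_inverse[OF P0 t]
  define u where "u = R0 *\<^sub>v r j"
  have u: "u \<in> carrier_vec p" using R0(1) r by (auto simp: u_def)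
  have q: "0 \<le> q0" by (rule quadratic_resolvent_nonneg)
  have uq: "u \<bullet> u \<le> q0 / t"
    using resolvent_energy[OF P0 t r] t by (simp add: u_def field_simps)
  have Cc: "C \<in> carrier_mat p p" using C by (simp add: op_bound_def)
  have "\<bar>mtrace (R0 * C) - mtrace (R1 * C)\<bar> = \<bar>u \<bullet> (C *\<^sub>v u)\<bar> / (1 + q0)"
    unfolding mtrace_resolvent_insert[OF Cc] using q by (simp add: u_def abs_divide)
  also have "\<dots> \<le> (\<kappa> * (u \<bullet> u)) / (1 + q0)"
    using op_bound_quadratic[OF C u \<kappa>] q by (intro divide_right_mono) auto
  also have "\<dots> \<le> (\<kappa> * (q0 / t)) / (1 + q0)"
    using uq \<kappa> q by (intro divide_right_mono mult_left_mono) auto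
  also have "\<dots> = \<kappa> / t * (q0 / (1 + q0))" by simp
  also have "\<dots> \<le> \<kappa> / t * 1"
    using q \<kappa> t by (intro mult_left_mono) auto
  finally show ?thesis by simp
qed

end

context
  fixes p :: nat and r :: "nat \<Rightarrow> real vec" and J :: "nat set" and t :: real
  assumes J: "finite J" and r: "\<And>i. r i \<in> carrier_vec p" and t: "t > 0"
begin

private abbreviation "R \<equiv> resolvent t (gram p r J)"
private abbreviation "Rm j \<equiv> resolvent t (gram p r (J - {j}))"
private abbreviation "q j \<equiv> r j \<bullet> (Rm j *\<^sub>v r j)"

lemma leave_one_out_nonneg: "0 \<le> q j"
  using quadratic_resolvent_nonneg[of "J - {j}" j r p t] J r t by simp

lemma leave_one_out_mult:
  "j \<in> J \<Longrightarrow> R *\<^sub>v r j = (1 / (1 + q j)) \<cdot>\<^sub>v (Rm j *\<^sub>v r j)"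
  using resolvent_insert_mult[of "J - {j}" j r p t] J r t by (simp add: insert_absorb)

text \<open>The trace of \<open>(G + t) R = 1\<close>, where \<open>r\<^sub>j \<bullet> R r\<^sub>j = q\<^sub>j / (1 + q\<^sub>j) = 1 - 1 / (1 + q\<^sub>j)\<close>. This identity
  closes the equation for the trace: the only way in which the \<open>q\<^sub>j\<close> enter in the limit is
  through the average of the \<open>1 / (1 + q\<^sub>j)\<close>, and that is an affine function of \<open>tr R\<close>.\<close>

lemma sum_leave_one_out:
  "(\<Sum>j\<in>J. 1 / (1 + q j)) = real (card J) - real p + t * mtrace R"
proof -
  have P: "psd p (gram p r J)" by (intro gram_psd r)
  note R = resolvent_inverse[OF P t]
  have "mtrace (gram p r J * R + t \<cdot>\<^sub>m R) = mtrace (1\<^sub>m p)"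
    by (subst R(2)[symmetric], rule arg_cong[of _ _ mtrace])
      (use R(1) in \<open>simp add: add_mult_distrib_mat[of _ p p _ _ p] mult_smult_assoc_mat[of _ p p _ p]\<close>)
  hence "mtrace (gram p r J * R) + t * mtrace R = real p"
    using R(1) mult_carrier_mat[OF gram_carrier R(1), of r J]
    by (simp add: mtrace_add[of _ p] mtrace_smult[of _ p] mtrace_one)
  moreover have "mtrace (gram p r J * R) = (\<Sum>j\<in>J. r j \<bullet> (R *\<^sub>v r j))"
    using R(1) r by (intro mtrace_gram_mult) auto
  moreover have "(\<Sum>j\<in>J. r j \<bullet> (R *\<^sub>v r j)) = (\<Sum>j\<in>J. 1 - 1 / (1 + q j))"
  proof (rule sum.cong[OF refl])
    fix j assume j: "j \<in> J"
    have "Rm j *\<^sub>v r j \<in> carrier_vec p"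
      using resolvent_inverse(1)[OF gram_psd t, of "J - {j}" r p] r by auto
    hence "r j \<bullet> (R *\<^sub>v r j) = q j / (1 + q j)"
      unfolding leave_one_out_mult[OF j] using r[of j] by simp
    also have "\<dots> = 1 - 1 / (1 + q j)" using leave_one_out_nonneg[of j] by (simp add: field_simps)
    finally show "r j \<bullet> (R *\<^sub>v r j) = 1 - 1 / (1 + q j)" .
  qed
  ultimately show ?thesis by (simp add: sum_subtractf)
qed

text \<open>Expand \<open>R ((b S + t) - (G + t)) D = R - D\<close>. In the term with \<open>G\<close>, each column meets \<open>D R\<close>, which
  depends on that column; the factor \<open>1 / (1 + q\<^sub>j)\<close> trades \<open>R\<close> for the resolvent that does not.\<close>

lemma resolvent_comparison:
  assumes S: "psd p S" and b: "psd p (b \<cdot>\<^sub>m S)" and D: "D = resolvent t (b \<cdot>\<^sub>m S)"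
  shows "mtrace R - mtrace D =
    b * mtrace (R * (S * D)) - (\<Sum>j\<in>J. (r j \<bullet> ((D * Rm j) *\<^sub>v r j)) / (1 + q j))"
proof -
  have P: "psd p (gram p r J)" by (intro gram_psd r)
  note R = resolvent_inverse[OF P t] and D' = resolvent_inverse[OF b t, folded D]
  have Sc: "S \<in> carrier_mat p p" using S by (simp add: psd_def)
  let ?G = "gram p r J"
  have bc: "b \<cdot>\<^sub>m S \<in> carrier_mat p p" using Sc by auto
  have RG: "R * ?G \<in> carrier_mat p p" using R(1) by auto
  have e1: "R * ?G * D + t \<cdot>\<^sub>m (R * D) = D"
  proof -
    have "R * ?G * D + t \<cdot>\<^sub>m (R * D) = R * (?G + t \<cdot>\<^sub>m 1\<^sub>m p) * D"
      using R(1) D'(1) by (simp add: mult_add_distrib_mat[OF R(1) gram_carrier]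
         add_mult_distrib_mat[OF RG] mult_smult_distrib[of _ p p _ p] mult_smult_assoc_mat[of _ p p _ p])
    thus ?thesis using R D'(1) by simp
  qed
  have e2: "R = b \<cdot>\<^sub>m (R * (S * D)) + t \<cdot>\<^sub>m (R * D)"
  proof -
    have "R = R * ((b \<cdot>\<^sub>m S + t \<cdot>\<^sub>m 1\<^sub>m p) * D)" using R(1) by (simp add: D'(2))
    also have "(b \<cdot>\<^sub>m S + t \<cdot>\<^sub>m 1\<^sub>m p) * D = b \<cdot>\<^sub>m (S * D) + t \<cdot>\<^sub>m D"
      using Sc D'(1) by (simp add: add_mult_distrib_mat[OF bc] mult_smult_assoc_mat[of _ p p _ p])
    also have "R * (b \<cdot>\<^sub>m (S * D) + t \<cdot>\<^sub>m D) = b \<cdot>\<^sub>m (R * (S * D)) + t \<cdot>\<^sub>m (R * D)"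
      using R(1) Sc D'(1)
      by (subst mult_add_distrib_mat[of _ p p _ p]) (auto simp: mult_smult_distrib[of _ p p _ p])
    finally show ?thesis .
  qed
  have cc: "R * ?G * D \<in> carrier_mat p p" "R * D \<in> carrier_mat p p" "R * (S * D) \<in> carrier_mat p p"
    using R(1) D'(1) Sc by auto
  have "mtrace D = mtrace (R * ?G * D) + t * mtrace (R * D)"
    by (subst e1[symmetric], subst mtrace_add[of _ p]) (use cc in \<open>auto simp: mtrace_smult[of _ p]\<close>)
  moreover have "mtrace R = b * mtrace (R * (S * D)) + t * mtrace (R * D)"
    by (subst e2, subst mtrace_add[of _ p]) (use cc in \<open>auto simp: mtrace_smult[of _ p]\<close>)
  moreover have "mtrace (R * ?G * D) = (\<Sum>j\<in>J. r j \<bullet> ((D * R) *\<^sub>v r j))"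
  proof -
    have "mtrace (R * ?G * D) = mtrace (R * (?G * D))"
      using R(1) D'(1) by (simp add: assoc_mult_mat[of _ p p _ p _ p])
    also have "\<dots> = mtrace (?G * D * R)" using R(1) D'(1) by (intro mtrace_comm[of _ p p]) (auto intro!: mult_carrier_mat[of _ p p])
    also have "\<dots> = mtrace (?G * (D * R))"
      using R(1) D'(1) by (simp add: assoc_mult_mat[of _ p p _ p _ p])
    finally show ?thesis using R(1) D'(1) r by (simp add: mtrace_gram_mult)
  qed
  moreover have "(\<Sum>j\<in>J. r j \<bullet> ((D * R) *\<^sub>v r j)) = (\<Sum>j\<in>J. (r j \<bullet> ((D * Rm j) *\<^sub>v r j)) / (1 + q j))"
  proof (rule sum.cong[OF refl])
    fix j assume j: "j \<in> J"
    have Rm: "Rm j \<in> carrier_mat p p"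
      using resolvent_inverse(1)[OF gram_psd t, of "J - {j}" r p] r by auto
    have "(D * R) *\<^sub>v r j = D *\<^sub>v (R *\<^sub>v r j)"
      using R(1) D'(1) r[of j] by (intro assoc_mult_mat_vec) auto
    also have "\<dots> = (1 / (1 + q j)) \<cdot>\<^sub>v (D *\<^sub>v (Rm j *\<^sub>v r j))"
      unfolding leave_one_out_mult[OF j] using D'(1) Rm r[of j]
      by (intro mult_mat_vec) auto
    also have "D *\<^sub>v (Rm j *\<^sub>v r j) = (D * Rm j) *\<^sub>v r j"
      using Rm D'(1) r[of j] by (intro assoc_mult_mat_vec[symmetric]) auto
    finally show "r j \<bullet> ((D * R) *\<^sub>v r j) = (r j \<bullet> ((D * Rm j) *\<^sub>v r j)) / (1 + q j)"
      using Rm D'(1) r[of j] by simp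
  qed
  ultimately show ?thesis by simp
qed

text \<open>Let \<open>h = tr (R S D) / n\<close>, let \<open>d\<^sub>j = r\<^sub>j \<bullet> D R\<^sub>j r\<^sub>j\<close>, and let \<open>bh\<close> be the average of the
  \<open>1 / (1 + q\<^sub>j)\<close>. The comparison identity then reads: \<open>(tr R - tr D) / n\<close> is \<open>(b - bh) h\<close> plus the
  average of the \<open>(h - d\<^sub>j) / (1 + q\<^sub>j)\<close>. The three terms of the bound come from \<open>b - bh\<close>, from the
  deviations of the quadratic forms \<open>d\<^sub>j\<close>, and from putting the left-out columns back.\<close>

lemma resolvent_comparison_bound:
  assumes S: "psd p S" and b: "0 \<le> b" and D: "D = resolvent t (b \<cdot>\<^sub>m S)"
    and B: "op_bound p B S" "B \<ge> 0"
    and n: "n = real (card J)" "J \<noteq> {}"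
  shows "\<bar>mtrace R - mtrace D\<bar> / n \<le>
    B * real p / (t\<^sup>2 * n) * \<bar>b - (1 - real p / n + t * mtrace R / n)\<bar>
    + (\<Sum>j\<in>J. \<bar>r j \<bullet> ((D * Rm j) *\<^sub>v r j) - mtrace (D * Rm j * S) / n\<bar>) / n + B / (t\<^sup>2 * n)"
proof -
  have n0: "n > 0" using n J by (simp add: card_gt_0_iff)
  have P: "psd p (gram p r J)" by (intro gram_psd r)
  note R = resolvent_inverse[OF P t]
  have Sc: "S \<in> carrier_mat p p" using S by (simp add: psd_def)
  have Sv: "S *\<^sub>v v \<in> carrier_vec p" if "v \<in> carrier_vec p" for v using Sc that by auto
  have bS: "psd p (b \<cdot>\<^sub>m S)" by (rule psd_smult[OF S b])
  note D' = resolvent_inverse[OF bS t, folded D]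
  define \<kappa> where "\<kappa> = B / t"
  have SD: "op_bound p \<kappa> (S * D)"
    using op_bound_mult[OF B(1) resolvent_op_bound[OF bS t]] by (simp add: \<kappa>_def D)
  have \<kappa>: "\<kappa> \<ge> 0" using B t by (simp add: \<kappa>_def)
  have RSD: "op_bound p (\<kappa> / t) (R * (S * D))"
    using op_bound_mult[OF resolvent_op_bound[OF P t] SD] by simp
  define h where "h = mtrace (R * (S * D)) / n"
  define d where "d j = r j \<bullet> ((D * Rm j) *\<^sub>v r j)" for j
  define \<eta> where "\<eta> j = \<bar>d j - mtrace (D * Rm j * S) / n\<bar>" for j
  define bh where "bh = 1 - real p / n + t * mtrace R / n"
  have bh: "bh = (\<Sum>j\<in>J. 1 / (1 + q j)) / n"
    unfolding sum_leave_one_out using n0 n by (simp add: bh_def field_simps)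
  have hb: "\<bar>h\<bar> \<le> B * real p / (t\<^sup>2 * n)"
  proof -
    have "\<bar>mtrace (R * (S * D))\<bar> \<le> \<kappa> / t * real p" using \<kappa> t by (intro op_bound_mtrace RSD) auto
    thus ?thesis using n0 by (simp add: h_def \<kappa>_def field_simps power2_eq_square)
  qed
  have hd: "\<bar>h - d j\<bar> \<le> \<eta> j + B / (t\<^sup>2 * n)" if j: "j \<in> J" for j
  proof -
    have Rm: "Rm j \<in> carrier_mat p p"
      using resolvent_inverse(1)[OF gram_psd t, of "J - {j}" r p] r by auto
    have "mtrace (D * Rm j * S) = mtrace (D * (Rm j * S))"
      using Rm D'(1) Sc by (simp add: assoc_mult_mat[of _ p p _ p _ p])
    also have "\<dots> = mtrace (Rm j * S * D)" using Rm D'(1) Sc by (intro mtrace_comm) auto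
    also have "\<dots> = mtrace (Rm j * (S * D))"
      using Rm D'(1) Sc by (simp add: assoc_mult_mat[of _ p p _ p _ p])
    finally have e: "mtrace (D * Rm j * S) = mtrace (Rm j * (S * D))" .
    have "\<bar>mtrace (Rm j * (S * D)) - mtrace (R * (S * D))\<bar> \<le> \<kappa> / t"
      using mtrace_resolvent_insert_bound[of "J - {j}" j r p t, OF _ _ r t SD \<kappa>] J j
      by (simp add: insert_absorb)
    hence "\<bar>mtrace (D * Rm j * S) / n - h\<bar> \<le> (\<kappa> / t) / n"
      unfolding e h_def using n0 divide_right_mono[of "\<bar>mtrace (Rm j * (S * D)) - mtrace (R * (S * D))\<bar>" "\<kappa> / t" n]
      by (simp add: diff_divide_distrib[symmetric])
    also have "(\<kappa> / t) / n = B / (t\<^sup>2 * n)" by (simp add: \<kappa>_def power2_eq_square)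
    finally show ?thesis unfolding \<eta>_def by linarith
  qed
  have "(mtrace R - mtrace D) / n = b * h - (\<Sum>j\<in>J. d j / (1 + q j)) / n"
    unfolding resolvent_comparison[OF S bS D] h_def d_def by (simp add: diff_divide_distrib)
  also have "\<dots> = (b - bh) * h + (\<Sum>j\<in>J. (h - d j) / (1 + q j)) / n"
    unfolding bh by (simp add: diff_divide_distrib sum_subtractf sum_divide_distrib left_diff_distrib
       sum_distrib_right)
  finally have "\<bar>mtrace R - mtrace D\<bar> / n \<le> \<bar>b - bh\<bar> * \<bar>h\<bar> + \<bar>\<Sum>j\<in>J. (h - d j) / (1 + q j)\<bar> / n"
    using n0 abs_triangle_ineq[of "(b - bh) * h" "(\<Sum>j\<in>J. (h - d j) / (1 + q j)) / n"]
    by (simp add: abs_mult abs_divide)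
  also have "\<bar>\<Sum>j\<in>J. (h - d j) / (1 + q j)\<bar> \<le> (\<Sum>j\<in>J. \<eta> j + B / (t\<^sup>2 * n))"
  proof (rule order_trans[OF sum_abs sum_mono])
    fix j assume j: "j \<in> J"
    have "\<bar>(h - d j) / (1 + q j)\<bar> = \<bar>h - d j\<bar> / (1 + q j)"
      using leave_one_out_nonneg[of j] by (simp add: abs_divide)
    also have "\<dots> \<le> \<bar>h - d j\<bar> / 1"
      using leave_one_out_nonneg[of j] by (intro divide_left_mono) auto
    finally show "\<bar>(h - d j) / (1 + q j)\<bar> \<le> \<eta> j + B / (t\<^sup>2 * n)" using hd[OF j] by simp
  qed
  also have "(\<Sum>j\<in>J. \<eta> j + B / (t\<^sup>2 * n)) / n = (\<Sum>j\<in>J. \<eta> j) / n + B / (t\<^sup>2 * n)"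
    using n0 n by (simp add: sum.distrib add_divide_distrib)
  finally have "\<bar>mtrace R - mtrace D\<bar> / n
      \<le> \<bar>b - bh\<bar> * \<bar>h\<bar> + ((\<Sum>j\<in>J. \<eta> j) / n + B / (t\<^sup>2 * n))"
    using n0 by (simp add: divide_right_mono)
  also have "\<bar>b - bh\<bar> * \<bar>h\<bar> \<le> \<bar>b - bh\<bar> * (B * real p / (t\<^sup>2 * n))"
    by (intro mult_left_mono hb) auto
  finally show ?thesis unfolding \<eta>_def d_def bh_def by (simp add: mult.commute)
qed

end

section \<open>Spectral distributions and resolvent traces\<close>

text \<open>The characteristic polynomial splits over the complex numbers. A root \<open>a\<close> with eigenvector \<open>v\<close>
  is real because \<open>v\<^sup>* C v = a (v\<^sup>* v)\<close>, where both \<open>v\<^sup>* C v\<close> and \<open>v\<^sup>* v\<close> equal their conjugates.\<close>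

lemma symmetric_char_poly_splits:
  fixes A :: "real mat"
  assumes A: "A \<in> carrier_mat p p" and sym: "transpose_mat A = A"
  shows "\<exists>es. char_poly A = (\<Prod>e\<leftarrow>es. [:- e, 1:]) \<and> length es = p"
proof -
  define C where "C = map_mat complex_of_real A"
  have C: "C \<in> carrier_mat p p" using A by (simp add: C_def)
  obtain as where as: "char_poly C = (\<Prod>a\<leftarrow>as. [:- a, 1:])" "length as = p"
    using char_poly_factorized[OF C] by blast
  have Cs: "C $$ (i, j) = C $$ (j, i)" "cnj (C $$ (i, j)) = C $$ (i, j)" if "i < p" "j < p" for i j
    using that A arg_cong[OF sym, of "\<lambda>B. B $$ (i, j)"] by (auto simp: C_def)
  have real: "cnj a = a" if a: "a \<in> set as" for a
  proof -
    have "poly (char_poly C) a = 0" unfolding as using a by (auto simp: poly_prod_list prod_list_zero_iff)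
    then obtain v where v: "v \<in> carrier_vec p" "v \<noteq> 0\<^sub>v p" "C *\<^sub>v v = a \<cdot>\<^sub>v v"
      using eigenvalue_root_char_poly[OF C, of a] C by (auto simp: eigenvalue_def eigenvector_def)
    define s where "s = (\<Sum>i<p. (\<Sum>j<p. C $$ (i, j) * v $ j) * cnj (v $ i))"
    define N where "N = (\<Sum>i<p. v $ i * cnj (v $ i))"
    have "cnj s = (\<Sum>i<p. \<Sum>j<p. C $$ (i, j) * cnj (v $ j) * v $ i)"
      by (simp add: s_def sum_distrib_right Cs(2))
    also have "\<dots> = (\<Sum>j<p. \<Sum>i<p. C $$ (i, j) * cnj (v $ j) * v $ i)" by (rule sum.swap)
    also have "\<dots> = (\<Sum>j<p. \<Sum>i<p. C $$ (j, i) * v $ i * cnj (v $ j))"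
      by (intro sum.cong refl) (simp add: Cs(1) mult_ac)
    also have "\<dots> = s" by (simp add: s_def sum_distrib_right)
    finally have s1: "cnj s = s" .
    have "(\<Sum>j<p. C $$ (i, j) * v $ j) = a * v $ i" if "i < p" for i
      using arg_cong[OF v(3), of "\<lambda>w. w $ i"] that C v(1) by (simp add: scalar_prod_def atLeast0LessThan)
    hence s2: "s = a * N" by (simp add: s_def N_def sum_distrib_left mult_ac)
    have N: "N = of_real (\<Sum>i<p. (cmod (v $ i))\<^sup>2)"
      unfolding N_def of_real_sum
      by (intro sum.cong refl) (rule complex_norm_square[symmetric])
    have "N \<noteq> 0"
    proof
      assume "N = 0"
      hence "(\<Sum>i<p. (cmod (v $ i))\<^sup>2) = 0" unfolding N by (simp only: of_real_eq_0_iff)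
      hence "\<forall>i<p. v $ i = 0" by (subst (asm) sum_nonneg_eq_0_iff) auto
      hence "v = 0\<^sub>v p" using v(1) by (intro eq_vecI) auto
      thus False using v by simp
    qed
    moreover have "cnj a * N = a * N" using s1 unfolding s2 by (simp add: N)
    ultimately show ?thesis by simp
  qed
  define es where "es = map Re as"
  have as_es: "as = map complex_of_real es"
    unfolding es_def using real by (auto intro!: nth_equalityI simp: complex_eq_iff)
  have "map_poly complex_of_real (char_poly A) = char_poly C"
    unfolding C_def by (rule of_real_hom.char_poly_hom[OF A, symmetric])
  also have "\<dots> = map_poly complex_of_real (\<Prod>e\<leftarrow>es. [:- e, 1:])"
    unfolding as(1) as_es
  proof (induction es)
    case (Cons e es)
    interpret h: map_poly_comm_ring_hom complex_of_real by unfold_locales auto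
    show ?case using Cons by (simp add: h.hom_mult map_poly_pCons del: mult_pCons_left)
  qed simp
  finally have "char_poly A = (\<Prod>e\<leftarrow>es. [:- e, 1:])"
    by (auto simp: poly_eq_iff coeff_map_poly)
  moreover have "length es = p" using as(2) by (simp add: es_def)
  ultimately show ?thesis by blast
qed

text \<open>Back substitution from the last row upwards shows that the inverse is upper triangular as well.\<close>

lemma upper_triangular_inverse_diagonal:
  fixes T :: "real mat"
  assumes T: "T \<in> carrier_mat p p" and S: "S \<in> carrier_mat p p" and ut: "upper_triangular T"
    and inv: "T * S = 1\<^sub>m p" and d: "\<And>i. i < p \<Longrightarrow> T $$ (i, i) \<noteq> 0" and k: "k < p"
  shows "S $$ (k, k) = 1 / T $$ (k, k)"
proof -
  have row: "(\<Sum>l\<in>{i..<p}. T $$ (i, l) * S $$ (l, k)) = (if i = k then 1 else 0)" if i: "i < p" for i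
  proof -
    have "(\<Sum>l<p. T $$ (i, l) * S $$ (l, k)) = (if i = k then 1 else 0)"
      using arg_cong[OF inv, of "\<lambda>B. B $$ (i, k)"] T S i k by (simp add: scalar_prod_def atLeast0LessThan)
    moreover have "(\<Sum>l<p. T $$ (i, l) * S $$ (l, k)) = (\<Sum>l\<in>{i..<p}. T $$ (i, l) * S $$ (l, k))"
      using ut T i by (intro sum.mono_neutral_right) (auto simp: upper_triangular_def)
    ultimately show ?thesis by simp
  qed
  have zero: "S $$ (i, k) = 0" if "k < i" "i < p" for i
    using that
  proof (induction "p - i" arbitrary: i rule: less_induct)
    case less
    have "(\<Sum>l\<in>{i..<p}. T $$ (i, l) * S $$ (l, k)) = T $$ (i, i) * S $$ (i, k)"
      using less by (subst sum.mono_neutral_right[of _ "{i}"]) auto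
    thus ?case using row[of i] d[of i] less.prems by auto
  qed
  have "(\<Sum>l\<in>{k..<p}. T $$ (k, l) * S $$ (l, k)) = T $$ (k, k) * S $$ (k, k)"
    using zero k by (subst sum.mono_neutral_right[of _ "{k}"]) auto
  thus ?thesis using row[OF k] d[OF k] by (simp add: field_simps)
qed

lemma psd_eigenvalue:
  assumes A: "psd p A" and cp: "char_poly A = (\<Prod>e\<leftarrow>es. [:- e, 1:])" and e: "e \<in> set es"
  shows "0 \<le> e" "op_bound p B A \<Longrightarrow> 0 \<le> B \<Longrightarrow> e \<le> B"
proof -
  have Ac: "A \<in> carrier_mat p p" using A by (simp add: psd_def)
  have "poly (char_poly A) e = 0" unfolding cp using e by (auto simp: poly_prod_list prod_list_zero_iff)
  then obtain v where v: "v \<in> carrier_vec p" "v \<noteq> 0\<^sub>v p" "A *\<^sub>v v = e \<cdot>\<^sub>v v"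
    using eigenvalue_root_char_poly[OF Ac, of e] Ac by (auto simp: eigenvalue_def eigenvector_def)
  have "v \<bullet> v \<noteq> 0" using conjugate_square_eq_0_vec[OF v(1)] v(2) by simp
  hence vv: "v \<bullet> v > 0" using scalar_prod_self_nonneg[of v] by simp
  have vA: "v \<bullet> (A *\<^sub>v v) = e * (v \<bullet> v)" using v by simp
  have "0 \<le> v \<bullet> (A *\<^sub>v v)" using A v(1) by (simp add: psd_def)
  thus "0 \<le> e" using vv vA by (simp add: zero_le_mult_iff)
  assume "op_bound p B A" "0 \<le> B"
  from op_bound_quadratic[OF this(1) v(1) this(2)] have "e * (v \<bullet> v) \<le> B * (v \<bullet> v)" using vA by simp
  thus "e \<le> B" using vv by (simp only: mult_le_cancel_right_pos)
qed

text \<open>In a Schur decomposition \<open>A = P B Q\<close> the matrix \<open>b B + t\<close> is upper triangular with diagonal entries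
  \<open>b e + t\<close>, and the trace of its inverse is the trace of the resolvent of \<open>b A\<close> by similarity.\<close>

lemma mtrace_resolvent_eigenvalues:
  assumes A: "psd p A" and cp: "char_poly A = (\<Prod>e\<leftarrow>es. [:- e, 1:])" and len: "length es = p"
    and b: "b \<ge> 0" and t: "t > 0"
  shows "mtrace (resolvent t (b \<cdot>\<^sub>m A)) = (\<Sum>e\<leftarrow>es. 1 / (b * e + t))"
proof -
  have Ac: "A \<in> carrier_mat p p" using A by (simp add: psd_def)
  note R = resolvent_inverse[OF psd_smult[OF A b] t]
  let ?R = "resolvent t (b \<cdot>\<^sub>m A)"
  obtain B P Q where sch: "schur_decomposition A es = (B, P, Q)" by (cases "schur_decomposition A es") auto
  note S = schur_decomposition[OF Ac cp sch]
  have W: "P * Q = 1\<^sub>m p" "Q * P = 1\<^sub>m p" "A = P * B * Q"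
    "B \<in> carrier_mat p p" "P \<in> carrier_mat p p" "Q \<in> carrier_mat p p"
    using similar_mat_witD2[OF Ac, of B P Q] S by auto
  define T where "T = b \<cdot>\<^sub>m B + t \<cdot>\<^sub>m 1\<^sub>m p"
  define N where "N = Q * (?R * P)"
  have T: "T \<in> carrier_mat p p" and N: "N \<in> carrier_mat p p" using W R(1) by (auto simp: T_def N_def)
  have TQ: "T * Q = Q * (b \<cdot>\<^sub>m A + t \<cdot>\<^sub>m 1\<^sub>m p)"
  proof -
    have "Q * A = (Q * P) * (B * Q)"
      unfolding W(3) using W(4-6) by (simp add: assoc_mult_mat[of _ p p _ p _ p])
    hence QA: "Q * A = B * Q" using W(2,4,6) by simp
    have "T * Q = b \<cdot>\<^sub>m (B * Q) + t \<cdot>\<^sub>m Q"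
      unfolding T_def using W(4,6) by (simp add: add_mult_distrib_mat[of _ p p _ _ p] mult_smult_assoc_mat[of _ p p _ p])
    moreover have "Q * (b \<cdot>\<^sub>m A + t \<cdot>\<^sub>m 1\<^sub>m p) = b \<cdot>\<^sub>m (Q * A) + t \<cdot>\<^sub>m Q"
      using W(6) Ac by (simp add: mult_add_distrib_mat[of _ p p _ p] mult_smult_distrib[of _ p p _ p])
    ultimately show ?thesis using QA by simp
  qed
  have "T * N = (T * Q) * (?R * P)"
    unfolding N_def using T W R(1) by (simp add: assoc_mult_mat[of _ p p _ p _ p])
  also have "\<dots> = Q * ((b \<cdot>\<^sub>m A + t \<cdot>\<^sub>m 1\<^sub>m p) * ?R * P)"
    unfolding TQ using Ac W(5,6) R(1) by (simp add: assoc_mult_mat[of _ p p _ p _ p])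
  also have "\<dots> = 1\<^sub>m p" using R(2) W(2,5) by simp
  finally have TN: "T * N = 1\<^sub>m p" .
  have Bii: "B $$ (i, i) = es ! i" if "i < p" for i
    using S W(4) that by (auto simp: diag_mat_def)
  have Tii: "T $$ (i, i) = b * es ! i + t" if "i < p" for i
    using that W(4) by (simp add: T_def Bii)
  have pos: "b * es ! i + t > 0" if "i < p" for i
    using psd_eigenvalue(1)[OF A cp, of "es ! i"] that len b t by (simp add: add_nonneg_pos)
  have ut: "upper_triangular T" using S W(4) by (auto simp: T_def upper_triangular_def)
  have "mtrace ?R = mtrace (?R * (P * Q))" using W(1) R(1) by simp
  also have "\<dots> = mtrace ((?R * P) * Q)" using W(5,6) R(1) by (simp add: assoc_mult_mat[of _ p p _ p _ p])
  also have "\<dots> = mtrace N" unfolding N_def using W(5,6) R(1) by (intro mtrace_comm) auto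
  also have "\<dots> = (\<Sum>i<p. 1 / (b * es ! i + t))"
    unfolding mtrace_def using N upper_triangular_inverse_diagonal[OF T N ut TN]
    by (intro sum.cong) (use Tii pos in force)+
  also have "\<dots> = (\<Sum>e\<leftarrow>es. 1 / (b * e + t))"
    using len by (simp add: sum_list_sum_nth atLeast0LessThan)
  finally show ?thesis .
qed

lemma proots_linear_factors: "proots (\<Prod>e\<leftarrow>es. [:- e, 1:]) = mset (es :: real list)"
proof (induction es)
  case (Cons e es)
  have "(\<Prod>e\<leftarrow>es. [:- e, 1:]) \<noteq> 0" by (auto simp: prod_list_zero_iff)
  thus ?case using Cons by (simp add: proots_mult del: mult_pCons_left)
qed simp

lemma sum_mset_count: "(\<Sum>x\<in>set_mset M. real (count M x) * f x) = (\<Sum>x\<in>#M. f x :: real)"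
proof (induction M)
  case (add a M)
  have *: "(\<Sum>x\<in>set_mset N. real (count N x) * f x) = (\<Sum>x\<in>insert a (set_mset M). real (count N x) * f x)"
    if "set_mset N \<subseteq> insert a (set_mset M)" for N
    using that by (intro sum.mono_neutral_left) (auto simp: not_in_iff)
  have "(\<Sum>x\<in>set_mset (add_mset a M). real (count (add_mset a M) x) * f x)
      = (\<Sum>x\<in>insert a (set_mset M). real (count (add_mset a M) x) * f x)"
    by (rule *) auto
  also have "\<dots> = (\<Sum>x\<in>insert a (set_mset M). real (count M x) * f x + (if x = a then f x else 0))"
    by (intro sum.cong refl) (auto simp: algebra_simps)
  also have "\<dots> = (\<Sum>x\<in>set_mset M. real (count M x) * f x) + f a"
    unfolding sum.distrib *[of M, OF subset_insertI, symmetric] by (simp add: sum.delta)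
  finally show ?case using add by simp
qed simp

lemma integral_esd:
  fixes f :: "real \<Rightarrow> real"
  assumes cp: "char_poly A = (\<Prod>e\<leftarrow>es. [:- e, 1:])" and len: "length es = p" and p: "p \<ge> 1"
    and f: "f \<in> borel_measurable borel"
  shows "(\<integral>x. f x \<partial>esd A) = (\<Sum>e\<leftarrow>es. f e) / real p"
proof -
  have ne: "mset es \<noteq> {#}" using len p by auto
  have "(\<integral>x. f x \<partial>esd A) = (\<integral>x. f x \<partial>measure_pmf (pmf_of_multiset (mset es)))"
    unfolding esd_def cp proots_linear_factors by (subst integral_distr) (auto intro: f)
  also have "\<dots> = (\<Sum>x\<in>set es. pmf (pmf_of_multiset (mset es)) x * f x)"
    by (subst integral_measure_pmf[of "set es"]) (auto simp: set_pmf_of_multiset[OF ne])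
  also have "\<dots> = (\<Sum>x\<in>set_mset (mset es). real (count (mset es) x) * f x) / real p"
    using ne len by (simp add: sum_divide_distrib)
  also have "\<dots> = (\<Sum>e\<leftarrow>es. f e) / real p" unfolding sum_mset_count by (simp flip: sum_mset_sum_list)
  finally show ?thesis .
qed

lemma AE_esd:
  assumes cp: "char_poly A = (\<Prod>e\<leftarrow>es. [:- e, 1:])" and es: "es \<noteq> []" and Q: "\<And>e. e \<in> set es \<Longrightarrow> Q e"
    and [measurable]: "Measurable.pred borel Q"
  shows "AE x in esd A. Q x"
  unfolding esd_def cp proots_linear_factors
  by (subst AE_distr_iff) (auto simp: AE_measure_pmf_iff es Q)

text \<open>The passage between matrices and measures: normalized resolvent traces are Stieltjes transforms of
  spectral distributions at the points \<open>- t\<close>.\<close>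

theorem esd_resolvent:
  assumes A: "psd p A" and p: "p \<ge> 1" and b: "b \<ge> 0" and t: "t > 0"
  shows "(\<integral>x. 1 / (b * x + t) \<partial>esd A) = mtrace (resolvent t (b \<cdot>\<^sub>m A)) / real p"
    and "AE x in esd A. 0 \<le> x"
    and "op_bound p B A \<Longrightarrow> 0 \<le> B \<Longrightarrow> AE x in esd A. x \<le> B"
proof -
  have "A \<in> carrier_mat p p" "transpose_mat A = A" using A by (auto simp: psd_def)
  from symmetric_char_poly_splits[OF this] obtain es where
    es: "char_poly A = (\<Prod>e\<leftarrow>es. [:- e, 1:])" "length es = p" by blast
  show "(\<integral>x. 1 / (b * x + t) \<partial>esd A) = mtrace (resolvent t (b \<cdot>\<^sub>m A)) / real p"
    unfolding mtrace_resolvent_eigenvalues[OF A es b t] by (rule integral_esd[OF es p]) measurable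
  have ne: "es \<noteq> []" using es p by auto
  show "AE x in esd A. 0 \<le> x" using psd_eigenvalue(1)[OF A es(1)] by (intro AE_esd[OF es(1) ne]) auto
  show "AE x in esd A. x \<le> B" if "op_bound p B A" "0 \<le> B"
    using psd_eigenvalue(2)[OF A es(1) _ that] by (intro AE_esd[OF es(1) ne]) auto
qed

section \<open>Sums over ordered quadruples of indices\<close>

text \<open>For a given value \<open>g\<close> of the maximum there are fewer than \<open>2 g\<close> pairs of gaps. This is why the
  sequence \<open>\<phi>\<close> has to be summable with the weight \<open>g\<close>.\<close>

lemma sum_paired_gaps_le:
  fixes \<phi> :: "nat \<Rightarrow> real"
  assumes nn: "\<And>g. 1 \<le> g \<Longrightarrow> 0 \<le> \<phi> g" and S: "\<And>N. (\<Sum>g=1..N. real g * \<phi> g) \<le> \<Phi>1"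
  shows "(\<Sum>(g, h)\<in>{1..N} \<times> {1..N}. \<phi> (max g h)) \<le> 2 * \<Phi>1"
proof -
  have "(\<Sum>(g, h)\<in>{1..N} \<times> {1..N}. \<phi> (max g h)) = (\<Sum>g=1..N. \<Sum>h=1..N. \<phi> (max g h))"
    by (simp add: sum.cartesian_product)
  also have "\<dots> \<le> (\<Sum>g=1..N. \<Sum>h=1..N. (if h \<le> g then \<phi> g else 0) + (if g \<le> h then \<phi> h else 0))"
    by (intro sum_mono) (auto simp: max_def nn)
  also have "\<dots> = (\<Sum>g=1..N. \<Sum>h=1..N. if h \<le> g then \<phi> g else 0) + (\<Sum>h=1..N. \<Sum>g=1..N. if g \<le> h then \<phi> h else 0)"
    unfolding sum.distrib by (subst (2) sum.swap) simp
  also have "\<dots> = 2 * (\<Sum>g=1..N. \<Sum>h=1..N. if h \<le> g then \<phi> g else 0)" by simp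
  also have "(\<Sum>g=1..N. \<Sum>h=1..N. if h \<le> g then \<phi> g else 0) = (\<Sum>g=1..N. real g * \<phi> g)"
  proof (rule sum.cong[OF refl])
    fix g assume g: "g \<in> {1..N}"
    have "(\<Sum>h=1..N. if h \<le> g then \<phi> g else 0) = (\<Sum>h=1..g. \<phi> g)"
      using g by (intro sum.mono_neutral_cong_right) auto
    thus "(\<Sum>h=1..N. if h \<le> g then \<phi> g else 0) = real g * \<phi> g" by simp
  qed
  finally show ?thesis using S[of N] by linarith
qed

text \<open>The map \<open>s \<mapsto> (\<pi> s, \<gamma> s)\<close> embeds \<open>S\<close> in a product, over which the sum factorizes. For quadruples,
  \<open>\<pi>\<close> extracts the two indices of a matrix entry and \<open>\<gamma>\<close> two gaps.\<close>

lemma sum_projection_le: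
  fixes u :: "'b \<Rightarrow> real" and F :: "'c \<Rightarrow> real"
  assumes fin: "finite A" "finite G" and inj: "inj_on (\<lambda>s. (\<pi> s, \<gamma> s)) S"
    and sub: "\<And>s. s \<in> S \<Longrightarrow> \<pi> s \<in> A \<and> \<gamma> s \<in> G"
    and nn: "\<And>a. a \<in> A \<Longrightarrow> 0 \<le> u a" "\<And>g. g \<in> G \<Longrightarrow> 0 \<le> F g"
  shows "(\<Sum>s\<in>S. u (\<pi> s) * F (\<gamma> s)) \<le> (\<Sum>a\<in>A. u a) * (\<Sum>g\<in>G. F g)"
proof -
  have "(\<Sum>s\<in>S. u (\<pi> s) * F (\<gamma> s)) = (\<Sum>(a, g)\<in>(\<lambda>s. (\<pi> s, \<gamma> s)) ` S. u a * F g)"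
    by (subst sum.reindex[OF inj]) simp
  also have "\<dots> \<le> (\<Sum>(a, g)\<in>A \<times> G. u a * F g)"
    using fin sub nn by (intro sum_mono2) auto
  also have "\<dots> = (\<Sum>a\<in>A. u a) * (\<Sum>g\<in>G. F g)"
    by (simp add: sum_product sum.cartesian_product)
  finally show ?thesis .
qed

definition quads :: "nat \<Rightarrow> (nat \<times> nat \<times> nat \<times> nat) set" where
  "quads N = {(i, j, k, l). i < j \<and> j < k \<and> k < l \<and> l < N}"

lemma finite_quads [simp]: "finite (quads N)"
proof (rule finite_subset)
  show "quads N \<subseteq> {..<N} \<times> {..<N} \<times> {..<N} \<times> {..<N}" by (auto simp: quads_def)
qed auto

lemma nested_sum_quads:
  "(\<Sum>l<N. \<Sum>k<l. \<Sum>j<k. \<Sum>i<j. f i j k l) = (\<Sum>(i, j, k, l)\<in>quads N. f i j k (l::nat) :: real)"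
proof -
  have "(\<Sum>l<N. \<Sum>k<l. \<Sum>j<k. \<Sum>i<j. f i j k l)
    = (\<Sum>(l, k, j, i)\<in>(SIGMA l:{..<N}. SIGMA k:{..<l}. SIGMA j:{..<k}. {..<j}). f i j k l)"
    by (simp add: sum.Sigma)
  also have "\<dots> = (\<Sum>(i, j, k, l)\<in>quads N. f i j k l)"
    by (rule sum.reindex_bij_witness[of _ "\<lambda>(i, j, k, l). (l, k, j, i)" "\<lambda>(l, k, j, i). (i, j, k, l)"])
      (auto simp: quads_def)
  finally show ?thesis .
qed

context
  fixes \<phi> :: "nat \<Rightarrow> real" and \<Phi>1 :: real and N :: nat
  assumes nn: "\<And>g. 1 \<le> g \<Longrightarrow> 0 \<le> \<phi> g" and S: "\<And>N. (\<Sum>g=1..N. real g * \<phi> g) \<le> \<Phi>1"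
begin

lemma sum_quads_two_gaps:
  fixes u :: "nat \<Rightarrow> nat \<Rightarrow> real" and \<pi> \<gamma> :: "nat \<times> nat \<times> nat \<times> nat \<Rightarrow> nat \<times> nat"
  assumes inj: "inj_on (\<lambda>s. (\<pi> s, \<gamma> s)) (quads N)"
    and sub: "\<And>s. s \<in> quads N \<Longrightarrow> \<pi> s \<in> {..<N} \<times> {..<N} \<and> \<gamma> s \<in> {1..N} \<times> {1..N}"
    and W: "\<And>s. s \<in> quads N \<Longrightarrow> W s \<le> c * \<phi> (max (fst (\<gamma> s)) (snd (\<gamma> s)))" and c: "c \<ge> 0"
  shows "(\<Sum>s\<in>quads N. (case \<pi> s of (a, b) \<Rightarrow> (u a b)\<^sup>2) * W s)
    \<le> 2 * c * \<Phi>1 * (\<Sum>a<N. \<Sum>b<N. (u a b)\<^sup>2)"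
proof -
  let ?v = "\<lambda>(a, b). (u a b)\<^sup>2" and ?F = "\<lambda>(g, h). \<phi> (max g h)"
  have "(\<Sum>s\<in>quads N. ?v (\<pi> s) * W s) \<le> (\<Sum>s\<in>quads N. ?v (\<pi> s) * (c * ?F (\<gamma> s)))"
  proof (intro sum_mono mult_left_mono)
    show "W s \<le> c * ?F (\<gamma> s)" if "s \<in> quads N" for s
      using W[OF that] by (simp add: case_prod_beta)
  qed (auto split: prod.splits)
  also have "\<dots> = c * (\<Sum>s\<in>quads N. ?v (\<pi> s) * ?F (\<gamma> s))"
    by (simp add: sum_distrib_left mult_ac)
  also have "\<dots> \<le> c * ((\<Sum>a\<in>{..<N} \<times> {..<N}. ?v a) * (\<Sum>g\<in>{1..N} \<times> {1..N}. ?F g))"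
  proof (intro mult_left_mono[OF _ c] sum_projection_le[OF _ _ inj])
    show "0 \<le> ?F g" if "g \<in> {1..N} \<times> {1..N}" for g
      using that by (auto intro!: nn simp: max_def)
  qed (use sub in auto)
  also have "\<dots> \<le> c * ((\<Sum>a\<in>{..<N} \<times> {..<N}. ?v a) * (2 * \<Phi>1))"
    using sum_paired_gaps_le[of \<phi> \<Phi>1 N] nn S
    by (intro mult_left_mono c sum_nonneg) auto
  also have "(\<Sum>a\<in>{..<N} \<times> {..<N}. ?v a) = (\<Sum>a<N. \<Sum>b<N. (u a b)\<^sup>2)"
    by (simp add: sum.cartesian_product)
  finally show ?thesis by (simp add: mult_ac)
qed

text \<open>The product of two matrix entries is at most half the sum of their squares. Each of the squares is
  then summed with a pair of gaps of its own.\<close>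

lemma sum_quads_product_le:
  fixes u :: "nat \<Rightarrow> nat \<Rightarrow> real" and \<pi> \<pi>' \<gamma> \<gamma>' :: "nat \<times> nat \<times> nat \<times> nat \<Rightarrow> nat \<times> nat"
  assumes inj: "inj_on (\<lambda>s. (\<pi> s, \<gamma> s)) (quads N)" "inj_on (\<lambda>s. (\<pi>' s, \<gamma>' s)) (quads N)"
    and sub: "\<And>s. s \<in> quads N \<Longrightarrow> \<pi> s \<in> {..<N} \<times> {..<N} \<and> \<gamma> s \<in> {1..N} \<times> {1..N}"
      "\<And>s. s \<in> quads N \<Longrightarrow> \<pi>' s \<in> {..<N} \<times> {..<N} \<and> \<gamma>' s \<in> {1..N} \<times> {1..N}"
    and W: "\<And>s. s \<in> quads N \<Longrightarrow> \<bar>W s\<bar> \<le> c * \<phi> (max (fst (\<gamma> s)) (snd (\<gamma> s)))"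
      "\<And>s. s \<in> quads N \<Longrightarrow> \<bar>W s\<bar> \<le> c * \<phi> (max (fst (\<gamma>' s)) (snd (\<gamma>' s)))" and c: "c \<ge> 0"
  shows "\<bar>\<Sum>s\<in>quads N. (case \<pi> s of (a, b) \<Rightarrow> u a b) * (case \<pi>' s of (a, b) \<Rightarrow> u a b) * W s\<bar>
    \<le> 2 * c * \<Phi>1 * (\<Sum>a<N. \<Sum>b<N. (u a b)\<^sup>2)"
proof -
  let ?v = "\<lambda>(a, b). u a b" and ?w = "\<lambda>(a, b). (u a b)\<^sup>2"
  have vw: "\<bar>?v x * ?v y * z\<bar> \<le> (?w x * \<bar>z\<bar> + ?w y * \<bar>z\<bar>) / 2" for x y z
  proof -
    have "\<bar>?v x * ?v y\<bar> \<le> ((?v x)\<^sup>2 + (?v y)\<^sup>2) / 2"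
      using sum_squares_bound[of "\<bar>?v x\<bar>" "\<bar>?v y\<bar>"] by (simp add: abs_mult)
    hence "\<bar>?v x * ?v y\<bar> * \<bar>z\<bar> \<le> ((?v x)\<^sup>2 + (?v y)\<^sup>2) / 2 * \<bar>z\<bar>" by (intro mult_right_mono) auto
    thus ?thesis by (cases x; cases y) (simp add: abs_mult algebra_simps add_divide_distrib)
  qed
  have "\<bar>\<Sum>s\<in>quads N. ?v (\<pi> s) * ?v (\<pi>' s) * W s\<bar>
    \<le> (\<Sum>s\<in>quads N. (?w (\<pi> s) * \<bar>W s\<bar> + ?w (\<pi>' s) * \<bar>W s\<bar>) / 2)"
    by (intro order_trans[OF sum_abs] sum_mono vw)
  also have "\<dots> = ((\<Sum>s\<in>quads N. ?w (\<pi> s) * \<bar>W s\<bar>) + (\<Sum>s\<in>quads N. ?w (\<pi>' s) * \<bar>W s\<bar>)) / 2"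
    by (simp add: sum_divide_distrib[symmetric] sum.distrib)
  also have "\<dots> \<le> 2 * c * \<Phi>1 * (\<Sum>a<N. \<Sum>b<N. (u a b)\<^sup>2)"
    using sum_quads_two_gaps[OF inj(1) sub(1) W(1) c, of u] sum_quads_two_gaps[OF inj(2) sub(2) W(2) c, of u]
    by simp
  finally show ?thesis .
qed

text \<open>In these two pairings each matrix entry has one index in \<open>{i, j}\<close> and one in \<open>{k, l}\<close>. Together with
  the outer gaps \<open>j - i\<close> and \<open>l - k\<close> it determines all four indices.\<close>

lemma sum_quads_outer_gaps:
  assumes W: "\<And>i j k l. (i, j, k, l) \<in> quads N \<Longrightarrow> \<bar>W i j k l\<bar> \<le> c * \<phi> (max (j - i) (l - k))" and c: "c \<ge> 0"
  shows "\<bar>\<Sum>(i, j, k, l)\<in>quads N. u i k * u j l * W i j k l\<bar> \<le> 2 * c * \<Phi>1 * (\<Sum>a<N. \<Sum>b<N. (u a b)\<^sup>2)"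
    and "\<bar>\<Sum>(i, j, k, l)\<in>quads N. u i l * u j k * W i j k l\<bar> \<le> 2 * c * \<Phi>1 * (\<Sum>a<N. \<Sum>b<N. (u a b)\<^sup>2)"
proof -
  let ?\<gamma> = "\<lambda>(i, j, k, l). (j - i, l - k)" and ?W = "\<lambda>(i, j, k, l). W i j k l"
  let ?A = "\<lambda>(i, j, k, l). (i, k)" and ?B = "\<lambda>(i, j, k, l). (j, l)"
    and ?C = "\<lambda>(i, j, k, l). (i, l)" and ?D = "\<lambda>(i, j, k, l). (j, k)"
  have "\<bar>\<Sum>s\<in>quads N. (case ?A s of (a, b) \<Rightarrow> u a b) * (case ?B s of (a, b) \<Rightarrow> u a b) * ?W s\<bar>
      \<le> 2 * c * \<Phi>1 * (\<Sum>a<N. \<Sum>b<N. (u a b)\<^sup>2)"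
    by (rule sum_quads_product_le[of ?A ?\<gamma> ?B ?\<gamma>]) (auto simp: inj_on_def quads_def W c)
  thus "\<bar>\<Sum>(i, j, k, l)\<in>quads N. u i k * u j l * W i j k l\<bar> \<le> 2 * c * \<Phi>1 * (\<Sum>a<N. \<Sum>b<N. (u a b)\<^sup>2)"
    by (simp add: case_prod_beta)
  have "\<bar>\<Sum>s\<in>quads N. (case ?C s of (a, b) \<Rightarrow> u a b) * (case ?D s of (a, b) \<Rightarrow> u a b) * ?W s\<bar>
      \<le> 2 * c * \<Phi>1 * (\<Sum>a<N. \<Sum>b<N. (u a b)\<^sup>2)"
    by (rule sum_quads_product_le[of ?C ?\<gamma> ?D ?\<gamma>]) (auto simp: inj_on_def quads_def W c)
  thus "\<bar>\<Sum>(i, j, k, l)\<in>quads N. u i l * u j k * W i j k l\<bar> \<le> 2 * c * \<Phi>1 * (\<Sum>a<N. \<Sum>b<N. (u a b)\<^sup>2)"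
    by (simp add: case_prod_beta)
qed

text \<open>In this pairing the outer gaps lie inside the matrix entries. The entry at \<open>(i, j)\<close> has to be
  combined with the gaps \<open>k - j\<close> and \<open>l - k\<close>, and the entry at \<open>(k, l)\<close> with \<open>j - i\<close> and \<open>k - j\<close>.\<close>

lemma sum_quads_middle_gap:
  assumes W: "\<And>i j k l. (i, j, k, l) \<in> quads N \<Longrightarrow> \<bar>W i j k l\<bar> \<le> c * \<phi> (max (k - j) (l - k))"
      "\<And>i j k l. (i, j, k, l) \<in> quads N \<Longrightarrow> \<bar>W i j k l\<bar> \<le> c * \<phi> (max (j - i) (k - j))" and c: "c \<ge> 0"
  shows "\<bar>\<Sum>(i, j, k, l)\<in>quads N. u i j * u k l * W i j k l\<bar> \<le> 2 * c * \<Phi>1 * (\<Sum>a<N. \<Sum>b<N. (u a b)\<^sup>2)"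
proof -
  let ?\<gamma> = "\<lambda>(i, j, k, l). (k - j, l - k)" and ?\<gamma>' = "\<lambda>(i, j, k, l). (j - i, k - j)"
    and ?W = "\<lambda>(i, j, k, l). W i j k l"
  let ?A = "\<lambda>(i, j, k, l). (i, j)" and ?B = "\<lambda>(i, j, k, l). (k, l)"
  have "\<bar>\<Sum>s\<in>quads N. (case ?A s of (a, b) \<Rightarrow> u a b) * (case ?B s of (a, b) \<Rightarrow> u a b) * ?W s\<bar>
      \<le> 2 * c * \<Phi>1 * (\<Sum>a<N. \<Sum>b<N. (u a b)\<^sup>2)"
    by (rule sum_quads_product_le[of ?A ?\<gamma> ?B ?\<gamma>']) (auto simp: inj_on_def quads_def W c)
  thus ?thesis by (simp add: case_prod_beta)
qed

end

text \<open>Newton's identity for the fourth elementary symmetric polynomial in terms of power sums. The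
  induction on the number of variables passes through the identities of order two and three.\<close>

lemma newton_fourth_power:
  fixes x :: "nat \<Rightarrow> real"
  defines "p \<equiv> \<lambda>a n. \<Sum>i<n. x i ^ a"
  shows "24 * (\<Sum>l<n. \<Sum>k<l. \<Sum>j<k. \<Sum>i<j. x i * x j * x k * x l) =
    p 1 n ^ 4 - 6 * (p 1 n)\<^sup>2 * p 2 n + 3 * (p 2 n)\<^sup>2 + 8 * p 1 n * p 3 n - 6 * p 4 n"
proof -
  have e2: "2 * (\<Sum>j<n. \<Sum>i<j. x i * x j) = (p 1 n)\<^sup>2 - p 2 n" for n
  proof (induction n)
    case (Suc n)
    have "(\<Sum>i<n. x i * x n) = p 1 n * x n" by (simp add: p_def sum_distrib_right)
    with Suc show ?case by (simp add: p_def power2_eq_square algebra_simps)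
  qed (simp add: p_def)
  have e3: "6 * (\<Sum>k<n. \<Sum>j<k. \<Sum>i<j. x i * x j * x k) = p 1 n ^ 3 - 3 * p 1 n * p 2 n + 2 * p 3 n" for n
  proof (induction n)
    case (Suc n)
    have "(\<Sum>j<n. \<Sum>i<j. x i * x j * x n) = (\<Sum>j<n. \<Sum>i<j. x i * x j) * x n" by (simp add: sum_distrib_right)
    hence "6 * (\<Sum>j<n. \<Sum>i<j. x i * x j * x n) = 3 * ((p 1 n)\<^sup>2 - p 2 n) * x n" using e2[of n] by simp
    with Suc show ?case by (simp add: p_def power2_eq_square power3_eq_cube algebra_simps)
  qed (simp add: p_def)
  show ?thesis
  proof (induction n)
    case (Suc n)
    have "(\<Sum>k<n. \<Sum>j<k. \<Sum>i<j. x i * x j * x k * x n) = (\<Sum>k<n. \<Sum>j<k. \<Sum>i<j. x i * x j * x k) * x n"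
      by (simp add: sum_distrib_right)
    hence "24 * (\<Sum>k<n. \<Sum>j<k. \<Sum>i<j. x i * x j * x k * x n) =
       4 * (p 1 n ^ 3 - 3 * p 1 n * p 2 n + 2 * p 3 n) * x n" using e3[of n] by simp
    with Suc show ?case by (simp add: p_def power2_eq_square power3_eq_cube power4_eq_xxxx algebra_simps)
  qed (simp add: p_def)
qed

lemma sum_squares_le_square_sum:
  fixes a :: "nat \<Rightarrow> real"
  assumes "\<And>i. i \<in> A \<Longrightarrow> 0 \<le> a i" "finite A"
  shows "(\<Sum>i\<in>A. (a i)\<^sup>2) \<le> (\<Sum>i\<in>A. a i)\<^sup>2"
proof -
  have "(\<Sum>i\<in>A. (a i)\<^sup>2) \<le> (\<Sum>i\<in>A. a i * (\<Sum>j\<in>A. a j))"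
    using assms by (intro sum_mono) (auto simp: power2_eq_square intro!: mult_left_mono member_le_sum)
  thus ?thesis by (simp add: sum_distrib_right power2_eq_square)
qed

text \<open>Write \<open>L\<close> for the sum of the \<open>x\<^sub>i\<close> and \<open>p2\<close> for that of their squares. Newton's identity expresses
  \<open>L\<^sup>4\<close> by the quadruples and by terms with repeated indices. The latter are at most
  \<open>10 L\<^sup>2 p2 + 7 p2\<^sup>2\<close>, hence at most \<open>L\<^sup>4 / 2 + 57 p2\<^sup>2\<close>, and half of \<open>L\<^sup>4\<close> moves to the left-hand side.\<close>

lemma fourth_power_le:
  fixes x :: "nat \<Rightarrow> real"
  shows "(\<Sum>i<n. x i) ^ 4 \<le> 48 * (\<Sum>(i, j, k, l)\<in>quads n. x i * x j * x k * x l) + 114 * (\<Sum>i<n. (x i)\<^sup>2)\<^sup>2"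
proof -
  define L p2 p3 p4 where "L = (\<Sum>i<n. x i)" and "p2 = (\<Sum>i<n. (x i)\<^sup>2)"
    and "p3 = (\<Sum>i<n. x i ^ 3)" and "p4 = (\<Sum>i<n. x i ^ 4)"
  define e where "e = (\<Sum>(i, j, k, l)\<in>quads n. x i * x j * x k * x l)"
  have newton: "24 * e = L ^ 4 - 6 * L\<^sup>2 * p2 + 3 * p2\<^sup>2 + 8 * L * p3 - 6 * p4"
    using newton_fourth_power[where x = x and n = n] unfolding nested_sum_quads
    by (simp add: L_def p2_def p3_def p4_def e_def)
  have p4: "p4 \<le> p2\<^sup>2"
    using sum_squares_le_square_sum[of "{..<n}" "\<lambda>i. (x i)\<^sup>2"] by (simp add: p4_def p2_def flip: power_mult)
  have p2: "0 \<le> p2" by (simp add: p2_def sum_nonneg)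
  have "p3\<^sup>2 \<le> p2 * p4"
    using Cauchy_Schwarz_ineq_sum[of "\<lambda>i. x i" "\<lambda>i. (x i)\<^sup>2" "{..<n}"]
    by (simp add: p2_def p3_def p4_def power3_eq_cube power2_eq_square power4_eq_xxxx mult.assoc)
  also have "\<dots> \<le> p2 * p2\<^sup>2" using p4 p2 by (intro mult_left_mono)
  finally have "(L * p3)\<^sup>2 \<le> L\<^sup>2 * (p2 * p2\<^sup>2)" by (simp add: power_mult_distrib mult_left_mono)
  also have "\<dots> \<le> ((L\<^sup>2 * p2 + p2\<^sup>2) / 2)\<^sup>2"
  proof -
    have "0 \<le> ((L\<^sup>2 * p2 - p2\<^sup>2) / 2)\<^sup>2" by simp
    thus ?thesis by (simp add: power2_eq_square field_simps)
  qed
  finally have "\<bar>L * p3\<bar> \<le> (L\<^sup>2 * p2 + p2\<^sup>2) / 2"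
    using abs_le_square_iff[of "L * p3" "(L\<^sup>2 * p2 + p2\<^sup>2) / 2"] p2 by simp
  hence a: "- (8 * L * p3) \<le> 4 * (L\<^sup>2 * p2) + 4 * p2\<^sup>2" by (simp add: abs_le_iff field_simps)
  \<comment> \<open>the constant 10 is the coefficient of \<open>L\<^sup>2 * p2\<close> in Newton's identity, 6, plus 4 from the term with \<open>p3\<close>\<close>
  have "0 \<le> (L\<^sup>2 - 10 * p2)\<^sup>2" by simp
  hence b: "10 * (L\<^sup>2 * p2) \<le> L ^ 4 / 2 + 50 * p2\<^sup>2"
    by (simp add: power2_eq_square power4_eq_xxxx field_simps)
  from newton a b p4 have "L ^ 4 \<le> 48 * e + 114 * p2\<^sup>2" by (simp add: algebra_simps)
  thus ?thesis by (simp add: L_def e_def p2_def)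
qed

lemma sum_pairs_symmetric:
  fixes y :: "nat \<Rightarrow> nat \<Rightarrow> real"
  assumes sym: "\<And>i j. y i j = y j i" and diag: "\<And>i. y i i = 0"
  shows "(\<Sum>i<n. \<Sum>j<n. y i j) = 2 * (\<Sum>j<n. \<Sum>i<j. y i j)"
proof (induction n)
  case (Suc n)
  have "(\<Sum>j<n. y n j) = (\<Sum>i<n. y i n)" by (intro sum.cong refl sym)
  with Suc show ?case by (simp add: sum.distrib diag)
qed simp

text \<open>The increment of the sum over quadruples in \<open>square_sum_symmetric\<close> when the largest index is
  fixed and its row is \<open>z\<close>.\<close>

lemma sum_triples_symmetric:
  fixes y :: "nat \<Rightarrow> nat \<Rightarrow> real" and z :: "nat \<Rightarrow> real"
  assumes sym: "\<And>i j. y i j = y j i" and diag: "\<And>i. y i i = 0"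
  shows "2 * (\<Sum>k<n. \<Sum>j<k. \<Sum>i<j. y i j * z k + y i k * z j + z i * y j k) =
    (\<Sum>c<n. z c) * (\<Sum>i<n. \<Sum>j<n. y i j) - 2 * (\<Sum>c<n. z c * (\<Sum>j<n. y c j))"
proof (induction n)
  case (Suc n)
  define T where "T n = (\<Sum>i<n. \<Sum>j<n. y i j)" for n
  define Z where "Z n = (\<Sum>c<n. z c)" for n
  define s where "s = (\<Sum>i<n. y i n)"
  have s': "(\<Sum>j<n. y n j) = s" unfolding s_def by (intro sum.cong refl sym)
  have T: "T (Suc n) = T n + 2 * s" by (simp add: T_def sum.distrib diag s' s_def)
  have pr: "(\<Sum>j<m. \<Sum>i<j. y i n * z j + z i * y j n) = (\<Sum>i<m. y i n) * (\<Sum>i<m. z i) - (\<Sum>i<m. y i n * z i)" for m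
    by (induction m) (auto simp: sum.distrib sum_distrib_left sum_distrib_right algebra_simps)
  have "(\<Sum>j<n. \<Sum>i<j. y i j * z n + y i n * z j + z i * y j n) =
     (\<Sum>j<n. \<Sum>i<j. y i j) * z n + (\<Sum>j<n. \<Sum>i<j. y i n * z j + z i * y j n)"
    by (simp add: sum.distrib sum_distrib_right)
  also have "2 * \<dots> = T n * z n + 2 * (s * Z n) - 2 * (\<Sum>i<n. y i n * z i)"
    using sum_pairs_symmetric[of y n, OF sym diag] unfolding pr
    by (simp add: T_def s_def Z_def algebra_simps)
  finally have A: "2 * (\<Sum>j<n. \<Sum>i<j. y i j * z n + y i n * z j + z i * y j n) =
     T n * z n + 2 * (s * Z n) - 2 * (\<Sum>i<n. y i n * z i)" .
  have B: "(\<Sum>c<Suc n. z c * (\<Sum>j<Suc n. y c j)) = (\<Sum>c<n. z c * (\<Sum>j<n. y c j)) + (\<Sum>i<n. y i n * z i) + z n * s"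
    by (simp add: distrib_left sum.distrib s' diag mult.commute)
  define W where "W = (\<Sum>c<n. z c * (\<Sum>j<n. y c j))"
  define V where "V = (\<Sum>i<n. y i n * z i)"
  have Z: "(\<Sum>c<Suc n. z c) = Z n + z n" by (simp add: Z_def)
  have "2 * (\<Sum>k<Suc n. \<Sum>j<k. \<Sum>i<j. y i j * z k + y i k * z j + z i * y j k) =
      2 * (\<Sum>k<n. \<Sum>j<k. \<Sum>i<j. y i j * z k + y i k * z j + z i * y j k)
      + 2 * (\<Sum>j<n. \<Sum>i<j. y i j * z n + y i n * z j + z i * y j n)" by simp
  also have "\<dots> = (Z n * T n - 2 * W) + (T n * z n + 2 * (s * Z n) - 2 * V)"
    unfolding A Suc Z_def T_def W_def V_def ..
  also have "\<dots> = (Z n + z n) * (T n + 2 * s) - 2 * (W + V + z n * s)" by (simp add: algebra_simps)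
  finally show ?case unfolding B W_def[symmetric] V_def[symmetric] Z T_def[symmetric] T .
qed simp

text \<open>The square is a sum over pairs of index pairs, sorted by how many indices coincide. Four different
  indices can be paired in three ways and each pairing arises eight times; pairs that share an index
  are collected in the squared row sums. These also count the coinciding pairs, four times
  instead of twice, whence the last term.\<close>

lemma square_sum_symmetric:
  fixes y :: "nat \<Rightarrow> nat \<Rightarrow> real"
  assumes sym: "\<And>i j. y i j = y j i" and diag: "\<And>i. y i i = 0"
  shows "(\<Sum>i<n. \<Sum>j<n. y i j)\<^sup>2 =
    8 * (\<Sum>l<n. \<Sum>k<l. \<Sum>j<k. \<Sum>i<j. y i j * y k l + y i k * y j l + y i l * y j k)
    + 4 * (\<Sum>i<n. (\<Sum>j<n. y i j)\<^sup>2) - 2 * (\<Sum>i<n. \<Sum>j<n. (y i j)\<^sup>2)"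
proof (induction n)
  case (Suc n)
  define T where "T n = (\<Sum>i<n. \<Sum>j<n. y i j)" for n
  define s where "s = (\<Sum>i<n. y i n)"
  define w where "w = (\<Sum>c<n. y c n * (\<Sum>j<n. y c j))"
  define v where "v = (\<Sum>i<n. (y i n)\<^sup>2)"
  have s': "(\<Sum>j<n. y n j) = s" unfolding s_def by (intro sum.cong refl sym)
  have v': "(\<Sum>j<n. (y n j)\<^sup>2) = v" unfolding v_def by (intro sum.cong refl) (simp add: sym[of n])
  have T: "T (Suc n) = T n + 2 * s" by (simp add: T_def sum.distrib diag s' s_def)
  have A: "2 * (\<Sum>k<n. \<Sum>j<k. \<Sum>i<j. y i j * y k n + y i k * y j n + y i n * y j k) = s * T n - 2 * w"
    using sum_triples_symmetric[of y "\<lambda>c. y c n" n, OF sym diag] by (simp add: s_def T_def w_def)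
  have B: "(\<Sum>i<Suc n. (\<Sum>j<Suc n. y i j)\<^sup>2) = (\<Sum>i<n. (\<Sum>j<n. y i j)\<^sup>2) + 2 * w + v + s\<^sup>2"
    by (simp add: power2_sum sum.distrib diag s' w_def v_def sum_distrib_left mult_ac)
  have C: "(\<Sum>i<Suc n. \<Sum>j<Suc n. (y i j)\<^sup>2) = (\<Sum>i<n. \<Sum>j<n. (y i j)\<^sup>2) + 2 * v"
    by (simp add: sum.distrib diag v' v_def)
  have "(T (Suc n))\<^sup>2 = (T n)\<^sup>2 + 4 * (s * T n) + 4 * s\<^sup>2"
    unfolding T by (simp add: power2_eq_square algebra_simps)
  thus ?case using Suc A unfolding B C T_def[symmetric] by simp
qed simp

section \<open>Quadratic forms in weakly dependent variables\<close>

lemma (in prob_space) covariance_eq: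
  assumes "integrable M U" "integrable M V" "integrable M (\<lambda>\<omega>. U \<omega> * V \<omega>)"
  shows "covariance M U V = expectation (\<lambda>\<omega>. U \<omega> * V \<omega>) - expectation U * expectation V"
proof -
  have "covariance M U V = expectation (\<lambda>\<omega>. U \<omega> * V \<omega> - expectation V * U \<omega> - expectation U * V \<omega>
      + expectation U * expectation V)"
    unfolding covariance_def by (intro Bochner_Integration.integral_cong) (auto simp: algebra_simps)
  also have "\<dots> = expectation (\<lambda>\<omega>. U \<omega> * V \<omega>) - expectation U * expectation V"
    using assms by (simp add: prob_space)
  finally show ?thesis .
qed

lemma abs_prod4_le:
  fixes a b c d :: real
  shows "\<bar>a * b * c * d\<bar> \<le> (a ^ 4 + b ^ 4 + c ^ 4 + d ^ 4) / 4"
proof -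
  have *: "\<bar>x * y\<bar> \<le> (x\<^sup>2 + y\<^sup>2) / 2" for x y :: real
    using sum_squares_bound[of "\<bar>x\<bar>" "\<bar>y\<bar>"] by (simp add: abs_mult)
  have "\<bar>a * b * c * d\<bar> = \<bar>(a * b) * (c * d)\<bar>" by (simp add: mult.assoc)
  also have "\<dots> \<le> ((a * b)\<^sup>2 + (c * d)\<^sup>2) / 2" by (rule *)
  also have "(a * b)\<^sup>2 \<le> (a ^ 4 + b ^ 4) / 2" using *[of "a\<^sup>2" "b\<^sup>2"] by (simp add: power_mult_distrib flip: power_mult)
  also have "(c * d)\<^sup>2 \<le> (c ^ 4 + d ^ 4) / 2" using *[of "c\<^sup>2" "d\<^sup>2"] by (simp add: power_mult_distrib flip: power_mult)
  finally show ?thesis by (simp add: field_simps)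
qed

lemma integrable_prod4:
  fixes f g h k :: "'a \<Rightarrow> real"
  assumes "f \<in> borel_measurable M" "g \<in> borel_measurable M" "h \<in> borel_measurable M" "k \<in> borel_measurable M"
    and "integrable M (\<lambda>x. f x ^ 4)" "integrable M (\<lambda>x. g x ^ 4)" "integrable M (\<lambda>x. h x ^ 4)" "integrable M (\<lambda>x. k x ^ 4)"
  shows "integrable M (\<lambda>x. f x * g x * h x * k x)"
proof (rule Bochner_Integration.integrable_bound)
  show "integrable M (\<lambda>x. (f x ^ 4 + g x ^ 4 + h x ^ 4 + k x ^ 4) / 4)" using assms by simp
  show "AE x in M. norm (f x * g x * h x * k x) \<le> norm ((f x ^ 4 + g x ^ 4 + h x ^ 4 + k x ^ 4) / 4)"
  proof (rule AE_I2)
    fix x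
    have "\<bar>f x * g x * h x * k x\<bar> \<le> (f x ^ 4 + g x ^ 4 + h x ^ 4 + k x ^ 4) / 4" by (rule abs_prod4_le)
    thus "norm (f x * g x * h x * k x) \<le> norm ((f x ^ 4 + g x ^ 4 + h x ^ 4 + k x ^ 4) / 4)" by simp
  qed
qed (use assms in measurable)

lemma (in prob_space) square_expectation_diff_le:
  fixes f g :: "'a \<Rightarrow> real"
  assumes f: "f \<in> borel_measurable M" "integrable M (\<lambda>x. (f x)\<^sup>2)"
  shows "expectation (\<lambda>x. (f x - expectation f)\<^sup>2) \<le> expectation (\<lambda>x. (f x)\<^sup>2)"
    and "integrable M (\<lambda>x. (f x - c)\<^sup>2)" and "integrable M f"
proof -
  show fi: "integrable M f"
    by (rule square_integrable_imp_integrable) (use f in auto)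
  have e: "(\<lambda>x. (f x - c)\<^sup>2) = (\<lambda>x. (f x)\<^sup>2 - 2 * c * f x + c\<^sup>2)" for c
    by (auto simp: power2_eq_square algebra_simps)
  show "integrable M (\<lambda>x. (f x - c)\<^sup>2)" unfolding e using f fi by simp
  show "expectation (\<lambda>x. (f x - expectation f)\<^sup>2) \<le> expectation (\<lambda>x. (f x)\<^sup>2)"
    unfolding e using f fi by (simp add: prob_space power2_eq_square)
qed

text \<open>The variables are numbered from 0. The constants \<open>\<Phi>0\<close>, \<open>\<Phi>1\<close> and \<open>\<Phi>2\<close> are upper bounds for the
  fourth moments and for partial sums, so that all estimates below concern finite sums.\<close>

locale weakly_dependent = prob_space M for M :: "'a measure" +
  fixes X :: "nat \<Rightarrow> 'a \<Rightarrow> real" and \<phi> \<psi> :: "nat \<Rightarrow> real" and \<Phi>0 \<Phi>1 \<Phi>2 :: real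
  assumes meas [measurable]: "X k \<in> borel_measurable M"
    and int4: "integrable M (\<lambda>\<omega>. X k \<omega> ^ 4)" and fourth: "expectation (\<lambda>\<omega>. X k \<omega> ^ 4) \<le> \<Phi>0"
    and centred: "expectation (X k) = 0" and second: "expectation (\<lambda>\<omega>. (X k \<omega>)\<^sup>2) \<le> 1"
    and phi_nonneg: "1 \<le> g \<Longrightarrow> 0 \<le> \<phi> g" and phi_antimono: "1 \<le> g \<Longrightarrow> g \<le> h \<Longrightarrow> \<phi> h \<le> \<phi> g"
    and psi_nonneg: "1 \<le> g \<Longrightarrow> 0 \<le> \<psi> g"
    and phi_sum: "(\<Sum>g=1..n. real g * \<phi> g) \<le> \<Phi>1" and psi_sum: "(\<Sum>g=1..n. \<psi> g) \<le> \<Phi>2"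
    and cov13: "i < j \<Longrightarrow> j < k \<Longrightarrow> k < l \<Longrightarrow>
      \<bar>covariance M (X i) (\<lambda>\<omega>. X j \<omega> * X k \<omega> * X l \<omega>)\<bar> \<le> \<phi> (j - i)"
    and cov31: "i < j \<Longrightarrow> j < k \<Longrightarrow> k < l \<Longrightarrow>
      \<bar>covariance M (\<lambda>\<omega>. X i \<omega> * X j \<omega> * X k \<omega>) (X l)\<bar> \<le> \<phi> (l - k)"
    and cov22: "i < j \<Longrightarrow> j < k \<Longrightarrow> k < l \<Longrightarrow>
      \<bar>covariance M (\<lambda>\<omega>. X i \<omega> * X j \<omega>) (\<lambda>\<omega>. X k \<omega> * X l \<omega>)\<bar> \<le> \<phi> (k - j)"
    and cov11: "i < j \<Longrightarrow> \<bar>covariance M (X i) (X j)\<bar> \<le> \<phi> (j - i)"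
    and covsq: "i < j \<Longrightarrow> covariance M (\<lambda>\<omega>. (X i \<omega>)\<^sup>2) (\<lambda>\<omega>. (X j \<omega>)\<^sup>2) \<le> \<psi> (j - i)"
begin

definition "mom2 i j = expectation (\<lambda>\<omega>. X i \<omega> * X j \<omega>)"
definition "mom4 i j k l = expectation (\<lambda>\<omega>. X i \<omega> * X j \<omega> * X k \<omega> * X l \<omega>)"

lemma integrable4: "integrable M (\<lambda>\<omega>. X i \<omega> * X j \<omega> * X k \<omega> * X l \<omega>)"
  by (rule integrable_prod4) (auto intro: int4)
lemma integrable3: "integrable M (\<lambda>\<omega>. X i \<omega> * X j \<omega> * X k \<omega>)"
  using integrable_prod4[of "X i" M "X j" "X k" "\<lambda>_. 1"] by (simp add: int4)
lemma integrable2: "integrable M (\<lambda>\<omega>. X i \<omega> * X j \<omega>)"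
  using integrable_prod4[of "X i" M "X j" "\<lambda>_. 1" "\<lambda>_. 1"] by (simp add: int4)
lemma integrable1: "integrable M (X i)"
  using integrable_prod4[of "X i" M "\<lambda>_. 1" "\<lambda>_. 1" "\<lambda>_. 1"] by (simp add: int4)

lemma Phi0_nonneg: "0 \<le> \<Phi>0"
proof -
  have "0 \<le> expectation (\<lambda>\<omega>. X 0 \<omega> ^ 4)" by (intro Bochner_Integration.integral_nonneg) simp
  thus ?thesis using fourth[of 0] by (rule order_trans)
qed

lemma Phi1_nonneg: "0 \<le> \<Phi>1"
  using phi_sum[of 0] by simp

lemma Phi2_nonneg: "0 \<le> \<Phi>2"
  using psi_sum[of 0] by simp

lemma mom2_bounds:
  shows "i < j \<Longrightarrow> \<bar>mom2 i j\<bar> \<le> \<phi> (j - i)" "\<bar>mom2 i j\<bar> \<le> 1"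
proof -
  show "\<bar>mom2 i j\<bar> \<le> \<phi> (j - i)" if "i < j"
    using cov11[OF that] covariance_eq[OF integrable1 integrable1 integrable2, of i j]
    by (simp add: mom2_def centred)
  have sq: "integrable M (\<lambda>\<omega>. (X i \<omega>)\<^sup>2)" for i using integrable2[of i i] by (simp add: power2_eq_square)
  have "\<bar>mom2 i j\<bar> \<le> expectation (\<lambda>\<omega>. \<bar>X i \<omega> * X j \<omega>\<bar>)" unfolding mom2_def by (rule integral_abs_bound)
  also have "\<dots> \<le> expectation (\<lambda>\<omega>. ((X i \<omega>)\<^sup>2 + (X j \<omega>)\<^sup>2) / 2)"
  proof (rule integral_mono)
    show "\<bar>X i x * X j x\<bar> \<le> ((X i x)\<^sup>2 + (X j x)\<^sup>2) / 2" for x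
      using sum_squares_bound[of "\<bar>X i x\<bar>" "\<bar>X j x\<bar>"] by (simp add: abs_mult)
  qed (use sq in \<open>auto intro!: integrable_abs integrable2\<close>)
  also have "\<dots> \<le> 1" using sq second[of i] second[of j] by simp
  finally show "\<bar>mom2 i j\<bar> \<le> 1" .
qed

text \<open>The variables are centred, so the covariances of one variable with three others are fourth moments.
  Thus a fourth moment is small as soon as one outer gap is large, and it nearly factorizes if the
  middle gap is large.\<close>

lemma mom4_bounds:
  assumes "i < j" "j < k" "k < l"
  shows "\<bar>mom4 i j k l\<bar> \<le> \<phi> (j - i)" "\<bar>mom4 i j k l\<bar> \<le> \<phi> (l - k)"
    "\<bar>mom4 i j k l - mom2 i j * mom2 k l\<bar> \<le> \<phi> (k - j)"
proof -
  have "integrable M (\<lambda>\<omega>. X i \<omega> * (X j \<omega> * X k \<omega> * X l \<omega>))"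
    using integrable4[of i j k l] by (simp add: mult.assoc)
  from covariance_eq[OF integrable1 integrable3 this] cov13[OF assms]
  show "\<bar>mom4 i j k l\<bar> \<le> \<phi> (j - i)" by (simp add: centred mom4_def mult.assoc)
  from covariance_eq[OF integrable3 integrable1 integrable4, of i j k l] cov31[OF assms]
  show "\<bar>mom4 i j k l\<bar> \<le> \<phi> (l - k)" by (simp add: centred mom4_def)
  have "integrable M (\<lambda>\<omega>. (X i \<omega> * X j \<omega>) * (X k \<omega> * X l \<omega>))"
    using integrable4[of i j k l] by (simp add: mult.assoc)
  from covariance_eq[OF integrable2 integrable2 this] cov22[OF assms]
  show "\<bar>mom4 i j k l - mom2 i j * mom2 k l\<bar> \<le> \<phi> (k - j)"
    by (simp add: mom2_def mom4_def mult.assoc)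
qed

lemma mom2222: "expectation (\<lambda>\<omega>. (X i \<omega>)\<^sup>2 * (X j \<omega>)\<^sup>2) \<le> \<Phi>0"
proof -
  have "expectation (\<lambda>\<omega>. (X i \<omega>)\<^sup>2 * (X j \<omega>)\<^sup>2) \<le> expectation (\<lambda>\<omega>. (X i \<omega> ^ 4 + X j \<omega> ^ 4) / 2)"
  proof (rule integral_mono)
    show "integrable M (\<lambda>\<omega>. (X i \<omega>)\<^sup>2 * (X j \<omega>)\<^sup>2)"
      using integrable4[of i i j j] by (simp add: power2_eq_square mult.assoc)
    show "(X i x)\<^sup>2 * (X j x)\<^sup>2 \<le> (X i x ^ 4 + X j x ^ 4) / 2" for x
      using sum_squares_bound[of "(X i x)\<^sup>2" "(X j x)\<^sup>2"] by (simp flip: power_mult)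
  qed (use int4 in auto)
  also have "\<dots> \<le> \<Phi>0" using int4 fourth[of i] fourth[of j] by simp
  finally show ?thesis .
qed

text \<open>The factors 48 and 114 are those of \<open>fourth_power_le\<close>, and \<open>2 * \<Phi>1\<close> comes from the outer gaps.\<close>

definition "C4 = 48 * (2 * \<Phi>1) + 114 * \<Phi>0"

lemma C4_nonneg: "0 \<le> C4" using Phi0_nonneg Phi1_nonneg by (simp add: C4_def)

text \<open>In \<open>fourth_power_le\<close> the quadruples are summed by means of the outer gaps, and the square of
  \<open>\<Sum>i<N. (b i * X i)\<^sup>2\<close> needs only the individual fourth moments.\<close>

lemma linear_form_fourth_moment:
  shows "expectation (\<lambda>\<omega>. (\<Sum>i<N. b i * X i \<omega>) ^ 4) \<le> C4 * (\<Sum>i<N. (b i)\<^sup>2)\<^sup>2"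
    and "integrable M (\<lambda>\<omega>. (\<Sum>i<N. b i * X i \<omega>) ^ 4)"
proof -
  define S where "S = (\<Sum>i<N. (b i)\<^sup>2)"
  let ?e = "\<lambda>\<omega>. \<Sum>(i, j, k, l)\<in>quads N. (b i * X i \<omega>) * (b j * X j \<omega>) * (b k * X k \<omega>) * (b l * X l \<omega>)"
  let ?s = "\<lambda>\<omega>. (\<Sum>i<N. (b i * X i \<omega>)\<^sup>2)\<^sup>2"
  have e_eq: "?e = (\<lambda>\<omega>. \<Sum>(i, j, k, l)\<in>quads N. (b i * b k) * (b j * b l) * (X i \<omega> * X j \<omega> * X k \<omega> * X l \<omega>))"
    by (rule ext, rule sum.cong[OF refl]) (simp add: case_prod_beta mult_ac)
  have s_eq: "?s = (\<lambda>\<omega>. \<Sum>i<N. \<Sum>j<N. (b i)\<^sup>2 * (b j)\<^sup>2 * ((X i \<omega>)\<^sup>2 * (X j \<omega>)\<^sup>2))"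
    by (rule ext) (simp add: power2_eq_square sum_product mult_ac)
  have i22: "integrable M (\<lambda>\<omega>. (X i \<omega>)\<^sup>2 * (X j \<omega>)\<^sup>2)" for i j
    using integrable4[of i i j j] by (simp add: power2_eq_square mult.assoc)
  have ie: "integrable M ?e" unfolding e_eq case_prod_beta
    by (intro Bochner_Integration.integrable_sum integrable_mult_right integrable4)
  have iS: "integrable M ?s" unfolding s_eq
    by (intro Bochner_Integration.integrable_sum integrable_mult_right i22)
  show i4: "integrable M (\<lambda>\<omega>. (\<Sum>i<N. b i * X i \<omega>) ^ 4)"
  proof (rule Bochner_Integration.integrable_bound)
    show "integrable M (\<lambda>\<omega>. 48 * ?e \<omega> + 114 * ?s \<omega>)" using ie iS by simp
    show "AE x in M. norm ((\<Sum>i<N. b i * X i x) ^ 4) \<le> norm (48 * ?e x + 114 * ?s x)"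
    proof (rule AE_I2)
      fix x
      have "(\<Sum>i<N. b i * X i x) ^ 4 \<le> 48 * ?e x + 114 * ?s x" by (rule fourth_power_le)
      moreover have "0 \<le> (\<Sum>i<N. b i * X i x) ^ 4" by simp
      ultimately show "norm ((\<Sum>i<N. b i * X i x) ^ 4) \<le> norm (48 * ?e x + 114 * ?s x)"
        unfolding real_norm_def by linarith
    qed
  qed measurable
  have "expectation ?e = (\<Sum>(i, j, k, l)\<in>quads N. (b i * b k) * (b j * b l) * mom4 i j k l)"
    unfolding e_eq case_prod_beta mom4_def
    by (subst Bochner_Integration.integral_sum) (intro integrable_mult_right integrable4, simp)
  also have "\<dots> \<le> \<bar>\<Sum>(i, j, k, l)\<in>quads N. (b i * b k) * (b j * b l) * mom4 i j k l\<bar>" by simp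
  also have "\<dots> \<le> 2 * 1 * \<Phi>1 * (\<Sum>i<N. \<Sum>j<N. (b i * b j)\<^sup>2)"
  proof (rule sum_quads_outer_gaps(1)[of \<phi> \<Phi>1 N mom4 1 "\<lambda>i j. b i * b j"])
    show "\<bar>mom4 i j k l\<bar> \<le> 1 * \<phi> (max (j - i) (l - k))" if "(i, j, k, l) \<in> quads N" for i j k l
      using that mom4_bounds[of i j k l] by (auto simp: quads_def max_def)
  qed (use phi_nonneg phi_sum in auto)
  also have "(\<Sum>i<N. \<Sum>j<N. (b i * b j)\<^sup>2) = S\<^sup>2"
    by (simp add: S_def power2_eq_square sum_product mult_ac)
  finally have Ee: "expectation ?e \<le> 2 * \<Phi>1 * S\<^sup>2" by simp
  have "expectation ?s = (\<Sum>i<N. \<Sum>j<N. (b i)\<^sup>2 * (b j)\<^sup>2 * expectation (\<lambda>\<omega>. (X i \<omega>)\<^sup>2 * (X j \<omega>)\<^sup>2))"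
    unfolding s_eq
    by (subst Bochner_Integration.integral_sum, intro integrable_mult_right i22 Bochner_Integration.integrable_sum,
        subst Bochner_Integration.integral_sum, intro integrable_mult_right i22, simp)
  also have "\<dots> \<le> (\<Sum>i<N. \<Sum>j<N. (b i)\<^sup>2 * (b j)\<^sup>2 * \<Phi>0)"
    by (intro sum_mono mult_left_mono mom2222) auto
  also have "\<dots> = \<Phi>0 * S\<^sup>2" by (simp add: S_def power2_eq_square sum_product sum_distrib_left mult_ac)
  finally have Es: "expectation ?s \<le> \<Phi>0 * S\<^sup>2" .
  have "expectation (\<lambda>\<omega>. (\<Sum>i<N. b i * X i \<omega>) ^ 4) \<le> expectation (\<lambda>\<omega>. 48 * ?e \<omega> + 114 * ?s \<omega>)"
    using ie iS by (intro integral_mono i4 fourth_power_le) auto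
  also have "\<dots> = 48 * expectation ?e + 114 * expectation ?s" using ie iS by simp
  also have "\<dots> \<le> C4 * S\<^sup>2" using Ee Es by (simp add: C4_def algebra_simps)
  finally show "expectation (\<lambda>\<omega>. (\<Sum>i<N. b i * X i \<omega>) ^ 4) \<le> C4 * (\<Sum>i<N. (b i)\<^sup>2)\<^sup>2" by (simp add: S_def)
qed

text \<open>The inequality \<open>2 X\<^sup>2 Z\<^sup>2 \<le> S X\<^sup>4 + Z\<^sup>4 / S\<close>, in which the weight \<open>S\<close> balances the two terms, because
  the fourth moment of the linear form \<open>Z\<close> is of the order \<open>S\<^sup>2\<close>.\<close>

lemma mixed_square_moment:
  shows "expectation (\<lambda>\<omega>. (X k \<omega> * (\<Sum>i<N. b i * X i \<omega>))\<^sup>2) \<le> (\<Phi>0 + C4) * (\<Sum>i<N. (b i)\<^sup>2)"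
    and "integrable M (\<lambda>\<omega>. (X k \<omega> * (\<Sum>i<N. b i * X i \<omega>))\<^sup>2)"
proof -
  define S where "S = (\<Sum>i<N. (b i)\<^sup>2)"
  define Z where "Z \<omega> = (\<Sum>i<N. b i * X i \<omega>)" for \<omega>
  have Zm [measurable]: "Z \<in> borel_measurable M" unfolding Z_def by measurable
  note Z4 = linear_form_fourth_moment[where N = N and b = b, folded Z_def S_def]
  show int: "integrable M (\<lambda>\<omega>. (X k \<omega> * (\<Sum>i<N. b i * X i \<omega>))\<^sup>2)"
    using integrable_prod4[of "X k" M "X k" Z Z] Z4(2) int4[of k]
    by (simp add: power2_eq_square mult_ac flip: Z_def)
  have S0: "0 \<le> S" by (simp add: S_def sum_nonneg)
  have "expectation (\<lambda>\<omega>. (X k \<omega> * Z \<omega>)\<^sup>2) \<le> (\<Phi>0 + C4) * S"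
  proof (cases "S = 0")
    case True
    hence "b i = 0" if "i < N" for i using that by (simp add: S_def sum_nonneg_eq_0_iff)
    hence "Z \<omega> = 0" for \<omega> by (simp add: Z_def)
    thus ?thesis using True by simp
  next
    case False
    have pt: "(X k \<omega> * Z \<omega>)\<^sup>2 \<le> (S * X k \<omega> ^ 4 + Z \<omega> ^ 4 / S) / 2" for \<omega>
    proof -
      have "0 \<le> (S * (X k \<omega>)\<^sup>2 - (Z \<omega>)\<^sup>2)\<^sup>2" by simp
      hence "2 * S * (X k \<omega> * Z \<omega>)\<^sup>2 \<le> S\<^sup>2 * X k \<omega> ^ 4 + Z \<omega> ^ 4"
        by (simp add: power2_eq_square power4_eq_xxxx algebra_simps)
      thus ?thesis using False S0 by (simp add: field_simps power2_eq_square)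
    qed
    have "expectation (\<lambda>\<omega>. (X k \<omega> * Z \<omega>)\<^sup>2) \<le> expectation (\<lambda>\<omega>. (S * X k \<omega> ^ 4 + Z \<omega> ^ 4 / S) / 2)"
      using int Z4(2) int4[of k] by (intro integral_mono pt) (auto simp flip: Z_def)
    also have "\<dots> = (S * expectation (\<lambda>\<omega>. X k \<omega> ^ 4) + expectation (\<lambda>\<omega>. Z \<omega> ^ 4) / S) / 2"
      using Z4(2) int4[of k] by simp
    also have "\<dots> \<le> (S * \<Phi>0 + (C4 * S\<^sup>2) / S) / 2"
      using fourth[of k] Z4(1) S0
      by (intro divide_right_mono add_mono mult_left_mono) auto
    also have "\<dots> = (\<Phi>0 + C4) * S / 2" using False by (simp add: power2_eq_square algebra_simps)
    also have "\<dots> \<le> (\<Phi>0 + C4) * S" using S0 Phi0_nonneg C4_nonneg by simp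
    finally show ?thesis .
  qed
  thus "expectation (\<lambda>\<omega>. (X k \<omega> * (\<Sum>i<N. b i * X i \<omega>))\<^sup>2) \<le> (\<Phi>0 + C4) * (\<Sum>i<N. (b i)\<^sup>2)"
    by (simp add: Z_def S_def)
qed

text \<open>The square is expanded by \<open>square_sum_symmetric\<close>. The three pairings of four different indices are
  summed by means of two gaps each. The row sums are the centred variables \<open>X i * (\<Sum>j. a i j * X j)\<close>,
  whose second moments are given by \<open>mixed_square_moment\<close>.\<close>

lemma off_diagonal_variance:
  fixes a :: "nat \<Rightarrow> nat \<Rightarrow> real"
  assumes sym: "\<And>i j. a i j = a j i" and diag: "\<And>i. a i i = 0"
  shows "expectation (\<lambda>\<omega>. (\<Sum>i<N. \<Sum>j<N. a i j * (X i \<omega> * X j \<omega> - mom2 i j))\<^sup>2)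
      \<le> (96 * \<Phi>1 + 4 * (\<Phi>0 + C4)) * (\<Sum>i<N. \<Sum>j<N. (a i j)\<^sup>2)"
    and "integrable M (\<lambda>\<omega>. (\<Sum>i<N. \<Sum>j<N. a i j * (X i \<omega> * X j \<omega> - mom2 i j))\<^sup>2)"
proof -
  define P where "P i j \<omega> = X i \<omega> * X j \<omega> - mom2 i j" for i j \<omega>
  define A where "A = (\<Sum>i<N. \<Sum>j<N. (a i j)\<^sup>2)"
  have mom2_sym: "mom2 i j = mom2 j i" for i j by (simp add: mom2_def mult.commute)
  have PP: "integrable M (\<lambda>\<omega>. P i j \<omega> * P k l \<omega>)" for i j k l
  proof -
    have "(\<lambda>\<omega>. P i j \<omega> * P k l \<omega>) = (\<lambda>\<omega>. X i \<omega> * X j \<omega> * X k \<omega> * X l \<omega> - mom2 k l * (X i \<omega> * X j \<omega>)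
       - mom2 i j * (X k \<omega> * X l \<omega>) + mom2 i j * mom2 k l)"
      by (auto simp: P_def algebra_simps)
    thus ?thesis using integrable4 integrable2 by simp
  qed
  have EPP: "expectation (\<lambda>\<omega>. P i j \<omega> * P k l \<omega>) = mom4 i j k l - mom2 i j * mom2 k l" for i j k l
  proof -
    have "(\<lambda>\<omega>. P i j \<omega> * P k l \<omega>) = (\<lambda>\<omega>. X i \<omega> * X j \<omega> * X k \<omega> * X l \<omega> - mom2 k l * (X i \<omega> * X j \<omega>)
       - mom2 i j * (X k \<omega> * X l \<omega>) + mom2 i j * mom2 k l)"
      by (auto simp: P_def algebra_simps)
    thus ?thesis using integrable4 integrable2 by (simp add: prob_space mom4_def mom2_def)
  qed
  let ?T = "\<lambda>\<omega>. \<Sum>i<N. \<Sum>j<N. a i j * P i j \<omega>"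
  let ?D = "\<lambda>\<omega>. \<Sum>(i, j, k, l)\<in>quads N. a i j * a k l * (P i j \<omega> * P k l \<omega>)
     + a i k * a j l * (P i k \<omega> * P j l \<omega>) + a i l * a j k * (P i l \<omega> * P j k \<omega>)"
  let ?V = "\<lambda>\<omega>. \<Sum>i<N. (\<Sum>j<N. a i j * P i j \<omega>)\<^sup>2"
  have sq: "(?T \<omega>)\<^sup>2 \<le> 8 * ?D \<omega> + 4 * ?V \<omega>" for \<omega>
  proof -
    have "(?T \<omega>)\<^sup>2 = 8 * (\<Sum>l<N. \<Sum>k<l. \<Sum>j<k. \<Sum>i<j. (a i j * P i j \<omega>) * (a k l * P k l \<omega>)
       + (a i k * P i k \<omega>) * (a j l * P j l \<omega>) + (a i l * P i l \<omega>) * (a j k * P j k \<omega>))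
       + 4 * ?V \<omega> - 2 * (\<Sum>i<N. \<Sum>j<N. (a i j * P i j \<omega>)\<^sup>2)"
    proof (rule square_sum_symmetric)
      show "a i j * P i j \<omega> = a j i * P j i \<omega>" for i j
        by (simp add: sym[of i j] mom2_sym[of i j] P_def mult.commute)
    qed (simp add: diag)
    also have "(\<Sum>l<N. \<Sum>k<l. \<Sum>j<k. \<Sum>i<j. (a i j * P i j \<omega>) * (a k l * P k l \<omega>)
       + (a i k * P i k \<omega>) * (a j l * P j l \<omega>) + (a i l * P i l \<omega>) * (a j k * P j k \<omega>)) = ?D \<omega>"
      unfolding nested_sum_quads by (intro sum.cong refl) (simp add: case_prod_beta mult_ac)
    finally have "(?T \<omega>)\<^sup>2 = 8 * ?D \<omega> + 4 * ?V \<omega> - 2 * (\<Sum>i<N. \<Sum>j<N. (a i j * P i j \<omega>)\<^sup>2)" .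
    moreover have "0 \<le> (\<Sum>i<N. \<Sum>j<N. (a i j * P i j \<omega>)\<^sup>2)" by (intro sum_nonneg) auto
    ultimately show ?thesis by simp
  qed
  have iD: "integrable M ?D" unfolding case_prod_beta
    by (intro Bochner_Integration.integrable_sum integrable_mult_right PP Bochner_Integration.integrable_add)
  have iT: "integrable M (\<lambda>\<omega>. (?T \<omega>)\<^sup>2)"
  proof -
    have "(\<lambda>\<omega>. (?T \<omega>)\<^sup>2) = (\<lambda>\<omega>. \<Sum>i<N. \<Sum>k<N. \<Sum>j<N. \<Sum>l<N. a i j * a k l * (P i j \<omega> * P k l \<omega>))"
      by (simp add: power2_eq_square sum_product mult_ac)
    thus ?thesis by (simp only:) (intro Bochner_Integration.integrable_sum integrable_mult_right PP)
  qed
  define Z where "Z i \<omega> = X i \<omega> * (\<Sum>j<N. a i j * X j \<omega>)" for i \<omega>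
  have Zm [measurable]: "Z i \<in> borel_measurable M" for i unfolding Z_def by measurable
  have Zi: "integrable M (\<lambda>\<omega>. (Z i \<omega>)\<^sup>2)" for i unfolding Z_def by (rule mixed_square_moment)
  have EZ: "expectation (Z i) = (\<Sum>j<N. a i j * mom2 i j)" for i
  proof -
    have "Z i = (\<lambda>\<omega>. \<Sum>j<N. a i j * (X i \<omega> * X j \<omega>))"
      by (simp add: Z_def[abs_def] sum_distrib_left mult_ac)
    thus ?thesis by (simp add: mom2_def integrable2)
  qed
  have PZ: "(\<Sum>j<N. a i j * P i j \<omega>) = Z i \<omega> - expectation (Z i)" for i \<omega>
    unfolding EZ by (simp add: Z_def P_def sum_distrib_left right_diff_distrib sum_subtractf mult_ac)
  have iV: "integrable M ?V" unfolding PZ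
    by (intro Bochner_Integration.integrable_sum square_expectation_diff_le(2) Zi Zm)
  have "expectation ?V = (\<Sum>i<N. expectation (\<lambda>\<omega>. (Z i \<omega> - expectation (Z i))\<^sup>2))"
    unfolding PZ by (rule Bochner_Integration.integral_sum) (intro square_expectation_diff_le(2) Zi Zm)
  also have "\<dots> \<le> (\<Sum>i<N. expectation (\<lambda>\<omega>. (Z i \<omega>)\<^sup>2))"
    by (intro sum_mono square_expectation_diff_le(1) Zi Zm)
  also have "\<dots> \<le> (\<Sum>i<N. (\<Phi>0 + C4) * (\<Sum>j<N. (a i j)\<^sup>2))"
    unfolding Z_def by (intro sum_mono mixed_square_moment)
  also have "\<dots> = (\<Phi>0 + C4) * A" by (simp add: A_def sum_distrib_left)
  finally have EV: "expectation ?V \<le> (\<Phi>0 + C4) * A" .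
  have "expectation ?D = (\<Sum>(i, j, k, l)\<in>quads N. a i j * a k l * (mom4 i j k l - mom2 i j * mom2 k l)
     + a i k * a j l * (mom4 i k j l - mom2 i k * mom2 j l) + a i l * a j k * (mom4 i l j k - mom2 i l * mom2 j k))"
    unfolding case_prod_beta
    by (subst Bochner_Integration.integral_sum)
      (intro integrable_mult_right PP Bochner_Integration.integrable_add, simp add: PP EPP)
  also have "\<dots> = (\<Sum>(i, j, k, l)\<in>quads N. a i j * a k l * (mom4 i j k l - mom2 i j * mom2 k l))
     + (\<Sum>(i, j, k, l)\<in>quads N. a i k * a j l * (mom4 i k j l - mom2 i k * mom2 j l))
     + (\<Sum>(i, j, k, l)\<in>quads N. a i l * a j k * (mom4 i l j k - mom2 i l * mom2 j k))"
    by (simp add: case_prod_beta sum.distrib)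
  finally have ED: "expectation ?D = \<dots>" .
  have prod_le: "\<bar>x * y\<bar> \<le> z" if "\<bar>x\<bar> \<le> 1 \<and> \<bar>y\<bar> \<le> z \<or> \<bar>y\<bar> \<le> 1 \<and> \<bar>x\<bar> \<le> z" for x y z :: real
    using that mult_mono[of "\<bar>x\<bar>" 1 "\<bar>y\<bar>" z] mult_mono[of "\<bar>x\<bar>" z "\<bar>y\<bar>" 1]
    by (auto simp: abs_mult)
  have d1: "\<bar>\<Sum>(i, j, k, l)\<in>quads N. a i j * a k l * (mom4 i j k l - mom2 i j * mom2 k l)\<bar> \<le> 2 * 2 * \<Phi>1 * A"
    unfolding A_def
  proof (rule sum_quads_middle_gap[of \<phi> \<Phi>1 N "\<lambda>i j k l. mom4 i j k l - mom2 i j * mom2 k l" 2 a])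
    fix i j k l assume q: "(i, j, k, l) \<in> quads N"
    hence o: "i < j" "j < k" "k < l" by (auto simp: quads_def)
    note m = mom4_bounds[OF o]
    have "\<bar>mom2 i j * mom2 k l\<bar> \<le> \<phi> (j - i)" "\<bar>mom2 i j * mom2 k l\<bar> \<le> \<phi> (l - k)"
      using mom2_bounds(1)[OF o(1)] mom2_bounds(1)[OF o(3)] mom2_bounds(2) by (intro prod_le; blast)+
    moreover have "0 \<le> \<phi> (k - j)" using o by (intro phi_nonneg) auto
    ultimately have "\<bar>mom4 i j k l - mom2 i j * mom2 k l\<bar> \<le> 2 * \<phi> g"
      if "g = j - i \<or> g = k - j \<or> g = l - k" for g
      using that m by (elim disjE; simp only:; linarith)
    thus "\<bar>mom4 i j k l - mom2 i j * mom2 k l\<bar> \<le> 2 * \<phi> (max (k - j) (l - k))"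
      and "\<bar>mom4 i j k l - mom2 i j * mom2 k l\<bar> \<le> 2 * \<phi> (max (j - i) (k - j))"
      by (simp_all add: max_def)
  qed (use phi_nonneg phi_sum in auto)
  have d2: "\<bar>\<Sum>(i, j, k, l)\<in>quads N. a i k * a j l * (mom4 i k j l - mom2 i k * mom2 j l)\<bar> \<le> 2 * 2 * \<Phi>1 * A"
    unfolding A_def
  proof (rule sum_quads_outer_gaps(1)[of \<phi> \<Phi>1 N "\<lambda>i j k l. mom4 i k j l - mom2 i k * mom2 j l" 2 a])
    fix i j k l assume q: "(i, j, k, l) \<in> quads N"
    hence o: "i < j" "j < k" "k < l" by (auto simp: quads_def)
    have e: "mom4 i k j l = mom4 i j k l" by (simp add: mom4_def mult_ac)
    have "\<bar>mom2 i k\<bar> \<le> \<phi> (j - i)"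
      using mom2_bounds(1)[of i k] phi_antimono[of "j - i" "k - i"] o by linarith
    moreover have "\<bar>mom2 j l\<bar> \<le> \<phi> (l - k)"
      using mom2_bounds(1)[of j l] phi_antimono[of "l - k" "l - j"] o by linarith
    ultimately have "\<bar>mom2 i k * mom2 j l\<bar> \<le> \<phi> (j - i)" "\<bar>mom2 i k * mom2 j l\<bar> \<le> \<phi> (l - k)"
      using mom2_bounds(2) by (intro prod_le; blast)+
    thus "\<bar>mom4 i k j l - mom2 i k * mom2 j l\<bar> \<le> 2 * \<phi> (max (j - i) (l - k))"
      unfolding e max_def using mom4_bounds[OF o] by (simp split: if_split; linarith)
  qed (use phi_nonneg phi_sum in auto)
  have d3: "\<bar>\<Sum>(i, j, k, l)\<in>quads N. a i l * a j k * (mom4 i l j k - mom2 i l * mom2 j k)\<bar> \<le> 2 * 2 * \<Phi>1 * A"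
    unfolding A_def
  proof (rule sum_quads_outer_gaps(2)[of \<phi> \<Phi>1 N "\<lambda>i j k l. mom4 i l j k - mom2 i l * mom2 j k" 2 a])
    fix i j k l assume q: "(i, j, k, l) \<in> quads N"
    hence o: "i < j" "j < k" "k < l" by (auto simp: quads_def)
    have e: "mom4 i l j k = mom4 i j k l" by (simp add: mom4_def mult_ac)
    have "\<bar>mom2 i l\<bar> \<le> \<phi> (j - i)" "\<bar>mom2 i l\<bar> \<le> \<phi> (l - k)"
      using mom2_bounds(1)[of i l] phi_antimono[of "j - i" "l - i"] phi_antimono[of "l - k" "l - i"] o by linarith+
    hence "\<bar>mom2 i l * mom2 j k\<bar> \<le> \<phi> (j - i)" "\<bar>mom2 i l * mom2 j k\<bar> \<le> \<phi> (l - k)"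
      using mom2_bounds(2) by (intro prod_le; blast)+
    thus "\<bar>mom4 i l j k - mom2 i l * mom2 j k\<bar> \<le> 2 * \<phi> (max (j - i) (l - k))"
      unfolding e max_def using mom4_bounds[OF o] by (simp split: if_split; linarith)
  qed (use phi_nonneg phi_sum in auto)
  have "expectation (\<lambda>\<omega>. (?T \<omega>)\<^sup>2) \<le> expectation (\<lambda>\<omega>. 8 * ?D \<omega> + 4 * ?V \<omega>)"
    using iD iV by (intro integral_mono iT sq) auto
  also have "\<dots> = 8 * expectation ?D + 4 * expectation ?V" using iD iV by simp
  \<comment> \<open>three pairings, each with weights of at most \<open>2 * \<phi>\<close> at the larger of two gaps\<close>
  also have "\<dots> \<le> 8 * (3 * (2 * 2 * \<Phi>1 * A)) + 4 * ((\<Phi>0 + C4) * A)"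
  proof (intro add_mono mult_left_mono)
    show "expectation ?D \<le> 3 * (2 * 2 * \<Phi>1 * A)"
    proof -
      have "x + y + z \<le> 3 * u" if "\<bar>x\<bar> \<le> u" "\<bar>y\<bar> \<le> u" "\<bar>z\<bar> \<le> u" for x y z u :: real
        using that by linarith
      from this[OF d1 d2 d3] show ?thesis unfolding ED .
    qed
  qed (use EV in auto)
  finally show "expectation (\<lambda>\<omega>. (\<Sum>i<N. \<Sum>j<N. a i j * (X i \<omega> * X j \<omega> - mom2 i j))\<^sup>2)
      \<le> (96 * \<Phi>1 + 4 * (\<Phi>0 + C4)) * (\<Sum>i<N. \<Sum>j<N. (a i j)\<^sup>2)"
    by (simp add: P_def A_def algebra_simps)
  show "integrable M (\<lambda>\<omega>. (\<Sum>i<N. \<Sum>j<N. a i j * (X i \<omega> * X j \<omega> - mom2 i j))\<^sup>2)"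
    using iT by (simp add: P_def)
qed

lemma sum_weights_le:
  assumes i: "i < N"
  shows "(\<Sum>j<N. if i = j then \<Phi>0 else if i < j then \<psi> (j - i) else \<psi> (i - j)) \<le> \<Phi>0 + 2 * \<Phi>2"
proof -
  let ?w = "\<lambda>j. if i = j then \<Phi>0 else if i < j then \<psi> (j - i) else \<psi> (i - j)"
  have "{..<N} = {..<i} \<union> ({i} \<union> {i<..<N})" using i by auto
  hence "(\<Sum>j<N. ?w j) = (\<Sum>j<i. ?w j) + ((\<Sum>j\<in>{i}. ?w j) + (\<Sum>j\<in>{i<..<N}. ?w j))"
    by (simp only:) (subst sum.union_disjoint; force)+
  also have "(\<Sum>j<i. ?w j) = (\<Sum>g=1..i. \<psi> g)"
    by (rule sum.reindex_bij_witness[of _ "\<lambda>g. i - g" "\<lambda>j. i - j"]) auto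
  also have "(\<Sum>j\<in>{i<..<N}. ?w j) = (\<Sum>g=1..N - i - 1. \<psi> g)"
    by (rule sum.reindex_bij_witness[of _ "\<lambda>g. i + g" "\<lambda>j. j - i"]) auto
  finally show ?thesis using psi_sum[of i] psi_sum[of "N - i - 1"] by simp
qed

text \<open>The covariances of squares have only an upper bound, which is of use as long as it is multiplied
  by nonnegative coefficients.\<close>

lemma diagonal_variance_nonneg:
  fixes c :: "nat \<Rightarrow> real"
  assumes c: "\<And>i. 0 \<le> c i"
  shows "expectation (\<lambda>\<omega>. (\<Sum>i<N. c i * ((X i \<omega>)\<^sup>2 - mom2 i i))\<^sup>2) \<le> (\<Phi>0 + 2 * \<Phi>2) * (\<Sum>i<N. (c i)\<^sup>2)"
    and "integrable M (\<lambda>\<omega>. (\<Sum>i<N. c i * ((X i \<omega>)\<^sup>2 - mom2 i i))\<^sup>2)"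
proof -
  define P where "P i \<omega> = (X i \<omega>)\<^sup>2 - mom2 i i" for i \<omega>
  define w where "w i j = (if i = j then \<Phi>0 else if i < j then \<psi> (j - i) else \<psi> (i - j))" for i j
  have sq: "integrable M (\<lambda>\<omega>. (X i \<omega>)\<^sup>2)" for i using integrable2[of i i] by (simp add: power2_eq_square)
  have sq2: "integrable M (\<lambda>\<omega>. (X i \<omega>)\<^sup>2 * (X j \<omega>)\<^sup>2)" for i j
    using integrable4[of i i j j] by (simp add: power2_eq_square mult.assoc)
  have PPe: "(\<lambda>\<omega>. P i \<omega> * P j \<omega>) = (\<lambda>\<omega>. (X i \<omega>)\<^sup>2 * (X j \<omega>)\<^sup>2 - mom2 j j * (X i \<omega>)\<^sup>2
       - mom2 i i * (X j \<omega>)\<^sup>2 + mom2 i i * mom2 j j)" for i j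
    by (auto simp: P_def algebra_simps)
  have PP: "integrable M (\<lambda>\<omega>. P i \<omega> * P j \<omega>)" for i j
    unfolding PPe using sq sq2 by simp
  have cov: "expectation (\<lambda>\<omega>. P i \<omega> * P j \<omega>) = covariance M (\<lambda>\<omega>. (X i \<omega>)\<^sup>2) (\<lambda>\<omega>. (X j \<omega>)\<^sup>2)" for i j
    by (simp add: covariance_def P_def mom2_def power2_eq_square)
  have w: "expectation (\<lambda>\<omega>. P i \<omega> * P j \<omega>) \<le> w i j" for i j
  proof -
    consider "i = j" | "i < j" | "j < i" by linarith
    thus ?thesis
    proof cases
      case 1
      have "expectation (\<lambda>\<omega>. P i \<omega> * P i \<omega>) \<le> expectation (\<lambda>\<omega>. ((X i \<omega>)\<^sup>2)\<^sup>2)"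
        using square_expectation_diff_le(1)[of "\<lambda>\<omega>. (X i \<omega>)\<^sup>2"] sq2[of i i]
        by (simp add: P_def mom2_def power2_eq_square)
      thus ?thesis using 1 fourth[of i] by (simp add: w_def flip: power_mult)
    next
      case 2
      thus ?thesis using covsq[OF 2] by (simp add: cov w_def)
    next
      case 3
      have "expectation (\<lambda>\<omega>. P i \<omega> * P j \<omega>) = expectation (\<lambda>\<omega>. P j \<omega> * P i \<omega>)" by (simp add: mult.commute)
      thus ?thesis using 3 covsq[OF 3] by (simp add: cov w_def)
    qed
  qed
  have w0: "0 \<le> w i j" for i j using Phi0_nonneg psi_nonneg by (auto simp: w_def)
  have sqe: "(\<lambda>\<omega>. (\<Sum>i<N. c i * P i \<omega>)\<^sup>2) = (\<lambda>\<omega>. \<Sum>i<N. \<Sum>j<N. c i * c j * (P i \<omega> * P j \<omega>))"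
    by (simp add: power2_eq_square sum_product mult_ac)
  have "expectation (\<lambda>\<omega>. (\<Sum>i<N. c i * P i \<omega>)\<^sup>2) = (\<Sum>i<N. \<Sum>j<N. c i * c j * expectation (\<lambda>\<omega>. P i \<omega> * P j \<omega>))"
    unfolding sqe
    by (subst Bochner_Integration.integral_sum, intro integrable_mult_right PP Bochner_Integration.integrable_sum,
        subst Bochner_Integration.integral_sum, intro integrable_mult_right PP, simp)
  also have "\<dots> \<le> (\<Sum>i<N. \<Sum>j<N. ((c i)\<^sup>2 + (c j)\<^sup>2) / 2 * w i j)"
  proof (intro sum_mono)
    fix i j
    have "c i * c j * expectation (\<lambda>\<omega>. P i \<omega> * P j \<omega>) \<le> c i * c j * w i j"
      by (intro mult_left_mono w) (simp add: c)
    also have "\<dots> \<le> ((c i)\<^sup>2 + (c j)\<^sup>2) / 2 * w i j"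
      using sum_squares_bound[of "c i" "c j"] by (intro mult_right_mono w0) simp
    finally show "c i * c j * expectation (\<lambda>\<omega>. P i \<omega> * P j \<omega>) \<le> ((c i)\<^sup>2 + (c j)\<^sup>2) / 2 * w i j" .
  qed
  also have "\<dots> = ((\<Sum>i<N. \<Sum>j<N. (c i)\<^sup>2 * w i j) + (\<Sum>i<N. \<Sum>j<N. (c j)\<^sup>2 * w i j)) / 2"
    unfolding sum.distrib[symmetric] sum_divide_distrib
    by (intro sum.cong refl) (simp add: algebra_simps add_divide_distrib)
  also have "(\<Sum>i<N. \<Sum>j<N. (c j)\<^sup>2 * w i j) = (\<Sum>i<N. \<Sum>j<N. (c i)\<^sup>2 * w i j)"
    by (subst sum.swap) (auto intro!: sum.cong simp: w_def)
  also have "((\<Sum>i<N. \<Sum>j<N. (c i)\<^sup>2 * w i j) + (\<Sum>i<N. \<Sum>j<N. (c i)\<^sup>2 * w i j)) / 2 = (\<Sum>i<N. (c i)\<^sup>2 * (\<Sum>j<N. w i j))"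
    by (simp add: sum_distrib_left[symmetric])
  also have "\<dots> \<le> (\<Sum>i<N. (c i)\<^sup>2 * (\<Phi>0 + 2 * \<Phi>2))"
    using sum_weights_le unfolding w_def by (intro sum_mono mult_left_mono) auto
  also have "\<dots> = (\<Phi>0 + 2 * \<Phi>2) * (\<Sum>i<N. (c i)\<^sup>2)" by (simp add: sum_distrib_left mult.commute)
  finally show "expectation (\<lambda>\<omega>. (\<Sum>i<N. c i * ((X i \<omega>)\<^sup>2 - mom2 i i))\<^sup>2) \<le> (\<Phi>0 + 2 * \<Phi>2) * (\<Sum>i<N. (c i)\<^sup>2)"
    by (simp add: P_def)
  have "integrable M (\<lambda>\<omega>. (\<Sum>i<N. c i * P i \<omega>)\<^sup>2)"
    unfolding sqe by (intro integrable_mult_right PP Bochner_Integration.integrable_sum)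
  thus "integrable M (\<lambda>\<omega>. (\<Sum>i<N. c i * ((X i \<omega>)\<^sup>2 - mom2 i i))\<^sup>2)" by (simp add: P_def)
qed

lemma integral_square_add_le:
  fixes f g :: "'a \<Rightarrow> real"
  assumes f: "integrable M (\<lambda>\<omega>. (f \<omega>)\<^sup>2)" "f \<in> borel_measurable M"
    and g: "integrable M (\<lambda>\<omega>. (g \<omega>)\<^sup>2)" "g \<in> borel_measurable M"
  shows "expectation (\<lambda>\<omega>. (f \<omega> + g \<omega>)\<^sup>2) \<le> 2 * expectation (\<lambda>\<omega>. (f \<omega>)\<^sup>2) + 2 * expectation (\<lambda>\<omega>. (g \<omega>)\<^sup>2)"
    and "integrable M (\<lambda>\<omega>. (f \<omega> + g \<omega>)\<^sup>2)"
proof -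
  have le: "(f \<omega> + g \<omega>)\<^sup>2 \<le> 2 * (f \<omega>)\<^sup>2 + 2 * (g \<omega>)\<^sup>2" for \<omega>
    using sum_squares_bound[of "f \<omega>" "g \<omega>"] by (simp add: power2_sum)
  show i: "integrable M (\<lambda>\<omega>. (f \<omega> + g \<omega>)\<^sup>2)"
  proof (rule Bochner_Integration.integrable_bound)
    show "integrable M (\<lambda>\<omega>. 2 * (f \<omega>)\<^sup>2 + 2 * (g \<omega>)\<^sup>2)" using f g by simp
    show "AE x in M. norm ((f x + g x)\<^sup>2) \<le> norm (2 * (f x)\<^sup>2 + 2 * (g x)\<^sup>2)" using le by simp
  qed (use f g in measurable)
  have "expectation (\<lambda>\<omega>. (f \<omega> + g \<omega>)\<^sup>2) \<le> expectation (\<lambda>\<omega>. 2 * (f \<omega>)\<^sup>2 + 2 * (g \<omega>)\<^sup>2)"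
    using f g by (intro integral_mono i le) auto
  thus "expectation (\<lambda>\<omega>. (f \<omega> + g \<omega>)\<^sup>2) \<le> 2 * expectation (\<lambda>\<omega>. (f \<omega>)\<^sup>2) + 2 * expectation (\<lambda>\<omega>. (g \<omega>)\<^sup>2)"
    using f g by simp
qed

text \<open>The positive and the negative parts of the coefficients are treated separately.\<close>

lemma diagonal_variance:
  fixes c :: "nat \<Rightarrow> real"
  shows "expectation (\<lambda>\<omega>. (\<Sum>i<N. c i * ((X i \<omega>)\<^sup>2 - mom2 i i))\<^sup>2) \<le> 2 * (\<Phi>0 + 2 * \<Phi>2) * (\<Sum>i<N. (c i)\<^sup>2)"
    and "integrable M (\<lambda>\<omega>. (\<Sum>i<N. c i * ((X i \<omega>)\<^sup>2 - mom2 i i))\<^sup>2)"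
proof -
  define a b where "a i = max (c i) 0" and "b i = max (- c i) 0" for i
  define F G where "F \<omega> = (\<Sum>i<N. a i * ((X i \<omega>)\<^sup>2 - mom2 i i))"
    and "G \<omega> = - (\<Sum>i<N. b i * ((X i \<omega>)\<^sup>2 - mom2 i i))" for \<omega>
  have c: "c i = a i - b i" for i by (auto simp: a_def b_def max_def)
  have FG: "(\<Sum>i<N. c i * ((X i \<omega>)\<^sup>2 - mom2 i i)) = F \<omega> + G \<omega>" for \<omega>
    by (simp add: c F_def G_def left_diff_distrib sum_subtractf)
  have m [measurable]: "F \<in> borel_measurable M" "G \<in> borel_measurable M" unfolding F_def G_def by measurable
  have A: "expectation (\<lambda>\<omega>. (F \<omega>)\<^sup>2) \<le> (\<Phi>0 + 2 * \<Phi>2) * (\<Sum>i<N. (a i)\<^sup>2)" "integrable M (\<lambda>\<omega>. (F \<omega>)\<^sup>2)"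
    unfolding F_def by (intro diagonal_variance_nonneg; simp add: a_def)+
  have B: "expectation (\<lambda>\<omega>. (G \<omega>)\<^sup>2) \<le> (\<Phi>0 + 2 * \<Phi>2) * (\<Sum>i<N. (b i)\<^sup>2)" "integrable M (\<lambda>\<omega>. (G \<omega>)\<^sup>2)"
    unfolding G_def power2_minus by (intro diagonal_variance_nonneg; simp add: b_def)+
  have "(\<Sum>i<N. (a i)\<^sup>2) + (\<Sum>i<N. (b i)\<^sup>2) = (\<Sum>i<N. (c i)\<^sup>2)"
    unfolding sum.distrib[symmetric] by (intro sum.cong) (auto simp: a_def b_def max_def)
  hence e: "2 * ((\<Phi>0 + 2 * \<Phi>2) * (\<Sum>i<N. (a i)\<^sup>2)) + 2 * ((\<Phi>0 + 2 * \<Phi>2) * (\<Sum>i<N. (b i)\<^sup>2))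
    = 2 * (\<Phi>0 + 2 * \<Phi>2) * (\<Sum>i<N. (c i)\<^sup>2)"
    by (simp flip: distrib_left)
  show "expectation (\<lambda>\<omega>. (\<Sum>i<N. c i * ((X i \<omega>)\<^sup>2 - mom2 i i))\<^sup>2) \<le> 2 * (\<Phi>0 + 2 * \<Phi>2) * (\<Sum>i<N. (c i)\<^sup>2)"
    unfolding FG e[symmetric] using integral_square_add_le(1)[OF A(2) m(1) B(2) m(2)] A(1) B(1) by linarith
  show "integrable M (\<lambda>\<omega>. (\<Sum>i<N. c i * ((X i \<omega>)\<^sup>2 - mom2 i i))\<^sup>2)"
    unfolding FG by (rule integral_square_add_le(2)[OF A(2) m(1) B(2) m(2)])
qed

text \<open>Twice the constants for the diagonal and for the off-diagonal part.\<close>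

definition "CQ = 4 * (\<Phi>0 + 2 * \<Phi>2) + 2 * (96 * \<Phi>1 + 4 * (\<Phi>0 + C4))"

lemma CQ_nonneg: "0 \<le> CQ"
  using Phi0_nonneg Phi1_nonneg Phi2_nonneg C4_nonneg by (simp add: CQ_def)

text \<open>The diagonal part and the symmetrized off-diagonal part are estimated separately. The essential
  point is that the constant depends neither on the number of variables nor on the matrix.\<close>

theorem quadratic_form_variance:
  fixes c :: "nat \<Rightarrow> nat \<Rightarrow> real"
  shows "expectation (\<lambda>\<omega>. (\<Sum>i<N. \<Sum>j<N. c i j * (X i \<omega> * X j \<omega> - mom2 i j))\<^sup>2)
      \<le> CQ * (\<Sum>i<N. \<Sum>j<N. (c i j)\<^sup>2)"
    and "integrable M (\<lambda>\<omega>. (\<Sum>i<N. \<Sum>j<N. c i j * (X i \<omega> * X j \<omega> - mom2 i j))\<^sup>2)"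
proof -
  define a where "a i j = (if i = j then 0 else (c i j + c j i) / 2)" for i j
  define A where "A = (\<Sum>i<N. \<Sum>j<N. (c i j)\<^sup>2)"
  define F G where "F \<omega> = (\<Sum>i<N. c i i * ((X i \<omega>)\<^sup>2 - mom2 i i))"
    and "G \<omega> = (\<Sum>i<N. \<Sum>j<N. a i j * (X i \<omega> * X j \<omega> - mom2 i j))" for \<omega>
  have m [measurable]: "F \<in> borel_measurable M" "G \<in> borel_measurable M" unfolding F_def G_def by measurable
  have FG: "(\<Sum>i<N. \<Sum>j<N. c i j * (X i \<omega> * X j \<omega> - mom2 i j)) = F \<omega> + G \<omega>" for \<omega>
  proof -
    define P where "P i j = X i \<omega> * X j \<omega> - mom2 i j" for i j
    define b where "b i j = (if i = j then 0 else c i j)" for i j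
    have Ps: "P i j = P j i" for i j by (simp add: P_def mom2_def mult.commute)
    have "(\<Sum>j<N. c i j * P i j) = c i i * P i i + (\<Sum>j<N. b i j * P i j)" if "i < N" for i
    proof -
      have "(\<Sum>j<N. c i j * P i j) = (\<Sum>j<N. (if j = i then c i i * P i i else 0) + b i j * P i j)"
        by (intro sum.cong) (auto simp: b_def)
      thus ?thesis using that by (simp add: sum.distrib)
    qed
    hence e1: "(\<Sum>i<N. \<Sum>j<N. c i j * P i j) = (\<Sum>i<N. c i i * P i i) + (\<Sum>i<N. \<Sum>j<N. b i j * P i j)"
      by (simp add: sum.distrib)
    have "(\<Sum>i<N. \<Sum>j<N. b i j * P i j) = (\<Sum>i<N. \<Sum>j<N. b j i * P i j)"
      by (subst sum.swap) (simp add: Ps)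
    hence "(\<Sum>i<N. \<Sum>j<N. b i j * P i j) = ((\<Sum>i<N. \<Sum>j<N. b i j * P i j) + (\<Sum>i<N. \<Sum>j<N. b j i * P i j)) / 2"
      by simp
    also have "\<dots> = (\<Sum>i<N. \<Sum>j<N. a i j * P i j)"
      unfolding sum.distrib[symmetric] sum_divide_distrib
      by (intro sum.cong refl) (simp add: a_def b_def algebra_simps add_divide_distrib)
    finally show ?thesis using e1 by (simp add: F_def G_def P_def power2_eq_square)
  qed
  have Fv: "expectation (\<lambda>\<omega>. (F \<omega>)\<^sup>2) \<le> 2 * (\<Phi>0 + 2 * \<Phi>2) * (\<Sum>i<N. (c i i)\<^sup>2)" "integrable M (\<lambda>\<omega>. (F \<omega>)\<^sup>2)"
    unfolding F_def by (rule diagonal_variance)+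
  have Gv: "expectation (\<lambda>\<omega>. (G \<omega>)\<^sup>2) \<le> (96 * \<Phi>1 + 4 * (\<Phi>0 + C4)) * (\<Sum>i<N. \<Sum>j<N. (a i j)\<^sup>2)"
      "integrable M (\<lambda>\<omega>. (G \<omega>)\<^sup>2)"
    unfolding G_def by (rule off_diagonal_variance; simp add: a_def)+
  have "(\<Sum>i<N. (c i i)\<^sup>2) \<le> A" unfolding A_def
    by (intro sum_mono member_le_sum) auto
  hence d1: "2 * (\<Phi>0 + 2 * \<Phi>2) * (\<Sum>i<N. (c i i)\<^sup>2) \<le> 2 * (\<Phi>0 + 2 * \<Phi>2) * A"
    using Phi0_nonneg Phi2_nonneg by (intro mult_left_mono) auto
  have "(\<Sum>i<N. \<Sum>j<N. (a i j)\<^sup>2) \<le> (\<Sum>i<N. \<Sum>j<N. ((c i j)\<^sup>2 + (c j i)\<^sup>2) / 2)"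
  proof (intro sum_mono)
    fix i j
    show "(a i j)\<^sup>2 \<le> ((c i j)\<^sup>2 + (c j i)\<^sup>2) / 2"
      using sum_squares_bound[of "c i j" "c j i"] by (simp add: a_def power_divide power2_sum)
  qed
  also have "\<dots> = (A + (\<Sum>i<N. \<Sum>j<N. (c j i)\<^sup>2)) / 2"
    by (simp add: A_def sum.distrib sum_divide_distrib[symmetric])
  also have "(\<Sum>i<N. \<Sum>j<N. (c j i)\<^sup>2) = A" unfolding A_def by (rule sum.swap)
  finally have d2: "(96 * \<Phi>1 + 4 * (\<Phi>0 + C4)) * (\<Sum>i<N. \<Sum>j<N. (a i j)\<^sup>2) \<le> (96 * \<Phi>1 + 4 * (\<Phi>0 + C4)) * A"
    using Phi0_nonneg Phi1_nonneg C4_nonneg by (intro mult_left_mono) auto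
  have "expectation (\<lambda>\<omega>. (F \<omega> + G \<omega>)\<^sup>2) \<le> 2 * expectation (\<lambda>\<omega>. (F \<omega>)\<^sup>2) + 2 * expectation (\<lambda>\<omega>. (G \<omega>)\<^sup>2)"
    by (rule integral_square_add_le(1)[OF Fv(2) m(1) Gv(2) m(2)])
  also have "\<dots> \<le> 2 * (2 * (\<Phi>0 + 2 * \<Phi>2) * A) + 2 * ((96 * \<Phi>1 + 4 * (\<Phi>0 + C4)) * A)"
    using Fv(1) Gv(1) d1 d2 by (intro add_mono mult_left_mono) auto
  also have "\<dots> = CQ * A" by (simp add: CQ_def algebra_simps)
  finally show "expectation (\<lambda>\<omega>. (\<Sum>i<N. \<Sum>j<N. c i j * (X i \<omega> * X j \<omega> - mom2 i j))\<^sup>2)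
      \<le> CQ * (\<Sum>i<N. \<Sum>j<N. (c i j)\<^sup>2)" unfolding FG A_def .
  show "integrable M (\<lambda>\<omega>. (\<Sum>i<N. \<Sum>j<N. c i j * (X i \<omega> * X j \<omega> - mom2 i j))\<^sup>2)"
    unfolding FG by (rule integral_square_add_le(2)[OF Fv(2) m(1) Gv(2) m(2)])
qed

corollary quadratic_form_deviation:
  fixes c :: "nat \<Rightarrow> nat \<Rightarrow> real"
  shows "expectation (\<lambda>\<omega>. \<bar>\<Sum>i<N. \<Sum>j<N. c i j * (X i \<omega> * X j \<omega> - mom2 i j)\<bar>)
      \<le> sqrt (CQ * (\<Sum>i<N. \<Sum>j<N. (c i j)\<^sup>2))"
proof -
  define F where "F \<omega> = \<bar>\<Sum>i<N. \<Sum>j<N. c i j * (X i \<omega> * X j \<omega> - mom2 i j)\<bar>" for \<omega>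
  have F2: "(\<lambda>\<omega>. (F \<omega>)\<^sup>2) = (\<lambda>\<omega>. (\<Sum>i<N. \<Sum>j<N. c i j * (X i \<omega> * X j \<omega> - mom2 i j))\<^sup>2)" by (simp add: F_def)
  have m [measurable]: "F \<in> borel_measurable M" unfolding F_def by measurable
  have i: "integrable M (\<lambda>\<omega>. (F \<omega>)\<^sup>2)" unfolding F2 by (rule quadratic_form_variance)
  note fi = square_expectation_diff_le(3)[OF m i]
  have "0 \<le> expectation (\<lambda>\<omega>. (F \<omega> - expectation F)\<^sup>2)" by (intro Bochner_Integration.integral_nonneg) simp
  also have "\<dots> = expectation (\<lambda>\<omega>. (F \<omega>)\<^sup>2) - (expectation F)\<^sup>2"
    by (rule variance_eq[OF fi i])
  finally have "(expectation F)\<^sup>2 \<le> CQ * (\<Sum>i<N. \<Sum>j<N. (c i j)\<^sup>2)"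
    using quadratic_form_variance(1)[where N = N and c = c] unfolding F2 by simp
  from real_le_rsqrt[OF this] show ?thesis by (simp add: F_def[abs_def])
qed

end

section \<open>The bounded differences inequality\<close>

definition bounded_differences :: "'i set \<Rightarrow> 'a measure \<Rightarrow> (('i \<Rightarrow> 'a) \<Rightarrow> real) \<Rightarrow> real \<Rightarrow> bool" where
  "bounded_differences I \<nu> f \<delta> \<longleftrightarrow>
    (\<forall>x\<in>space (PiM I (\<lambda>_. \<nu>)). \<forall>i\<in>I. \<forall>y\<in>space \<nu>. \<bar>f (x(i := y)) - f x\<bar> \<le> \<delta>)"

text \<open>Induction on the set of coordinates. Integrating out the coordinate \<open>i\<close> leaves a function \<open>g\<close> that
  inherits the bounded differences. The deviation from \<open>g\<close> has mean zero as a function of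
  the coordinate \<open>i\<close> and takes values in an interval of length \<open>2 \<delta>\<close>, so that Hoeffding's lemma
  contributes a factor \<open>exp (s\<^sup>2 \<delta>\<^sup>2 / 2)\<close>.\<close>

lemma (in prob_space) bounded_differences_mgf:
  fixes f :: "('i \<Rightarrow> 'a) \<Rightarrow> real" and \<delta> :: real
  assumes "finite I" "f \<in> borel_measurable (PiM I (\<lambda>_. M))" "\<And>x. \<bar>f x\<bar> \<le> K"
    "bounded_differences I M f \<delta>" "s > 0" "\<delta> \<ge> 0"
  shows "(\<integral>\<^sup>+x. ennreal (exp (s * (f x - (\<integral>x. f x \<partial>PiM I (\<lambda>_. M))))) \<partial>PiM I (\<lambda>_. M))
    \<le> ennreal (exp (s\<^sup>2 * \<delta>\<^sup>2 * card I / 2))"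
  using assms
proof (induction I arbitrary: f rule: finite_induct)
  case empty
  interpret P: prob_space "PiM {} (\<lambda>_. M)" by (intro prob_space_PiM prob_space_axioms)
  have "(\<integral>x. f x \<partial>PiM {} (\<lambda>_. M)) = (\<integral>x. f (\<lambda>_. undefined) \<partial>(PiM {} (\<lambda>_. M) :: ('i \<Rightarrow> 'a) measure))"
    by (rule Bochner_Integration.integral_cong) (auto simp: space_PiM)
  also have "\<dots> = f (\<lambda>_. undefined)" by (simp add: P.prob_space)
  finally have e: "(\<integral>x. f x \<partial>PiM {} (\<lambda>_. M)) = f (\<lambda>_. undefined)" .
  have "(\<integral>\<^sup>+x. ennreal (exp (s * (f x - f (\<lambda>_. undefined)))) \<partial>PiM {} (\<lambda>_. M))
      = (\<integral>\<^sup>+x. 1 \<partial>(PiM {} (\<lambda>_. M) :: ('i \<Rightarrow> 'a) measure))"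
    by (intro nn_integral_cong) (auto simp: space_PiM)
  thus ?case unfolding e by (simp add: P.emeasure_space_1)
next
  case (insert i I)
  interpret PS: product_prob_space "\<lambda>_ :: 'i. M" "insert i I"
    by (simp add: product_prob_space_def product_prob_space_axioms_def product_sigma_finite_def
        prob_space_axioms prob_space_imp_sigma_finite)
  let ?P = "PiM (insert i I) (\<lambda>_. M)" and ?Q = "PiM I (\<lambda>_. M)"
  interpret P: prob_space ?P by (intro prob_space_PiM prob_space_axioms)
  interpret Q: prob_space ?Q by (intro prob_space_PiM prob_space_axioms)
  define g where "g x = (\<integral>y. f (x(i := y)) \<partial>M)" for x
  note fm [measurable] = insert.prems(1) and K = insert.prems(2)
  have upd: "x(i := y) \<in> space ?P" if "x \<in> space ?Q" "y \<in> space M" for x y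
    using that by (auto simp: space_PiM PiE_iff extensional_def)
  have [measurable]: "(\<lambda>(x, y). f (x(i := y))) \<in> borel_measurable (?Q \<Otimes>\<^sub>M M)" by measurable
  have gm [measurable]: "g \<in> borel_measurable ?Q" unfolding g_def by measurable
  have gK: "\<bar>g x\<bar> \<le> K" for x
  proof (cases "integrable M (\<lambda>y. f (x(i := y)))")
    case True
    have "\<bar>g x\<bar> \<le> (\<integral>y. \<bar>f (x(i := y))\<bar> \<partial>M)" unfolding g_def by (rule integral_abs_bound)
    also have "\<dots> \<le> (\<integral>y. K \<partial>M)" using True K by (intro integral_mono) auto
    finally show ?thesis by (simp add: prob_space)
  next
    case False
    thus ?thesis using K[of x] by (simp add: g_def not_integrable_integral_eq)
  qed
  have fy_m: "(\<lambda>y. f (x(i := y))) \<in> borel_measurable M" if "x \<in> space ?Q" for x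
    using measurable_compose[OF measurable_component_update[OF that insert.hyps(2)] fm] by (simp add: fun_upd_def)
  have fy_i: "integrable M (\<lambda>y. f (x(i := y)))" if "x \<in> space ?Q" for x
    by (rule integrable_const_bound[of _ K]) (auto simp: K fy_m that)
  have gd: "bounded_differences I M g \<delta>"
    unfolding bounded_differences_def
  proof safe
    fix x j z assume x: "x \<in> space ?Q" and j: "j \<in> I" and z: "z \<in> space M"
    have x': "x(j := z) \<in> space ?Q" using x j z by (auto simp: space_PiM PiE_iff extensional_def)
    have ji: "j \<noteq> i" using j insert.hyps by auto
    have "\<bar>g (x(j := z)) - g x\<bar> = \<bar>\<integral>y. f (x(j := z, i := y)) - f (x(i := y)) \<partial>M\<bar>"
      unfolding g_def by (subst Bochner_Integration.integral_diff) (auto intro: fy_i x x')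
    also have "\<dots> \<le> (\<integral>y. \<bar>f (x(j := z, i := y)) - f (x(i := y))\<bar> \<partial>M)" by (rule integral_abs_bound)
    also have "\<dots> \<le> (\<integral>y. \<delta> \<partial>M)"
    proof (rule integral_mono)
      fix y assume y: "y \<in> space M"
      have "\<bar>f ((x(i := y))(j := z)) - f (x(i := y))\<bar> \<le> \<delta>"
        using insert.prems(3) upd[OF x y] j z unfolding bounded_differences_def by blast
      thus "\<bar>f (x(j := z, i := y)) - f (x(i := y))\<bar> \<le> \<delta>" using ji by (simp add: fun_upd_twist)
    qed (auto intro!: integrable_abs Bochner_Integration.integrable_diff fy_i x x')
    finally show "\<bar>g (x(j := z)) - g x\<bar> \<le> \<delta>" by (simp add: prob_space)
  qed
  have "finite_measure ?P" by (intro prob_space.finite_measure prob_space_PiM prob_space_axioms)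
  hence fi: "integrable ?P f"
    by (rule finite_measure.integrable_const_bound[of _ _ K]) (auto simp: K)
  have Eg: "(\<integral>x. f x \<partial>?P) = (\<integral>x. g x \<partial>?Q)" unfolding g_def
    by (rule PS.product_integral_insert[OF insert.hyps fi])
  define m where "m = (\<integral>x. g x \<partial>?Q)"
  have inner: "(\<integral>\<^sup>+y. ennreal (exp (s * (f (x(i := y)) - g x))) \<partial>M) \<le> ennreal (exp (s\<^sup>2 * \<delta>\<^sup>2 / 2))"
    if x: "x \<in> space ?Q" for x
  proof -
    obtain y0 where y0: "y0 \<in> space M" using not_empty by blast
    interpret B: interval_bounded_random_variable M "\<lambda>y. f (x(i := y))" "f (x(i := y0)) - \<delta>" "f (x(i := y0)) + \<delta>"
    proof
      show "random_variable borel (\<lambda>y. f (x(i := y)))" by (rule fy_m[OF x])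
      show "AE y in M. f (x(i := y)) \<in> {f (x(i := y0)) - \<delta>..f (x(i := y0)) + \<delta>}"
      proof (rule AE_I2)
        fix y assume y: "y \<in> space M"
        have "\<bar>f ((x(i := y0))(i := y)) - f (x(i := y0))\<bar> \<le> \<delta>"
          using insert.prems(3) upd[OF x y0] y unfolding bounded_differences_def by blast
        thus "f (x(i := y)) \<in> {f (x(i := y0)) - \<delta>..f (x(i := y0)) + \<delta>}" by auto
      qed
    qed
    show ?thesis using B.Hoeffdings_lemma_nn_integral[OF insert.prems(4)]
      by (simp add: g_def power2_eq_square mult_ac)
  qed
  have "(\<integral>\<^sup>+x. ennreal (exp (s * (f x - m))) \<partial>?P)
      = (\<integral>\<^sup>+x. (\<integral>\<^sup>+y. ennreal (exp (s * (f (x(i := y)) - m))) \<partial>M) \<partial>?Q)"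
    by (rule PS.product_nn_integral_insert[OF insert.hyps]) measurable
  also have "\<dots> \<le> (\<integral>\<^sup>+x. ennreal (exp (s * (g x - m))) * ennreal (exp (s\<^sup>2 * \<delta>\<^sup>2 / 2)) \<partial>?Q)"
  proof (rule nn_integral_mono)
    fix x assume x: "x \<in> space ?Q"
    note [measurable] = fy_m[OF x]
    have "(\<integral>\<^sup>+y. ennreal (exp (s * (f (x(i := y)) - m))) \<partial>M)
        = (\<integral>\<^sup>+y. ennreal (exp (s * (g x - m))) * ennreal (exp (s * (f (x(i := y)) - g x))) \<partial>M)"
      by (intro nn_integral_cong) (simp add: ennreal_mult[symmetric] exp_add[symmetric] algebra_simps)
    also have "\<dots> = ennreal (exp (s * (g x - m))) * (\<integral>\<^sup>+y. ennreal (exp (s * (f (x(i := y)) - g x))) \<partial>M)"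
      by (rule nn_integral_cmult) measurable
    also have "\<dots> \<le> ennreal (exp (s * (g x - m))) * ennreal (exp (s\<^sup>2 * \<delta>\<^sup>2 / 2))"
      by (intro mult_left_mono inner x) auto
    finally show "(\<integral>\<^sup>+y. ennreal (exp (s * (f (x(i := y)) - m))) \<partial>M)
      \<le> ennreal (exp (s * (g x - m))) * ennreal (exp (s\<^sup>2 * \<delta>\<^sup>2 / 2))" .
  qed
  also have "\<dots> = (\<integral>\<^sup>+x. ennreal (exp (s * (g x - m))) \<partial>?Q) * ennreal (exp (s\<^sup>2 * \<delta>\<^sup>2 / 2))"
    by (rule nn_integral_multc) measurable
  also have "\<dots> \<le> ennreal (exp (s\<^sup>2 * \<delta>\<^sup>2 * card I / 2)) * ennreal (exp (s\<^sup>2 * \<delta>\<^sup>2 / 2))"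
    unfolding m_def by (intro mult_right_mono insert.IH gm gK gd insert.prems) auto
  also have "\<dots> = ennreal (exp (s\<^sup>2 * \<delta>\<^sup>2 * card (insert i I) / 2))"
    using insert.hyps by (simp add: ennreal_mult[symmetric] exp_add[symmetric] field_simps)
  finally show ?case unfolding Eg m_def .
qed

text \<open>Chernoff's method, applied to \<open>f\<close> and to \<open>- f\<close>.\<close>

theorem (in prob_space) mcdiarmid:
  fixes f :: "('i \<Rightarrow> 'a) \<Rightarrow> real" and \<delta> :: real
  assumes I: "finite I" "I \<noteq> {}" and f [measurable]: "f \<in> borel_measurable (PiM I (\<lambda>_. M))"
    and K: "\<And>x. \<bar>f x\<bar> \<le> K" and d: "bounded_differences I M f \<delta>" and \<delta>: "\<delta> > 0" and \<epsilon>: "\<epsilon> > 0"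
  shows "measure (PiM I (\<lambda>_. M)) {x \<in> space (PiM I (\<lambda>_. M)). \<bar>f x - (\<integral>x. f x \<partial>PiM I (\<lambda>_. M))\<bar> \<ge> \<epsilon>}
    \<le> 2 * exp (- \<epsilon>\<^sup>2 / (2 * card I * \<delta>\<^sup>2))"
proof -
  let ?P = "PiM I (\<lambda>_. M)"
  interpret P: prob_space ?P by (intro prob_space_PiM prob_space_axioms)
  define n where "n = real (card I)"
  have n: "n > 0" using I by (simp add: n_def card_gt_0_iff)
  \<comment> \<open>the minimum point of \<open>- s * \<epsilon> + s\<^sup>2 * \<delta>\<^sup>2 * n / 2\<close>\<close>
  define s where "s = \<epsilon> / (n * \<delta>\<^sup>2)"
  have s: "s > 0" using \<epsilon> \<delta> n by (simp add: s_def)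
  have one: "measure ?P {x \<in> space ?P. h x - (\<integral>x. h x \<partial>?P) \<ge> \<epsilon>} \<le> exp (- \<epsilon>\<^sup>2 / (2 * n * \<delta>\<^sup>2))"
    if [measurable]: "h \<in> borel_measurable ?P" and hK: "\<And>x. \<bar>h x\<bar> \<le> K"
      and hd: "bounded_differences I M h \<delta>" for h
  proof -
    let ?u = "\<lambda>x. ennreal (exp (s * (h x - (\<integral>x. h x \<partial>?P))))"
    have "emeasure ?P {x \<in> space ?P. h x - (\<integral>x. h x \<partial>?P) \<ge> \<epsilon>}
        \<le> emeasure ?P {x \<in> space ?P. 1 \<le> ennreal (exp (- (s * \<epsilon>))) * ?u x}"
    proof (rule emeasure_mono)
      show "{x \<in> space ?P. h x - (\<integral>x. h x \<partial>?P) \<ge> \<epsilon>} \<subseteq> {x \<in> space ?P. 1 \<le> ennreal (exp (- (s * \<epsilon>))) * ?u x}"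
      proof safe
        fix x assume "\<epsilon> \<le> h x - (\<integral>x. h x \<partial>?P)"
        hence "s * \<epsilon> \<le> s * (h x - (\<integral>x. h x \<partial>?P))" using s by (intro mult_left_mono) auto
        thus "1 \<le> ennreal (exp (- (s * \<epsilon>))) * ?u x"
          by (simp add: ennreal_mult[symmetric] exp_add[symmetric])
      qed
    qed measurable
    also have "\<dots> \<le> ennreal (exp (- (s * \<epsilon>))) * (\<integral>\<^sup>+x. ?u x * indicator (space ?P) x \<partial>?P)"
      using nn_integral_Markov_inequality[of ?u "space ?P" ?P "ennreal (exp (- (s * \<epsilon>)))"] by simp
    also have "(\<integral>\<^sup>+x. ?u x * indicator (space ?P) x \<partial>?P) = (\<integral>\<^sup>+x. ?u x \<partial>?P)"
      by (intro nn_integral_cong) auto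
    also have "ennreal (exp (- (s * \<epsilon>))) * \<dots> \<le> ennreal (exp (- (s * \<epsilon>))) * ennreal (exp (s\<^sup>2 * \<delta>\<^sup>2 * card I / 2))"
      by (intro mult_left_mono bounded_differences_mgf[where K = K] I hK hd s that(1)) (use \<delta> in auto)
    also have "\<dots> = ennreal (exp (- \<epsilon>\<^sup>2 / (2 * n * \<delta>\<^sup>2)))"
    proof -
      have "- (s * \<epsilon>) + s\<^sup>2 * \<delta>\<^sup>2 * n / 2 = - \<epsilon>\<^sup>2 / (2 * n * \<delta>\<^sup>2)"
        unfolding s_def using n \<delta> by (simp add: field_simps power2_eq_square)
      thus ?thesis by (simp add: ennreal_mult[symmetric] exp_add[symmetric] n_def)
    qed
    finally show ?thesis by (simp add: P.emeasure_eq_measure)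
  qed
  have "{x \<in> space ?P. \<bar>f x - (\<integral>x. f x \<partial>?P)\<bar> \<ge> \<epsilon>} =
     {x \<in> space ?P. f x - (\<integral>x. f x \<partial>?P) \<ge> \<epsilon>} \<union> {x \<in> space ?P. - f x - (\<integral>x. - f x \<partial>?P) \<ge> \<epsilon>}"
    by (auto simp: abs_le_iff)
  hence "measure ?P {x \<in> space ?P. \<bar>f x - (\<integral>x. f x \<partial>?P)\<bar> \<ge> \<epsilon>} \<le>
     measure ?P {x \<in> space ?P. f x - (\<integral>x. f x \<partial>?P) \<ge> \<epsilon>} +
     measure ?P {x \<in> space ?P. - f x - (\<integral>x. - f x \<partial>?P) \<ge> \<epsilon>}"
    by (simp only:) (rule measure_Un_le; measurable)
  also have "\<dots> \<le> exp (- \<epsilon>\<^sup>2 / (2 * n * \<delta>\<^sup>2)) + exp (- \<epsilon>\<^sup>2 / (2 * n * \<delta>\<^sup>2))"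
    using d by (intro add_mono one f) (auto simp: K bounded_differences_def abs_minus_commute)
  finally show ?thesis by (simp add: n_def)
qed

section \<open>Weak convergence and resolvent integrals\<close>

text \<open>Used with functions that vanish on a closed half-line, this carries bounds for the support over to
  the weak limit.\<close>

lemma weak_conv_m_null:
  fixes f :: "real \<Rightarrow> real"
  assumes \<mu>: "\<And>n. real_distribution (\<mu> n)" and F: "real_distribution F" and w: "weak_conv_m \<mu> F"
    and f: "\<And>x. isCont f x" "\<And>x. 0 \<le> f x" "\<And>x. f x \<le> 1" and z: "\<And>n. AE x in \<mu> n. f x = 0"
  shows "AE x in F. f x = 0"
proof -
  interpret F: real_distribution F by fact
  have fm [measurable]: "f \<in> borel_measurable borel"
    by (intro borel_measurable_continuous_onI continuous_at_imp_continuous_on) (use f in auto)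
  have "(\<lambda>n. integral\<^sup>L (\<mu> n) f) \<longlonglongrightarrow> integral\<^sup>L F f"
    using f by (intro weak_conv_imp_integral_bdd_continuous_conv[OF \<mu> F w, of f 1]) auto
  moreover have "integral\<^sup>L (\<mu> n) f = 0" for n
  proof -
    interpret real_distribution "\<mu> n" by (rule \<mu>)
    have "integral\<^sup>L (\<mu> n) f = integral\<^sup>L (\<mu> n) (\<lambda>_. 0)" by (rule integral_cong_AE) (use z in auto)
    thus ?thesis by simp
  qed
  ultimately have "integral\<^sup>L F f = 0" by (simp add: LIMSEQ_const_iff)
  moreover have "integrable F f" by (rule F.integrable_const_bound[of _ 1]) (use f in auto)
  ultimately show ?thesis using f(2) by (subst (asm) integral_nonneg_eq_0_iff_AE) auto
qed

lemma weak_conv_m_support_nonneg: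
  assumes "\<And>n. real_distribution (\<mu> n)" "real_distribution F" "weak_conv_m \<mu> F"
    and "\<And>n. AE x in \<mu> n. 0 \<le> x"
  shows "AE x in F. 0 \<le> x"
proof -
  have "AE x in F. min 1 (max 0 (- x)) = 0"
  proof (rule weak_conv_m_null[OF assms(1-3)])
    show "AE x in \<mu> n. min 1 (max 0 (- x)) = 0" for n
      using assms(4)[of n] by eventually_elim auto
  qed (auto intro!: continuous_intros)
  thus ?thesis by eventually_elim (auto simp: min_def max_def split: if_splits)
qed

lemma weak_conv_m_support_le:
  assumes "\<And>n. real_distribution (\<mu> n)" "real_distribution F" "weak_conv_m \<mu> F"
    and "\<And>n. AE x in \<mu> n. x \<le> B"
  shows "AE x in F. x \<le> B"
proof -
  have "AE x in F. min 1 (max 0 (x - B)) = 0"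
  proof (rule weak_conv_m_null[OF assms(1-3)])
    show "AE x in \<mu> n. min 1 (max 0 (x - B)) = 0" for n
      using assms(4)[of n] by eventually_elim auto
  qed (auto intro!: continuous_intros)
  thus ?thesis by eventually_elim (auto simp: min_def max_def split: if_splits)
qed

text \<open>On the half-line the integrand agrees with \<open>1 / (b * max x 0 + t)\<close>, which is bounded and continuous
  on the whole line.\<close>

lemma weak_conv_m_resolvent_integral:
  assumes \<mu>: "\<And>n. real_distribution (\<mu> n)" and F: "real_distribution F" and w: "weak_conv_m \<mu> F"
    and nn: "\<And>n. AE x in \<mu> n. 0 \<le> x" and b: "b \<ge> 0" and t: "t > 0"
  shows "(\<lambda>n. \<integral>x. 1 / (b * x + t) \<partial>\<mu> n) \<longlonglongrightarrow> (\<integral>x. 1 / (b * x + t) \<partial>F)"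
proof -
  let ?f = "\<lambda>x. 1 / (b * max x 0 + t)"
  have pos: "b * max x 0 + t > 0" for x using b t by (intro add_nonneg_pos) auto
  have "(\<lambda>n. integral\<^sup>L (\<mu> n) ?f) \<longlonglongrightarrow> integral\<^sup>L F ?f"
  proof (rule weak_conv_imp_integral_bdd_continuous_conv[OF \<mu> F w])
    show "isCont ?f x" for x using pos[of x] by (intro continuous_intros) auto
    show "norm (?f x) \<le> 1 / t" for x
    proof -
      have "1 / (b * max x 0 + t) \<le> 1 / t" using b t by (intro divide_left_mono) (auto intro!: mult_pos_pos pos)
      thus ?thesis using pos[of x] by simp
    qed
  qed
  moreover have "integral\<^sup>L G ?f = (\<integral>x. 1 / (b * x + t) \<partial>G)" if G: "real_distribution G" and "AE x in G. 0 \<le> x" for G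
  proof -
    interpret real_distribution G by (rule G)
    show ?thesis
    proof (rule integral_cong_AE)
      show "AE x in G. 1 / (b * max x 0 + t) = 1 / (b * x + t)"
        using that(2) by eventually_elim (simp add: max_def)
    qed auto
  qed
  ultimately show ?thesis
    using \<mu> F nn weak_conv_m_support_nonneg[OF \<mu> F w nn] by simp
qed

text \<open>The functions on the half-line whose integrals converge. This class is a vector space and is
  closed under uniform limits on the half-line, and the aim is to show that it contains enough
  functions for weak convergence.\<close>

definition test_class :: "(nat \<Rightarrow> real measure) \<Rightarrow> real measure \<Rightarrow> (real \<Rightarrow> real) \<Rightarrow> bool" where
  "test_class \<mu> F g \<longleftrightarrow> g \<in> borel_measurable borel \<and> (\<exists>K. \<forall>x\<ge>0. \<bar>g x\<bar> \<le> K) \<and>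
     (\<lambda>n. \<integral>x. g x \<partial>\<mu> n) \<longlonglongrightarrow> (\<integral>x. g x \<partial>F)"

context
  fixes \<mu> :: "nat \<Rightarrow> real measure" and F :: "real measure"
  assumes \<mu>: "\<And>n. real_distribution (\<mu> n)" and F: "real_distribution F"
    and nn: "\<And>n. AE x in \<mu> n. 0 \<le> x" and nnF: "AE x in F. 0 \<le> x"
begin

lemma integrable_of_bounded_nonneg:
  assumes G: "real_distribution G" "AE x in G. 0 \<le> x" and g: "g \<in> borel_measurable borel" "\<forall>x\<ge>0. \<bar>g x\<bar> \<le> (K :: real)"
  shows "integrable G g"
proof -
  interpret real_distribution G by (rule G)
  show ?thesis by (rule integrable_const_bound[of _ K]) (use G(2) g in \<open>auto elim!: eventually_mono\<close>)
qed

lemma integral_diff_le_of_nonneg: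
  assumes G: "real_distribution G" "AE x in G. 0 \<le> x"
    and g: "integrable G g" and h: "integrable G h" and e: "\<And>x. 0 \<le> x \<Longrightarrow> \<bar>g x - h x\<bar> \<le> (e :: real)"
  shows "\<bar>(\<integral>x. g x \<partial>G) - (\<integral>x. h x \<partial>G)\<bar> \<le> e"
proof -
  interpret real_distribution G by (rule G)
  have "\<bar>(\<integral>x. g x \<partial>G) - (\<integral>x. h x \<partial>G)\<bar> = \<bar>\<integral>x. g x - h x \<partial>G\<bar>" using g h by simp
  also have "\<dots> \<le> (\<integral>x. \<bar>g x - h x\<bar> \<partial>G)" by (rule integral_abs_bound)
  also have "\<dots> \<le> (\<integral>x. e \<partial>G)" by (rule integral_mono_AE) (use G(2) g h e in \<open>auto elim!: eventually_mono\<close>)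
  finally show ?thesis using prob_space by simp
qed

lemma test_class_integrable:
  assumes "test_class \<mu> F g"
  shows "integrable (\<mu> n) g" "integrable F g"
proof -
  from assms obtain K where "g \<in> borel_measurable borel" "\<forall>x\<ge>0. \<bar>g x\<bar> \<le> K" by (auto simp: test_class_def)
  thus "integrable (\<mu> n) g" "integrable F g" using \<mu> F nn nnF by (auto intro: integrable_of_bounded_nonneg)
qed

lemma test_class_const: "test_class \<mu> F (\<lambda>_. c)"
proof -
  have "(\<integral>x. c \<partial>G) = c" if "real_distribution G" for G :: "real measure"
  proof -
    interpret real_distribution G by fact
    show ?thesis using prob_space by simp
  qed
  hence "(\<lambda>n. \<integral>x. c \<partial>\<mu> n) = (\<lambda>n. c)" "(\<integral>x. c \<partial>F) = c" using \<mu> F by blast+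
  thus ?thesis unfolding test_class_def by (simp only:) auto
qed

lemma test_class_cmult:
  assumes "test_class \<mu> F g" shows "test_class \<mu> F (\<lambda>x. c * g x)"
proof -
  from assms obtain K where "\<forall>x\<ge>0. \<bar>g x\<bar> \<le> K" by (auto simp: test_class_def)
  hence "\<forall>x\<ge>0. \<bar>c * g x\<bar> \<le> \<bar>c\<bar> * K" by (auto simp: abs_mult intro: mult_left_mono)
  thus ?thesis using assms by (auto simp: test_class_def intro!: tendsto_intros)
qed

lemma test_class_add:
  assumes "test_class \<mu> F g" "test_class \<mu> F h" shows "test_class \<mu> F (\<lambda>x. g x + h x)"
proof -
  from assms obtain K L where K: "\<forall>x\<ge>0. \<bar>g x\<bar> \<le> K" "\<forall>x\<ge>0. \<bar>h x\<bar> \<le> L" by (auto simp: test_class_def)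
  hence "\<forall>x\<ge>0. \<bar>g x + h x\<bar> \<le> K + L" by (meson abs_triangle_ineq add_mono order_trans)
  moreover have "(\<lambda>n. \<integral>x. g x + h x \<partial>\<mu> n) \<longlonglongrightarrow> (\<integral>x. g x + h x \<partial>F)"
    using assms test_class_integrable[OF assms(1)] test_class_integrable[OF assms(2)]
    by (simp add: test_class_def tendsto_add)
  ultimately show ?thesis using assms by (auto simp: test_class_def)
qed

lemma test_class_uniform_limit:
  assumes g [measurable]: "g \<in> borel_measurable borel"
    and ap: "\<And>e. e > 0 \<Longrightarrow> \<exists>h. test_class \<mu> F h \<and> (\<forall>x\<ge>0. \<bar>g x - h x\<bar> \<le> e)"
  shows "test_class \<mu> F g"
proof -
  obtain h where h: "test_class \<mu> F h" "\<forall>x\<ge>0. \<bar>g x - h x\<bar> \<le> 1" using ap[of 1] by auto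
  obtain K where K: "\<forall>x\<ge>0. \<bar>h x\<bar> \<le> K" using h(1) by (auto simp: test_class_def)
  have gK: "\<forall>x\<ge>0. \<bar>g x\<bar> \<le> K + 1"
  proof safe
    fix x :: real assume "0 \<le> x"
    with h(2) K have "\<bar>g x - h x\<bar> \<le> 1" "\<bar>h x\<bar> \<le> K" by auto
    thus "\<bar>g x\<bar> \<le> K + 1" by linarith
  qed
  have gi: "integrable (\<mu> n) g" "integrable F g" for n
    using \<mu> F nn nnF g gK by (auto intro: integrable_of_bounded_nonneg)
  have "(\<lambda>n. \<integral>x. g x \<partial>\<mu> n) \<longlonglongrightarrow> (\<integral>x. g x \<partial>F)"
  proof (rule LIMSEQ_I)
    fix r :: real assume r: "0 < r"
    obtain h where h: "test_class \<mu> F h" "\<forall>x\<ge>0. \<bar>g x - h x\<bar> \<le> r / 4" using ap[of "r / 4"] r by auto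
    have "(\<lambda>n. \<integral>x. h x \<partial>\<mu> n) \<longlonglongrightarrow> (\<integral>x. h x \<partial>F)" using h(1) by (simp add: test_class_def)
    from LIMSEQ_D[OF this, of "r / 4"] r obtain N where
      N: "\<And>n. n \<ge> N \<Longrightarrow> \<bar>(\<integral>x. h x \<partial>\<mu> n) - (\<integral>x. h x \<partial>F)\<bar> < r / 4" by auto
    have "\<bar>(\<integral>x. g x \<partial>\<mu> n) - (\<integral>x. g x \<partial>F)\<bar> < r" if n: "n \<ge> N" for n
    proof -
      have "\<bar>(\<integral>x. g x \<partial>\<mu> n) - (\<integral>x. h x \<partial>\<mu> n)\<bar> \<le> r / 4"
        using h by (intro integral_diff_le_of_nonneg \<mu> nn gi test_class_integrable) auto
      moreover have "\<bar>(\<integral>x. g x \<partial>F) - (\<integral>x. h x \<partial>F)\<bar> \<le> r / 4"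
        using h by (intro integral_diff_le_of_nonneg F nnF gi test_class_integrable) auto
      ultimately show ?thesis using N[OF n] r by linarith
    qed
    thus "\<exists>N. \<forall>n\<ge>N. norm ((\<integral>x. g x \<partial>\<mu> n) - (\<integral>x. g x \<partial>F)) < r" by auto
  qed
  thus ?thesis using gK by (auto simp: test_class_def)
qed

lemma test_class_cong:
  assumes "g \<in> borel_measurable borel" "test_class \<mu> F h" "\<And>x. 0 \<le> x \<Longrightarrow> g x = h x"
  shows "test_class \<mu> F g"
  by (rule test_class_uniform_limit) (use assms in \<open>auto intro!: exI[of _ h]\<close>)

text \<open>By partial fractions, the product of \<open>1 / (x + 1)\<close> and \<open>1 / (x + t)\<close> is a multiple of their
  difference if \<open>t \<noteq> 1\<close>. The limit \<open>t \<longlongrightarrow> 1\<close> then yields the next power of \<open>1 / (x + 1)\<close>.\<close>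

lemma test_class_resolvent_powers:
  assumes conv: "\<And>t. t \<in> \<rat> \<Longrightarrow> t > 0 \<Longrightarrow> (\<lambda>n. \<integral>x. 1 / (x + t) \<partial>\<mu> n) \<longlonglongrightarrow> (\<integral>x. 1 / (x + t) \<partial>F)"
  shows "test_class \<mu> F (\<lambda>x. (1 / (x + 1)) ^ Suc k)"
    and "t \<in> \<rat> \<Longrightarrow> t > 0 \<Longrightarrow> test_class \<mu> F (\<lambda>x. (1 / (x + 1)) ^ k * (1 / (x + t)))"
proof -
  have base: "test_class \<mu> F (\<lambda>x. 1 / (x + t))" if "t \<in> \<rat>" "t > 0" for t
    unfolding test_class_def
  proof (intro conjI exI[of _ "1 / t"] allI impI conv that)
    fix x :: real assume "0 \<le> x"
    thus "\<bar>1 / (x + t)\<bar> \<le> 1 / t" using that by (simp add: frac_le)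
  qed measurable
  have "test_class \<mu> F (\<lambda>x. (1 / (x + 1)) ^ Suc k) \<and>
    (\<forall>t. t \<in> \<rat> \<and> t > 0 \<longrightarrow> test_class \<mu> F (\<lambda>x. (1 / (x + 1)) ^ k * (1 / (x + t))))"
  proof (induction k)
    case 0
    show ?case using base base[of 1] by simp
  next
    case (Suc k)
    have step: "test_class \<mu> F (\<lambda>x. (1 / (x + 1)) ^ Suc k * (1 / (x + t)))" if t: "t \<in> \<rat>" "t > 0" "t \<noteq> 1" for t
    proof (rule test_class_cong)
      show "test_class \<mu> F (\<lambda>x. 1 / (t - 1) * ((1 / (x + 1)) ^ Suc k + (- 1) * ((1 / (x + 1)) ^ k * (1 / (x + t)))))"
        using Suc t by (intro test_class_cmult test_class_add) auto
      fix x :: real assume x: "0 \<le> x"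
      have "(1 / (x + 1)) * (1 / (x + t)) = 1 / (t - 1) * (1 / (x + 1) - 1 / (x + t))"
        using x t by (simp add: field_simps)
      hence "(1 / (x + 1)) ^ k * ((1 / (x + 1)) * (1 / (x + t))) =
         (1 / (x + 1)) ^ k * (1 / (t - 1) * (1 / (x + 1) - 1 / (x + t)))" by simp
      thus "(1 / (x + 1)) ^ Suc k * (1 / (x + t)) =
        1 / (t - 1) * ((1 / (x + 1)) ^ Suc k + (- 1) * ((1 / (x + 1)) ^ k * (1 / (x + t))))"
        by (simp add: algebra_simps)
    qed measurable
    have lim: "test_class \<mu> F (\<lambda>x. (1 / (x + 1)) ^ Suc (Suc k))"
    proof (rule test_class_uniform_limit)
      fix e :: real assume e: "e > 0"
      obtain m :: nat where m: "1 / real (Suc m) < e" using nat_approx_posE[OF e] by blast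
      define t where "t = 1 + 1 / real (Suc m)"
      have t: "t \<in> \<rat>" "t > 0" "t \<noteq> 1" "t \<ge> 1" "t - 1 \<le> e" using m by (auto simp: t_def add_pos_pos)
      have "\<bar>(1 / (x + 1)) ^ Suc (Suc k) - (1 / (x + 1)) ^ Suc k * (1 / (x + t))\<bar> \<le> e" if x: "0 \<le> x" for x
      proof -
        have d: "\<bar>1 / (x + 1) - 1 / (x + t)\<bar> \<le> t - 1"
        proof -
          have "1 / (x + 1) - 1 / (x + t) = (t - 1) / ((x + 1) * (x + t))" using x t by (simp add: field_simps)
          also have "\<dots> \<le> (t - 1) / 1"
          proof (rule divide_left_mono)
            show "1 \<le> (x + 1) * (x + t)" using mult_mono[of 1 "x + 1" 1 "x + t"] x t by simp
          qed (use x t in auto)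
          finally have "1 / (x + 1) - 1 / (x + t) \<le> t - 1" by simp
          moreover have "1 / (x + t) \<le> 1 / (x + 1)" using x t by (simp add: frac_le)
          ultimately show ?thesis by simp
        qed
        have "\<bar>(1 / (x + 1)) ^ Suc (Suc k) - (1 / (x + 1)) ^ Suc k * (1 / (x + t))\<bar>
          = (1 / (x + 1)) ^ Suc k * \<bar>1 / (x + 1) - 1 / (x + t)\<bar>"
        proof -
          have "a ^ Suc (Suc k) - a ^ Suc k * b = a ^ Suc k * (a - b)" for a b :: real
            by (simp add: algebra_simps)
          moreover have "0 \<le> (1 / (x + 1)) ^ Suc k" using x by simp
          ultimately show ?thesis by (simp only: abs_mult abs_of_nonneg)
        qed
        also have "\<dots> \<le> 1 * (t - 1)"
          using x by (intro mult_mono d power_le_one) auto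
        finally show ?thesis using t by simp
      qed
      thus "\<exists>h. test_class \<mu> F h \<and> (\<forall>x\<ge>0. \<bar>(1 / (x + 1)) ^ Suc (Suc k) - h x\<bar> \<le> e)"
        using step[of t] t by (intro exI[of _ "\<lambda>x. (1 / (x + 1)) ^ Suc k * (1 / (x + t))"]) auto
    qed measurable
    have "test_class \<mu> F (\<lambda>x. (1 / (x + 1)) ^ Suc k * (1 / (x + t)))" if t: "t \<in> \<rat>" "t > 0" for t
    proof (cases "t = 1")
      case True
      have "(\<lambda>x :: real. (1 / (x + 1)) ^ Suc k * (1 / (x + t))) = (\<lambda>x. (1 / (x + 1)) ^ Suc (Suc k))"
        by (auto simp: True)
      thus ?thesis using lim by (simp only:)
    qed (use step t in auto)
    thus ?case using lim by blast
  qed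
  thus "test_class \<mu> F (\<lambda>x. (1 / (x + 1)) ^ Suc k)"
    and "t \<in> \<rat> \<Longrightarrow> t > 0 \<Longrightarrow> test_class \<mu> F (\<lambda>x. (1 / (x + 1)) ^ k * (1 / (x + t)))" by auto
qed

text \<open>In the variable \<open>y = 1 / (x + 1)\<close> the half-line becomes the interval from 0 to 1. A step function with a
  sloping edge vanishes near \<open>y = 0\<close>, so it is continuous on the closed interval and can be
  approximated uniformly by Bernstein polynomials in \<open>y\<close>.\<close>

theorem weak_conv_of_resolvent_integrals:
  assumes conv: "\<And>t. t \<in> \<rat> \<Longrightarrow> t > 0 \<Longrightarrow> (\<lambda>n. \<integral>x. 1 / (x + t) \<partial>\<mu> n) \<longlonglongrightarrow> (\<integral>x. 1 / (x + t) \<partial>F)"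
  shows "weak_conv_m \<mu> F"
proof (rule integral_cts_step_conv_imp_weak_conv[OF \<mu> F])
  have pw: "test_class \<mu> F (\<lambda>x. (1 / (x + 1)) ^ k)" for k
    using test_class_const[of 1] test_class_resolvent_powers(1)[OF conv] by (cases k) auto
  have poly: "test_class \<mu> F (\<lambda>x. poly q (1 / (x + 1)))" for q :: "real poly"
  proof -
    have "test_class \<mu> F (\<lambda>x. \<Sum>i\<le>d. coeff q i * (1 / (x + 1)) ^ i)" for d
    proof (induction d)
      case 0
      show ?case using test_class_const by simp
    next
      case (Suc d)
      show ?case unfolding sum.atMost_Suc by (intro test_class_add test_class_cmult pw Suc)
    qed
    thus ?thesis by (simp add: poly_altdef)
  qed
  fix a b :: real assume ab: "a < b"
  \<comment> \<open>for \<open>y < \<eta>\<close> the point \<open>1 / y - 1\<close> lies beyond \<open>b\<close>, where the step function is zero\<close>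
  define \<eta> where "\<eta> = 1 / (2 + \<bar>b\<bar>)"
  have \<eta>: "\<eta> > 0" by (simp add: \<eta>_def add_pos_nonneg)
  define h where "h y = cts_step a b (1 / max y \<eta> - 1)" for y
  have cont: "isCont (cts_step a b) x" for x
    using cts_step_uniformly_continuous[OF ab] uniformly_continuous_imp_continuous continuous_on_eq_continuous_at
    by blast
  have hc: "continuous_on {0..1} h"
  proof (rule continuous_at_imp_continuous_on, rule ballI)
    fix y :: real
    have "max y \<eta> \<noteq> 0" using \<eta> by auto
    hence "isCont (\<lambda>y. 1 / max y \<eta> - 1) y" by (intro continuous_intros)
    from isCont_o2[OF this cont] show "isCont h y" unfolding h_def .
  qed
  have m: "cts_step a b \<in> borel_measurable borel"
    by (intro borel_measurable_continuous_onI continuous_at_imp_continuous_on) (use cont in auto)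
  have "test_class \<mu> F (cts_step a b)"
  proof (rule test_class_uniform_limit[OF m])
    fix e :: real assume e: "e > 0"
    from Bernstein_Weierstrass[OF hc e] obtain N where
      N: "\<And>n y. N \<le> n \<Longrightarrow> y \<in> {0..1} \<Longrightarrow> \<bar>h y - (\<Sum>k\<le>n. h (k / n) * Bernstein n k y)\<bar> < e" by blast
    define q where "q = (\<Sum>k\<le>N. Polynomial.smult (h (real k / real N) * real (N choose k)) ([:0, 1:] ^ k * [:1, - 1:] ^ (N - k)))"
    have q: "poly q y = (\<Sum>k\<le>N. h (k / N) * Bernstein N k y)" for y
      by (simp add: q_def poly_sum Bernstein_def mult_ac)
    have "\<bar>cts_step a b x - poly q (1 / (x + 1))\<bar> \<le> e" if x: "0 \<le> x" for x
    proof -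
      have y: "1 / (x + 1) \<in> {0..1}" using x by simp
      have "h (1 / (x + 1)) = cts_step a b x"
      proof (cases "1 / (x + 1) \<ge> \<eta>")
        case True
        thus ?thesis using x by (simp add: h_def max_def)
      next
        case False
        hence "2 + \<bar>b\<bar> < x + 1" using x unfolding \<eta>_def
          by (simp add: divide_simps split: if_splits)
        thus ?thesis using False ab by (simp add: h_def cts_step_def max_def \<eta>_def)
      qed
      thus ?thesis using N[OF order.refl y] by (simp add: q)
    qed
    thus "\<exists>g. test_class \<mu> F g \<and> (\<forall>x\<ge>0. \<bar>cts_step a b x - g x\<bar> \<le> e)"
      using poly[of q] by (intro exI[of _ "\<lambda>x. poly q (1 / (x + 1))"]) auto
  qed
  thus "(\<lambda>n. integral\<^sup>L (\<mu> n) (cts_step a b)) \<longlonglongrightarrow> integral\<^sup>L F (cts_step a b)"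
    by (simp add: test_class_def)
qed

end

text \<open>The lower bound for \<open>m\<close> gives \<open>t * m t \<longlongrightarrow> 1\<close> as \<open>t\<close> grows, which means that no mass escapes to
  infinity. Tightness and Helly's selection theorem then provide a limit along a subsequence, which
  has the resolvent integrals \<open>m\<close>.\<close>

theorem weak_limit_exists_of_resolvent_integrals:
  assumes \<mu>: "\<And>n. real_distribution (\<mu> n)" and nn: "\<And>n. AE x in \<mu> n. 0 \<le> x"
    and conv: "\<And>t. t \<in> \<rat> \<Longrightarrow> t > 0 \<Longrightarrow> (\<lambda>n. \<integral>x. 1 / (x + t) \<partial>\<mu> n) \<longlonglongrightarrow> m t"
    and m: "\<And>t. t \<in> \<rat> \<Longrightarrow> t > 0 \<Longrightarrow> m t \<ge> 1 / (B + t)" and B: "B \<ge> 0"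
  shows "\<exists>F. real_distribution F \<and> (AE x in F. 0 \<le> x) \<and>
    (\<forall>t. t \<in> \<rat> \<and> t > 0 \<longrightarrow> (\<integral>x. 1 / (x + t) \<partial>F) = m t)"
proof -
  have cdf0: "measure (\<mu> n) {- 1<..b} = cdf (\<mu> n) b" if "b > -1" for n b
  proof -
    interpret real_distribution "\<mu> n" by (rule \<mu>)
    have "cdf (\<mu> n) b - cdf (\<mu> n) (-1) = measure (\<mu> n) {-1<..b}" using that by (rule cdf_diff_eq)
    moreover have "cdf (\<mu> n) (-1) = 0"
      unfolding cdf_def by (subst measure_eq_0_null_sets) (use nn[of n] in \<open>auto simp: AE_iff_null_sets[of "{..-1}" "\<mu> n"] elim!: eventually_mono\<close>)
    ultimately show ?thesis by simp
  qed
  have "tight \<mu>" unfolding tight_def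
  proof (intro conjI allI impI \<mu>)
    fix \<epsilon> :: real assume \<epsilon>: "\<epsilon> > 0"
    \<comment> \<open>\<open>t\<close> is so large that \<open>1 - t * m t \<le> B / t < \<epsilon> / 2\<close>\<close>
    obtain k :: nat where k: "2 * B / \<epsilon> < real k" using reals_Archimedean2 by blast
    define t where "t = real (Suc k)"
    have t: "t \<in> \<rat>" "t > 0" by (auto simp: t_def)
    have tB: "2 * B < \<epsilon> * t"
    proof -
      have "2 * B / \<epsilon> < t" using k by (simp add: t_def)
      thus ?thesis using \<epsilon> by (simp add: field_simps)
    qed
    have "1 - t * m t \<le> 1 - t * (1 / (B + t))" using m[OF t] t by (intro diff_left_mono mult_left_mono) auto
    also have "\<dots> = B / (B + t)" using t B by (simp add: field_simps)
    also have "\<dots> \<le> B / t" using t B by (intro divide_left_mono) auto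
    also have "\<dots> < \<epsilon> / 2" using tB t by (simp add: field_simps)
    finally have "t * m t > 1 - \<epsilon> / 2" by simp
    moreover have "(\<lambda>n. t * (\<integral>x. 1 / (x + t) \<partial>\<mu> n)) \<longlonglongrightarrow> t * m t" by (intro tendsto_intros conv t)
    ultimately have "\<forall>\<^sub>F n in sequentially. t * (\<integral>x. 1 / (x + t) \<partial>\<mu> n) > 1 - \<epsilon> / 2"
      by (rule order_tendstoD(1)[rotated])
    then obtain N where N: "\<And>n. n \<ge> N \<Longrightarrow> t * (\<integral>x. 1 / (x + t) \<partial>\<mu> n) > 1 - \<epsilon> / 2"
      by (auto simp: eventually_sequentially)
    have large: "cdf (\<mu> n) t > 1 - \<epsilon>" if n: "n \<ge> N" for n
    proof -
      interpret real_distribution "\<mu> n" by (rule \<mu>)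
      have i1: "integrable (\<mu> n) (\<lambda>x. t * (1 / (x + t)))"
        by (rule integrable_const_bound[of _ 1])
          (use nn[of n] t in \<open>auto elim!: eventually_mono simp: field_simps\<close>)
      have "t * (\<integral>x. 1 / (x + t) \<partial>\<mu> n) = (\<integral>x. t * (1 / (x + t)) \<partial>\<mu> n)"
        by (rule Bochner_Integration.integral_mult_right_zero[symmetric])
      \<comment> \<open>\<open>t / (x + t)\<close> is at most \<open>1\<close>, and at most \<open>1 / 2\<close> beyond \<open>t\<close>\<close>
      also have "\<dots> \<le> (\<integral>x. (1 + indicator {..t} x) / 2 \<partial>\<mu> n)"
      proof (rule integral_mono_AE[OF i1])
        show "AE x in \<mu> n. t * (1 / (x + t)) \<le> (1 + indicator {..t} x) / 2"
          using nn[of n]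
        proof eventually_elim
          case (elim x)
          thus ?case using t by (auto simp: indicator_def field_simps)
        qed
      qed (auto intro!: integrable_real_indicator simp: emeasure_eq_measure)
      also have "\<dots> = (1 + cdf (\<mu> n) t) / 2"
        using prob_space by (simp add: cdf_def add_divide_distrib emeasure_eq_measure integrable_real_indicator)
      finally show ?thesis using N[OF n] by simp
    qed
    have "\<forall>\<^sub>F b in at_top. \<forall>n\<in>{..<N}. cdf (\<mu> n) b > 1 - \<epsilon>"
    proof (rule eventually_ball_finite)
      show "\<forall>n\<in>{..<N}. \<forall>\<^sub>F b in at_top. cdf (\<mu> n) b > 1 - \<epsilon>"
      proof
        fix n
        interpret real_distribution "\<mu> n" by (rule \<mu>)
        show "\<forall>\<^sub>F b in at_top. cdf (\<mu> n) b > 1 - \<epsilon>"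
          by (rule order_tendstoD(1)[OF cdf_lim_at_top_prob]) (use \<epsilon> in auto)
      qed
    qed auto
    hence "\<forall>\<^sub>F b in at_top. (\<forall>n\<in>{..<N}. cdf (\<mu> n) b > 1 - \<epsilon>) \<and> b \<ge> t"
      by (intro eventually_conj eventually_ge_at_top)
    then obtain b where b: "\<And>n. n < N \<Longrightarrow> cdf (\<mu> n) b > 1 - \<epsilon>" "b \<ge> t"
      by (auto simp: eventually_at_top_linorder)
    have "cdf (\<mu> n) b > 1 - \<epsilon>" for n
    proof (cases "n < N")
      case False
      interpret real_distribution "\<mu> n" by (rule \<mu>)
      show ?thesis using large[of n] cdf_nondecreasing[OF b(2)] False by simp
    qed (rule b)
    moreover have "-1 < b" using b t by simp
    ultimately show "\<exists>a b. a < b \<and> (\<forall>n. measure (\<mu> n) {a<..b} > 1 - \<epsilon>)"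
      by (intro exI[of _ "-1"] exI[of _ b]) (simp add: cdf0)
  qed
  from tight_imp_convergent_subsubsequence[OF this strict_mono_id]
  obtain r F where r: "strict_mono r" "real_distribution F" "weak_conv_m (\<lambda>n. \<mu> (r n)) F" by (auto simp: o_def id_def)
  have \<mu>r: "real_distribution (\<mu> (r n))" "AE x in \<mu> (r n). 0 \<le> x" for n
    by (rule \<mu>, rule nn)
  have F0: "AE x in F. 0 \<le> x" by (rule weak_conv_m_support_nonneg[of "\<lambda>n. \<mu> (r n)", OF \<mu>r(1) r(2,3) \<mu>r(2)])
  have "(\<integral>x. 1 / (x + t) \<partial>F) = m t" if t: "t \<in> \<rat>" "t > 0" for t
  proof -
    have "(\<lambda>n. \<integral>x. 1 / (1 * x + t) \<partial>\<mu> (r n)) \<longlonglongrightarrow> (\<integral>x. 1 / (1 * x + t) \<partial>F)"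
      by (rule weak_conv_m_resolvent_integral[of "\<lambda>n. \<mu> (r n)", OF \<mu>r(1) r(2,3) \<mu>r(2)]) (use t in auto)
    moreover have "(\<lambda>n. \<integral>x. 1 / (x + t) \<partial>\<mu> (r n)) \<longlonglongrightarrow> m t"
      using LIMSEQ_subseq_LIMSEQ[OF conv[OF t] r(1)] by (simp add: o_def)
    ultimately show ?thesis by (intro LIMSEQ_unique) auto
  qed
  thus ?thesis using r F0 by blast
qed

section \<open>Analytic continuation of the limiting equation\<close>

text \<open>By Cauchy's estimate on a smaller disc the difference quotients have a bound that does not depend
  on \<open>x\<close>, so dominated convergence allows differentiation under the integral.\<close>

lemma holomorphic_integral:
  fixes f :: "complex \<Rightarrow> 'a \<Rightarrow> complex"
  assumes M: "finite_measure M" and U: "open U"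
    and meas: "\<And>z. z \<in> U \<Longrightarrow> f z \<in> borel_measurable M"
    and hol: "\<And>x. x \<in> space M \<Longrightarrow> (\<lambda>z. f z x) holomorphic_on U"
    and bnd: "\<And>z x. z \<in> U \<Longrightarrow> x \<in> space M \<Longrightarrow> norm (f z x) \<le> K"
  shows "(\<lambda>z. \<integral>x. f z x \<partial>M) holomorphic_on U"
proof -
  interpret finite_measure M by fact
  have "(\<lambda>z. \<integral>x. f z x \<partial>M) field_differentiable at w" if w: "w \<in> U" for w
  proof -
    obtain r where r: "r > 0" "cball w (2 * r) \<subseteq> U"
    proof -
      obtain e where "e > 0" "cball w e \<subseteq> U" using U w open_contains_cball by blast
      thus ?thesis using that[of "e / 2"] by simp
    qed
    have K0: "norm (f z x) \<le> \<bar>K\<bar>" if "z \<in> U" "x \<in> space M" for z x using bnd[OF that] by simp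
    have int: "integrable M (f z)" if "z \<in> U" for z
      by (rule integrable_const_bound[of _ K]) (use bnd meas that in auto)
    define D where "D x = deriv (\<lambda>z. f z x) w" for x
    have quot: "norm ((f z x - f w x) / (z - w)) \<le> \<bar>K\<bar> / r" if z: "z \<in> cball w r" "z \<noteq> w" and x: "x \<in> space M" for z x
    proof -
      have der: "norm (deriv (\<lambda>z. f z x) u) \<le> \<bar>K\<bar> / r" if u: "u \<in> cball w r" for u
      proof -
        have sub: "cball u r \<subseteq> U"
        proof
          fix v assume "v \<in> cball u r"
          hence "dist w v \<le> r + r" using u dist_triangle[of w v u] by simp
          thus "v \<in> U" using r by auto
        qed
        have "norm ((deriv ^^ 1) (\<lambda>z. f z x) u) \<le> fact 1 * \<bar>K\<bar> / r ^ 1"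
        proof (rule Cauchy_inequality)
          show "(\<lambda>z. f z x) holomorphic_on ball u r"
            by (rule holomorphic_on_subset[OF hol[OF x]]) (use sub in auto)
          show "continuous_on (cball u r) (\<lambda>z. f z x)"
            by (rule continuous_on_subset[OF holomorphic_on_imp_continuous_on[OF hol[OF x]] sub])
          show "norm (f v x) \<le> \<bar>K\<bar>" if "norm (u - v) = r" for v
            using that sub x by (intro K0) (auto simp: dist_norm subset_iff)
        qed (rule r)
        thus ?thesis by simp
      qed
      have "norm (f z x - f w x) \<le> \<bar>K\<bar> / r * norm (z - w)"
      proof (rule field_differentiable_bound[of "cball w r" "\<lambda>z. f z x" "deriv (\<lambda>z. f z x)"])
        fix u assume u: "u \<in> cball w r"
        hence "u \<in> U" using r by auto
        thus "((\<lambda>z. f z x) has_field_derivative deriv (\<lambda>z. f z x) u) (at u within cball w r)"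
          using hol[OF x] U holomorphic_derivI by blast
      qed (use der z r in auto)
      thus ?thesis using z by (simp add: norm_divide field_simps)
    qed
    have lim: "((\<lambda>z. (f z x - f w x) / (z - w)) \<longlongrightarrow> D x) (at w)" if x: "x \<in> space M" for x
      using holomorphic_derivI[OF hol[OF x] U w, of UNIV] by (simp add: D_def DERIV_def has_field_derivative_iff)
    have "((\<lambda>z. ((\<integral>x. f z x \<partial>M) - (\<integral>x. f w x \<partial>M)) / (z - w)) \<longlongrightarrow> (\<integral>x. D x \<partial>M)) (at w)"
      unfolding tendsto_at_iff_sequentially
    proof (intro allI impI)
      fix Z :: "nat \<Rightarrow> complex" assume Z: "\<forall>i. Z i \<in> UNIV - {w}" "Z \<longlonglongrightarrow> w"
      have "eventually (\<lambda>n. Z n \<in> ball w r) sequentially"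
        using Z(2) r by (intro topological_tendstoD) auto
      then obtain N where N: "\<And>n. n \<ge> N \<Longrightarrow> Z n \<in> ball w r" by (auto simp: eventually_sequentially)
      define Y where "Y n = Z (n + N)" for n
      have Y: "Y n \<in> cball w r" "Y n \<noteq> w" "Y n \<in> U" for n
        using N[of "n + N"] Z(1) r by (auto simp: Y_def)
      have Yw: "Y \<longlonglongrightarrow> w" unfolding Y_def by (rule LIMSEQ_ignore_initial_segment[OF Z(2)])
      have "(\<lambda>n. \<integral>x. (f (Y n) x - f w x) / (Y n - w) \<partial>M) \<longlonglongrightarrow> (\<integral>x. D x \<partial>M)"
      proof (rule integral_dominated_convergence[where w = "\<lambda>_. \<bar>K\<bar> / r"])
        have ptw: "(\<lambda>n. (f (Y n) x - f w x) / (Y n - w)) \<longlonglongrightarrow> D x" if x: "x \<in> space M" for x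
          using lim[OF x] Y Yw unfolding tendsto_at_iff_sequentially by (auto simp: o_def)
        thus "AE x in M. (\<lambda>n. (f (Y n) x - f w x) / (Y n - w)) \<longlonglongrightarrow> D x" by (intro AE_I2)
        show m: "(\<lambda>x. (f (Y n) x - f w x) / (Y n - w)) \<in> borel_measurable M" for n
          using meas[OF Y(3)[of n]] meas[OF w] by measurable
        show "D \<in> borel_measurable M"
          by (rule borel_measurable_LIMSEQ_metric[OF m ptw])
        show "AE x in M. norm ((f (Y n) x - f w x) / (Y n - w)) \<le> \<bar>K\<bar> / r" for n
          using quot Y by (intro AE_I2) blast
      qed simp
      moreover have "(\<integral>x. (f (Y n) x - f w x) / (Y n - w) \<partial>M) = ((\<integral>x. f (Y n) x \<partial>M) - (\<integral>x. f w x \<partial>M)) / (Y n - w)" for n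
        using int[OF Y(3)[of n]] int[OF w] by simp
      ultimately have "(\<lambda>n. ((\<integral>x. f (Y n) x \<partial>M) - (\<integral>x. f w x \<partial>M)) / (Y n - w)) \<longlonglongrightarrow> (\<integral>x. D x \<partial>M)"
        by (simp only:)
      hence "(\<lambda>n. ((\<lambda>z. ((\<integral>x. f z x \<partial>M) - (\<integral>x. f w x \<partial>M)) / (z - w)) \<circ> Z) (n + N)) \<longlonglongrightarrow> (\<integral>x. D x \<partial>M)"
        unfolding o_def Y_def .
      thus "((\<lambda>z. ((\<integral>x. f z x \<partial>M) - (\<integral>x. f w x \<partial>M)) / (z - w)) \<circ> Z) \<longlonglongrightarrow> (\<integral>x. D x \<partial>M)"
        by (rule LIMSEQ_offset)
    qed
    thus ?thesis unfolding field_differentiable_def has_field_derivative_iff by blast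
  qed
  thus ?thesis using U by (simp add: holomorphic_on_open field_differentiable_def)
qed

text \<open>For \<open>x \<ge> 0\<close> the quotient \<open>z / (x - z)\<close> has imaginary part \<open>x Im z / \<bar>x - z\<bar>\<^sup>2\<close>, and \<open>\<bar>z\<bar> \<le> \<bar>x - z\<bar>\<close> if
  \<open>Re z < 0\<close>. These bounds keep the denominators of the limiting equation away from zero.\<close>

lemma stieltjes_bounds:
  assumes F: "real_distribution F" and nn: "AE x in F. 0 \<le> x"
  shows "Im z > 0 \<Longrightarrow> Im (z * stieltjes F z) \<ge> 0"
    and "Re z < 0 \<Longrightarrow> norm (z * stieltjes F z) \<le> 1"
proof -
  interpret real_distribution F by fact
  have meas [measurable]: "(\<lambda>x. 1 / (complex_of_real x - z)) \<in> borel_measurable F" by measurable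
  {
    assume z: "Im z > 0"
    have b: "norm (1 / (complex_of_real x - z)) \<le> 1 / Im z" for x
    proof -
      have "Im z \<le> norm (complex_of_real x - z)" using abs_Im_le_cmod[of "complex_of_real x - z"] z by simp
      thus ?thesis using z by (simp add: norm_divide frac_le)
    qed
    have i: "integrable F (\<lambda>x. z * (1 / (complex_of_real x - z)))"
      by (intro integrable_mult_right integrable_const_bound[of _ "1 / Im z"]) (use b in auto)
    have "Im (z * stieltjes F z) = Im (\<integral>x. z * (1 / (complex_of_real x - z)) \<partial>F)"
      unfolding stieltjes_def Bochner_Integration.integral_mult_right_zero ..
    also have "\<dots> = (\<integral>x. Im (z * (1 / (complex_of_real x - z))) \<partial>F)" using i by simp
    also have "\<dots> \<ge> 0"
    proof (rule integral_nonneg_AE)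
      show "AE x in F. 0 \<le> Im (z * (1 / (complex_of_real x - z)))"
        using nn
      proof eventually_elim
        case (elim x)
        have "Im (z * (1 / (complex_of_real x - z))) = x * Im z / ((x - Re z)\<^sup>2 + (Im z)\<^sup>2)"
          by (simp add: Im_divide algebra_simps)
        thus ?case using elim z by simp
      qed
    qed
    finally show "Im (z * stieltjes F z) \<ge> 0" .
  }
  {
    assume z: "Re z < 0"
    have b: "AE x in F. norm (z * (1 / (complex_of_real x - z))) \<le> 1"
      using nn
    proof eventually_elim
      case (elim x)
      have "x * Re z \<le> 0" using elim z by (simp add: mult_nonneg_nonpos)
      moreover have "2 * x * Re z = 2 * (x * Re z)" "0 \<le> x\<^sup>2" by simp_all
      ultimately have "2 * x * Re z \<le> x\<^sup>2" by linarith
      hence "(norm z)\<^sup>2 \<le> (norm (complex_of_real x - z))\<^sup>2"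
        by (simp add: cmod_power2 power2_diff)
      hence "norm z \<le> norm (complex_of_real x - z)" by (rule power2_le_imp_le) simp
      moreover have "complex_of_real x - z \<noteq> 0" using elim z by (auto simp: complex_eq_iff)
      ultimately show ?case by (simp add: norm_divide norm_mult divide_simps)
    qed
    have i: "integrable F (\<lambda>x. z * (1 / (complex_of_real x - z)))"
      by (rule integrable_const_bound[OF b]) measurable
    have "norm (z * stieltjes F z) = norm (\<integral>x. z * (1 / (complex_of_real x - z)) \<partial>F)"
      unfolding stieltjes_def Bochner_Integration.integral_mult_right_zero ..
    also have "\<dots> \<le> (\<integral>x. norm (z * (1 / (complex_of_real x - z))) \<partial>F)" by (rule integral_norm_bound)
    also have "\<dots> \<le> (\<integral>x. 1 \<partial>F)" by (rule integral_mono_AE) (use i b in auto)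
    finally show "norm (z * stieltjes F z) \<le> 1" using prob_space by simp
  }
qed

text \<open>Both sides of the equation are holomorphic on the union of the upper half-plane and a
  half-plane \<open>Re z < - T\<close>, which is connected because the two overlap. They agree at the points \<open>- t\<close>
  with \<open>t\<close> rational and large, and these points accumulate.\<close>

theorem stieltjes_equation_continuation:
  assumes F: "real_distribution F" and nnF: "AE x in F. 0 \<le> x"
    and P: "real_distribution P" and nnP: "AE x in P. 0 \<le> x" and PB: "AE x in P. x \<le> B" and B: "B \<ge> 0"
    and c: "c > 0"
    and eq: "\<And>t. t \<in> \<rat> \<Longrightarrow> t > 0 \<Longrightarrow> (\<integral>x. 1 / (x + t) \<partial>F) = (\<integral>x. 1 / ((1 - c + c * t * (\<integral>x. 1 / (x + t) \<partial>F)) * x + t) \<partial>P)"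
    and z: "Im z > 0"
  shows "stieltjes F z = (\<integral>x. 1 / (complex_of_real x * (1 - complex_of_real c
            - complex_of_real c * z * stieltjes F z) - z) \<partial>P)"
proof -
  interpret F: real_distribution F by fact
  interpret P: real_distribution P by fact
  \<comment> \<open>for \<open>Re w < - T\<close>, the modulus of \<open>w\<close> exceeds that of \<open>x * b w\<close> by at least 1, for all \<open>x\<close> in the support of \<open>P\<close>\<close>
  define T where "T = B * (1 + 2 * c) + 1"
  define U where "U = {z. Im z > 0} \<union> {z. Re z < - T}"
  have T: "T \<ge> 1" using B c by (simp add: T_def)
  have opU: "open U" unfolding U_def by (intro open_Un open_halfspace_Im_gt open_halfspace_Re_lt)
  have coU: "connected U" unfolding U_def
  proof (rule connected_Un)
    show "connected {z. Im z > 0}" "connected {z. Re z < - T}"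
      by (intro convex_connected convex_halfspace_Im_gt convex_halfspace_Re_lt)+
    have "Complex (- T - 1) 1 \<in> {z. Im z > 0} \<inter> {z. Re z < - T}" by simp
    thus "{z. Im z > 0} \<inter> {z. Re z < - T} \<noteq> {}" by blast
  qed
  define s where "s w = stieltjes F w" for w
  define b where "b w = 1 - complex_of_real c - complex_of_real c * w * s w" for w
  \<comment> \<open>with \<open>x\<close> truncated to the interval from 0 to \<open>B\<close> the bounds hold everywhere, not only almost everywhere\<close>
  define \<tau> where "\<tau> x = min (max x 0) B" for x
  have \<tau>: "0 \<le> \<tau> x" "\<tau> x \<le> B" for x using B by (auto simp: \<tau>_def)
  define s' where "s' w = (\<integral>x. 1 / (complex_of_real (max x 0) - w) \<partial>F)" for w
  have ss': "s w = s' w" for w unfolding s_def s'_def stieltjes_def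
  proof (rule integral_cong_AE)
    show "AE x in F. 1 / (complex_of_real x - w) = 1 / (complex_of_real (max x 0) - w)"
      using nnF by eventually_elim (simp add: max_def)
  qed auto
  have pole: "w \<in> U \<Longrightarrow> x \<ge> 0 \<Longrightarrow> complex_of_real x - w \<noteq> 0" for w x
    using T by (auto simp: U_def complex_eq_iff)
  have hs: "s holomorphic_on V" if V: "open V" "V \<subseteq> U" and low: "\<And>w x. w \<in> V \<Longrightarrow> x \<ge> 0 \<Longrightarrow> norm (complex_of_real x - w) \<ge> \<delta>"
    and \<delta>: "\<delta> > 0" for V \<delta>
  proof -
    have "s' holomorphic_on V" unfolding s'_def
    proof (rule holomorphic_integral[where K = "1 / \<delta>"])
      show "finite_measure F" by unfold_locales
      show "norm (1 / (complex_of_real (max x 0) - w)) \<le> 1 / \<delta>" if "w \<in> V" for w x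
        using low[OF that, of "max x 0"] \<delta> by (simp add: norm_divide frac_le)
      show "(\<lambda>w. 1 / (complex_of_real (max x 0) - w)) holomorphic_on V" for x
      proof (intro holomorphic_intros)
        fix w assume "w \<in> V"
        thus "complex_of_real (max x 0) - w \<noteq> 0" using pole[of w "max x 0"] V by auto
      qed
    qed (use V in auto)
    thus ?thesis using ss' by (simp add: holomorphic_cong[of V V s s'])
  qed
  have low1: "norm (complex_of_real x - w) \<ge> Im w" for x w
    using abs_Im_le_cmod[of "complex_of_real x - w"] by simp
  have Imb: "Im (b w) \<le> 0" if "Im w > 0" for w
    using stieltjes_bounds(1)[OF F nnF that] c by (simp add: b_def s_def mult.assoc)
  have normb: "norm (b w) \<le> 1 + 2 * c" if "Re w < 0" for w
  proof -
    have "norm (b w) \<le> norm (1 - complex_of_real c) + norm (complex_of_real c * (w * s w))"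
      unfolding b_def using norm_triangle_ineq4[of "1 - complex_of_real c" "complex_of_real c * (w * s w)"]
      by (simp add: mult.assoc)
    also have "\<dots> \<le> (1 + c) + c * 1"
    proof (rule add_mono)
      show "norm (1 - complex_of_real c) \<le> 1 + c" using norm_triangle_ineq4[of 1 "complex_of_real c"] c by simp
      show "norm (complex_of_real c * (w * s w)) \<le> c * 1"
        unfolding norm_mult[of "complex_of_real c"] using stieltjes_bounds(2)[OF F nnF that] c
        by (intro mult_mono) (auto simp: s_def)
    qed
    finally show ?thesis by simp
  qed
  have low2: "norm (complex_of_real (\<tau> x) * b w - w) \<ge> Im w" if w: "Im w > 0" for x w
  proof -
    have "Im (complex_of_real (\<tau> x) * b w - w) \<le> - Im w" using Imb[OF w] \<tau>[of x] by (simp add: mult_nonneg_nonpos)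
    hence "Im w \<le> \<bar>Im (complex_of_real (\<tau> x) * b w - w)\<bar>" using w by linarith
    thus ?thesis using abs_Im_le_cmod order_trans by blast
  qed
  have low3: "norm (complex_of_real (\<tau> x) * b w - w) \<ge> 1" if w: "Re w < - T" for x w
  proof -
    have "norm (complex_of_real (\<tau> x) * b w) \<le> B * (1 + 2 * c)"
      unfolding norm_mult using normb[of w] w T \<tau>[of x] B by (intro mult_mono) auto
    moreover have "norm w \<ge> T" using abs_Re_le_cmod[of w] w T by linarith
    moreover have "norm w - norm (complex_of_real (\<tau> x) * b w) \<le> norm (complex_of_real (\<tau> x) * b w - w)"
      using norm_triangle_ineq2[of w "complex_of_real (\<tau> x) * b w"] by (simp add: norm_minus_commute)
    ultimately show ?thesis by (simp add: T_def)
  qed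
  define g where "g w = (\<integral>x. 1 / (complex_of_real (\<tau> x) * b w - w) \<partial>P)" for w
  have hg: "(\<lambda>w. s w - g w) holomorphic_on V" if V: "open V" "V \<subseteq> U" and \<delta>: "\<delta> > 0"
    and l1: "\<And>w x. w \<in> V \<Longrightarrow> x \<ge> 0 \<Longrightarrow> norm (complex_of_real x - w) \<ge> \<delta>"
    and l2: "\<And>w x. w \<in> V \<Longrightarrow> norm (complex_of_real (\<tau> x) * b w - w) \<ge> \<delta>" for V \<delta>
  proof -
    have sV: "s holomorphic_on V" by (rule hs[OF V l1 \<delta>])
    have bV: "b holomorphic_on V" unfolding b_def by (intro holomorphic_intros sV)
    have nz: "complex_of_real (\<tau> x) * b w - w \<noteq> 0" if "w \<in> V" for w x using l2[OF that, of x] \<delta> by auto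
    have "g holomorphic_on V" unfolding g_def
    proof (rule holomorphic_integral[where K = "1 / \<delta>"])
      show "finite_measure P" by unfold_locales
      show "norm (1 / (complex_of_real (\<tau> x) * b w - w)) \<le> 1 / \<delta>" if "w \<in> V" for w x
        using l2[OF that, of x] \<delta> by (simp add: norm_divide frac_le)
      show "(\<lambda>w. 1 / (complex_of_real (\<tau> x) * b w - w)) holomorphic_on V" for x
        using nz by (intro holomorphic_intros bV) auto
      show "(\<lambda>x. 1 / (complex_of_real (\<tau> x) * b w - w)) \<in> borel_measurable P" for w
        unfolding \<tau>_def by measurable
    qed (use V in auto)
    thus ?thesis using sV by (intro holomorphic_intros)
  qed
  have "(\<lambda>w. s w - g w) field_differentiable at w" if w: "w \<in> U" for w
  proof (cases "Im w > 0")
    case True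
    let ?V = "{v. Im v > Im w / 2}"
    have o: "open ?V" by (rule open_halfspace_Im_gt)
    have low: "Im v > 0 \<and> Im w / 2 \<le> Im v" if "v \<in> ?V" for v using that True by auto
    have "(\<lambda>w. s w - g w) holomorphic_on ?V"
    proof (rule hg[OF o])
      show "?V \<subseteq> U" using low by (auto simp: U_def)
      show "0 < Im w / 2" using True by simp
      show "Im w / 2 \<le> norm (complex_of_real x - v)" if "v \<in> ?V" for v x
        using low1[of v x] low[OF that] by linarith
      show "Im w / 2 \<le> norm (complex_of_real (\<tau> x) * b v - v)" if "v \<in> ?V" for v x
        using low2[of v x] low[OF that] by linarith
    qed
    thus ?thesis using o True by (auto simp: holomorphic_on_open field_differentiable_def)
  next
    case False
    let ?V = "{v. Re v < - T}"
    have o: "open ?V" by (rule open_halfspace_Re_lt)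
    have wV: "w \<in> ?V" using w False by (auto simp: U_def)
    have "(\<lambda>w. s w - g w) holomorphic_on ?V"
    proof (rule hg[OF o])
      show "?V \<subseteq> U" by (auto simp: U_def)
      show "(0 :: real) < 1" by simp
      show "1 \<le> norm (complex_of_real x - v)" if "v \<in> ?V" "x \<ge> 0" for v x
        using abs_Re_le_cmod[of "complex_of_real x - v"] that T by auto
      show "1 \<le> norm (complex_of_real (\<tau> x) * b v - v)" if "v \<in> ?V" for v x
        using low3 that by auto
    qed
    thus ?thesis using o wV unfolding holomorphic_on_open[OF o] field_differentiable_def by blast
  qed
  hence hol: "(\<lambda>w. s w - g w) holomorphic_on U" using opU by (simp add: holomorphic_on_open field_differentiable_def)
  define A where "A = (\<lambda>t. - complex_of_real t) ` {t \<in> \<rat>. t > T}"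
  have zero: "s w - g w = 0" if w: "w \<in> A" for w
  proof -
    obtain t where t: "t \<in> \<rat>" "t > T" "w = - complex_of_real t" using w unfolding A_def by blast
    define m where "m = (\<integral>x. 1 / (x + t) \<partial>F)"
    have "s w = (\<integral>x. complex_of_real (1 / (x + t)) \<partial>F)" by (simp add: s_def stieltjes_def t(3))
    also have "\<dots> = complex_of_real m" unfolding m_def by (rule integral_complex_of_real)
    finally have sm: "s w = complex_of_real m" .
    have bw: "b w = complex_of_real (1 - c + c * t * m)" unfolding b_def sm unfolding t(3) by simp
    have "g w = (\<integral>x. complex_of_real (1 / ((1 - c + c * t * m) * x + t)) \<partial>P)"
      unfolding g_def
    proof (rule integral_cong_AE)
      show "AE x in P. 1 / (complex_of_real (\<tau> x) * b w - w) = complex_of_real (1 / ((1 - c + c * t * m) * x + t))"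
        using nnP PB
      proof eventually_elim
        case (elim x)
        hence "\<tau> x = x" by (simp add: \<tau>_def)
        thus ?case unfolding bw by (simp add: t(3) mult.commute)
      qed
    qed (auto simp: \<tau>_def)
    also have "\<dots> = complex_of_real (\<integral>x. 1 / ((1 - c + c * t * m) * x + t) \<partial>P)" by (rule integral_complex_of_real)
    also have "\<dots> = complex_of_real m" using eq[of t] t T by (simp add: m_def)
    finally show ?thesis by (simp add: sm)
  qed
  define \<xi> where "\<xi> = - complex_of_real (T + 1)"
  have lp: "\<xi> islimpt A"
    unfolding islimpt_approachable
  proof safe
    fix e :: real assume e: "e > 0"
    obtain q :: rat where q: "T + 1 < of_rat q" "of_rat q < T + 1 + e" using of_rat_dense[of "T + 1" "T + 1 + e"] e by auto
    show "\<exists>x'\<in>A. x' \<noteq> \<xi> \<and> dist x' \<xi> < e"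
    proof (intro bexI conjI)
      show "- complex_of_real (of_rat q) \<in> A" using q by (auto simp: A_def)
      show "- complex_of_real (of_rat q) \<noteq> \<xi>" using q unfolding \<xi>_def by (simp only: neg_equal_iff_equal of_real_eq_iff)
      have "dist (- complex_of_real (of_rat q)) \<xi> = \<bar>of_rat q - (T + 1)\<bar>"
      proof -
        have "- complex_of_real (of_rat q) - \<xi> = complex_of_real (T + 1 - of_rat q)" by (simp add: \<xi>_def)
        thus ?thesis unfolding dist_norm by (simp only: norm_of_real abs_minus_commute)
      qed
      thus "dist (- complex_of_real (of_rat q)) \<xi> < e" using q by simp
    qed
  qed
  have "s z - g z = 0"
  proof (rule analytic_continuation[OF hol opU coU _ _ lp zero])
    show "A \<subseteq> U" by (auto simp: A_def U_def)
    show "\<xi> \<in> U" by (simp add: U_def \<xi>_def)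
    show "z \<in> U" using z by (simp add: U_def)
  qed
  hence "stieltjes F z = g z" by (simp add: s_def)
  also have "g z = (\<integral>x. 1 / (complex_of_real x * b z - z) \<partial>P)"
    unfolding g_def
  proof (rule integral_cong_AE)
    show "AE x in P. 1 / (complex_of_real (\<tau> x) * b z - z) = 1 / (complex_of_real x * b z - z)"
      using nnP PB by eventually_elim (simp add: \<tau>_def)
  qed (auto simp: \<tau>_def)
  finally show ?thesis by (simp add: b_def s_def)
qed

section \<open>The mean resolvent trace for independent columns\<close>

definition mat_measurable :: "'a measure \<Rightarrow> nat \<Rightarrow> ('a \<Rightarrow> real mat) \<Rightarrow> bool" where
  "mat_measurable M p A \<longleftrightarrow> (\<forall>x. A x \<in> carrier_mat p p) \<and>
     (\<forall>i<p. \<forall>j<p. (\<lambda>x. A x $$ (i, j)) \<in> borel_measurable M)"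

lemma mat_measurable_det:
  assumes "mat_measurable M k A"
  shows "(\<lambda>x. Determinant.det (A x)) \<in> borel_measurable M"
proof -
  have e: "(\<lambda>x. Determinant.det (A x)) = (\<lambda>x. \<Sum>q\<in>{q. q permutes {0..<k}}. signof q * (\<Prod>i = 0..<k. A x $$ (i, q i)))"
    using assms by (intro ext det_def') (simp add: mat_measurable_def)
  show ?thesis unfolding e
  proof (intro borel_measurable_sum borel_measurable_times borel_measurable_const borel_measurable_prod)
    fix q i assume "q \<in> {q. q permutes {0..<k}}" "i \<in> {0..<k}"
    hence "i < k" "q i < k" using permutes_in_image[of q "{0..<k}" i] by auto
    thus "(\<lambda>x. A x $$ (i, q i)) \<in> borel_measurable M" using assms by (simp add: mat_measurable_def)
  qed
qed

text \<open>The entries of the inverse are cofactors divided by the determinant.\<close>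

lemma mat_measurable_minv:
  assumes A: "mat_measurable M k A"
  shows "mat_measurable M k (\<lambda>x. minv (A x))"
  unfolding mat_measurable_def
proof (intro conjI allI impI)
  have Ac: "A x \<in> carrier_mat k k" for x using A by (simp add: mat_measurable_def)
  show "minv (A x) \<in> carrier_mat k k" for x using adj_mat(1)[OF Ac] by (simp add: minv_def)
  fix i j assume ij: "i < k" "j < k"
  have del: "mat_measurable M (k - 1) (\<lambda>x. mat_delete (A x) j i)"
    unfolding mat_measurable_def
  proof (intro conjI allI impI)
    show "mat_delete (A x) j i \<in> carrier_mat (k - 1) (k - 1)" for x using Ac[of x] by (simp add: mat_delete_def)
    fix a b assume ab: "a < k - 1" "b < k - 1"
    define a' b' where "a' = (if a < j then a else Suc a)" and "b' = (if b < i then b else Suc b)"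
    have "a' < k" "b' < k" using ab by (auto simp: a'_def b'_def)
    moreover have "(\<lambda>x. mat_delete (A x) j i $$ (a, b)) = (\<lambda>x. A x $$ (a', b'))"
    proof
      fix x
      show "mat_delete (A x) j i $$ (a, b) = A x $$ (a', b')"
        using ab Ac[of x] by (auto simp: mat_delete_def a'_def b'_def)
    qed
    ultimately show "(\<lambda>x. mat_delete (A x) j i $$ (a, b)) \<in> borel_measurable M"
      using A by (simp add: mat_measurable_def)
  qed
  have "(\<lambda>x. minv (A x) $$ (i, j)) =
     (\<lambda>x. 1 / Determinant.det (A x) * ((- 1) ^ (j + i) * Determinant.det (mat_delete (A x) j i)))"
  proof
    fix x
    show "minv (A x) $$ (i, j) = 1 / Determinant.det (A x) * ((- 1) ^ (j + i) * Determinant.det (mat_delete (A x) j i))"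
      using ij Ac[of x] by (simp add: minv_def adj_mat_def cofactor_def)
  qed
  thus "(\<lambda>x. minv (A x) $$ (i, j)) \<in> borel_measurable M"
    using mat_measurable_det[OF A] mat_measurable_det[OF del] by simp
qed

lemma mat_measurable_resolvent:
  assumes A: "mat_measurable M p A"
  shows "mat_measurable M p (\<lambda>x. resolvent t (A x))"
proof -
  have Ac: "A x \<in> carrier_mat p p" for x using A by (simp add: mat_measurable_def)
  have "mat_measurable M p (\<lambda>x. A x + t \<cdot>\<^sub>m 1\<^sub>m p)"
    unfolding mat_measurable_def
  proof (intro conjI allI impI)
    fix i j assume ij: "i < p" "j < p"
    have "(\<lambda>x. (A x + t \<cdot>\<^sub>m 1\<^sub>m p) $$ (i, j)) = (\<lambda>x. A x $$ (i, j) + t * (1\<^sub>m p $$ (i, j)))"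
      using ij by auto
    thus "(\<lambda>x. (A x + t \<cdot>\<^sub>m 1\<^sub>m p) $$ (i, j)) \<in> borel_measurable M"
      using A ij by (auto simp del: index_one_mat simp: mat_measurable_def intro!: borel_measurable_add)
  qed auto
  moreover have "dim_row (A x) = p" for x using Ac[of x] by simp
  ultimately show ?thesis using mat_measurable_minv by (simp add: resolvent_def)
qed

lemma mat_measurable_const: "A \<in> carrier_mat p p \<Longrightarrow> mat_measurable M p (\<lambda>_. A)"
  by (simp add: mat_measurable_def)

lemma mat_measurable_mult:
  assumes A: "mat_measurable M p A" and B: "mat_measurable M p B"
  shows "mat_measurable M p (\<lambda>x. A x * B x)"
  unfolding mat_measurable_def
proof (intro conjI allI impI)
  have c: "A x \<in> carrier_mat p p" "B x \<in> carrier_mat p p" for x using A B by (auto simp: mat_measurable_def)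
  show "A x * B x \<in> carrier_mat p p" for x by (rule mult_carrier_mat[OF c])
  fix i j assume ij: "i < p" "j < p"
  have "(\<lambda>x. (A x * B x) $$ (i, j)) = (\<lambda>x. \<Sum>k<p. A x $$ (i, k) * B x $$ (k, j))"
  proof
    fix x show "(A x * B x) $$ (i, j) = (\<Sum>k<p. A x $$ (i, k) * B x $$ (k, j))"
      using c[of x] ij by (simp add: scalar_prod_def atLeast0LessThan)
  qed
  thus "(\<lambda>x. (A x * B x) $$ (i, j)) \<in> borel_measurable M"
    using A B ij by (auto simp: mat_measurable_def intro!: borel_measurable_sum borel_measurable_times)
qed

lemma mat_measurable_gram:
  assumes "\<And>j i. j \<in> J \<Longrightarrow> i < p \<Longrightarrow> (\<lambda>x. r x j $ i) \<in> borel_measurable M"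
  shows "mat_measurable M p (\<lambda>x. gram p (r x) J)"
  unfolding mat_measurable_def
proof (intro conjI allI impI)
  fix a b assume ab: "a < p" "b < p"
  hence "(\<lambda>x. gram p (r x) J $$ (a, b)) = (\<lambda>x. \<Sum>j\<in>J. r x j $ a * r x j $ b)" by (simp add: gram_def)
  thus "(\<lambda>x. gram p (r x) J $$ (a, b)) \<in> borel_measurable M"
    using assms ab by (auto intro!: borel_measurable_sum borel_measurable_times)
qed simp

lemma mat_measurable_mtrace:
  assumes A: "mat_measurable M p A"
  shows "(\<lambda>x. mtrace (A x)) \<in> borel_measurable M"
proof -
  have "dim_row (A x) = p" for x using A by (auto simp: mat_measurable_def)
  hence "(\<lambda>x. mtrace (A x)) = (\<lambda>x. \<Sum>i<p. A x $$ (i, i))" by (simp add: mtrace_def)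
  thus ?thesis using A by (auto simp: mat_measurable_def intro!: borel_measurable_sum)
qed

lemma mat_measurable_quadratic:
  assumes A: "mat_measurable M p A" and v: "\<And>x. v x \<in> carrier_vec p"
    and vm: "\<And>i. i < p \<Longrightarrow> (\<lambda>x. v x $ i) \<in> borel_measurable M"
  shows "(\<lambda>x. v x \<bullet> (A x *\<^sub>v v x)) \<in> borel_measurable M"
proof -
  have Ac: "A x \<in> carrier_mat p p" for x using A by (simp add: mat_measurable_def)
  have "v x \<bullet> (A x *\<^sub>v v x) = (\<Sum>i<p. v x $ i * (\<Sum>j<p. A x $$ (i, j) * v x $ j))" for x
    using v[of x] Ac[of x] by (simp add: scalar_prod_def atLeast0LessThan)
  thus ?thesis using A vm by (auto simp: mat_measurable_def intro!: borel_measurable_sum borel_measurable_times)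
qed

lemma gram_cong: "(\<And>j. j \<in> J \<Longrightarrow> r j = r' j) \<Longrightarrow> gram p r J = gram p r' J"
  by (simp add: gram_def cong: sum.cong)

definition scaled_column :: "nat \<Rightarrow> nat \<Rightarrow> (nat \<Rightarrow> nat \<Rightarrow> real) \<Rightarrow> nat \<Rightarrow> real Matrix.vec" where
  "scaled_column p n x j = Matrix.vec p (\<lambda>i. x j i / sqrt (real n))"

lemma scaled_column_carrier [simp, intro]: "scaled_column p n x j \<in> carrier_vec p"
  by (simp add: scaled_column_def)

text \<open>The unscaled columns are independent with the law \<open>\<nu>\<close>. All that is assumed about this law is the bound
  \<open>qf\<close> for the mean deviation of its quadratic forms.\<close>

locale iid_columns = prob_space \<nu> for \<nu> :: "(nat \<Rightarrow> real) measure" +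
  fixes p n :: nat and t B K :: real and S :: "real mat"
  assumes sets_\<nu>: "sets \<nu> = sets (borel_vec p)" and p: "p \<ge> 1" and n: "n \<ge> 1" and t: "t > 0"
    and S: "psd p S" and B: "op_bound p B S" "B \<ge> 0" and K: "K \<ge> 0"
    and qf: "\<And>A \<beta>. op_bound p \<beta> A \<Longrightarrow> \<beta> \<ge> 0 \<Longrightarrow>
      (\<integral>\<^sup>+z. ennreal \<bar>Matrix.vec p z \<bullet> (A *\<^sub>v Matrix.vec p z) - mtrace (A * S)\<bar> \<partial>\<nu>) \<le> ennreal (K * \<beta> * sqrt (real p))"
begin

abbreviation "Q \<equiv> PiM {..<n} (\<lambda>_ :: nat. \<nu>)"
definition "f x = mtrace (resolvent t (gram p (scaled_column p n x) {..<n})) / real p"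
definition "m = (\<integral>x. f x \<partial>Q)"
text \<open>By \<open>sum_leave_one_out\<close>, \<open>b\<close> is the mean of the average of the \<open>1 / (1 + q\<^sub>j)\<close>.\<close>

definition "b = 1 - real p / real n + real p / real n * t * m"

sublocale Q: prob_space Q by (intro prob_space_PiM prob_space_axioms)

lemma entry_measurable:
  assumes "j \<in> J" "i < p" shows "(\<lambda>x. x j i) \<in> borel_measurable (PiM J (\<lambda>_. \<nu>))"
proof -
  have "(\<lambda>z. z i) \<in> measurable (borel_vec p) borel" using assms by (intro measurable_component_singleton) auto
  hence "(\<lambda>z. z i) \<in> measurable \<nu> borel" by (simp add: measurable_cong_sets[OF sets_\<nu> refl])
  thus ?thesis using assms(1) measurable_component_singleton[of j J "\<lambda>_. \<nu>"] measurable_compose by blast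
qed

lemma column_measurable:
  assumes "j \<in> J" "i < p" shows "(\<lambda>x. scaled_column p n x j $ i) \<in> borel_measurable (PiM J (\<lambda>_. \<nu>))"
  using entry_measurable[OF assms] assms by (simp add: scaled_column_def)

lemma resolvent_measurable:
  "J \<subseteq> J' \<Longrightarrow> mat_measurable (PiM J' (\<lambda>_. \<nu>)) p (\<lambda>x. resolvent t (gram p (scaled_column p n x) J))"
  by (intro mat_measurable_resolvent mat_measurable_gram column_measurable) auto

lemma f_measurable [measurable]: "f \<in> borel_measurable Q"
  unfolding f_def using mat_measurable_mtrace[OF resolvent_measurable[of "{..<n}" "{..<n}"]] by simp

lemma f_bounds: "0 \<le> f x" "f x \<le> 1 / t" "\<bar>f x\<bar> \<le> 1 / t"
proof -
  have P: "psd p (gram p (scaled_column p n x) {..<n})" by (intro gram_psd) simp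
  show "0 \<le> f x" using psd_mtrace[OF resolvent_psd[OF P t]] by (simp add: f_def)
  show "f x \<le> 1 / t"
    using order_trans[OF abs_ge_self op_bound_mtrace[OF resolvent_op_bound[OF P t]]] t p
    by (simp add: f_def field_simps)
  thus "\<bar>f x\<bar> \<le> 1 / t" using \<open>0 \<le> f x\<close> by simp
qed

lemma f_integrable: "integrable Q f"
  by (rule Q.integrable_const_bound[of _ "1 / t"]) (auto simp: f_bounds)

text \<open>Exchanging a column is a deletion followed by an insertion, and each of them moves the trace
  by at most \<open>1 / t\<close>.\<close>

lemma f_bounded_differences: "bounded_differences {..<n} \<nu> f (2 / (t * real p))"
  unfolding bounded_differences_def
proof safe
  fix x :: "nat \<Rightarrow> nat \<Rightarrow> real" and j z assume j: "j < n"
  let ?J = "{..<n} - {j}" and ?x' = "x(j := z)"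
  have ins: "insert j ?J = {..<n}" using j by auto
  have one: "op_bound p 1 (1\<^sub>m p)" by (auto simp: op_bound_def)
  have g: "gram p (scaled_column p n ?x') ?J = gram p (scaled_column p n x) ?J"
    by (rule gram_cong) (simp add: scaled_column_def)
  have b: "\<bar>mtrace (resolvent t (gram p (scaled_column p n w) ?J)) - real p * f w\<bar> \<le> 1 / t" for w
  proof -
    have P: "psd p (gram p (scaled_column p n w) J)" for J by (intro gram_psd) simp
    have r: "resolvent t (gram p (scaled_column p n w) J) * 1\<^sub>m p = resolvent t (gram p (scaled_column p n w) J)" for J
      using resolvent_inverse(1)[OF P[of J] t] by simp
    have "\<bar>mtrace (resolvent t (gram p (scaled_column p n w) ?J) * 1\<^sub>m p)
      - mtrace (resolvent t (gram p (scaled_column p n w) (insert j ?J)) * 1\<^sub>m p)\<bar> \<le> 1 / t"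
      by (rule mtrace_resolvent_insert_bound[OF _ _ _ t one]) auto
    thus ?thesis unfolding r ins using p by (simp add: f_def)
  qed
  have "\<bar>real p * f ?x' - real p * f x\<bar> \<le> 2 / t" using b[of x] b[of ?x'] unfolding g by (simp add: abs_le_iff)
  hence "real p * \<bar>f ?x' - f x\<bar> \<le> 2 / t" by (simp add: right_diff_distrib[symmetric] abs_mult)
  thus "\<bar>f ?x' - f x\<bar> \<le> 2 / (t * real p)" using p t by (simp add: field_simps)
qed

lemma f_concentration:
  assumes "\<epsilon> > 0"
  shows "measure Q {x \<in> space Q. \<bar>f x - m\<bar> \<ge> \<epsilon>} \<le> 2 * exp (- (\<epsilon>\<^sup>2 * t\<^sup>2 * (real p)\<^sup>2 / (8 * real n)))"
proof -
  have "measure Q {x \<in> space Q. \<bar>f x - m\<bar> \<ge> \<epsilon>} \<le> 2 * exp (- \<epsilon>\<^sup>2 / (2 * card {..<n} * (2 / (t * real p))\<^sup>2))"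
    unfolding m_def
    by (rule mcdiarmid[OF _ _ f_measurable f_bounds(3) f_bounded_differences]) (use n t p assms in \<open>auto simp: lessThan_empty_iff\<close>)
  also have "- \<epsilon>\<^sup>2 / (2 * card {..<n} * (2 / (t * real p))\<^sup>2) = - (\<epsilon>\<^sup>2 * t\<^sup>2 * (real p)\<^sup>2 / (8 * real n))"
    using t p n by (simp add: field_simps power2_eq_square)
  finally show ?thesis .
qed

lemma m_bounds: "0 \<le> m" "m \<le> 1 / t"
proof -
  show "0 \<le> m" unfolding m_def by (intro Bochner_Integration.integral_nonneg f_bounds)
  have "m \<le> (\<integral>x. 1 / t \<partial>Q)" unfolding m_def by (intro integral_mono f_integrable f_bounds) simp
  thus "m \<le> 1 / t" using Q.prob_space by simp
qed

lemma mean_deviation: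
  assumes \<epsilon>: "\<epsilon> > 0"
  shows "(\<integral>x. \<bar>f x - m\<bar> \<partial>Q) \<le> \<epsilon> + 2 / t * exp (- (\<epsilon>\<^sup>2 * t\<^sup>2 * (real p)\<^sup>2 / (8 * real n)))"
proof -
  let ?E = "{x \<in> space Q. \<bar>f x - m\<bar> \<ge> \<epsilon>}"
  have E: "?E \<in> sets Q" by measurable
  have iE: "integrable Q (\<lambda>x. 1 / t * indicator ?E x)" using E by (intro integrable_mult_right integrable_real_indicator) (auto simp: Q.emeasure_eq_measure)
  have "(\<integral>x. \<bar>f x - m\<bar> \<partial>Q) \<le> (\<integral>x. \<epsilon> + 1 / t * indicator ?E x \<partial>Q)"
  proof (rule integral_mono)
    fix x assume x: "x \<in> space Q"
    have "\<bar>f x - m\<bar> \<le> 1 / t" using f_bounds(1,2)[of x] m_bounds by (simp add: abs_le_iff)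
    thus "\<bar>f x - m\<bar> \<le> \<epsilon> + 1 / t * indicator ?E x" using x \<epsilon> by (auto simp: indicator_def)
  qed (use f_integrable iE in auto)
  also have "\<dots> = \<epsilon> + 1 / t * measure Q ?E"
    using iE Q.prob_space E by (subst Bochner_Integration.integral_add) auto
  also have "1 / t * measure Q ?E \<le> 1 / t * (2 * exp (- (\<epsilon>\<^sup>2 * t\<^sup>2 * (real p)\<^sup>2 / (8 * real n))))"
    using f_concentration[OF \<epsilon>] t by (intro mult_left_mono) auto
  finally show ?thesis by simp
qed

lemma b_bounds: "0 \<le> b" "b \<le> 1"
proof -
  have c: "real (card {..<n}) = real n" by simp
  define g where "g x = 1 - real p / real n + real p / real n * t * f x" for x
  have g: "0 \<le> g x \<and> g x \<le> 1" for x
  proof -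
    let ?r = "scaled_column p n x"
    define q where "q j = ?r j \<bullet> (resolvent t (gram p ?r ({..<n} - {j})) *\<^sub>v ?r j)" for j
    have q0: "0 \<le> q j" for j unfolding q_def by (rule leave_one_out_nonneg) (use t in auto)
    have "(\<Sum>j<n. 1 / (1 + q j)) = real n - real p + t * (real p * f x)"
      unfolding q_def by (subst sum_leave_one_out) (use t p in \<open>auto simp: f_def\<close>)
    moreover have "real n * g x = real n - real p + t * (real p * f x)"
      using n by (simp add: g_def right_diff_distrib distrib_left)
    ultimately have ge: "real n * g x = (\<Sum>j<n. 1 / (1 + q j))" by simp
    have "0 \<le> (\<Sum>j<n. 1 / (1 + q j))" using q0 by (intro sum_nonneg) auto
    moreover have "(\<Sum>j<n. 1 / (1 + q j)) \<le> (\<Sum>j<n. 1)" using q0 by (intro sum_mono) (simp add: divide_le_eq_1 add_pos_nonneg)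
    ultimately show ?thesis unfolding ge[symmetric] using n by (auto simp: zero_le_mult_iff mult_le_cancel_left1)
  qed
  have bg: "b = (\<integral>x. g x \<partial>Q)"
    unfolding b_def g_def m_def using f_integrable Q.prob_space by simp
  have ig: "integrable Q g" unfolding g_def using f_integrable by simp
  show "0 \<le> b" unfolding bg by (intro Bochner_Integration.integral_nonneg) (use g in auto)
  have "b \<le> (\<integral>x. 1 \<partial>Q)" unfolding bg by (intro integral_mono ig) (use g in auto)
  thus "b \<le> 1" using Q.prob_space by simp
qed

text \<open>By Fubini's theorem the column \<open>j\<close> can be integrated out first, while the resolvent of
  the other columns is a fixed matrix. Then \<open>qf\<close> applies with \<open>\<beta> = 1 / t\<^sup>2\<close>.\<close>

lemma leave_one_out_deviation:
  assumes j: "j < n" and D: "op_bound p (1 / t) D"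
  defines "h \<equiv> \<lambda>x. \<bar>scaled_column p n x j \<bullet> ((D * resolvent t (gram p (scaled_column p n x) ({..<n} - {j}))) *\<^sub>v scaled_column p n x j)
     - mtrace (D * resolvent t (gram p (scaled_column p n x) ({..<n} - {j})) * S) / real n\<bar>"
  shows "integrable Q h" "(\<integral>x. h x \<partial>Q) \<le> K / t\<^sup>2 * sqrt (real p) / real n"
proof -
  interpret PS: product_prob_space "\<lambda>_ :: nat. \<nu>" "{..<n}"
    by (simp add: product_prob_space_def product_prob_space_axioms_def product_sigma_finite_def
        prob_space_axioms prob_space_imp_sigma_finite)
  let ?J = "{..<n} - {j}"
  have ins: "insert j ?J = {..<n}" using j by auto
  have Dc: "D \<in> carrier_mat p p" using D by (simp add: op_bound_def)
  have Sc: "S \<in> carrier_mat p p" using S by (simp add: psd_def)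
  have Rm: "mat_measurable Q p (\<lambda>x. D * resolvent t (gram p (scaled_column p n x) ?J))"
    by (intro mat_measurable_mult mat_measurable_const Dc resolvent_measurable) auto
  have hm [measurable]: "h \<in> borel_measurable Q"
    unfolding h_def using j
    by (intro borel_measurable_abs borel_measurable_diff mat_measurable_quadratic[OF Rm] borel_measurable_divide
        borel_measurable_const mat_measurable_mtrace[OF mat_measurable_mult[OF Rm mat_measurable_const[OF Sc]]]
        column_measurable) auto
  interpret J: prob_space "PiM ?J (\<lambda>_. \<nu>)" by (intro prob_space_PiM prob_space_axioms)
  have inner: "(\<integral>\<^sup>+z. ennreal (h (x(j := z))) \<partial>\<nu>) \<le> ennreal (K / t\<^sup>2 * sqrt (real p) / real n)" for x
  proof -
    define R where "R = resolvent t (gram p (scaled_column p n x) ?J)"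
    have P: "psd p (gram p (scaled_column p n x) ?J)" by (intro gram_psd) simp
    have Rc: "R \<in> carrier_mat p p" unfolding R_def by (rule resolvent_inverse(1)[OF P t])
    have DR: "op_bound p (1 / t * (1 / t)) (D * R)" unfolding R_def by (intro op_bound_mult D resolvent_op_bound P t)
    have DRc: "D * R \<in> carrier_mat p p" using Dc Rc by auto
    have heq: "h (x(j := z)) = 1 / real n * \<bar>Matrix.vec p z \<bullet> ((D * R) *\<^sub>v Matrix.vec p z) - mtrace (D * R * S)\<bar>" for z
    proof -
      have g: "gram p (scaled_column p n (x(j := z))) ?J = gram p (scaled_column p n x) ?J"
        by (rule gram_cong) (simp add: scaled_column_def)
      have c: "scaled_column p n (x(j := z)) j = (1 / sqrt (real n)) \<cdot>\<^sub>v Matrix.vec p z"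
        by (rule eq_vecI) (auto simp: scaled_column_def)
      have vz: "(D * R) *\<^sub>v Matrix.vec p z \<in> carrier_vec p" using DRc by auto
      have "((1 / sqrt (real n)) \<cdot>\<^sub>v Matrix.vec p z) \<bullet> ((D * R) *\<^sub>v ((1 / sqrt (real n)) \<cdot>\<^sub>v Matrix.vec p z))
        = 1 / sqrt (real n) * (1 / sqrt (real n)) * (Matrix.vec p z \<bullet> ((D * R) *\<^sub>v Matrix.vec p z))"
        using DRc vz by (subst mult_mat_vec[of _ p p]) auto
      also have "1 / sqrt (real n) * (1 / sqrt (real n)) = 1 / real n" by (simp add: field_simps)
      finally have e: "((1 / sqrt (real n)) \<cdot>\<^sub>v Matrix.vec p z) \<bullet> ((D * R) *\<^sub>v ((1 / sqrt (real n)) \<cdot>\<^sub>v Matrix.vec p z))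
        = 1 / real n * (Matrix.vec p z \<bullet> ((D * R) *\<^sub>v Matrix.vec p z))" .
      show ?thesis unfolding h_def g c R_def[symmetric] e using n
        by (simp add: diff_divide_distrib[symmetric])
    qed
    have "(\<integral>\<^sup>+z. ennreal (h (x(j := z))) \<partial>\<nu>) =
      (\<integral>\<^sup>+z. ennreal (1 / real n) * ennreal \<bar>Matrix.vec p z \<bullet> ((D * R) *\<^sub>v Matrix.vec p z) - mtrace (D * R * S)\<bar> \<partial>\<nu>)"
      unfolding heq by (intro nn_integral_cong ennreal_mult) auto
    also have "\<dots> = ennreal (1 / real n) * (\<integral>\<^sup>+z. ennreal \<bar>Matrix.vec p z \<bullet> ((D * R) *\<^sub>v Matrix.vec p z) - mtrace (D * R * S)\<bar> \<partial>\<nu>)"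
    proof (rule nn_integral_cmult)
      have "(\<lambda>z. z i) \<in> borel_measurable \<nu>" if "i < p" for i
        using that by (subst measurable_cong_sets[OF sets_\<nu> refl]) (intro measurable_component_singleton, auto)
      hence "(\<lambda>z. Matrix.vec p z \<bullet> ((D * R) *\<^sub>v Matrix.vec p z)) \<in> borel_measurable \<nu>"
        by (intro mat_measurable_quadratic[OF mat_measurable_const[OF DRc]]) auto
      thus "(\<lambda>z. ennreal \<bar>Matrix.vec p z \<bullet> ((D * R) *\<^sub>v Matrix.vec p z) - mtrace (D * R * S)\<bar>) \<in> borel_measurable \<nu>"
        by measurable
    qed
    also have "\<dots> \<le> ennreal (1 / real n) * ennreal (K * (1 / t * (1 / t)) * sqrt (real p))"
      using t by (intro mult_left_mono qf DR) auto
    also have "\<dots> = ennreal (K / t\<^sup>2 * sqrt (real p) / real n)"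
      using K t by (simp add: ennreal_mult[symmetric] power2_eq_square)
    finally show ?thesis .
  qed
  have "(\<integral>\<^sup>+x. ennreal (h x) \<partial>Q) = (\<integral>\<^sup>+x. ennreal (h x) \<partial>PiM (insert j ?J) (\<lambda>_. \<nu>))" by (simp only: ins)
  also have "\<dots> = (\<integral>\<^sup>+x. (\<integral>\<^sup>+z. ennreal (h (x(j := z))) \<partial>\<nu>) \<partial>PiM ?J (\<lambda>_. \<nu>))"
    using hm by (intro PS.product_nn_integral_insert) (simp_all only: ins, auto)
  also have "\<dots> \<le> (\<integral>\<^sup>+x. ennreal (K / t\<^sup>2 * sqrt (real p) / real n) \<partial>PiM ?J (\<lambda>_. \<nu>))"
    by (intro nn_integral_mono inner)
  also have "\<dots> = ennreal (K / t\<^sup>2 * sqrt (real p) / real n)" using J.emeasure_space_1 by simp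
  finally have le: "(\<integral>\<^sup>+x. ennreal (h x) \<partial>Q) \<le> ennreal (K / t\<^sup>2 * sqrt (real p) / real n)" .
  have h0: "0 \<le> h x" for x by (simp add: h_def)
  show i: "integrable Q h"
  proof (rule integrableI_bounded)
    have "(\<integral>\<^sup>+x. ennreal (norm (h x)) \<partial>Q) = (\<integral>\<^sup>+x. ennreal (h x) \<partial>Q)" using h0 by simp
    also note le
    also have "ennreal (K / t\<^sup>2 * sqrt (real p) / real n) < \<infinity>" by simp
    finally show "(\<integral>\<^sup>+x. ennreal (norm (h x)) \<partial>Q) < \<infinity>" .
  qed simp
  have "ennreal (\<integral>x. h x \<partial>Q) \<le> ennreal (K / t\<^sup>2 * sqrt (real p) / real n)"
    using le by (subst nn_integral_eq_integral[symmetric]) (use i h0 in auto)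
  thus "(\<integral>x. h x \<partial>Q) \<le> K / t\<^sup>2 * sqrt (real p) / real n"
    using K by (subst (asm) ennreal_le_iff) auto
qed

text \<open>The mean of \<open>resolvent_comparison_bound\<close>. The difference between \<open>b\<close> and its random counterpart
  is a multiple of \<open>f x - m\<close>, so it is controlled by concentration.\<close>

theorem mean_resolvent_trace:
  assumes \<epsilon>: "\<epsilon> > 0"
  shows "\<bar>m - mtrace (resolvent t (b \<cdot>\<^sub>m S)) / real p\<bar> \<le>
    B / t * (real p / real n) * (\<epsilon> + 2 / t * exp (- (\<epsilon>\<^sup>2 * t\<^sup>2 * (real p)\<^sup>2 / (8 * real n))))
    + K / (t\<^sup>2 * sqrt (real p)) + B / (t\<^sup>2 * real p)"
proof -
  define D where "D = resolvent t (b \<cdot>\<^sub>m S)"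
  define mD where "mD = mtrace D / real p"
  have Db: "op_bound p (1 / t) D" unfolding D_def by (intro resolvent_op_bound psd_smult S b_bounds t)
  define h where "h j x = \<bar>scaled_column p n x j \<bullet> ((D * resolvent t (gram p (scaled_column p n x) ({..<n} - {j}))) *\<^sub>v scaled_column p n x j)
     - mtrace (D * resolvent t (gram p (scaled_column p n x) ({..<n} - {j})) * S) / real n\<bar>" for j x
  have h: "integrable Q (h j)" "(\<integral>x. h j x \<partial>Q) \<le> K / t\<^sup>2 * sqrt (real p) / real n" if "j < n" for j
    using leave_one_out_deviation[OF that Db] unfolding h_def by auto
  have np: "real n > 0" "real p > 0" using n p by auto
  define c where "c = real p / real n"
  have c0: "c > 0" using np by (simp add: c_def)
  have pt: "c * \<bar>f x - mD\<bar> \<le> B / t * c\<^sup>2 * \<bar>f x - m\<bar> + (\<Sum>j<n. h j x) / real n + B / (t\<^sup>2 * real n)" for x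
  proof -
    let ?R = "resolvent t (gram p (scaled_column p n x) {..<n})"
    have tr: "mtrace ?R = real p * f x" "mtrace D = real p * mD" using np by (auto simp: f_def mD_def)
    have "\<bar>mtrace ?R - mtrace D\<bar> / real n \<le>
      B * real p / (t\<^sup>2 * real n) * \<bar>b - (1 - real p / real n + t * mtrace ?R / real n)\<bar>
      + (\<Sum>j<n. h j x) / real n + B / (t\<^sup>2 * real n)"
      unfolding h_def
      by (rule resolvent_comparison_bound[OF _ _ t S b_bounds(1) D_def B]) (use n in \<open>auto simp: lessThan_empty_iff\<close>)
    moreover have "\<bar>mtrace ?R - mtrace D\<bar> / real n = c * \<bar>f x - mD\<bar>"
      unfolding tr c_def using np by (simp add: right_diff_distrib[symmetric] abs_mult)
    moreover have "b - (1 - real p / real n + t * mtrace ?R / real n) = c * t * (m - f x)"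
      unfolding tr b_def c_def by (simp add: algebra_simps)
    moreover have "B * real p / (t\<^sup>2 * real n) * \<bar>c * t * (m - f x)\<bar> = B / t * c\<^sup>2 * \<bar>f x - m\<bar>"
      using c0 t by (simp add: abs_mult c_def power2_eq_square abs_minus_commute)
    ultimately show ?thesis by simp
  qed
  have ifm: "integrable Q (\<lambda>x. \<bar>f x - m\<bar>)" "integrable Q (\<lambda>x. \<bar>f x - mD\<bar>)" using f_integrable by auto
  have iH: "integrable Q (\<lambda>x. \<Sum>j<n. h j x)" by (intro Bochner_Integration.integrable_sum h(1)) simp
  have "\<bar>m - mD\<bar> = \<bar>\<integral>x. f x - mD \<partial>Q\<bar>" unfolding m_def using f_integrable Q.prob_space by simp
  also have "\<dots> \<le> (\<integral>x. \<bar>f x - mD\<bar> \<partial>Q)" by (rule integral_abs_bound)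
  finally have "c * \<bar>m - mD\<bar> \<le> (\<integral>x. c * \<bar>f x - mD\<bar> \<partial>Q)" using c0 by simp
  also have "\<dots> \<le> (\<integral>x. B / t * c\<^sup>2 * \<bar>f x - m\<bar> + (\<Sum>j<n. h j x) / real n + B / (t\<^sup>2 * real n) \<partial>Q)"
    using ifm iH by (intro integral_mono pt) simp_all
  also have "\<dots> = B / t * c\<^sup>2 * (\<integral>x. \<bar>f x - m\<bar> \<partial>Q) + (\<Sum>j<n. \<integral>x. h j x \<partial>Q) / real n + B / (t\<^sup>2 * real n)"
    using ifm iH Q.prob_space h(1) by simp
  also have "\<dots> \<le> B / t * c\<^sup>2 * (\<epsilon> + 2 / t * exp (- (\<epsilon>\<^sup>2 * t\<^sup>2 * (real p)\<^sup>2 / (8 * real n))))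
     + (\<Sum>j<n. K / t\<^sup>2 * sqrt (real p) / real n) / real n + B / (t\<^sup>2 * real n)"
    using B t c0 np by (intro add_mono mult_left_mono mean_deviation \<epsilon> divide_right_mono sum_mono h) auto
  also have "\<dots> = c * (B / t * c * (\<epsilon> + 2 / t * exp (- (\<epsilon>\<^sup>2 * t\<^sup>2 * (real p)\<^sup>2 / (8 * real n))))
    + K / (t\<^sup>2 * sqrt (real p)) + B / (t\<^sup>2 * real p))"
  proof -
    have "sqrt (real p) / real n = c / sqrt (real p)" using np by (simp add: c_def field_simps)
    hence "K / t\<^sup>2 * (sqrt (real p) / real n) = K / t\<^sup>2 * (c / sqrt (real p))" by simp
    hence "K / t\<^sup>2 * sqrt (real p) / real n = c * (K / (t\<^sup>2 * sqrt (real p)))" by simp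
    moreover have "B / (t\<^sup>2 * real n) = c * (B / (t\<^sup>2 * real p))" using np by (simp add: c_def)
    moreover have "(\<Sum>j<n. K / t\<^sup>2 * sqrt (real p) / real n) / real n = K / t\<^sup>2 * sqrt (real p) / real n" using np by simp
    ultimately show ?thesis by (simp add: power2_eq_square algebra_simps)
  qed
  finally have "\<bar>m - mD\<bar> \<le> B / t * c * (\<epsilon> + 2 / t * exp (- (\<epsilon>\<^sup>2 * t\<^sup>2 * (real p)\<^sup>2 / (8 * real n))))
    + K / (t\<^sup>2 * sqrt (real p)) + B / (t\<^sup>2 * real p)"
    by (rule mult_left_le_imp_le[OF _ c0])
  thus ?thesis by (simp only: mD_def D_def c_def)
qed

end

section \<open>Quadratic forms in random vectors\<close>

text \<open>The columns of \<open>A\<close> are the images of the unit vectors.\<close>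

lemma op_bound_entries:
  assumes "op_bound p \<beta> A"
  shows "(\<Sum>i<p. \<Sum>j<p. (A $$ (i, j))\<^sup>2) \<le> real p * \<beta>\<^sup>2"
proof -
  have A: "A \<in> carrier_mat p p" using assms by (simp add: op_bound_def)
  have "(\<Sum>i<p. (A $$ (i, j))\<^sup>2) \<le> \<beta>\<^sup>2" if j: "j < p" for j
  proof -
    let ?u = "unit_vec p j :: real vec"
    have "(A *\<^sub>v ?u) $ i = A $$ (i, j)" if "i < p" for i using A j that by simp
    hence "(A *\<^sub>v ?u) \<bullet> (A *\<^sub>v ?u) = (\<Sum>i<p. (A $$ (i, j))\<^sup>2)"
      using A unfolding scalar_prod_def by (intro sum.cong) (auto simp: power2_eq_square simp del: index_mult_mat_vec)
    moreover have "?u \<bullet> ?u = 1" using j by (simp add: scalar_prod_left_unit)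
    ultimately show ?thesis using assms unfolding op_bound_def by (metis unit_vec_carrier mult.right_neutral)
  qed
  hence "(\<Sum>j<p. \<Sum>i<p. (A $$ (i, j))\<^sup>2) \<le> (\<Sum>j<p. \<beta>\<^sup>2)" by (intro sum_mono) auto
  thus ?thesis by (subst sum.swap) simp
qed

text \<open>If \<open>u = A\<^sup>T v\<close> then \<open>\<parallel>u\<parallel>\<^sup>2 = v \<bullet> A u \<le> \<beta> \<parallel>v\<parallel> \<parallel>u\<parallel>\<close>.\<close>

lemma op_bound_transpose:
  assumes "op_bound p \<beta> A" "\<beta> \<ge> 0"
  shows "op_bound p \<beta> (transpose_mat A)"
  unfolding op_bound_def
proof (intro conjI ballI)
  have A: "A \<in> carrier_mat p p" using assms by (simp add: op_bound_def)
  show "transpose_mat A \<in> carrier_mat p p" using A by simp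
  fix v :: "real vec" assume v: "v \<in> carrier_vec p"
  define u where "u = transpose_mat A *\<^sub>v v"
  have u: "u \<in> carrier_vec p" using A v by (auto simp: u_def)
  have uu: "0 \<le> u \<bullet> u" by (rule scalar_prod_self_nonneg)
  have e: "u \<bullet> u = v \<bullet> (A *\<^sub>v u)" using transpose_vec_mult_scalar[OF A u v] by (simp add: u_def)
  have "(u \<bullet> u)\<^sup>2 \<le> (v \<bullet> v) * ((A *\<^sub>v u) \<bullet> (A *\<^sub>v u))"
    unfolding e by (rule scalar_prod_Cauchy_Schwarz) (use A u v in auto)
  also have "\<dots> \<le> (v \<bullet> v) * (\<beta>\<^sup>2 * (u \<bullet> u))"
    using assms u by (intro mult_left_mono scalar_prod_self_nonneg) (auto simp: op_bound_def)
  finally have "(u \<bullet> u) * (u \<bullet> u) \<le> (\<beta>\<^sup>2 * (v \<bullet> v)) * (u \<bullet> u)"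
    by (simp add: power2_eq_square mult_ac)
  thus "u \<bullet> u \<le> \<beta>\<^sup>2 * (v \<bullet> v)"
    using uu scalar_prod_self_nonneg[of v] by (cases "u \<bullet> u = 0") auto
qed

lemma quadratic_form_sum:
  fixes A :: "real mat"
  assumes "A \<in> carrier_mat p p"
  shows "Matrix.vec p f \<bullet> (A *\<^sub>v Matrix.vec p f) = (\<Sum>i<p. \<Sum>j<p. A $$ (i, j) * (f i * f j))"
  using assms by (simp add: scalar_prod_def atLeast0LessThan sum_distrib_left mult_ac)

lemma Cauchy_Schwarz_integral:
  fixes f g :: "'a \<Rightarrow> real"
  assumes [measurable]: "f \<in> borel_measurable M" "g \<in> borel_measurable M"
    and f: "integrable M (\<lambda>x. (f x)\<^sup>2)" and g: "integrable M (\<lambda>x. (g x)\<^sup>2)"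
  shows "integrable M (\<lambda>x. f x * g x)"
    and "(\<integral>x. \<bar>f x * g x\<bar> \<partial>M) \<le> sqrt ((\<integral>x. (f x)\<^sup>2 \<partial>M) * (\<integral>x. (g x)\<^sup>2 \<partial>M))"
proof -
  show fg: "integrable M (\<lambda>x. f x * g x)"
  proof (rule Bochner_Integration.integrable_bound)
    show "integrable M (\<lambda>x. ((f x)\<^sup>2 + (g x)\<^sup>2) / 2)" using f g by simp
    show "AE x in M. norm (f x * g x) \<le> norm (((f x)\<^sup>2 + (g x)\<^sup>2) / 2)"
    proof (rule AE_I2)
      fix x
      have "\<bar>f x * g x\<bar> \<le> ((f x)\<^sup>2 + (g x)\<^sup>2) / 2"
        using sum_squares_bound[of "\<bar>f x\<bar>" "\<bar>g x\<bar>"] by (simp add: abs_mult)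
      thus "norm (f x * g x) \<le> norm (((f x)\<^sup>2 + (g x)\<^sup>2) / 2)" by simp
    qed
  qed measurable
  have "(\<integral>\<^sup>+x. ennreal \<bar>f x\<bar> * ennreal \<bar>g x\<bar> \<partial>M)\<^sup>2 \<le> (\<integral>\<^sup>+x. ennreal \<bar>f x\<bar> ^ 2 \<partial>M) * (\<integral>\<^sup>+x. ennreal \<bar>g x\<bar> ^ 2 \<partial>M)"
    by (rule Cauchy_Schwarz_nn_integral) measurable
  also have "(\<integral>\<^sup>+x. ennreal \<bar>f x\<bar> * ennreal \<bar>g x\<bar> \<partial>M) = ennreal (\<integral>x. \<bar>f x * g x\<bar> \<partial>M)"
    using integrable_abs[OF fg] by (subst nn_integral_eq_integral[symmetric]) (auto simp: ennreal_mult abs_mult)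
  also have "(\<integral>\<^sup>+x. ennreal \<bar>f x\<bar> ^ 2 \<partial>M) = ennreal (\<integral>x. (f x)\<^sup>2 \<partial>M)"
    using f by (subst nn_integral_eq_integral[symmetric]) (auto simp: ennreal_power)
  also have "(\<integral>\<^sup>+x. ennreal \<bar>g x\<bar> ^ 2 \<partial>M) = ennreal (\<integral>x. (g x)\<^sup>2 \<partial>M)"
    using g by (subst nn_integral_eq_integral[symmetric]) (auto simp: ennreal_power)
  finally have "(\<integral>x. \<bar>f x * g x\<bar> \<partial>M)\<^sup>2 \<le> (\<integral>x. (f x)\<^sup>2 \<partial>M) * (\<integral>x. (g x)\<^sup>2 \<partial>M)"
    by (simp add: ennreal_power ennreal_mult[symmetric])
  thus "(\<integral>x. \<bar>f x * g x\<bar> \<partial>M) \<le> sqrt ((\<integral>x. (f x)\<^sup>2 \<partial>M) * (\<integral>x. (g x)\<^sup>2 \<partial>M))"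
    by (rule real_le_rsqrt)
qed

lemma mtrace_mult_symmetric_sum:
  assumes "A \<in> carrier_mat p p" and "\<And>i j. g i j = g j i"
  shows "mtrace (A * Matrix.mat p p (\<lambda>(i, j). g i j)) = (\<Sum>i<p. \<Sum>j<p. A $$ (i, j) * g i j)"
  using assms by (simp add: mtrace_mult[of _ p p])

context weakly_dependent
begin

lemma quadratic_form_coordinates:
  assumes y: "\<And>\<omega>. \<omega> \<in> space M \<Longrightarrow> y \<omega> = Matrix.vec p (\<lambda>i. X i \<omega>)"
    and A: "op_bound p \<beta> A" and \<beta>: "\<beta> \<ge> 0"
  shows "(\<integral>\<^sup>+\<omega>. ennreal \<bar>y \<omega> \<bullet> (A *\<^sub>v y \<omega>) - mtrace (A * second_moment_mat M p y)\<bar> \<partial>M)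
    \<le> ennreal (sqrt CQ * \<beta> * sqrt (real p))"
proof -
  have Ac: "A \<in> carrier_mat p p" using A by (simp add: op_bound_def)
  have S: "second_moment_mat M p y = Matrix.mat p p (\<lambda>(i, j). mom2 i j)"
  proof (rule eq_matI)
    fix i j assume ij: "i < dim_row (Matrix.mat p p (\<lambda>(i, j). mom2 i j))" "j < dim_col (Matrix.mat p p (\<lambda>(i, j). mom2 i j))"
    have "(\<integral>\<omega>. y \<omega> $ i * y \<omega> $ j \<partial>M) = mom2 i j"
      unfolding mom2_def using ij by (intro Bochner_Integration.integral_cong) (auto simp: y)
    thus "second_moment_mat M p y $$ (i, j) = Matrix.mat p p (\<lambda>(i, j). mom2 i j) $$ (i, j)"
      using ij by (simp add: second_moment_mat_def)
  qed (auto simp: second_moment_mat_def)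
  define F where "F \<omega> = \<bar>\<Sum>i<p. \<Sum>j<p. A $$ (i, j) * (X i \<omega> * X j \<omega> - mom2 i j)\<bar>" for \<omega>
  have m2s: "mom2 i j = mom2 j i" for i j by (simp add: mom2_def mult.commute)
  have "(\<integral>\<^sup>+\<omega>. ennreal \<bar>y \<omega> \<bullet> (A *\<^sub>v y \<omega>) - mtrace (A * second_moment_mat M p y)\<bar> \<partial>M) = (\<integral>\<^sup>+\<omega>. ennreal (F \<omega>) \<partial>M)"
    by (intro nn_integral_cong arg_cong[where f = ennreal])
      (simp only: y S F_def quadratic_form_sum[OF Ac] mtrace_mult_symmetric_sum[OF Ac m2s]
        sum_subtractf[symmetric] right_diff_distrib)
  also have "\<dots> = ennreal (expectation F)"
    unfolding F_def
    by (intro nn_integral_eq_integral integrable_abs Bochner_Integration.integrable_sum integrable_mult_right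
        Bochner_Integration.integrable_diff integrable2) auto
  also have "\<dots> \<le> ennreal (sqrt (CQ * (\<Sum>i<p. \<Sum>j<p. (A $$ (i, j))\<^sup>2)))"
    unfolding F_def by (intro ennreal_leI quadratic_form_deviation)
  also have "\<dots> \<le> ennreal (sqrt (CQ * (real p * \<beta>\<^sup>2)))"
    by (intro ennreal_leI real_sqrt_le_mono mult_left_mono op_bound_entries A CQ_nonneg)
  also have "sqrt (CQ * (real p * \<beta>\<^sup>2)) = sqrt CQ * \<beta> * sqrt (real p)"
    using \<beta> by (simp add: real_sqrt_mult)
  finally show ?thesis .
qed

text \<open>Truncate all series after \<open>m\<close> terms. The truncated form is a quadratic form in the variables \<open>X k\<close>
  whose coefficients \<open>C k l\<close> have, by orthonormality, a squared Frobenius norm that is a polynomial in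
  the second moments of the truncated series; as \<open>m\<close> grows it tends to \<open>tr (A \<Sigma> A\<^sup>T \<Sigma>)\<close>, which is at
  most \<open>(\<beta> B)\<^sup>2 p\<close>. The truncation error vanishes in the mean since \<open>p\<close> is fixed.\<close>

lemma quadratic_form_linear_process:
  assumes one: "\<And>k. mom2 k k = 1" and orth: "\<And>k l. k \<noteq> l \<Longrightarrow> mom2 k l = 0"
    and V [measurable]: "\<And>i. V i \<in> borel_measurable M"
    and conv: "\<And>i. (\<lambda>m. \<integral>\<^sup>+\<omega>. ennreal ((V i \<omega> - (\<Sum>k<m. \<alpha> i k * X k \<omega>))\<^sup>2) \<partial>M) \<longlonglongrightarrow> 0"
    and y: "\<And>\<omega>. \<omega> \<in> space M \<Longrightarrow> y \<omega> = Matrix.vec p (\<lambda>i. V i \<omega>)"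
    and A: "op_bound p \<beta> A" and \<beta>: "\<beta> \<ge> 0"
    and B: "op_bound p B (second_moment_mat M p y)" "B \<ge> 0"
  shows "(\<integral>\<^sup>+\<omega>. ennreal \<bar>y \<omega> \<bullet> (A *\<^sub>v y \<omega>) - mtrace (A * second_moment_mat M p y)\<bar> \<partial>M)
    \<le> ennreal (sqrt CQ * (\<beta> * B) * sqrt (real p))"
    and "\<And>i. integrable M (\<lambda>\<omega>. (V i \<omega>)\<^sup>2)"
proof -
  have Ac: "A \<in> carrier_mat p p" using A by (simp add: op_bound_def)
  define S where "S m i \<omega> = (\<Sum>k<m. \<alpha> i k * X k \<omega>)" for m i \<omega>
  define e where "e m i \<omega> = S m i \<omega> - V i \<omega>" for m i \<omega>
  have Sm [measurable]: "S m i \<in> borel_measurable M" for m i unfolding S_def by measurable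
  have em [measurable]: "e m i \<in> borel_measurable M" for m i unfolding e_def by measurable
  have SS: "(\<lambda>\<omega>. S m i \<omega> * S m j \<omega>) = (\<lambda>\<omega>. \<Sum>k<m. \<Sum>l<m. \<alpha> i k * \<alpha> j l * (X k \<omega> * X l \<omega>))" for m i j
    by (simp add: S_def sum_product mult_ac)
  have iSS: "integrable M (\<lambda>\<omega>. S m i \<omega> * S m j \<omega>)" for m i j
    unfolding SS by (intro Bochner_Integration.integrable_sum integrable_mult_right integrable2)
  define G where "G m i j = expectation (\<lambda>\<omega>. S m i \<omega> * S m j \<omega>)" for m i j
  have m2: "mom2 k l = (if l = k then 1 else 0)" for k l using one orth by auto
  have G: "G m i j = (\<Sum>k<m. \<alpha> i k * \<alpha> j k)" for m i j
  proof -
    have "G m i j = (\<Sum>k<m. \<Sum>l<m. \<alpha> i k * \<alpha> j l * mom2 k l)"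
      unfolding G_def SS mom2_def
      by (subst Bochner_Integration.integral_sum, intro Bochner_Integration.integrable_sum integrable_mult_right integrable2,
        subst Bochner_Integration.integral_sum, intro integrable_mult_right integrable2, simp)
    thus ?thesis by (simp add: m2 if_distrib cong: if_cong)
  qed
  have S2: "integrable M (\<lambda>\<omega>. (S m i \<omega>)\<^sup>2)" for m i using iSS[of m i i] by (simp add: power2_eq_square)
  have conv': "(\<lambda>m. \<integral>\<^sup>+\<omega>. ennreal ((e m i \<omega>)\<^sup>2) \<partial>M) \<longlonglongrightarrow> 0" for i
    using conv[of i] by (simp add: e_def S_def power2_commute)
  show V2: "integrable M (\<lambda>\<omega>. (V i \<omega>)\<^sup>2)" for i
  proof -
    have "\<forall>\<^sub>F m in sequentially. (\<integral>\<^sup>+\<omega>. ennreal ((e m i \<omega>)\<^sup>2) \<partial>M) < 1"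
      using conv'[of i] by (rule order_tendstoD) simp
    then obtain m where m: "(\<integral>\<^sup>+\<omega>. ennreal ((e m i \<omega>)\<^sup>2) \<partial>M) < 1" by (auto simp: eventually_sequentially)
    have e2: "integrable M (\<lambda>\<omega>. (e m i \<omega>)\<^sup>2)"
    proof (rule integrableI_nn_integral_finite[where x = "enn2real (\<integral>\<^sup>+\<omega>. ennreal ((e m i \<omega>)\<^sup>2) \<partial>M)"])
      show "(\<integral>\<^sup>+\<omega>. ennreal ((e m i \<omega>)\<^sup>2) \<partial>M) = ennreal (enn2real (\<integral>\<^sup>+\<omega>. ennreal ((e m i \<omega>)\<^sup>2) \<partial>M))"
        using order.strict_trans[OF m ennreal_one_less_top] by simp
    qed auto
    have "integrable M (\<lambda>\<omega>. (S m i \<omega> + (- 1) * e m i \<omega>)\<^sup>2)"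
      by (rule integral_square_add_le(2)) (use S2 e2 in \<open>auto simp: power_mult_distrib\<close>)
    thus ?thesis by (simp add: e_def)
  qed
  have e2: "integrable M (\<lambda>\<omega>. (e m i \<omega>)\<^sup>2)" for m i
  proof -
    have "integrable M (\<lambda>\<omega>. (S m i \<omega> + (- 1) * V i \<omega>)\<^sup>2)"
      by (rule integral_square_add_le(2)) (use S2 V2 in \<open>auto simp: power_mult_distrib\<close>)
    thus ?thesis by (simp add: e_def)
  qed
  define \<epsilon> where "\<epsilon> m i = expectation (\<lambda>\<omega>. (e m i \<omega>)\<^sup>2)" for m i
  have \<epsilon>0: "0 \<le> \<epsilon> m i" for m i unfolding \<epsilon>_def by (intro Bochner_Integration.integral_nonneg) simp
  have \<epsilon>lim: "(\<lambda>m. \<epsilon> m i) \<longlonglongrightarrow> 0" for i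
  proof -
    have "(\<lambda>m. ennreal (\<epsilon> m i)) \<longlonglongrightarrow> 0"
      using conv'[of i] unfolding \<epsilon>_def by (subst (asm) nn_integral_eq_integral) (auto intro: e2)
    thus ?thesis using \<epsilon>0 by (simp add: ennreal_tendsto_0_iff)
  qed
  define D where "D m i j = expectation (\<lambda>\<omega>. \<bar>S m i \<omega> * S m j \<omega> - V i \<omega> * V j \<omega>\<bar>)" for m i j
  have iVV: "integrable M (\<lambda>\<omega>. V i \<omega> * V j \<omega>)" for i j by (intro Cauchy_Schwarz_integral V V2)
  have iD: "integrable M (\<lambda>\<omega>. S m i \<omega> * S m j \<omega> - V i \<omega> * V j \<omega>)" for m i j
    by (intro Bochner_Integration.integrable_diff iSS iVV)
  have D0: "0 \<le> D m i j" for m i j unfolding D_def by (intro Bochner_Integration.integral_nonneg) simp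
  have Dle: "D m i j \<le> sqrt (expectation (\<lambda>\<omega>. (V i \<omega>)\<^sup>2) * \<epsilon> m j) + sqrt (\<epsilon> m i * expectation (\<lambda>\<omega>. (V j \<omega>)\<^sup>2))
      + sqrt (\<epsilon> m i * \<epsilon> m j)" for m i j
  proof -
    note c1 = Cauchy_Schwarz_integral[OF V em V2 e2, of i m j]
    note c2 = Cauchy_Schwarz_integral[OF em V e2 V2, of m i j]
    note c3 = Cauchy_Schwarz_integral[OF em em e2 e2, of m i m j]
    have "D m i j \<le> expectation (\<lambda>\<omega>. \<bar>V i \<omega> * e m j \<omega>\<bar> + \<bar>e m i \<omega> * V j \<omega>\<bar> + \<bar>e m i \<omega> * e m j \<omega>\<bar>)"
      unfolding D_def
    proof (rule integral_mono)
      fix \<omega>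
      have "S m i \<omega> * S m j \<omega> - V i \<omega> * V j \<omega> = V i \<omega> * e m j \<omega> + e m i \<omega> * V j \<omega> + e m i \<omega> * e m j \<omega>"
        by (simp add: e_def algebra_simps)
      thus "\<bar>S m i \<omega> * S m j \<omega> - V i \<omega> * V j \<omega>\<bar> \<le> \<bar>V i \<omega> * e m j \<omega>\<bar> + \<bar>e m i \<omega> * V j \<omega>\<bar> + \<bar>e m i \<omega> * e m j \<omega>\<bar>"
        by linarith
    qed (intro integrable_abs iD Bochner_Integration.integrable_add c1(1) c2(1) c3(1))+
    also have "\<dots> = expectation (\<lambda>\<omega>. \<bar>V i \<omega> * e m j \<omega>\<bar>) + expectation (\<lambda>\<omega>. \<bar>e m i \<omega> * V j \<omega>\<bar>)
        + expectation (\<lambda>\<omega>. \<bar>e m i \<omega> * e m j \<omega>\<bar>)"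
      using c1(1) c2(1) c3(1) by (simp add: integrable_abs)
    also have "\<dots> \<le> sqrt (expectation (\<lambda>\<omega>. (V i \<omega>)\<^sup>2) * \<epsilon> m j) + sqrt (\<epsilon> m i * expectation (\<lambda>\<omega>. (V j \<omega>)\<^sup>2))
      + sqrt (\<epsilon> m i * \<epsilon> m j)"
      using c1(2) c2(2) c3(2) unfolding \<epsilon>_def by (intro add_mono) auto
    finally show ?thesis .
  qed
  have Dlim: "(\<lambda>m. D m i j) \<longlonglongrightarrow> 0" for i j
  proof (rule tendsto_sandwich[OF _ _ tendsto_const])
    show "\<forall>\<^sub>F m in sequentially. 0 \<le> D m i j" using D0 by simp
    show "\<forall>\<^sub>F m in sequentially. D m i j \<le> sqrt (expectation (\<lambda>\<omega>. (V i \<omega>)\<^sup>2) * \<epsilon> m j)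
       + sqrt (\<epsilon> m i * expectation (\<lambda>\<omega>. (V j \<omega>)\<^sup>2)) + sqrt (\<epsilon> m i * \<epsilon> m j)"
      using Dle by (intro always_eventually allI)
    have "(\<lambda>m. sqrt (expectation (\<lambda>\<omega>. (V i \<omega>)\<^sup>2) * \<epsilon> m j)
       + sqrt (\<epsilon> m i * expectation (\<lambda>\<omega>. (V j \<omega>)\<^sup>2)) + sqrt (\<epsilon> m i * \<epsilon> m j))
       \<longlonglongrightarrow> sqrt (expectation (\<lambda>\<omega>. (V i \<omega>)\<^sup>2) * 0) + sqrt (0 * expectation (\<lambda>\<omega>. (V j \<omega>)\<^sup>2)) + sqrt (0 * 0)"
      by (intro tendsto_intros \<epsilon>lim)
    thus "(\<lambda>m. sqrt (expectation (\<lambda>\<omega>. (V i \<omega>)\<^sup>2) * \<epsilon> m j)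
       + sqrt (\<epsilon> m i * expectation (\<lambda>\<omega>. (V j \<omega>)\<^sup>2)) + sqrt (\<epsilon> m i * \<epsilon> m j)) \<longlonglongrightarrow> 0" by simp
  qed
  define g where "g i j = expectation (\<lambda>\<omega>. V i \<omega> * V j \<omega>)" for i j
  have gs: "g i j = g j i" for i j by (simp add: g_def mult.commute)
  have Gg: "\<bar>G m i j - g i j\<bar> \<le> D m i j" for m i j
    unfolding G_def g_def D_def
    by (subst Bochner_Integration.integral_diff[symmetric, OF iSS iVV]) (rule integral_abs_bound)
  have Glim: "(\<lambda>m. G m i j) \<longlonglongrightarrow> g i j" for i j
  proof -
    have "(\<lambda>m. \<bar>G m i j - g i j\<bar>) \<longlonglongrightarrow> 0"
      by (rule tendsto_sandwich[OF _ _ tendsto_const Dlim[of i j]]) (use Gg in auto)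
    thus ?thesis by (simp add: tendsto_rabs_zero_iff LIM_zero_iff)
  qed
  have \<Sigma>: "second_moment_mat M p y = Matrix.mat p p (\<lambda>(i, j). g i j)"
  proof (rule eq_matI)
    fix i j assume ij: "i < dim_row (Matrix.mat p p (\<lambda>(i, j). g i j))" "j < dim_col (Matrix.mat p p (\<lambda>(i, j). g i j))"
    have "(\<integral>\<omega>. y \<omega> $ i * y \<omega> $ j \<partial>M) = g i j"
      unfolding g_def using ij by (intro Bochner_Integration.integral_cong) (auto simp: y)
    thus "second_moment_mat M p y $$ (i, j) = Matrix.mat p p (\<lambda>(i, j). g i j) $$ (i, j)"
      using ij by (simp add: second_moment_mat_def)
  qed (auto simp: second_moment_mat_def)
  let ?\<Sigma> = "second_moment_mat M p y"
  have \<Sigma>c: "?\<Sigma> \<in> carrier_mat p p" by (simp add: \<Sigma>)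
  \<comment> \<open>the coefficients of the truncated form in the variables \<open>X k\<close>\<close>
  define C where "C k l = (\<Sum>i<p. \<Sum>j<p. A $$ (i, j) * (\<alpha> i k * \<alpha> j l))" for k l
  have C2: "(\<Sum>k<m. \<Sum>l<m. (C k l)\<^sup>2) = (\<Sum>i<p. \<Sum>j<p. \<Sum>i'<p. \<Sum>j'<p. A $$ (i, j) * A $$ (i', j') * (G m i i' * G m j j'))" for m
  proof -
    have "(\<Sum>k<m. \<Sum>l<m. (C k l)\<^sup>2) = (\<Sum>k<m. \<Sum>l<m. \<Sum>i<p. \<Sum>j<p. \<Sum>i'<p. \<Sum>j'<p.
        (A $$ (i, j) * (\<alpha> i k * \<alpha> j l)) * (A $$ (i', j') * (\<alpha> i' k * \<alpha> j' l)))"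
      by (simp only: C_def power2_eq_square sum_distrib_right) (simp only: sum_distrib_left)
    also have "\<dots> = (\<Sum>i<p. \<Sum>j<p. \<Sum>i'<p. \<Sum>j'<p. \<Sum>k<m. \<Sum>l<m.
        (A $$ (i, j) * (\<alpha> i k * \<alpha> j l)) * (A $$ (i', j') * (\<alpha> i' k * \<alpha> j' l)))"
      by (simp only: sum.swap[of _ "{..<p}" "{..<m}"])
    also have "\<dots> = (\<Sum>i<p. \<Sum>j<p. \<Sum>i'<p. \<Sum>j'<p. A $$ (i, j) * A $$ (i', j') * (G m i i' * G m j j'))"
    proof (intro sum.cong refl)
      fix i j i' j'
      have "G m i i' * G m j j' = (\<Sum>k<m. \<Sum>l<m. (\<alpha> i k * \<alpha> i' k) * (\<alpha> j l * \<alpha> j' l))"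
        unfolding G by (rule sum_product)
      thus "(\<Sum>k<m. \<Sum>l<m. (A $$ (i, j) * (\<alpha> i k * \<alpha> j l)) * (A $$ (i', j') * (\<alpha> i' k * \<alpha> j' l)))
        = A $$ (i, j) * A $$ (i', j') * (G m i i' * G m j j')"
        by (simp add: sum_distrib_left mult_ac)
    qed
    finally show ?thesis .
  qed
  have C2lim: "(\<lambda>m. \<Sum>k<m. \<Sum>l<m. (C k l)\<^sup>2) \<longlonglongrightarrow> mtrace (A * (?\<Sigma> * (transpose_mat A * ?\<Sigma>)))"
  proof -
    have "(\<lambda>m. \<Sum>k<m. \<Sum>l<m. (C k l)\<^sup>2) \<longlonglongrightarrow>
       (\<Sum>i<p. \<Sum>j<p. \<Sum>i'<p. \<Sum>j'<p. A $$ (i, j) * A $$ (i', j') * (g i i' * g j j'))"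
      unfolding C2 by (intro tendsto_intros Glim)
    also have "(\<Sum>i<p. \<Sum>j<p. \<Sum>i'<p. \<Sum>j'<p. A $$ (i, j) * A $$ (i', j') * (g i i' * g j j'))
        = mtrace (A * (?\<Sigma> * (transpose_mat A * ?\<Sigma>)))"
    proof -
      have "mtrace (A * (?\<Sigma> * (transpose_mat A * ?\<Sigma>))) =
        (\<Sum>i<p. \<Sum>j<p. A $$ (i, j) * (\<Sum>j'<p. g j j' * (\<Sum>i'<p. A $$ (i', j') * g i' i)))"
        using Ac by (subst mtrace_mult[of _ p p]) (auto simp: \<Sigma> scalar_prod_def atLeast0LessThan)
      also have "\<dots> = (\<Sum>i<p. \<Sum>j<p. \<Sum>j'<p. \<Sum>i'<p. A $$ (i, j) * A $$ (i', j') * (g i i' * g j j'))"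
        by (simp add: sum_distrib_left gs mult_ac)
      also have "\<dots> = (\<Sum>i<p. \<Sum>j<p. \<Sum>i'<p. \<Sum>j'<p. A $$ (i, j) * A $$ (i', j') * (g i i' * g j j'))"
        by (intro sum.cong refl sum.swap)
      finally show ?thesis by simp
    qed
    finally show ?thesis .
  qed
  have trb: "mtrace (A * (?\<Sigma> * (transpose_mat A * ?\<Sigma>))) \<le> (\<beta> * B)\<^sup>2 * real p"
  proof -
    have "op_bound p (\<beta> * (B * (\<beta> * B))) (A * (?\<Sigma> * (transpose_mat A * ?\<Sigma>)))"
      by (intro op_bound_mult A B op_bound_transpose \<beta>)
    from op_bound_mtrace[OF this] \<beta> B(2) show ?thesis by (simp add: power2_eq_square mult_ac)
  qed
  define Q where "Q \<omega> = (\<Sum>i<p. \<Sum>j<p. A $$ (i, j) * (V i \<omega> * V j \<omega> - g i j))" for \<omega>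
  have iQ: "integrable M Q" unfolding Q_def
    by (intro Bochner_Integration.integrable_sum integrable_mult_right Bochner_Integration.integrable_diff iVV) simp
  \<comment> \<open>the mean error of the truncation after \<open>m\<close> terms\<close>
  define H where "H m = (\<Sum>i<p. \<Sum>j<p. \<bar>A $$ (i, j)\<bar> * (2 * D m i j))" for m
  have Hlim: "H \<longlonglongrightarrow> 0"
  proof -
    have "H \<longlonglongrightarrow> (\<Sum>i<p. \<Sum>j<p. \<bar>A $$ (i, j)\<bar> * (2 * 0))" unfolding H_def by (intro tendsto_intros Dlim)
    thus ?thesis by simp
  qed
  have bound: "expectation (\<lambda>\<omega>. \<bar>Q \<omega>\<bar>) \<le> H m + sqrt (CQ * (\<Sum>k<m. \<Sum>l<m. (C k l)\<^sup>2))" for m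
  proof -
    define T where "T \<omega> = (\<Sum>k<m. \<Sum>l<m. C k l * (X k \<omega> * X l \<omega> - mom2 k l))" for \<omega>
    have iT: "integrable M T" unfolding T_def
      by (intro Bochner_Integration.integrable_sum integrable_mult_right Bochner_Integration.integrable_diff integrable2) simp
    have T: "T \<omega> = (\<Sum>i<p. \<Sum>j<p. A $$ (i, j) * (S m i \<omega> * S m j \<omega> - G m i j))" for \<omega>
    proof -
      have "T \<omega> = (\<Sum>k<m. \<Sum>l<m. \<Sum>i<p. \<Sum>j<p. A $$ (i, j) * (\<alpha> i k * \<alpha> j l) * (X k \<omega> * X l \<omega> - mom2 k l))"
        by (simp add: T_def C_def sum_distrib_right)
      also have "\<dots> = (\<Sum>i<p. \<Sum>j<p. \<Sum>k<m. \<Sum>l<m. A $$ (i, j) * (\<alpha> i k * \<alpha> j l) * (X k \<omega> * X l \<omega> - mom2 k l))"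
        by (simp only: sum.swap[of _ "{..<p}" "{..<m}"])
      also have "\<dots> = (\<Sum>i<p. \<Sum>j<p. A $$ (i, j) * ((\<Sum>k<m. \<Sum>l<m. \<alpha> i k * \<alpha> j l * (X k \<omega> * X l \<omega>)) - (\<Sum>k<m. \<Sum>l<m. \<alpha> i k * \<alpha> j l * mom2 k l)))"
        by (intro sum.cong refl) (simp add: sum_distrib_left right_diff_distrib sum_subtractf mult_ac)
      also have "\<dots> = (\<Sum>i<p. \<Sum>j<p. A $$ (i, j) * (S m i \<omega> * S m j \<omega> - G m i j))"
      proof -
        have "(\<Sum>k<m. \<Sum>l<m. \<alpha> i k * \<alpha> j l * mom2 k l) = G m i j" for i j
          by (simp add: G m2 if_distrib cong: if_cong)
        moreover have "S m i \<omega> * S m j \<omega> = (\<Sum>k<m. \<Sum>l<m. \<alpha> i k * \<alpha> j l * (X k \<omega> * X l \<omega>))" for i j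
          by (rule fun_cong[OF SS])
        ultimately show ?thesis by simp
      qed
      finally show ?thesis .
    qed
    have pt: "\<bar>Q \<omega>\<bar> \<le> (\<Sum>i<p. \<Sum>j<p. \<bar>A $$ (i, j)\<bar> * (\<bar>S m i \<omega> * S m j \<omega> - V i \<omega> * V j \<omega>\<bar> + D m i j)) + \<bar>T \<omega>\<bar>" for \<omega>
    proof -
      have "\<bar>Q \<omega> - T \<omega>\<bar> = \<bar>\<Sum>i<p. \<Sum>j<p. A $$ (i, j) * ((V i \<omega> * V j \<omega> - S m i \<omega> * S m j \<omega>) + (G m i j - g i j))\<bar>"
        unfolding Q_def T sum_subtractf[symmetric] by (simp add: algebra_simps)
      also have "\<dots> \<le> (\<Sum>i<p. \<Sum>j<p. \<bar>A $$ (i, j)\<bar> * (\<bar>S m i \<omega> * S m j \<omega> - V i \<omega> * V j \<omega>\<bar> + D m i j))"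
      proof (intro order_trans[OF sum_abs] sum_mono order_trans[OF sum_abs])
        fix i j
        have "\<bar>(V i \<omega> * V j \<omega> - S m i \<omega> * S m j \<omega>) + (G m i j - g i j)\<bar> \<le> \<bar>S m i \<omega> * S m j \<omega> - V i \<omega> * V j \<omega>\<bar> + D m i j"
          using Gg[of m i j] by linarith
        thus "\<bar>A $$ (i, j) * ((V i \<omega> * V j \<omega> - S m i \<omega> * S m j \<omega>) + (G m i j - g i j))\<bar>
          \<le> \<bar>A $$ (i, j)\<bar> * (\<bar>S m i \<omega> * S m j \<omega> - V i \<omega> * V j \<omega>\<bar> + D m i j)"
          unfolding abs_mult by (intro mult_left_mono) auto
      qed
      finally show ?thesis by linarith
    qed
    have iS: "integrable M (\<lambda>\<omega>. \<Sum>i<p. \<Sum>j<p. \<bar>A $$ (i, j)\<bar> * (\<bar>S m i \<omega> * S m j \<omega> - V i \<omega> * V j \<omega>\<bar> + D m i j))"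
      by (intro Bochner_Integration.integrable_sum integrable_mult_right Bochner_Integration.integrable_add integrable_abs iD) simp
    have "expectation (\<lambda>\<omega>. \<bar>Q \<omega>\<bar>) \<le> expectation (\<lambda>\<omega>. (\<Sum>i<p. \<Sum>j<p. \<bar>A $$ (i, j)\<bar> * (\<bar>S m i \<omega> * S m j \<omega> - V i \<omega> * V j \<omega>\<bar> + D m i j)) + \<bar>T \<omega>\<bar>)"
      using iQ iT iS pt by (intro integral_mono) auto
    also have "\<dots> = expectation (\<lambda>\<omega>. \<Sum>i<p. \<Sum>j<p. \<bar>A $$ (i, j)\<bar> * (\<bar>S m i \<omega> * S m j \<omega> - V i \<omega> * V j \<omega>\<bar> + D m i j)) + expectation (\<lambda>\<omega>. \<bar>T \<omega>\<bar>)"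
      using iS iT by simp
    also have "expectation (\<lambda>\<omega>. \<Sum>i<p. \<Sum>j<p. \<bar>A $$ (i, j)\<bar> * (\<bar>S m i \<omega> * S m j \<omega> - V i \<omega> * V j \<omega>\<bar> + D m i j)) = H m"
    proof -
      have ia: "integrable M (\<lambda>\<omega>. \<bar>S m i \<omega> * S m j \<omega> - V i \<omega> * V j \<omega>\<bar> + D m i j)" for i j
        by (intro Bochner_Integration.integrable_add integrable_abs iD) simp
      have ea: "expectation (\<lambda>\<omega>. \<bar>S m i \<omega> * S m j \<omega> - V i \<omega> * V j \<omega>\<bar> + D m i j) = 2 * D m i j" for i j
        using iD[of m i j] by (subst Bochner_Integration.integral_add) (auto simp: prob_space D_def[symmetric] intro!: integrable_abs)
      show ?thesis unfolding H_def
        by (subst Bochner_Integration.integral_sum, intro Bochner_Integration.integrable_sum integrable_mult_right ia,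
          subst Bochner_Integration.integral_sum, intro integrable_mult_right ia, simp only: Bochner_Integration.integral_mult_right_zero ea)
    qed
    also have "expectation (\<lambda>\<omega>. \<bar>T \<omega>\<bar>) \<le> sqrt (CQ * (\<Sum>k<m. \<Sum>l<m. (C k l)\<^sup>2))"
      unfolding T_def by (rule quadratic_form_deviation)
    finally show ?thesis by simp
  qed
  have "expectation (\<lambda>\<omega>. \<bar>Q \<omega>\<bar>) \<le> 0 + sqrt (CQ * mtrace (A * (?\<Sigma> * (transpose_mat A * ?\<Sigma>))))"
  proof (rule LIMSEQ_le_const)
    show "(\<lambda>m. H m + sqrt (CQ * (\<Sum>k<m. \<Sum>l<m. (C k l)\<^sup>2))) \<longlonglongrightarrow> 0 + sqrt (CQ * mtrace (A * (?\<Sigma> * (transpose_mat A * ?\<Sigma>))))"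
      by (intro tendsto_intros Hlim C2lim)
  qed (use bound in auto)
  also have "\<dots> \<le> sqrt (CQ * ((\<beta> * B)\<^sup>2 * real p))"
    using trb CQ_nonneg by (auto intro: mult_left_mono)
  also have "\<dots> = sqrt CQ * (\<beta> * B) * sqrt (real p)" using \<beta> B(2) by (simp add: real_sqrt_mult)
  finally have main: "expectation (\<lambda>\<omega>. \<bar>Q \<omega>\<bar>) \<le> sqrt CQ * (\<beta> * B) * sqrt (real p)" .
  have "(\<integral>\<^sup>+\<omega>. ennreal \<bar>y \<omega> \<bullet> (A *\<^sub>v y \<omega>) - mtrace (A * ?\<Sigma>)\<bar> \<partial>M) = (\<integral>\<^sup>+\<omega>. ennreal \<bar>Q \<omega>\<bar> \<partial>M)"
    by (intro nn_integral_cong arg_cong[where f = ennreal])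
      (simp only: y \<Sigma> Q_def quadratic_form_sum[OF Ac] mtrace_mult_symmetric_sum[OF Ac gs]
        sum_subtractf[symmetric] right_diff_distrib)
  also have "\<dots> = ennreal (expectation (\<lambda>\<omega>. \<bar>Q \<omega>\<bar>))"
    using iQ by (intro nn_integral_eq_integral integrable_abs) auto
  finally show "(\<integral>\<^sup>+\<omega>. ennreal \<bar>y \<omega> \<bullet> (A *\<^sub>v y \<omega>) - mtrace (A * ?\<Sigma>)\<bar> \<partial>M)
    \<le> ennreal (sqrt CQ * (\<beta> * B) * sqrt (real p))" using main by (simp add: ennreal_leI)
qed

end

section \<open>Second moment matrices\<close>

text \<open>The supremum in the definition is finite because the Frobenius norm bounds it, and scaling passes
  from the unit ball to all vectors.\<close>

lemma spectral_norm_op_bound: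
  fixes A :: "real mat"
  assumes A: "A \<in> carrier_mat p p"
  shows "op_bound p (spectral_norm A) A" "0 \<le> spectral_norm A"
proof -
  define F where "F = (\<Sum>i<p. \<Sum>j<p. (A $$ (i, j))\<^sup>2)"
  let ?V = "{v \<in> carrier_vec (dim_col A). euclid_norm v \<le> 1}"
  have frob: "(A *\<^sub>v v) \<bullet> (A *\<^sub>v v) \<le> F * (v \<bullet> v)" if v: "v \<in> carrier_vec p" for v
  proof -
    have vv: "v \<bullet> v = (\<Sum>j<p. (v $ j)\<^sup>2)"
      using v by (simp add: scalar_prod_def atLeast0LessThan power2_eq_square)
    have "(A *\<^sub>v v) \<bullet> (A *\<^sub>v v) = (\<Sum>i<p. (\<Sum>j<p. A $$ (i, j) * v $ j)\<^sup>2)"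
      using A v by (simp add: scalar_prod_def atLeast0LessThan power2_eq_square)
    also have "\<dots> \<le> (\<Sum>i<p. (\<Sum>j<p. (A $$ (i, j))\<^sup>2) * (\<Sum>j<p. (v $ j)\<^sup>2))"
      by (intro sum_mono Cauchy_Schwarz_ineq_sum)
    also have "\<dots> = F * (v \<bullet> v)" by (simp add: F_def vv sum_distrib_right)
    finally show ?thesis .
  qed
  have F0: "0 \<le> F" unfolding F_def by (intro sum_nonneg) auto
  have bdd: "bdd_above ((\<lambda>v. euclid_norm (A *\<^sub>v v)) ` ?V)"
  proof (rule bdd_aboveI2[of _ _ "sqrt F"])
    fix v assume v: "v \<in> ?V"
    hence vc: "v \<in> carrier_vec p" and v1: "v \<bullet> v \<le> 1"
      using A by (auto simp: euclid_norm_def)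
    have "F * (v \<bullet> v) \<le> F * 1" using v1 F0 by (intro mult_left_mono)
    thus "euclid_norm (A *\<^sub>v v) \<le> sqrt F"
      unfolding euclid_norm_def using frob[OF vc] by (intro real_sqrt_le_mono) simp
  qed
  have up: "euclid_norm (A *\<^sub>v v) \<le> spectral_norm A" if "v \<in> carrier_vec p" "euclid_norm v \<le> 1" for v
    unfolding spectral_norm_def using that A by (intro cSUP_upper bdd) auto
  have "0 \<le> euclid_norm (A *\<^sub>v 0\<^sub>v p)" by (simp add: euclid_norm_def scalar_prod_self_nonneg)
  also have "\<dots> \<le> spectral_norm A" by (rule up) (auto simp: euclid_norm_def)
  finally show s0: "0 \<le> spectral_norm A" .
  show "op_bound p (spectral_norm A) A"
    unfolding op_bound_def
  proof (intro conjI ballI A)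
    fix v :: "real Matrix.vec" assume v: "v \<in> carrier_vec p"
    define s where "s = sqrt (v \<bullet> v)"
    have s2: "s\<^sup>2 = v \<bullet> v" using scalar_prod_self_nonneg[of v] by (simp add: s_def)
    have Av: "A *\<^sub>v v \<in> carrier_vec p" using A v by auto
    show "(A *\<^sub>v v) \<bullet> (A *\<^sub>v v) \<le> (spectral_norm A)\<^sup>2 * (v \<bullet> v)"
    proof (cases "v \<bullet> v = 0")
      case True
      thus ?thesis using frob[OF v] by simp
    next
      case False
      hence s: "s > 0" using scalar_prod_self_nonneg[of v] by (simp add: s_def)
      have "euclid_norm (A *\<^sub>v ((1 / s) \<cdot>\<^sub>v v)) \<le> spectral_norm A"
      proof (rule up)
        have "((1 / s) \<cdot>\<^sub>v v) \<bullet> ((1 / s) \<cdot>\<^sub>v v) = (v \<bullet> v) / s\<^sup>2"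
          using v by (simp add: power2_eq_square)
        thus "euclid_norm ((1 / s) \<cdot>\<^sub>v v) \<le> 1" using False by (simp add: euclid_norm_def s2)
      qed (use v in auto)
      moreover have "(A *\<^sub>v ((1 / s) \<cdot>\<^sub>v v)) \<bullet> (A *\<^sub>v ((1 / s) \<cdot>\<^sub>v v)) = ((A *\<^sub>v v) \<bullet> (A *\<^sub>v v)) / s\<^sup>2"
        using A v Av by (subst mult_mat_vec[of _ p p], auto, subst mult_mat_vec[of _ p p], auto simp: power2_eq_square)
      ultimately have "sqrt (((A *\<^sub>v v) \<bullet> (A *\<^sub>v v)) / s\<^sup>2) \<le> spectral_norm A" by (simp add: euclid_norm_def)
      hence "((A *\<^sub>v v) \<bullet> (A *\<^sub>v v)) / s\<^sup>2 \<le> (spectral_norm A)\<^sup>2" by (rule sqrt_le_D)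
      thus ?thesis using s by (simp add: s2[symmetric] field_simps)
    qed
  qed
qed

text \<open>The quadratic form at \<open>v\<close> is the second moment of \<open>\<Sum>i<p. v\<^sub>i W\<^sub>i\<close>.\<close>

lemma second_moment_psd:
  assumes y: "\<And>\<omega>. \<omega> \<in> space M \<Longrightarrow> y \<omega> = Matrix.vec p (\<lambda>i. W i \<omega>)"
    and W: "\<And>i j. integrable M (\<lambda>\<omega>. W i \<omega> * W j \<omega>)"
  shows "psd p (second_moment_mat M p y)"
proof -
  let ?\<Sigma> = "second_moment_mat M p y"
  have c: "?\<Sigma> \<in> carrier_mat p p" by (simp add: second_moment_mat_def)
  have e: "?\<Sigma> $$ (i, j) = (\<integral>\<omega>. W i \<omega> * W j \<omega> \<partial>M)" if "i < p" "j < p" for i j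
  proof -
    have "(\<integral>\<omega>. y \<omega> $ i * y \<omega> $ j \<partial>M) = (\<integral>\<omega>. W i \<omega> * W j \<omega> \<partial>M)"
      using that by (intro Bochner_Integration.integral_cong) (auto simp: y)
    thus ?thesis using that by (simp add: second_moment_mat_def)
  qed
  have "transpose_mat ?\<Sigma> = ?\<Sigma>"
    by (rule eq_matI) (use c in \<open>auto simp: second_moment_mat_def mult.commute\<close>)
  moreover have "0 \<le> v \<bullet> (?\<Sigma> *\<^sub>v v)" if v: "v \<in> carrier_vec p" for v
  proof -
    have "v \<bullet> (?\<Sigma> *\<^sub>v v) = (\<Sum>i<p. \<Sum>j<p. v $ i * v $ j * (\<integral>\<omega>. W i \<omega> * W j \<omega> \<partial>M))"
      using v c e by (simp add: scalar_prod_def atLeast0LessThan sum_distrib_left mult_ac)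
    also have "\<dots> = (\<integral>\<omega>. (\<Sum>i<p. \<Sum>j<p. v $ i * v $ j * (W i \<omega> * W j \<omega>)) \<partial>M)"
      by (subst Bochner_Integration.integral_sum, intro Bochner_Integration.integrable_sum integrable_mult_right W,
        subst Bochner_Integration.integral_sum, intro integrable_mult_right W, simp)
    also have "\<dots> = (\<integral>\<omega>. (\<Sum>i<p. v $ i * W i \<omega>)\<^sup>2 \<partial>M)"
      by (simp add: power2_eq_square sum_product mult_ac)
    also have "\<dots> \<ge> 0" by (intro Bochner_Integration.integral_nonneg) simp
    finally show ?thesis .
  qed
  ultimately show ?thesis using c by (auto simp: psd_def)
qed

section \<open>The limiting equation on the negative half-line\<close>

locale bounded_support = real_distribution \<mu> for \<mu> :: "real measure" +
  fixes B :: real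
  assumes supp: "AE x in \<mu>. 0 \<le> x" "AE x in \<mu>. x \<le> B" and B: "B \<ge> 0"
begin

lemma integrable_resolvent:
  assumes "b \<ge> 0" "t > 0" shows "integrable \<mu> (\<lambda>x. 1 / (b * x + t))"
proof (rule integrable_const_bound[of _ "1 / t"])
  show "AE x in \<mu>. norm (1 / (b * x + t)) \<le> 1 / t"
    using supp(1)
  proof eventually_elim
    case (elim x)
    hence "t \<le> b * x + t" using assms by simp
    thus ?case using assms by (simp add: frac_le)
  qed
qed auto

lemma resolvent_integral_lipschitz:
  assumes "b \<ge> 0" "b' \<ge> 0" "t > 0"
  shows "\<bar>(\<integral>x. 1 / (b * x + t) \<partial>\<mu>) - (\<integral>x. 1 / (b' * x + t) \<partial>\<mu>)\<bar> \<le> \<bar>b - b'\<bar> * B / t\<^sup>2"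
proof -
  have "\<bar>(\<integral>x. 1 / (b * x + t) \<partial>\<mu>) - (\<integral>x. 1 / (b' * x + t) \<partial>\<mu>)\<bar> = \<bar>\<integral>x. 1 / (b * x + t) - 1 / (b' * x + t) \<partial>\<mu>\<bar>"
    using integrable_resolvent assms by simp
  also have "\<dots> \<le> (\<integral>x. \<bar>1 / (b * x + t) - 1 / (b' * x + t)\<bar> \<partial>\<mu>)" by (rule integral_abs_bound)
  also have "\<dots> \<le> (\<integral>x. \<bar>b - b'\<bar> * B / t\<^sup>2 \<partial>\<mu>)"
  proof (rule integral_mono_AE)
    show "AE x in \<mu>. \<bar>1 / (b * x + t) - 1 / (b' * x + t)\<bar> \<le> \<bar>b - b'\<bar> * B / t\<^sup>2"
      using supp
    proof eventually_elim
      case (elim x)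
      have p: "b * x + t \<ge> t" "b' * x + t \<ge> t" using elim assms by auto
      have "1 / (b * x + t) - 1 / (b' * x + t) = (b' - b) * x / ((b * x + t) * (b' * x + t))"
        using p assms by (simp add: field_simps)
      hence "\<bar>1 / (b * x + t) - 1 / (b' * x + t)\<bar> = \<bar>b - b'\<bar> * x / ((b * x + t) * (b' * x + t))"
        using p assms elim by (simp add: abs_mult abs_minus_commute)
      also have "\<dots> \<le> \<bar>b - b'\<bar> * B / (t * t)"
        using p assms elim B by (intro frac_le mult_mono mult_left_mono) auto
      finally show ?case by (simp add: power2_eq_square)
    qed
  qed (use integrable_resolvent assms in auto)
  finally show ?thesis using prob_space by simp
qed

lemma resolvent_integral_antimono:
  assumes "0 \<le> b" "b \<le> b'" "t > 0"
  shows "(\<integral>x. 1 / (b' * x + t) \<partial>\<mu>) \<le> (\<integral>x. 1 / (b * x + t) \<partial>\<mu>)"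
proof (rule integral_mono_AE)
  show "AE x in \<mu>. 1 / (b' * x + t) \<le> 1 / (b * x + t)"
    using supp(1) by eventually_elim (use assms in \<open>auto intro!: divide_left_mono mult_right_mono mult_pos_pos add_nonneg_pos\<close>)
qed (use integrable_resolvent assms in auto)

lemma resolvent_integral_bounds:
  assumes "0 \<le> b" "t > 0"
  shows "0 \<le> (\<integral>x. 1 / (b * x + t) \<partial>\<mu>)" "(\<integral>x. 1 / (b * x + t) \<partial>\<mu>) \<le> 1 / t"
    and "b \<le> 1 \<Longrightarrow> 1 / (B + t) \<le> (\<integral>x. 1 / (b * x + t) \<partial>\<mu>)"
proof -
  show "0 \<le> (\<integral>x. 1 / (b * x + t) \<partial>\<mu>)"
  proof (rule integral_nonneg_AE)
    show "AE x in \<mu>. 0 \<le> 1 / (b * x + t)" using supp(1) by eventually_elim (use assms in auto)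
  qed
  have "(\<integral>x. 1 / (b * x + t) \<partial>\<mu>) \<le> (\<integral>x. 1 / (0 * x + t) \<partial>\<mu>)"
    using assms by (intro resolvent_integral_antimono) auto
  thus "(\<integral>x. 1 / (b * x + t) \<partial>\<mu>) \<le> 1 / t" using prob_space by simp
  assume b: "b \<le> 1"
  have "(\<integral>x. 1 / (B + t) \<partial>\<mu>) \<le> (\<integral>x. 1 / (b * x + t) \<partial>\<mu>)"
  proof (rule integral_mono_AE)
    show "AE x in \<mu>. 1 / (B + t) \<le> 1 / (b * x + t)"
      using supp
    proof eventually_elim
      case (elim x)
      have "b * x \<le> 1 * B" using elim b assms B by (intro mult_mono) auto
      moreover have "0 \<le> b * x" using elim assms by simp
      ultimately show ?case using assms by (intro divide_left_mono mult_pos_pos) auto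
    qed
  qed (use integrable_resolvent assms in auto)
  thus "1 / (B + t) \<le> (\<integral>x. 1 / (b * x + t) \<partial>\<mu>)" using prob_space by simp
qed

lemma resolvent_integral_almost_antimono:
  assumes "0 \<le> b" "0 \<le> b'" "b' - \<kappa> \<le> b" "0 \<le> \<kappa>" "t > 0"
  shows "(\<integral>x. 1 / (b * x + t) \<partial>\<mu>) \<le> (\<integral>x. 1 / (b' * x + t) \<partial>\<mu>) + \<kappa> * B / t\<^sup>2"
proof (cases "b' \<le> b")
  case True
  have "0 \<le> \<kappa> * B / t\<^sup>2" using assms B by simp
  thus ?thesis using resolvent_integral_antimono[of b' b t] True assms by linarith
next
  case False
  have "\<bar>b - b'\<bar> * B / t\<^sup>2 \<le> \<kappa> * B / t\<^sup>2"
    using False assms B by (intro divide_right_mono mult_right_mono) auto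
  thus ?thesis using resolvent_integral_lipschitz[of b b' t] assms by linarith
qed

text \<open>The intermediate value theorem for \<open>m\<close> minus the integral on the interval from 0 to \<open>1 / t\<close>. For \<open>c > 1\<close> the
  coefficient \<open>1 - c + c t m\<close> may be negative there and is replaced by its positive part. At the
  solution this changes nothing: a vanishing coefficient would give \<open>m = 1 / t\<close>, for which
  the coefficient is \<open>1\<close>.\<close>

lemma fixed_point_exists:
  assumes c: "c > 0" and t: "t > 0"
  shows "\<exists>m. 0 \<le> m \<and> m \<le> 1 / t \<and> 0 \<le> 1 - c + c * t * m \<and> 1 - c + c * t * m \<le> 1 \<and>
    m = (\<integral>x. 1 / ((1 - c + c * t * m) * x + t) \<partial>\<mu>) \<and> 1 / (B + t) \<le> m"
proof -
  define I where "I b = (\<integral>x. 1 / (b * x + t) \<partial>\<mu>)" for b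
  define \<beta> where "\<beta> m = max 0 (1 - c + c * t * m)" for m
  have "(B / t\<^sup>2)-lipschitz_on {0..} I"
    by (rule lipschitz_onI) (use resolvent_integral_lipschitz t B in \<open>auto simp: I_def dist_real_def mult.commute\<close>)
  hence Ic: "continuous_on {0..} I" by (rule lipschitz_on_continuous_on)
  have "continuous_on {0..1 / t} (\<lambda>m. I (\<beta> m))"
    by (rule continuous_on_compose2[OF Ic]) (auto simp: \<beta>_def intro!: continuous_intros)
  hence cont: "continuous_on {0..1 / t} (\<lambda>m. m - I (\<beta> m))" by (intro continuous_intros)
  have \<beta>0: "0 \<le> \<beta> m" for m by (simp add: \<beta>_def)
  have "\<exists>m\<ge>0. m \<le> 1 / t \<and> m - I (\<beta> m) = 0"
    by (rule IVT'[OF _ _ _ cont]) (use resolvent_integral_bounds \<beta>0 t in \<open>auto simp: I_def\<close>)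
  then obtain m where m: "0 \<le> m" "m \<le> 1 / t" "m = I (\<beta> m)" by auto
  have tm: "t * m \<le> 1" using m(2) t by (simp add: field_simps)
  have nonneg: "0 \<le> 1 - c + c * t * m"
  proof (rule ccontr)
    assume neg: "\<not> 0 \<le> 1 - c + c * t * m"
    hence "\<beta> m = 0" by (simp add: \<beta>_def)
    hence "m = 1 / t" using m(3) prob_space by (simp add: I_def)
    thus False using neg t by simp
  qed
  have "c * (t * m) \<le> c * 1" using tm c by (intro mult_left_mono) auto
  hence le1: "1 - c + c * t * m \<le> 1" by (simp add: mult.assoc)
  have \<beta>m: "\<beta> m = 1 - c + c * t * m" using nonneg by (simp add: \<beta>_def)
  have me: "m = (\<integral>x. 1 / ((1 - c + c * t * m) * x + t) \<partial>\<mu>)" using m(3) unfolding \<beta>m I_def .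
  moreover have "1 / (B + t) \<le> m"
    by (subst me, rule resolvent_integral_bounds(3)[OF nonneg t le1])
  ultimately show ?thesis using m(1,2) nonneg le1 by blast
qed

end

text \<open>The coefficient increases with \<open>m\<close> and the integral decreases with the coefficient. If an
  approximate solution lies above the exact one, then its integral lies below (up to the change from
  \<open>c\<close> to \<open>cn n\<close>), so the distance is at most the sum of the errors in the two equations; and likewise
  if it lies below.\<close>

lemma fixed_point_stability:
  fixes m cn bn :: "nat \<Rightarrow> real"
  assumes \<mu>: "\<And>n. bounded_support (\<mu> n) B" and B: "B \<ge> 0" and t: "t > 0"
    and cn: "cn \<longlonglongrightarrow> c" "\<And>n. cn n > 0"
    and bn: "\<And>n. bn n = 1 - cn n + cn n * t * m n" "\<And>n. 0 \<le> bn n"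
    and approx: "(\<lambda>n. m n - (\<integral>x. 1 / (bn n * x + t) \<partial>\<mu> n)) \<longlonglongrightarrow> 0"
    and ms: "0 \<le> ms" "ms \<le> 1 / t" "b = 1 - c + c * t * ms" "0 \<le> b"
    and lim: "(\<lambda>n. \<integral>x. 1 / (b * x + t) \<partial>\<mu> n) \<longlonglongrightarrow> ms"
  shows "m \<longlonglongrightarrow> ms"
proof -
  let ?\<delta> = "\<lambda>n. \<bar>m n - (\<integral>x. 1 / (bn n * x + t) \<partial>\<mu> n)\<bar>"
  let ?\<delta>' = "\<lambda>n. \<bar>(\<integral>x. 1 / (b * x + t) \<partial>\<mu> n) - ms\<bar>"
  have bd: "\<bar>m n - ms\<bar> \<le> ?\<delta> n + ?\<delta>' n + \<bar>cn n - c\<bar> * B / t\<^sup>2" for n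
  proof -
    interpret bounded_support "\<mu> n" B by (rule \<mu>)
    define bs where "bs = 1 - cn n + cn n * t * ms"
    have tm: "0 \<le> t * ms" "t * ms \<le> 1" using ms t by (auto simp: field_simps)
    have "bs - b = (cn n - c) * (t * ms - 1)" by (simp add: bs_def ms(3) algebra_simps)
    hence "\<bar>bs - b\<bar> = \<bar>cn n - c\<bar> * (1 - t * ms)" using tm by (simp add: abs_mult)
    also have "\<dots> \<le> \<bar>cn n - c\<bar> * 1" using tm by (intro mult_left_mono) auto
    finally have bsb: "\<bar>bs - b\<bar> \<le> \<bar>cn n - c\<bar>" by simp
    have diff: "bn n - bs = cn n * t * (m n - ms)" by (simp add: bs_def bn(1) algebra_simps)
    have ct: "0 < cn n * t" using cn(2)[of n] t by simp
    show ?thesis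
    proof (cases "ms \<le> m n")
      case True
      hence "bs \<le> bn n" using diff ct by (smt (verit) mult_nonneg_nonneg)
      hence "(\<integral>x. 1 / (bn n * x + t) \<partial>\<mu> n) \<le> (\<integral>x. 1 / (b * x + t) \<partial>\<mu> n) + \<bar>cn n - c\<bar> * B / t\<^sup>2"
        using bsb bn(2) ms(4) t by (intro resolvent_integral_almost_antimono) auto
      thus ?thesis using True by linarith
    next
      case False
      hence "bn n \<le> bs" using diff ct by (smt (verit) mult_pos_neg)
      hence "(\<integral>x. 1 / (b * x + t) \<partial>\<mu> n) \<le> (\<integral>x. 1 / (bn n * x + t) \<partial>\<mu> n) + \<bar>cn n - c\<bar> * B / t\<^sup>2"
        using bsb bn(2) ms(4) t by (intro resolvent_integral_almost_antimono) auto
      thus ?thesis using False by linarith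
    qed
  qed
  have "(\<lambda>n. ?\<delta> n + ?\<delta>' n + \<bar>cn n - c\<bar> * B / t\<^sup>2) \<longlonglongrightarrow> 0 + 0 + 0 * B / t\<^sup>2"
    using approx lim cn(1) t
    by (intro tendsto_intros) (auto intro: tendsto_rabs_zero simp: LIM_zero)
  hence "(\<lambda>n. m n - ms) \<longlonglongrightarrow> 0"
    by (intro Lim_null_comparison[OF _ \<open>_ \<longlonglongrightarrow> 0 + 0 + 0 * B / t\<^sup>2\<close>[simplified]]) (use bd in auto)
  thus ?thesis by (rule LIM_zero_cancel)
qed

text \<open>For error bounds with a free parameter \<open>\<epsilon>\<close>: first the index tends to infinity, then \<open>\<epsilon>\<close> to 0.\<close>

lemma tendsto_zero_of_small_bounds:
  fixes a :: "nat \<Rightarrow> real"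
  assumes "C \<ge> 0" and "\<And>\<epsilon>. \<epsilon> > 0 \<Longrightarrow> \<exists>g. g \<longlonglongrightarrow> C * \<epsilon> \<and> (\<forall>n. \<bar>a n\<bar> \<le> g n)"
  shows "a \<longlonglongrightarrow> 0"
proof (rule LIMSEQ_I)
  fix r :: real assume r: "r > 0"
  define \<epsilon> where "\<epsilon> = r / (2 * (C + 1))"
  have \<epsilon>: "\<epsilon> > 0" using r assms(1) by (simp add: \<epsilon>_def)
  have "C * \<epsilon> < r" using r assms(1) mult_nonneg_nonneg[of C r]
    by (simp add: \<epsilon>_def field_simps add_nonneg_pos)
  obtain g where g: "g \<longlonglongrightarrow> C * \<epsilon>" "\<And>n. \<bar>a n\<bar> \<le> g n" using assms(2)[OF \<epsilon>] by blast
  have "\<forall>\<^sub>F n in sequentially. g n < r" using g(1) \<open>C * \<epsilon> < r\<close> by (rule order_tendstoD)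
  then obtain N where "\<And>n. n \<ge> N \<Longrightarrow> g n < r" by (auto simp: eventually_sequentially)
  hence "\<forall>n\<ge>N. norm (a n - 0) < r" using g(2) by (auto intro: le_less_trans)
  thus "\<exists>N. \<forall>n\<ge>N. norm (a n - 0) < r" ..
qed

section \<open>Almost sure convergence of spectral distributions\<close>

definition sample_cov :: "nat \<Rightarrow> real mat \<Rightarrow> real mat" where
  "sample_cov n A = (1 / real n) \<cdot>\<^sub>m (A * transpose_mat A)"

text \<open>The matrix as a point of the product space that carries the joint law of its columns.\<close>

definition column_array :: "nat \<Rightarrow> nat \<Rightarrow> real mat \<Rightarrow> nat \<Rightarrow> nat \<Rightarrow> real" where
  "column_array p n A = (\<lambda>j\<in>{..<n}. coords p (col A j))"

lemma sample_cov_gram: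
  assumes "A \<in> carrier_mat p n"
  shows "sample_cov n A = gram p (scaled_column p n (column_array p n A)) {..<n}"
  unfolding sample_cov_def
proof (rule eq_matI)
  fix a b assume ab: "a < dim_row (gram p (scaled_column p n (column_array p n A)) {..<n})"
    "b < dim_col (gram p (scaled_column p n (column_array p n A)) {..<n})"
  hence ab': "a < p" "b < p" by (simp_all add: gram_def)
  have "(\<Sum>j<n. A $$ (a, j) * A $$ (b, j)) / real n = (\<Sum>j<n. (A $$ (a, j) / sqrt (real n)) * (A $$ (b, j) / sqrt (real n)))"
    by (simp add: sum_divide_distrib)
  also have "\<dots> = gram p (scaled_column p n (column_array p n A)) {..<n} $$ (a, b)"
    using ab' assms by (simp add: gram_def scaled_column_def column_array_def coords_def)
  finally show "((1 / real n) \<cdot>\<^sub>m (A * transpose_mat A)) $$ (a, b) = gram p (scaled_column p n (column_array p n A)) {..<n} $$ (a, b)"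
    using ab' assms by (simp add: scalar_prod_def atLeast0LessThan)
qed (use assms in \<open>auto simp: gram_def\<close>)

lemma esd_sample_cov:
  assumes A: "A \<in> carrier_mat p n" and p: "p \<ge> 1" and t: "t > 0"
  shows "(\<integral>x. 1 / (x + t) \<partial>esd (sample_cov n A))
    = mtrace (resolvent t (gram p (scaled_column p n (column_array p n A)) {..<n})) / real p"
    and "AE x in esd (sample_cov n A). 0 \<le> x"
proof -
  let ?G = "gram p (scaled_column p n (column_array p n A)) {..<n}"
  have P: "psd p ?G" by (intro gram_psd) simp
  have one: "1 \<cdot>\<^sub>m ?G = ?G" by (rule eq_matI) auto
  show "(\<integral>x. 1 / (x + t) \<partial>esd (sample_cov n A)) = mtrace (resolvent t ?G) / real p"
    unfolding sample_cov_gram[OF A] using esd_resolvent(1)[OF P p _ t, of 1] by (simp add: one)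
  show "AE x in esd (sample_cov n A). 0 \<le> x"
    unfolding sample_cov_gram[OF A] using esd_resolvent(2)[OF P p _ t, of 1] by simp
qed

lemma column_array_distr:
  assumes N: "prob_space N" and n: "n \<ge> 1" and Y: "columns_indep_copies N M p n A y"
  shows "(\<lambda>\<omega>. column_array p n (A \<omega>)) \<in> measurable N (PiM {..<n} (\<lambda>_. borel_vec p))"
    and "distr N (PiM {..<n} (\<lambda>_. borel_vec p)) (\<lambda>\<omega>. column_array p n (A \<omega>))
      = PiM {..<n} (\<lambda>_. distr M (borel_vec p) (\<lambda>\<omega>. coords p (y \<omega>)))"
proof -
  interpret prob_space N by fact
  let ?X = "\<lambda>j \<omega>. coords p (col (A \<omega>) j)"
  have ind: "indep_vars (\<lambda>_. borel_vec p) ?X {..<n}" and eq: "\<And>j. j < n \<Longrightarrow> distr N (borel_vec p) (?X j) = distr M (borel_vec p) (\<lambda>\<omega>. coords p (y \<omega>))"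
    using Y by (auto simp: columns_indep_copies_def)
  have rv: "random_variable (borel_vec p) (?X j)" if "j \<in> {..<n}" for j
    using ind that unfolding indep_vars_def by blast
  show "(\<lambda>\<omega>. column_array p n (A \<omega>)) \<in> measurable N (PiM {..<n} (\<lambda>_. borel_vec p))"
    unfolding column_array_def by (intro measurable_restrict rv)
  have ne: "{..<n} \<noteq> {}" using n by (auto simp: lessThan_empty_iff)
  have "distr N (PiM {..<n} (\<lambda>_. borel_vec p)) (\<lambda>\<omega>. column_array p n (A \<omega>)) = PiM {..<n} (\<lambda>j. distr N (borel_vec p) (?X j))"
    unfolding column_array_def using ind by (subst (asm) indep_vars_iff_distr_eq_PiM'[OF ne rv]) auto
  also have "\<dots> = PiM {..<n} (\<lambda>_. distr M (borel_vec p) (\<lambda>\<omega>. coords p (y \<omega>)))"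
    by (intro PiM_cong) (auto simp: eq)
  finally show "distr N (PiM {..<n} (\<lambda>_. borel_vec p)) (\<lambda>\<omega>. column_array p n (A \<omega>))
      = PiM {..<n} (\<lambda>_. distr M (borel_vec p) (\<lambda>\<omega>. coords p (y \<omega>)))" .
qed

text \<open>The hypotheses of the theorem with weak dependence reduced to its one consequence \<open>qf\<close>, which both
  kinds of random vectors satisfy.\<close>

locale mp_setting =
  fixes M :: "'a measure" and N :: "'b measure" and y :: "nat \<Rightarrow> 'a \<Rightarrow> real Matrix.vec"
    and Y :: "nat \<Rightarrow> nat \<Rightarrow> 'b \<Rightarrow> real mat" and p :: "nat \<Rightarrow> nat" and c B K :: real and P :: "real measure"
  assumes M: "prob_space M" and N: "prob_space N"
    and Y: "\<And>q n. q \<ge> 1 \<Longrightarrow> n \<ge> 1 \<Longrightarrow> columns_indep_copies N M q n (Y q n) (y q)"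
    and p: "\<And>n. n \<ge> 1 \<Longrightarrow> p n \<ge> 1" and c: "c > 0" and pn: "(\<lambda>n. real (p n) / real n) \<longlonglongrightarrow> c"
    and ym: "\<And>q. q \<ge> 1 \<Longrightarrow> (\<lambda>\<omega>. coords q (y q \<omega>)) \<in> measurable M (borel_vec q)"
    and yc: "\<And>q \<omega>. q \<ge> 1 \<Longrightarrow> \<omega> \<in> space M \<Longrightarrow> y q \<omega> \<in> carrier_vec q"
    and S: "\<And>q. q \<ge> 1 \<Longrightarrow> psd q (second_moment_mat M q (y q))"
    and B: "\<And>q. q \<ge> 1 \<Longrightarrow> op_bound q B (second_moment_mat M q (y q))" "B \<ge> 0"
    and K: "K \<ge> 0"
    and qf: "\<And>q A \<beta>. q \<ge> 1 \<Longrightarrow> op_bound q \<beta> A \<Longrightarrow> \<beta> \<ge> 0 \<Longrightarrow>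
      (\<integral>\<^sup>+\<omega>. ennreal \<bar>y q \<omega> \<bullet> (A *\<^sub>v y q \<omega>) - mtrace (A * second_moment_mat M q (y q))\<bar> \<partial>M)
        \<le> ennreal (K * \<beta> * sqrt (real q))"
    and P: "real_distribution P" and wP: "weak_conv_m (\<lambda>q. esd (second_moment_mat M q (y q))) P"
begin

abbreviation "\<Sigma> q \<equiv> second_moment_mat M q (y q)"
abbreviation "\<nu> q \<equiv> distr M (borel_vec q) (\<lambda>\<omega>. coords q (y q \<omega>))"

lemma iid_columns:
  assumes n: "n \<ge> 1" and t: "t > 0"
  shows "iid_columns (\<nu> (p n)) (p n) n t B K (\<Sigma> (p n))"
proof -
  let ?q = "p n"
  have q: "?q \<ge> 1" by (rule p[OF n])
  interpret M: prob_space M by (rule M)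
  interpret \<nu>: prob_space "\<nu> ?q" by (intro M.prob_space_distr ym q)
  have vc: "Matrix.vec ?q (coords ?q v) = v" if "v \<in> carrier_vec ?q" for v
    using that by (intro eq_vecI) (auto simp: coords_def)
  show ?thesis
  proof (unfold_locales)
    fix A \<beta> assume A: "op_bound ?q \<beta> A" "\<beta> \<ge> (0 :: real)"
    have Ac: "A \<in> carrier_mat ?q ?q" using A by (simp add: op_bound_def)
    let ?g = "\<lambda>z. ennreal \<bar>Matrix.vec ?q z \<bullet> (A *\<^sub>v Matrix.vec ?q z) - mtrace (A * \<Sigma> ?q)\<bar>"
    have "(\<lambda>z. Matrix.vec ?q z \<bullet> (A *\<^sub>v Matrix.vec ?q z)) \<in> borel_measurable (borel_vec ?q)"
      by (intro mat_measurable_quadratic[OF mat_measurable_const[OF Ac]]) (auto intro: measurable_component_singleton)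
    hence "?g \<in> borel_measurable (borel_vec ?q)" by measurable
    hence "(\<integral>\<^sup>+z. ?g z \<partial>\<nu> ?q) = (\<integral>\<^sup>+\<omega>. ?g (coords ?q (y ?q \<omega>)) \<partial>M)"
      by (intro nn_integral_distr[OF ym[OF q]]) simp
    also have "\<dots> = (\<integral>\<^sup>+\<omega>. ennreal \<bar>y ?q \<omega> \<bullet> (A *\<^sub>v y ?q \<omega>) - mtrace (A * \<Sigma> ?q)\<bar> \<partial>M)"
      by (intro nn_integral_cong) (simp add: vc[OF yc[OF q]])
    also have "\<dots> \<le> ennreal (K * \<beta> * sqrt (real ?q))" by (rule qf[OF q A])
    finally show "(\<integral>\<^sup>+z. ?g z \<partial>\<nu> ?q) \<le> ennreal (K * \<beta> * sqrt (real ?q))" .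
  qed (use q n t S B K in auto)
qed

lemma p_at_top: "filterlim (\<lambda>n. real (p n)) at_top sequentially" "filterlim p at_top sequentially"
proof -
  have "filterlim (\<lambda>n. real (p n) / real n * real n) at_top sequentially"
    by (rule filterlim_tendsto_pos_mult_at_top[OF pn c filterlim_real_sequentially])
  moreover have "\<forall>\<^sub>F n in sequentially. real (p n) / real n * real n = real (p n)"
    using eventually_gt_at_top[of 0] by eventually_elim simp
  ultimately show r: "filterlim (\<lambda>n. real (p n)) at_top sequentially"
    by (rule filterlim_cong[OF refl refl, THEN iffD1, rotated])
  show "filterlim p at_top sequentially"
    unfolding filterlim_at_top
  proof
    fix Z :: nat
    show "\<forall>\<^sub>F n in sequentially. Z \<le> p n"
      using r[unfolded filterlim_at_top, rule_format, of "real Z"] by simp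
  qed
qed

lemma square_rate_at_top: "filterlim (\<lambda>n. (real (p n))\<^sup>2 / real n) at_top sequentially"
proof -
  have "filterlim (\<lambda>n. real (p n) / real n * real (p n)) at_top sequentially"
    by (rule filterlim_tendsto_pos_mult_at_top[OF pn c p_at_top(1)])
  thus ?thesis by (simp add: power2_eq_square)
qed

lemma support_esd:
  assumes "q \<ge> 1"
  shows "bounded_support (esd (\<Sigma> q)) B"
proof -
  interpret real_distribution "esd (\<Sigma> q)" by (rule real_distribution_esd)
  have "AE x in esd (\<Sigma> q). 0 \<le> x" by (rule esd_resolvent(2)[OF S[OF assms] assms, of 1 1]) auto
  moreover have "AE x in esd (\<Sigma> q). x \<le> B"
    by (rule esd_resolvent(3)[OF S[OF assms] assms _ _ B(1)[OF assms] B(2), of 1 1]) auto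
  ultimately show ?thesis using B(2) by unfold_locales
qed

lemma support_P: "bounded_support P B"
proof -
  interpret real_distribution P by (rule P)
  have w: "weak_conv_m (\<lambda>q. esd (\<Sigma> (Suc q))) P"
    using wP unfolding weak_conv_m_def weak_conv_def by (auto intro: LIMSEQ_Suc)
  have s: "AE x in esd (\<Sigma> (Suc q)). 0 \<le> x" "AE x in esd (\<Sigma> (Suc q)). x \<le> B" for q
    using support_esd[of "Suc q"] by (auto simp: bounded_support_def bounded_support_axioms_def)
  have "AE x in P. 0 \<le> x" by (rule weak_conv_m_support_nonneg[OF real_distribution_esd P w s(1)])
  moreover have "AE x in P. x \<le> B" by (rule weak_conv_m_support_le[OF real_distribution_esd P w s(2)])
  ultimately show ?thesis using B(2) by unfold_locales
qed

lemma population_limit: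
  assumes "b \<ge> 0" "t > 0"
  shows "(\<lambda>n. \<integral>x. 1 / (b * x + t) \<partial>esd (\<Sigma> (p n))) \<longlonglongrightarrow> (\<integral>x. 1 / (b * x + t) \<partial>P)"
proof -
  have w: "weak_conv_m (\<lambda>q. esd (\<Sigma> (Suc q))) P"
    using wP unfolding weak_conv_m_def weak_conv_def by (auto intro: LIMSEQ_Suc)
  have s: "AE x in esd (\<Sigma> (Suc q)). 0 \<le> x" for q
    using support_esd[of "Suc q"] by (auto simp: bounded_support_def bounded_support_axioms_def)
  have "(\<lambda>q. \<integral>x. 1 / (b * x + t) \<partial>esd (\<Sigma> (Suc q))) \<longlonglongrightarrow> (\<integral>x. 1 / (b * x + t) \<partial>P)"
    by (rule weak_conv_m_resolvent_integral[OF real_distribution_esd P w s assms])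
  hence "(\<lambda>q. \<integral>x. 1 / (b * x + t) \<partial>esd (\<Sigma> q)) \<longlonglongrightarrow> (\<integral>x. 1 / (b * x + t) \<partial>P)" by (rule LIMSEQ_imp_Suc)
  from filterlim_compose[OF this p_at_top(2)] show ?thesis .
qed

text \<open>The choice is immaterial: by \<open>fixed_point_stability\<close> the mean traces converge to any number with
  these properties.\<close>

definition "limit_trace t = (SOME m. 0 \<le> m \<and> m \<le> 1 / t \<and> 0 \<le> 1 - c + c * t * m \<and> 1 - c + c * t * m \<le> 1 \<and>
    m = (\<integral>x. 1 / ((1 - c + c * t * m) * x + t) \<partial>P) \<and> 1 / (B + t) \<le> m)"

lemma limit_trace:
  assumes "t > 0"
  shows "0 \<le> limit_trace t" "limit_trace t \<le> 1 / t" "0 \<le> 1 - c + c * t * limit_trace t"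
    "limit_trace t = (\<integral>x. 1 / ((1 - c + c * t * limit_trace t) * x + t) \<partial>P)"
    "1 / (B + t) \<le> limit_trace t"
  using someI_ex[OF bounded_support.fixed_point_exists[OF support_P c assms]]
  unfolding limit_trace_def[symmetric] by blast+

abbreviation "mean_trace t n \<equiv> iid_columns.m (\<nu> (p n)) (p n) n t"

text \<open>The mean traces solve the equation for the population spectral distributions up to a vanishing
  error, so stability applies.\<close>

lemma mean_trace_limit:
  assumes t: "t > 0"
  shows "mean_trace t \<longlonglongrightarrow> limit_trace t"
proof -
  \<comment> \<open>the index is shifted because nothing is known about \<open>p 0\<close>\<close>
  let ?m = "\<lambda>n. mean_trace t (Suc n)" and ?q = "\<lambda>n. p (Suc n)"
  let ?c = "\<lambda>n. real (?q n) / real (Suc n)"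
  define b where "b n = 1 - ?c n + ?c n * t * ?m n" for n
  have iid: "iid_columns (\<nu> (?q n)) (?q n) (Suc n) t B K (\<Sigma> (?q n))" for n by (rule iid_columns) (use t in auto)
  have q: "?q n \<ge> 1" for n by (rule p) simp
  have bdef: "b n = iid_columns.b (\<nu> (?q n)) (?q n) (Suc n) t" for n
    unfolding b_def iid_columns.b_def[OF iid] ..
  have b: "0 \<le> b n" "b n \<le> 1" for n
    unfolding bdef using iid_columns.b_bounds[OF iid] by auto
  have cl: "?c \<longlonglongrightarrow> c" using LIMSEQ_Suc[OF pn] .
  have dev: "(\<lambda>n. ?m n - (\<integral>x. 1 / (b n * x + t) \<partial>esd (\<Sigma> (?q n)))) \<longlonglongrightarrow> 0"
  proof (rule tendsto_zero_of_small_bounds[where C = "B / t * c"])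
    show "0 \<le> B / t * c" using B t c by simp
    fix \<epsilon> :: real assume \<epsilon>: "\<epsilon> > 0"
    let ?e = "\<lambda>n. exp (- (\<epsilon>\<^sup>2 * t\<^sup>2 * (real (?q n))\<^sup>2 / (8 * real (Suc n))))"
    let ?g = "\<lambda>n. B / t * ?c n * (\<epsilon> + 2 / t * ?e n) + K / (t\<^sup>2 * sqrt (real (?q n))) + B / (t\<^sup>2 * real (?q n))"
    have sq: "filterlim (\<lambda>n. (real (?q n))\<^sup>2 / real (Suc n)) at_top sequentially"
      using filterlim_compose[OF square_rate_at_top filterlim_Suc] .
    have "filterlim (\<lambda>n. \<epsilon>\<^sup>2 * t\<^sup>2 / 8 * ((real (?q n))\<^sup>2 / real (Suc n))) at_top sequentially"
      using \<epsilon> t by (intro filterlim_tendsto_pos_mult_at_top[OF tendsto_const _ sq]) auto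
    hence "filterlim (\<lambda>n. - (\<epsilon>\<^sup>2 * t\<^sup>2 / 8 * ((real (?q n))\<^sup>2 / real (Suc n)))) at_bot sequentially"
      by (simp add: filterlim_uminus_at_bot)
    from filterlim_compose[OF exp_at_bot this] have el: "?e \<longlonglongrightarrow> 0" by (simp add: mult_ac)
    have ql: "filterlim (\<lambda>n. real (?q n)) at_top sequentially"
      using filterlim_compose[OF p_at_top(1) filterlim_Suc] .
    have k1: "(\<lambda>n. K / t\<^sup>2 / sqrt (real (?q n))) \<longlonglongrightarrow> 0"
      by (rule real_tendsto_divide_at_top[OF tendsto_const filterlim_compose[OF sqrt_at_top ql]])
    have k2: "(\<lambda>n. B / t\<^sup>2 / real (?q n)) \<longlonglongrightarrow> 0"
      by (rule real_tendsto_divide_at_top[OF tendsto_const ql])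
    have "(\<lambda>n. B / t * ?c n * (\<epsilon> + 2 / t * ?e n) + K / t\<^sup>2 / sqrt (real (?q n)) + B / t\<^sup>2 / real (?q n))
        \<longlonglongrightarrow> B / t * c * (\<epsilon> + 2 / t * 0) + 0 + 0"
      by (intro tendsto_intros cl el k1 k2)
    hence "?g \<longlonglongrightarrow> B / t * c * \<epsilon>" by simp
    moreover have "\<bar>?m n - (\<integral>x. 1 / (b n * x + t) \<partial>esd (\<Sigma> (?q n)))\<bar> \<le> ?g n" for n
    proof -
      have "(\<integral>x. 1 / (b n * x + t) \<partial>esd (\<Sigma> (?q n))) = mtrace (resolvent t (b n \<cdot>\<^sub>m \<Sigma> (?q n))) / real (?q n)"
        by (rule esd_resolvent(1)[OF S[OF q] q b(1) t])
      thus ?thesis using iid_columns.mean_resolvent_trace[OF iid \<epsilon>, of n] unfolding bdef by simp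
    qed
    ultimately show "\<exists>g. g \<longlonglongrightarrow> B / t * c * \<epsilon> \<and> (\<forall>n. \<bar>?m n - (\<integral>x. 1 / (b n * x + t) \<partial>esd (\<Sigma> (?q n)))\<bar> \<le> g n)"
      by (intro exI[of _ ?g]) blast
  qed
  have "?m \<longlonglongrightarrow> limit_trace t"
  proof (rule fixed_point_stability[where cn = ?c and bn = b and \<mu> = "\<lambda>n. esd (\<Sigma> (?q n))" and B = B and t = t and c = c
        and b = "1 - c + c * t * limit_trace t"])
    show "bounded_support (esd (\<Sigma> (?q n))) B" for n by (rule support_esd[OF q])
    show "0 < ?c n" for n using q[of n] by simp
    have "(\<lambda>n. \<integral>x. 1 / ((1 - c + c * t * limit_trace t) * x + t) \<partial>esd (\<Sigma> (p n))) \<longlonglongrightarrow> limit_trace t"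
      using population_limit[OF limit_trace(3)[OF t] t] limit_trace(4)[OF t] by simp
    thus "(\<lambda>n. \<integral>x. 1 / ((1 - c + c * t * limit_trace t) * x + t) \<partial>esd (\<Sigma> (?q n))) \<longlonglongrightarrow> limit_trace t"
      by (rule LIMSEQ_Suc)
  qed (use B t cl b b_def dev limit_trace[OF t] in auto)
  thus ?thesis by (rule LIMSEQ_imp_Suc)
qed

abbreviation "sample_trace t n \<omega> \<equiv> (\<integral>x. 1 / (x + t) \<partial>esd (sample_cov n (Y (p n) n \<omega>)))"

lemma sample_trace_tail:
  assumes n: "n \<ge> 1" and t: "t > 0" and \<epsilon>: "\<epsilon> > 0"
  shows "{\<omega> \<in> space N. \<bar>sample_trace t n \<omega> - mean_trace t n\<bar> \<ge> \<epsilon>} \<in> sets N"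
    and "measure N {\<omega> \<in> space N. \<bar>sample_trace t n \<omega> - mean_trace t n\<bar> \<ge> \<epsilon>}
      \<le> 2 * exp (- (\<epsilon>\<^sup>2 * t\<^sup>2 * (real (p n))\<^sup>2 / (8 * real n)))"
proof -
  interpret I: iid_columns "\<nu> (p n)" "p n" n t B K "\<Sigma> (p n)" by (rule iid_columns[OF n t])
  let ?X = "\<lambda>\<omega>. column_array (p n) n (Y (p n) n \<omega>)"
  let ?R = "PiM {..<n} (\<lambda>_. borel_vec (p n))"
  note Yn = Y[OF p[OF n] n]
  note X = column_array_distr[OF N n Yn]
  have fX: "sample_trace t n \<omega> = I.f (?X \<omega>)" if "\<omega> \<in> space N" for \<omega>
  proof -
    have "Y (p n) n \<omega> \<in> carrier_mat (p n) n" using Yn that by (auto simp: columns_indep_copies_def)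
    thus ?thesis unfolding I.f_def by (rule esd_sample_cov(1)[OF _ p[OF n] t])
  qed
  let ?E = "{x \<in> space I.Q. \<bar>I.f x - I.m\<bar> \<ge> \<epsilon>}"
  have sQ: "sets I.Q = sets ?R" by (intro sets_PiM_cong) auto
  have E: "?E \<in> sets ?R" unfolding sQ[symmetric] by measurable
  have spQ: "space I.Q = space ?R" by (rule sets_eq_imp_space_eq[OF sQ])
  have pre: "{\<omega> \<in> space N. \<bar>sample_trace t n \<omega> - mean_trace t n\<bar> \<ge> \<epsilon>} = ?X -` ?E \<inter> space N"
    using fX measurable_space[OF X(1)] spQ by auto
  show "{\<omega> \<in> space N. \<bar>sample_trace t n \<omega> - mean_trace t n\<bar> \<ge> \<epsilon>} \<in> sets N"
    unfolding pre by (rule measurable_sets[OF X(1) E])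
  have "measure N (?X -` ?E \<inter> space N) = measure (distr N ?R ?X) ?E" by (rule measure_distr[OF X(1) E, symmetric])
  also have "\<dots> = measure I.Q ?E" unfolding X(2) ..
  also have "\<dots> \<le> 2 * exp (- (\<epsilon>\<^sup>2 * t\<^sup>2 * (real (p n))\<^sup>2 / (8 * real n)))" by (rule I.f_concentration[OF \<epsilon>])
  finally show "measure N {\<omega> \<in> space N. \<bar>sample_trace t n \<omega> - mean_trace t n\<bar> \<ge> \<epsilon>}
      \<le> 2 * exp (- (\<epsilon>\<^sup>2 * t\<^sup>2 * (real (p n))\<^sup>2 / (8 * real n)))" unfolding pre .
qed

text \<open>The exponents in the tail bounds are of the order \<open>p\<^sup>2 / n\<close>, hence at least a multiple of \<open>n\<close>, and the
  Borel-Cantelli lemma applies.\<close>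

lemma sample_trace_limit:
  assumes t: "t > 0"
  shows "AE \<omega> in N. (\<lambda>n. sample_trace t n \<omega>) \<longlonglongrightarrow> limit_trace t"
proof -
  interpret N: prob_space N by (rule N)
  let ?d = "\<lambda>n \<omega>. \<bar>sample_trace t (Suc n) \<omega> - mean_trace t (Suc n)\<bar>"
  have ev: "AE \<omega> in N. \<forall>\<^sub>F n in sequentially. ?d n \<omega> < \<epsilon>" if \<epsilon>: "\<epsilon> > 0" for \<epsilon>
  proof -
    let ?A = "\<lambda>n. {\<omega> \<in> space N. ?d n \<omega> \<ge> \<epsilon>}"
    note A = sample_trace_tail[OF _ t \<epsilon>]
    \<comment> \<open>from \<open>p / n \<ge> c / 2\<close>, which holds eventually: \<open>(c / 2)\<^sup>2 / 8 = c\<^sup>2 / 32\<close>\<close>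
    define a where "a = \<epsilon>\<^sup>2 * t\<^sup>2 * c\<^sup>2 / 32"
    have a: "a > 0" using \<epsilon> t c by (simp add: a_def)
    have sum: "summable (\<lambda>n. measure N (?A n))"
    proof (rule summable_comparison_test_ev)
      have "(\<lambda>n. real (p (Suc n)) / real (Suc n)) \<longlonglongrightarrow> c" by (rule LIMSEQ_Suc[OF pn])
      hence "\<forall>\<^sub>F n in sequentially. real (p (Suc n)) / real (Suc n) > c / 2" using c by (intro order_tendstoD(1)) auto
      thus "\<forall>\<^sub>F n in sequentially. norm (measure N (?A n)) \<le> 2 * exp (- a) ^ Suc n"
      proof eventually_elim
        case (elim n)
        let ?n = "real (Suc n)" and ?p = "real (p (Suc n))"
        have "(c / 2)\<^sup>2 \<le> (?p / ?n)\<^sup>2" using elim c by (intro power_mono) auto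
        hence "(c / 2)\<^sup>2 * ?n \<le> (?p / ?n)\<^sup>2 * ?n" by (intro mult_right_mono) auto
        also have "(?p / ?n)\<^sup>2 * ?n = ?p\<^sup>2 / ?n"
          by (simp add: power2_eq_square del: of_nat_Suc)
        finally have "\<epsilon>\<^sup>2 * t\<^sup>2 / 8 * ((c / 2)\<^sup>2 * ?n) \<le> \<epsilon>\<^sup>2 * t\<^sup>2 / 8 * (?p\<^sup>2 / ?n)" by (intro mult_left_mono) auto
        hence le: "?n * a \<le> \<epsilon>\<^sup>2 * t\<^sup>2 * ?p\<^sup>2 / (8 * ?n)" by (simp add: a_def power_divide mult_ac)
        have "measure N (?A n) \<le> 2 * exp (- (\<epsilon>\<^sup>2 * t\<^sup>2 * ?p\<^sup>2 / (8 * ?n)))" by (rule A(2)) simp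
        also have "\<dots> \<le> 2 * exp (?n * (- a))" using le by simp
        also have "exp (?n * (- a)) = exp (- a) ^ Suc n" by (rule exp_of_nat_mult)
        finally show ?case by simp
      qed
      have "summable (\<lambda>n. exp (- a) ^ n)" using a by (intro summable_geometric) simp
      hence "summable (\<lambda>n. exp (- a) ^ Suc n)" by (subst summable_Suc_iff)
      thus "summable (\<lambda>n. 2 * exp (- a) ^ Suc n)" by (rule summable_mult)
    qed
    have "AE \<omega> in N. \<forall>\<^sub>F n in sequentially. \<omega> \<in> space N - ?A n"
      by (rule borel_cantelli_AE1[OF A(1) _ sum]) (auto simp: N.emeasure_eq_measure)
    thus ?thesis
    proof eventually_elim
      case (elim \<omega>)
      thus ?case by eventually_elim (auto simp: not_le)
    qed
  qed
  have "AE \<omega> in N. \<forall>k. \<forall>\<^sub>F n in sequentially. ?d n \<omega> < 1 / real (Suc k)"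
    by (subst AE_all_countable) (intro allI ev, simp)
  thus ?thesis
  proof eventually_elim
    case (elim \<omega>)
    have "(\<lambda>n. sample_trace t (Suc n) \<omega> - mean_trace t (Suc n)) \<longlonglongrightarrow> 0"
    proof (rule tendstoI)
      fix e :: real assume "e > 0"
      then obtain k where k: "1 / real (Suc k) < e" using nat_approx_posE by blast
      from elim have "\<forall>\<^sub>F n in sequentially. ?d n \<omega> < 1 / real (Suc k)" by blast
      thus "\<forall>\<^sub>F n in sequentially. dist (sample_trace t (Suc n) \<omega> - mean_trace t (Suc n)) 0 < e"
        by eventually_elim (use k in \<open>simp add: dist_real_def\<close>)
    qed
    from tendsto_add[OF this LIMSEQ_Suc[OF mean_trace_limit[OF t]]]
    have "(\<lambda>n. sample_trace t (Suc n) \<omega>) \<longlonglongrightarrow> limit_trace t" by simp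
    thus ?case by (rule LIMSEQ_imp_Suc)
  qed
qed

text \<open>A single null set serves all rational \<open>t\<close>. One sample point outside of it yields the limit measure,
  and at every other such point the resolvent integrals have the same limits, hence the
  spectral distributions the same weak limit.\<close>

theorem generalized_marchenko_pastur:
  "\<exists>F. real_distribution F \<and> (AE \<omega> in N. weak_conv_m (\<lambda>n. esd (sample_cov n (Y (p n) n \<omega>))) F) \<and>
    (\<forall>z. Im z > 0 \<longrightarrow> stieltjes F z =
        (LINT x:{0..}|P. 1 / (complex_of_real x * (1 - complex_of_real c
            - complex_of_real c * z * stieltjes F z) - z)))"
proof -
  interpret N: prob_space N by (rule N)
  let ?\<mu> = "\<lambda>\<omega> n. esd (sample_cov n (Y (p n) n \<omega>))"
  have "AE \<omega> in N. \<forall>t\<in>{t \<in> \<rat>. t > 0}. (\<lambda>n. sample_trace t n \<omega>) \<longlonglongrightarrow> limit_trace t"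
  proof (subst AE_ball_countable)
    show "countable {t \<in> \<rat>. t > (0 :: real)}" by (rule countable_subset[OF _ countable_rat]) auto
  qed (auto intro: sample_trace_limit)
  hence ae: "AE \<omega> in N. \<omega> \<in> space N \<and> (\<forall>t\<in>{t \<in> \<rat>. t > 0}. (\<lambda>n. sample_trace t n \<omega>) \<longlonglongrightarrow> limit_trace t)"
    using AE_space by eventually_elim blast
  have nn: "AE x in ?\<mu> \<omega> (Suc n). 0 \<le> x" if "\<omega> \<in> space N" for \<omega> n
  proof -
    have n: "Suc n \<ge> 1" by simp
    have "Y (p (Suc n)) (Suc n) \<omega> \<in> carrier_mat (p (Suc n)) (Suc n)"
      using Y[OF p[OF n] n] that by (auto simp: columns_indep_copies_def)
    from esd_sample_cov(2)[OF this p[OF n], of 1] show ?thesis by simp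
  qed
  have tr: "(\<lambda>n. \<integral>x. 1 / (x + t) \<partial>?\<mu> \<omega> (Suc n)) \<longlonglongrightarrow> limit_trace t"
    if "\<forall>t\<in>{t \<in> \<rat>. t > 0}. (\<lambda>n. sample_trace t n \<omega>) \<longlonglongrightarrow> limit_trace t" "t \<in> \<rat>" "t > 0" for \<omega> t
    by (rule LIMSEQ_Suc) (use that in blast)
  have "\<exists>\<omega>. \<omega> \<in> space N \<and> (\<forall>t\<in>{t \<in> \<rat>. t > 0}. (\<lambda>n. sample_trace t n \<omega>) \<longlonglongrightarrow> limit_trace t)"
    by (rule eventually_happens'[OF N.ae_filter_bot ae])
  then obtain \<omega>0 where \<omega>0: "\<omega>0 \<in> space N" "\<forall>t\<in>{t \<in> \<rat>. t > 0}. (\<lambda>n. sample_trace t n \<omega>0) \<longlonglongrightarrow> limit_trace t"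
    by blast
  have "\<exists>F. real_distribution F \<and> (AE x in F. 0 \<le> x) \<and>
    (\<forall>t. t \<in> \<rat> \<and> t > 0 \<longrightarrow> (\<integral>x. 1 / (x + t) \<partial>F) = limit_trace t)"
    by (rule weak_limit_exists_of_resolvent_integrals[where \<mu> = "\<lambda>n. ?\<mu> \<omega>0 (Suc n)" and B = B])
      (use real_distribution_esd nn[OF \<omega>0(1)] tr[OF \<omega>0(2)] limit_trace(5) B(2) in auto)
  then obtain F where F: "real_distribution F" "AE x in F. 0 \<le> x"
    and Ft: "\<And>t. t \<in> \<rat> \<Longrightarrow> t > 0 \<Longrightarrow> (\<integral>x. 1 / (x + t) \<partial>F) = limit_trace t" by blast
  have conv: "AE \<omega> in N. weak_conv_m (?\<mu> \<omega>) F"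
    using ae
  proof eventually_elim
    case (elim \<omega>)
    have "weak_conv_m (\<lambda>n. ?\<mu> \<omega> (Suc n)) F"
    proof (rule weak_conv_of_resolvent_integrals[OF real_distribution_esd F(1) _ F(2)])
      show "(\<lambda>n. \<integral>x. 1 / (x + t) \<partial>?\<mu> \<omega> (Suc n)) \<longlonglongrightarrow> (\<integral>x. 1 / (x + t) \<partial>F)" if "t \<in> \<rat>" "t > 0" for t
        unfolding Ft[OF that] by (rule tr) (use elim that in auto)
    qed (use nn elim in auto)
    thus ?case unfolding weak_conv_m_def weak_conv_def by (auto intro: LIMSEQ_imp_Suc)
  qed
  interpret P: bounded_support P B by (rule support_P)
  have eq: "stieltjes F z = (LINT x:{0..}|P. 1 / (complex_of_real x * (1 - complex_of_real c
            - complex_of_real c * z * stieltjes F z) - z))" if z: "Im z > 0" for z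
  proof -
    have "stieltjes F z = (\<integral>x. 1 / (complex_of_real x * (1 - complex_of_real c
            - complex_of_real c * z * stieltjes F z) - z) \<partial>P)"
    proof (rule stieltjes_equation_continuation[OF F P P.supp B(2) c _ z])
      fix t :: real assume t: "t \<in> \<rat>" "t > 0"
      show "(\<integral>x. 1 / (x + t) \<partial>F) = (\<integral>x. 1 / ((1 - c + c * t * (\<integral>x. 1 / (x + t) \<partial>F)) * x + t) \<partial>P)"
        unfolding Ft[OF t] by (rule limit_trace(4)[OF t(2)])
    qed
    also have "\<dots> = (LINT x:{0..}|P. 1 / (complex_of_real x * (1 - complex_of_real c
            - complex_of_real c * z * stieltjes F z) - z))"
      unfolding set_lebesgue_integral_def
    proof (rule integral_cong_AE)
      show "AE x in P. 1 / (complex_of_real x * (1 - complex_of_real c - complex_of_real c * z * stieltjes F z) - z) =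
        indicat_real {0..} x *\<^sub>R (1 / (complex_of_real x * (1 - complex_of_real c - complex_of_real c * z * stieltjes F z) - z))"
        using P.supp(1) by eventually_elim simp
    qed auto
    finally show ?thesis .
  qed
  show ?thesis using F(1) conv eq by blast
qed

end

section \<open>The generalized Marchenko-Pastur theorem\<close>

lemma op_bound_mono:
  assumes "op_bound p \<kappa> A" "0 \<le> \<kappa>" "\<kappa> \<le> \<kappa>'"
  shows "op_bound p \<kappa>' A"
  unfolding op_bound_def
proof (intro conjI ballI)
  show "A \<in> carrier_mat p p" using assms by (simp add: op_bound_def)
  fix v :: "real Matrix.vec" assume "v \<in> carrier_vec p"
  hence "(A *\<^sub>v v) \<bullet> (A *\<^sub>v v) \<le> \<kappa>\<^sup>2 * (v \<bullet> v)" using assms by (simp add: op_bound_def)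
  also have "\<dots> \<le> \<kappa>'\<^sup>2 * (v \<bullet> v)"
    using assms by (intro mult_right_mono power_mono scalar_prod_self_nonneg) auto
  finally show "(A *\<^sub>v v) \<bullet> (A *\<^sub>v v) \<le> \<kappa>'\<^sup>2 * (v \<bullet> v)" .
qed

text \<open>The numbering is shifted to start from 0, and the supremum and the infinite sums become bounds.\<close>

lemma weakly_dependentI:
  fixes X :: "nat \<Rightarrow> 'a \<Rightarrow> real"
  assumes "prob_space M"
    and meas: "\<And>k. k \<ge> 1 \<Longrightarrow> X k \<in> borel_measurable M"
    and "\<And>k. k \<ge> 1 \<Longrightarrow> (\<integral>\<omega>. X k \<omega> \<partial>M) = 0"
    and "\<And>k. k \<ge> 1 \<Longrightarrow> (\<integral>\<omega>. (X k \<omega>)\<^sup>2 \<partial>M) \<le> 1"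
    and phi: "\<And>k. k \<ge> 1 \<Longrightarrow> \<phi> k \<ge> 0"
    and "\<And>j k. 1 \<le> j \<Longrightarrow> j \<le> k \<Longrightarrow> \<phi> k \<le> \<phi> j"
    and c13: "\<And>i j k l. 1 \<le> i \<Longrightarrow> i < j \<Longrightarrow> j < k \<Longrightarrow> k < l \<Longrightarrow>
          \<bar>covariance M (X i) (\<lambda>\<omega>. X j \<omega> * X k \<omega> * X l \<omega>)\<bar> \<le> \<phi> (j - i)"
    and c31: "\<And>i j k l. 1 \<le> i \<Longrightarrow> i < j \<Longrightarrow> j < k \<Longrightarrow> k < l \<Longrightarrow>
          \<bar>covariance M (\<lambda>\<omega>. X i \<omega> * X j \<omega> * X k \<omega>) (X l)\<bar> \<le> \<phi> (l - k)"
    and c22: "\<And>i j k l. 1 \<le> i \<Longrightarrow> i < j \<Longrightarrow> j < k \<Longrightarrow> k < l \<Longrightarrow>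
          \<bar>covariance M (\<lambda>\<omega>. X i \<omega> * X j \<omega>) (\<lambda>\<omega>. X k \<omega> * X l \<omega>)\<bar> \<le> \<phi> (k - j)"
    and c11: "\<And>i j. 1 \<le> i \<Longrightarrow> i < j \<Longrightarrow> \<bar>covariance M (X i) (X j)\<bar> \<le> \<phi> (j - i)"
    and psi: "\<And>k. k \<ge> 1 \<Longrightarrow> \<psi> k \<ge> 0"
    and csq: "\<And>i j. 1 \<le> i \<Longrightarrow> i < j \<Longrightarrow>
          covariance M (\<lambda>\<omega>. (X i \<omega>)\<^sup>2) (\<lambda>\<omega>. (X j \<omega>)\<^sup>2) \<le> \<psi> (j - i)"
    and four: "(SUP k\<in>{1..}. \<integral>\<^sup>+\<omega>. ennreal ((X k \<omega>) ^ 4) \<partial>M) < \<infinity>"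
    and sphi: "(\<lambda>k. real k * \<phi> k) summable_on {1..}"
    and spsi: "\<psi> summable_on {1..}"
  shows "weakly_dependent M (\<lambda>k. X (Suc k)) \<phi> \<psi>
    (enn2real (SUP k\<in>{1..}. \<integral>\<^sup>+\<omega>. ennreal ((X k \<omega>) ^ 4) \<partial>M))
    (\<Sum>\<^sub>\<infinity>k\<in>{1..}. real k * \<phi> k) (\<Sum>\<^sub>\<infinity>k\<in>{1..}. \<psi> k)"
proof -
  interpret prob_space M by fact
  let ?s = "SUP k\<in>{1..}. \<integral>\<^sup>+\<omega>. ennreal ((X k \<omega>) ^ 4) \<partial>M"
  have le: "(\<integral>\<^sup>+\<omega>. ennreal ((X (Suc k) \<omega>) ^ 4) \<partial>M) \<le> ennreal (enn2real ?s)" for k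
  proof -
    have "(\<integral>\<^sup>+\<omega>. ennreal ((X (Suc k) \<omega>) ^ 4) \<partial>M) \<le> ?s" by (rule SUP_upper) simp
    also have "?s = ennreal (enn2real ?s)" using four by simp
    finally show ?thesis .
  qed
  have int: "integrable M (\<lambda>\<omega>. X (Suc k) \<omega> ^ 4)" for k
  proof (rule integrableI_bounded)
    show "(\<integral>\<^sup>+\<omega>. ennreal (norm (X (Suc k) \<omega> ^ 4)) \<partial>M) < \<infinity>"
      using le[of k] by (simp add: le_less_trans[OF _ ennreal_less_top])
  qed (use meas in simp)
  show ?thesis
  proof (unfold_locales, goal_cases)
    case (3 k)
    have "ennreal (expectation (\<lambda>\<omega>. X (Suc k) \<omega> ^ 4)) \<le> ennreal (enn2real ?s)"
      using le[of k] by (subst nn_integral_eq_integral[symmetric]) (use int in auto)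
    thus ?case by simp
  next
    case (9 n)
    show ?case by (rule finite_sum_le_infsum[OF sphi]) (use phi in auto)
  next
    case (10 n)
    show ?case by (rule finite_sum_le_infsum[OF spsi]) (use psi in auto)
  next
    case (11 i j k l)
    show ?case using c13[of "Suc i" "Suc j" "Suc k" "Suc l"] 11 by simp
  next
    case (12 i j k l)
    show ?case using c31[of "Suc i" "Suc j" "Suc k" "Suc l"] 12 by simp
  next
    case (13 i j k l)
    show ?case using c22[of "Suc i" "Suc j" "Suc k" "Suc l"] 13 by simp
  next
    case (14 i j)
    show ?case using c11[of "Suc i" "Suc j"] 14 by simp
  next
    case (15 i j)
    show ?case using csq[of "Suc i" "Suc j"] 15 by simp
  qed (use assms int in auto)
qed

theorem theorem3p1:
  fixes M :: "'a measure" and N :: "'b measure"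
    and X :: "nat \<Rightarrow> 'a \<Rightarrow> real"
    and \<phi> \<psi> :: "nat \<Rightarrow> real"
    and y :: "nat \<Rightarrow> 'a \<Rightarrow> real Matrix.vec"
    and Y :: "nat \<Rightarrow> nat \<Rightarrow> 'b \<Rightarrow> real mat"
    and p :: "nat \<Rightarrow> nat" and c :: real
    and P :: "real measure"
  assumes "prob_space M" and "prob_space N"
    and "\<And>k. k \<ge> 1 \<Longrightarrow> X k \<in> borel_measurable M"
    and "\<And>k. k \<ge> 1 \<Longrightarrow> (\<integral>\<omega>. X k \<omega> \<partial>M) = 0"
    and "\<And>k. k \<ge> 1 \<Longrightarrow> (\<integral>\<omega>. (X k \<omega>)\<^sup>2 \<partial>M) \<le> 1"
    and "\<And>k. k \<ge> 1 \<Longrightarrow> \<phi> k \<ge> 0"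
    and "\<And>j k. 1 \<le> j \<Longrightarrow> j \<le> k \<Longrightarrow> \<phi> k \<le> \<phi> j"
    and "\<And>i j k l. 1 \<le> i \<Longrightarrow> i < j \<Longrightarrow> j < k \<Longrightarrow> k < l \<Longrightarrow>
          \<bar>covariance M (X i) (\<lambda>\<omega>. X j \<omega> * X k \<omega> * X l \<omega>)\<bar> \<le> \<phi> (j - i)"
    and "\<And>i j k l. 1 \<le> i \<Longrightarrow> i < j \<Longrightarrow> j < k \<Longrightarrow> k < l \<Longrightarrow>
          \<bar>covariance M (\<lambda>\<omega>. X i \<omega> * X j \<omega> * X k \<omega>) (X l)\<bar> \<le> \<phi> (l - k)"
    and "\<And>i j k l. 1 \<le> i \<Longrightarrow> i < j \<Longrightarrow> j < k \<Longrightarrow> k < l \<Longrightarrow>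
          \<bar>covariance M (\<lambda>\<omega>. X i \<omega> * X j \<omega>) (\<lambda>\<omega>. X k \<omega> * X l \<omega>)\<bar> \<le> \<phi> (k - j)"
    and "\<And>i j. 1 \<le> i \<Longrightarrow> i < j \<Longrightarrow> \<bar>covariance M (X i) (X j)\<bar> \<le> \<phi> (j - i)"
    and "\<And>k. k \<ge> 1 \<Longrightarrow> \<psi> k \<ge> 0"
    and "\<And>i j. 1 \<le> i \<Longrightarrow> i < j \<Longrightarrow>
          covariance M (\<lambda>\<omega>. (X i \<omega>)\<^sup>2) (\<lambda>\<omega>. (X j \<omega>)\<^sup>2) \<le> \<psi> (j - i)"
    and "(SUP k\<in>{1..}. \<integral>\<^sup>+\<omega>. ennreal ((X k \<omega>) ^ 4) \<partial>M) < \<infinity>"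
    and "(\<lambda>k. real k * \<phi> k) summable_on {1..}"
    and "\<psi> summable_on {1..}"
    and "(\<forall>p\<ge>1. \<forall>\<omega>\<in>space M. y p \<omega> = Matrix.vec p (\<lambda>i. X (Suc i) \<omega>)) \<or>
         ((\<forall>k\<ge>1. (\<integral>\<omega>. (X k \<omega>)\<^sup>2 \<partial>M) = 1) \<and>
          (\<forall>i\<ge>1. \<forall>j\<ge>1. i \<noteq> j \<longrightarrow> (\<integral>\<omega>. X i \<omega> * X j \<omega> \<partial>M) = 0) \<and>
          (\<exists>(V :: nat \<Rightarrow> 'a \<Rightarrow> real) (a :: nat \<Rightarrow> nat \<Rightarrow> real).
             (\<forall>j\<ge>1. (\<lambda>k. (a j k)\<^sup>2) summable_on {1..} \<and> L2_series M (a j) X (V j)) \<and>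
             (\<forall>p\<ge>1. \<forall>\<omega>\<in>space M. y p \<omega> = Matrix.vec p (\<lambda>i. V (Suc i) \<omega>))))"
    and "\<And>p n. p \<ge> 1 \<Longrightarrow> n \<ge> 1 \<Longrightarrow> columns_indep_copies N M p n (Y p n) (y p)"
    and "\<And>n. n \<ge> 1 \<Longrightarrow> p n \<ge> 1"
    and "c > 0" and "(\<lambda>n. real (p n) / real n) \<longlonglongrightarrow> c"
    and "bdd_above ((\<lambda>p. spectral_norm (second_moment_mat M p (y p))) ` {1..})"
    and "real_distribution P"
    and "weak_conv_m (\<lambda>p. esd (second_moment_mat M p (y p))) P"
  shows "\<exists>F. real_distribution F \<and>
    (AE \<omega> in N. weak_conv_m
        (\<lambda>n. esd ((1 / real n) \<cdot>\<^sub>m (Y (p n) n \<omega> * transpose_mat (Y (p n) n \<omega>)))) F) \<and>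
    (\<forall>z. Im z > 0 \<longrightarrow> stieltjes F z =
        (LINT x:{0..}|P. 1 / (complex_of_real x * (1 - complex_of_real c
            - complex_of_real c * z * stieltjes F z) - z)))"
proof -
  note asm = assms
  interpret M: prob_space M by (rule asm(1))
  define \<Phi>0 where "\<Phi>0 = enn2real (SUP k\<in>{1..}. \<integral>\<^sup>+\<omega>. ennreal ((X k \<omega>) ^ 4) \<partial>M)"
  define \<Phi>1 where "\<Phi>1 = (\<Sum>\<^sub>\<infinity>k\<in>{1..}. real k * \<phi> k)"
  define \<Phi>2 where "\<Phi>2 = (\<Sum>\<^sub>\<infinity>k\<in>{1..}. \<psi> k)"
  interpret W: weakly_dependent M "\<lambda>k. X (Suc k)" \<phi> \<psi> \<Phi>0 \<Phi>1 \<Phi>2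
    unfolding \<Phi>0_def \<Phi>1_def \<Phi>2_def by (rule weakly_dependentI[OF asm(1,3-16)])
  let ?\<Sigma> = "\<lambda>q. second_moment_mat M q (y q)"
  have \<Sigma>c: "?\<Sigma> q \<in> carrier_mat q q" for q by (simp add: second_moment_mat_def)
  obtain B0 where B0: "\<And>q. q \<ge> 1 \<Longrightarrow> spectral_norm (?\<Sigma> q) \<le> B0"
    using asm(22) by (auto simp: bdd_above_def)
  \<comment> \<open>a nonnegative bound that serves all dimensions \<open>q \<ge> 1\<close>\<close>
  define B where "B = max 0 B0"
  have B: "B \<ge> 0" by (simp add: B_def)
  have opB: "op_bound q B (?\<Sigma> q)" if "q \<ge> 1" for q
    by (rule op_bound_mono[OF spectral_norm_op_bound[OF \<Sigma>c]]) (use B0[OF that] in \<open>simp add: B_def\<close>)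
  \<comment> \<open>in both cases the vectors are initial segments of one sequence \<open>V\<close> of coordinates\<close>
  have "\<exists>V K. (\<forall>q\<ge>1. \<forall>\<omega>\<in>space M. y q \<omega> = Matrix.vec q (\<lambda>i. V i \<omega>)) \<and>
      (\<forall>i. V i \<in> borel_measurable M) \<and> (\<forall>i j. integrable M (\<lambda>\<omega>. V i \<omega> * V j \<omega>)) \<and> K \<ge> 0 \<and>
      (\<forall>q A \<beta>. q \<ge> 1 \<longrightarrow> op_bound q \<beta> A \<longrightarrow> \<beta> \<ge> 0 \<longrightarrow>
        (\<integral>\<^sup>+\<omega>. ennreal \<bar>y q \<omega> \<bullet> (A *\<^sub>v y q \<omega>) - mtrace (A * ?\<Sigma> q)\<bar> \<partial>M) \<le> ennreal (K * \<beta> * sqrt (real q)))"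
    using asm(17)
  proof (elim disjE conjE exE)
    assume y: "\<forall>q\<ge>1. \<forall>\<omega>\<in>space M. y q \<omega> = Matrix.vec q (\<lambda>i. X (Suc i) \<omega>)"
    have "(\<integral>\<^sup>+\<omega>. ennreal \<bar>y q \<omega> \<bullet> (A *\<^sub>v y q \<omega>) - mtrace (A * ?\<Sigma> q)\<bar> \<partial>M) \<le> ennreal (sqrt W.CQ * \<beta> * sqrt (real q))"
      if "q \<ge> 1" "op_bound q \<beta> A" "\<beta> \<ge> 0" for q A \<beta>
      by (rule W.quadratic_form_coordinates) (use y that in auto)
    thus ?thesis using y W.meas W.integrable2 W.CQ_nonneg
      by (intro exI[of _ "\<lambda>i. X (Suc i)"] exI[of _ "sqrt W.CQ"]) auto
  next
    fix V :: "nat \<Rightarrow> 'a \<Rightarrow> real" and a :: "nat \<Rightarrow> nat \<Rightarrow> real"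
    assume one: "\<forall>k\<ge>1. (\<integral>\<omega>. (X k \<omega>)\<^sup>2 \<partial>M) = 1"
      and orth: "\<forall>i\<ge>1. \<forall>j\<ge>1. i \<noteq> j \<longrightarrow> (\<integral>\<omega>. X i \<omega> * X j \<omega> \<partial>M) = 0"
      and V: "\<forall>j\<ge>1. (\<lambda>k. (a j k)\<^sup>2) summable_on {1..} \<and> L2_series M (a j) X (V j)"
      and y: "\<forall>q\<ge>1. \<forall>\<omega>\<in>space M. y q \<omega> = Matrix.vec q (\<lambda>i. V (Suc i) \<omega>)"
    have m1: "W.mom2 k k = 1" for k using one by (simp add: W.mom2_def power2_eq_square)
    have m0: "W.mom2 k l = 0" if "k \<noteq> l" for k l using orth that by (simp add: W.mom2_def)
    have L: "L2_series M (a (Suc i)) X (V (Suc i))" for i using V by simp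
    have Vm: "V (Suc i) \<in> borel_measurable M" for i using L by (simp add: L2_series_def)
    have conv: "(\<lambda>m. \<integral>\<^sup>+\<omega>. ennreal ((V (Suc i) \<omega> - (\<Sum>k<m. a (Suc i) (Suc k) * X (Suc k) \<omega>))\<^sup>2) \<partial>M) \<longlonglongrightarrow> 0" for i
      using L[of i] by (simp add: L2_series_def sum.atLeast1_atMost_eq)
    \<comment> \<open>this conclusion concerns all coordinates, so the instance \<open>p = 1\<close> yields it\<close>
    have V2: "integrable M (\<lambda>\<omega>. (V (Suc i) \<omega>)\<^sup>2)" for i
      by (rule W.quadratic_form_linear_process(2)[where V = "\<lambda>i. V (Suc i)" and \<alpha> = "\<lambda>i k. a (Suc i) (Suc k)"
            and y = "y 1" and p = 1 and \<beta> = B and A = "?\<Sigma> 1" and B = B, OF m1 m0 Vm conv _ opB B opB B])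
        (use y in auto)
    have "(\<integral>\<^sup>+\<omega>. ennreal \<bar>y q \<omega> \<bullet> (A *\<^sub>v y q \<omega>) - mtrace (A * ?\<Sigma> q)\<bar> \<partial>M) \<le> ennreal ((sqrt W.CQ * B) * \<beta> * sqrt (real q))"
      if q: "q \<ge> 1" and A: "op_bound q \<beta> A" "\<beta> \<ge> 0" for q A \<beta>
    proof -
      have "(\<integral>\<^sup>+\<omega>. ennreal \<bar>y q \<omega> \<bullet> (A *\<^sub>v y q \<omega>) - mtrace (A * ?\<Sigma> q)\<bar> \<partial>M) \<le> ennreal (sqrt W.CQ * (\<beta> * B) * sqrt (real q))"
        by (rule W.quadratic_form_linear_process(1)[where V = "\<lambda>i. V (Suc i)" and \<alpha> = "\<lambda>i k. a (Suc i) (Suc k)",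
            OF m1 m0 Vm conv _ A opB[OF q] B]) (use y q in auto)
      thus ?thesis by (simp add: mult_ac)
    qed
    moreover have "integrable M (\<lambda>\<omega>. V (Suc i) \<omega> * V (Suc j) \<omega>)" for i j
      by (rule Cauchy_Schwarz_integral(1)[OF Vm Vm V2 V2])
    ultimately show ?thesis using y Vm W.CQ_nonneg B
      by (intro exI[of _ "\<lambda>i. V (Suc i)"] exI[of _ "sqrt W.CQ * B"]) auto
  qed
  then obtain V K where y: "\<And>q \<omega>. q \<ge> 1 \<Longrightarrow> \<omega> \<in> space M \<Longrightarrow> y q \<omega> = Matrix.vec q (\<lambda>i. V i \<omega>)"
    and V: "\<And>i. V i \<in> borel_measurable M" "\<And>i j. integrable M (\<lambda>\<omega>. V i \<omega> * V j \<omega>)" and K: "K \<ge> 0"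
    and qf: "\<And>q A \<beta>. q \<ge> 1 \<Longrightarrow> op_bound q \<beta> A \<Longrightarrow> \<beta> \<ge> 0 \<Longrightarrow>
        (\<integral>\<^sup>+\<omega>. ennreal \<bar>y q \<omega> \<bullet> (A *\<^sub>v y q \<omega>) - mtrace (A * ?\<Sigma> q)\<bar> \<partial>M) \<le> ennreal (K * \<beta> * sqrt (real q))"
    by blast
  have ym: "(\<lambda>\<omega>. coords q (y q \<omega>)) \<in> measurable M (borel_vec q)" if q: "q \<ge> 1" for q
  proof -
    have "(\<lambda>\<omega>. \<lambda>i\<in>{..<q}. V i \<omega>) \<in> measurable M (borel_vec q)" by (intro measurable_restrict V)
    moreover have "coords q (y q \<omega>) = (\<lambda>i\<in>{..<q}. V i \<omega>)" if "\<omega> \<in> space M" for \<omega>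
      by (auto simp: coords_def y[OF q that])
    ultimately show ?thesis by (simp cong: measurable_cong)
  qed
  interpret N: prob_space N by (rule asm(2))
  interpret P: real_distribution P by (rule asm(23))
  interpret mp_setting M N y Y p c B K P
  proof (unfold_locales)
    show "(\<lambda>\<omega>. coords q (y q \<omega>)) \<in> measurable M (borel_vec q)" if "q \<ge> 1" for q
      using that by (rule ym)
    show "y q \<omega> \<in> carrier_vec q" if "q \<ge> 1" "\<omega> \<in> space M" for q \<omega>
      using that by (simp add: y)
    show "psd q (?\<Sigma> q)" if "q \<ge> 1" for q
      using that by (intro second_moment_psd[of M "y q" q V] y V)
    show "(\<integral>\<^sup>+\<omega>. ennreal \<bar>y q \<omega> \<bullet> (A *\<^sub>v y q \<omega>) - mtrace (A * ?\<Sigma> q)\<bar> \<partial>M) \<le> ennreal (K * \<beta> * sqrt (real q))"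
      if "q \<ge> 1" "op_bound q \<beta> A" "\<beta> \<ge> 0" for q A \<beta>
      using that by (rule qf)
  qed (rule asm(18-21,24) opB B K; assumption)+
  show ?thesis using generalized_marchenko_pastur unfolding sample_cov_def .
qed

end
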